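(* Under the standing assumptions given in the context, assume that $H$ cannot be written as the free additive convolution of a semicircular distribution with positive variance and a probability measure. For $\hat\sigma\ge0$ let $\hat Z\sim\hat\sigma\,GOE(n)$ be independent of $A_n,Z_n$, and let $$R_n(\hat\sigma)=\min_{T}\frac1n\sum_{j=1}^n(\hat t_j-\hat\lambda_j)^2,$$ where the minimum is over $T=(t_1,\dots,t_n)^\intercal\in\mathbb{R}^n$ with $t_1\ge\dots\ge t_n$, $\hat t_1\ge\dots\ge\hat t_n$ are the eigenvalues of $\operatorname{diag}(T)+n^{-1/2}\hat Z$, and $\hat\lambda_1\ge\dots\ge\hat\lambda_n$ are the eigenvalues of $\hat A_n$. Then, almost surely: 1. For $\hat\sigma<\sigma$, $\limsup_{n\to\infty}R_n(\hat\sigma)=0$. 2. For $\hat\sigma>\sigma$, $\liminf_{n\to\infty}R_n(\hat\sigma)>0$.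
   Context: Standing assumptions. For each $n$, $A_n\in\mathbb{R}^{n\times n}$ is a real symmetric matrix (deterministic or random), $\sigma>0$ is fixed, and $\hat{A}_n=A_n+\sigma n^{-1/2}Z_n$, with $n\to\infty$. (i) The empirical spectral distribution of the eigenvalues of $A_n$ converges weakly almost surely to a deterministic probability measure $H$. (ii) $H$ is supported on a compact interval of $\mathbb{R}$, and eventually (for all large $n$) all eigenvalues of $A_n$ lie in a compact interval $[h_1,h_2]\subset\mathbb{R}$. (iii) $Z_n$ is real symmetric and independent of $A_n$; it is the top-left $n\times n$ submatrix of an infinite symmetric matrix $(Z_{ij})_{i,j\ge1}$ whose entries on and above the diagonal are i.i.d. with mean $0$, variance $1$ and finite fourth moment. $GOE(n)$ denotes the Gaussian Orthogonal Ensemble on real symmetric $n\times n$ matrices (independent centered Gaussian entries on and above the diagonal, off-diagonal variance $1$, diagonal variance $2$). *)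

theory Defs
  imports "HOL-Probability.Probability" "Jordan_Normal_Form.Char_Poly"
begin

section \<open>Eigenvalues and empirical spectral distribution\<close>

text \<open>Eigenvalues with multiplicity, in decreasing order. Only real roots of the characteristic
  polynomial are listed, so this is meant for real symmetric matrices, where the list has
  length \<^term>\<open>dim_row A\<close>.\<close>

definition eigs :: "real mat \<Rightarrow> real list" where
  "eigs A = rev (sorted_list_of_multiset (proots (char_poly A)))"

text \<open>For the \<open>0 \<times> 0\<close> matrix this is the zero measure, which does not matter for limits.\<close>

definition esd :: "real mat \<Rightarrow> real measure" where
  "esd A = distr (uniform_count_measure {..<dim_row A}) borel (\<lambda>j. eigs A ! j)"


section \<open>Random matrices\<close>

definition borel_mat :: "nat \<Rightarrow> real mat measure" where
  "borel_mat n = vimage_algebra (carrier_mat n n)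
     (\<lambda>A. \<lambda>(i, j)\<in>{..<n} \<times> {..<n}. A $$ (i, j)) (\<Pi>\<^sub>M _\<in>{..<n} \<times> {..<n}. borel)"

definition top_left :: "nat \<Rightarrow> (nat \<Rightarrow> nat \<Rightarrow> real) \<Rightarrow> real mat" where
  "top_left n W = Matrix.mat n n (\<lambda>(i, j). W i j)"

text \<open>As \<^term>\<open>prob_space.indep_var M\<close> unfolds (\<open>indep_var_eq\<close>), but for random variables with values in
  different types.\<close>

definition indep_rvs ::
    "'w measure \<Rightarrow> 'a measure \<Rightarrow> ('w \<Rightarrow> 'a) \<Rightarrow> 'b measure \<Rightarrow> ('w \<Rightarrow> 'b) \<Rightarrow> bool" where
  "indep_rvs M S X T Y \<longleftrightarrow>
     X \<in> measurable M S \<and> Y \<in> measurable M T \<and>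
     prob_space.indep_set M
       (sigma_sets (space M) {X -` B \<inter> space M | B. B \<in> sets S})
       (sigma_sets (space M) {Y -` B \<inter> space M | B. B \<in> sets T})"

text \<open>The second parameter of \<^const>\<open>normal_density\<close> is the standard deviation.\<close>

definition GOE :: "nat \<Rightarrow> real mat measure" where
  "GOE n = distr
     (\<Pi>\<^sub>M (i, j)\<in>{(i, j). i \<le> j \<and> j < n}.
        density lborel (\<lambda>x. ennreal (normal_density 0 (if i = j then sqrt 2 else 1) x)))
     (borel_mat n)
     (\<lambda>g. Matrix.mat n n (\<lambda>(i, j). g (min i j, max i j)))"


section \<open>Free additive convolution\<close>

definition cauchy_transform :: "real measure \<Rightarrow> complex \<Rightarrow> complex" where
  "cauchy_transform \<mu> z = (LINT t|\<mu>. 1 / (z - complex_of_real t))"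

definition reciprocal_cauchy :: "real measure \<Rightarrow> complex \<Rightarrow> complex" where
  "reciprocal_cauchy \<mu> z = 1 / cauchy_transform \<mu> z"

definition truncated_cone :: "real \<Rightarrow> real \<Rightarrow> complex set" where
  "truncated_cone \<alpha> \<beta> = {z. Im z > \<beta> \<and> \<bar>Re z\<bar> < \<alpha> * Im z}"

text \<open>\<open>\<phi>\<close> is the Voiculescu transform \<open>\<phi>\<^sub>\<mu>(z) = F\<^sub>\<mu>\<inverse>(z) - z\<close> of \<open>\<mu>\<close> on the truncated cone,
  where \<open>F\<^sub>\<mu> = 1 / G\<^sub>\<mu>\<close>; equivalently \<open>\<phi>\<^sub>\<mu>(z) = R\<^sub>\<mu>(1 / z)\<close> for the R-transform \<open>R\<^sub>\<mu>\<close>. The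
  branch of the inverse is the one asymptotic to the identity, as the last condition
  expresses; it exists on a truncated cone for every probability measure (Bercovici and
  Voiculescu), compactly supported or not, and any two such branches agree.\<close>

definition voiculescu_transform_on ::
    "real measure \<Rightarrow> real \<Rightarrow> real \<Rightarrow> (complex \<Rightarrow> complex) \<Rightarrow> bool" where
  "voiculescu_transform_on \<mu> \<alpha> \<beta> \<phi> \<longleftrightarrow>
     \<phi> holomorphic_on truncated_cone \<alpha> \<beta> \<and>
     (\<forall>z\<in>truncated_cone \<alpha> \<beta>. Im (z + \<phi> z) > 0 \<and> reciprocal_cauchy \<mu> (z + \<phi> z) = z) \<and>
     ((\<lambda>z. \<phi> z / z) \<longlongrightarrow> 0) (inf at_infinity (principal (truncated_cone \<alpha> \<beta>)))"

text \<open>\<open>\<rho> = \<mu> \<boxplus> \<nu>\<close> for probability measures on the line: \<open>\<phi>\<^sub>\<rho> = \<phi>\<^sub>\<mu> + \<phi>\<^sub>\<nu>\<close> on a common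
  truncated cone. A relation rather than a function, so that no existence theorem is needed
  to make it meaningful.\<close>

definition is_free_additive_convolution ::
    "real measure \<Rightarrow> real measure \<Rightarrow> real measure \<Rightarrow> bool" where
  "is_free_additive_convolution \<mu> \<nu> \<rho> \<longleftrightarrow>
     (\<exists>\<alpha>>0. \<exists>\<beta>>0. \<exists>\<phi> \<psi>. voiculescu_transform_on \<mu> \<alpha> \<beta> \<phi> \<and>
        voiculescu_transform_on \<nu> \<alpha> \<beta> \<psi> \<and>
        voiculescu_transform_on \<rho> \<alpha> \<beta> (\<lambda>z. \<phi> z + \<psi> z))"

text \<open>Centred semicircular distribution of variance \<open>v > 0\<close>. A nonzero mean would only translate
  the other factor of a free convolution.\<close>

definition semicircle :: "real \<Rightarrow> real measure" where
  "semicircle v = density lborel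
     (\<lambda>x. ennreal (if \<bar>x\<bar> \<le> 2 * sqrt v then sqrt (4 * v - x\<^sup>2) / (2 * pi * v) else 0))"


section \<open>The fitting error\<close>

text \<open>\<open>Zh\<close> and \<open>Ah\<close> are realisations of \<open>Z\<close>-hat and \<open>A\<close>-hat. The infimum is a minimum: the
  objective is continuous and coercive in \<open>T\<close> restricted to \<open>{..<n}\<close>, and the constraint set
  is closed.\<close>

definition fit_error :: "nat \<Rightarrow> real mat \<Rightarrow> real mat \<Rightarrow> real" where
  "fit_error n Zh Ah =
     (INF T\<in>{T :: nat \<Rightarrow> real. antimono_on {..<n} T}.
        1 / real n *
        (\<Sum>j<n. (eigs (mat_diag n T + (1 / sqrt (real n)) \<cdot>\<^sub>m Zh) ! j - eigs Ah ! j)\<^sup>2))"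

end

theory Submission
  imports Defs "HOL-Complex_Analysis.Conformal_Mappings" "Jordan_Normal_Form.Schur_Decomposition"
begin

text \<open>
  Let \<open>m\<^sub>\<mu>(z) = \<integral> (x - z)\<^sup>-\<^sup>1 d\<mu>(x)\<close> be the Stieltjes transform. The spectrum of \<open>B + n\<^sup>-\<^sup>1\<^sup>/\<^sup>2 \<tau> W\<close>, with \<open>W\<close> a
  Wigner matrix independent of \<open>B\<close>, almost surely satisfies \<open>s(z) = m\<^sub>B(z + \<tau>\<^sup>2 s(z)) + o(1)\<close> for all \<open>z\<close> in the
  upper half plane (\<open>defect_tendsto\<close>; \<open>defect\<close> is the error). The error has two sources. The fluctuation of
  \<open>s\<close> around its mean has variance \<open>O(n\<^sup>-\<^sup>2)\<close> by the Efron-Stein inequality (\<open>variance_bound\<close>), which is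
  summable; this yields almost sure convergence whatever the joint law of the realisations
  for different \<open>n\<close> is. The bias is estimated by expanding the resolvent in one entry at a time
  (\<open>bias_bound\<close>). Neither constant depends on \<open>B\<close>. The limiting equation \<open>m = m\<^sub>\<mu>(z + t m)\<close> has exactly one
  solution with \<open>Im m \<ge> 0\<close> (\<open>pastur_exists\<close>, \<open>pastur_unique\<close>), so it determines limits of spectra.

  For \<open>\<sigma>hat < \<sigma>\<close>, take as \<open>T\<close> the eigenvalues of \<open>A + n\<^sup>-\<^sup>1\<^sup>/\<^sup>2 c Z\<close> with \<open>c\<^sup>2 = \<sigma>\<^sup>2 - \<sigma>hat\<^sup>2\<close>: the noise that is
  missing in \<open>Zhat\<close> is put into \<open>T\<close>. Substituting the equation for noise \<open>c\<close> into the one for noise \<open>\<sigma>hat\<close> gives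
  the one for noise \<open>\<sigma>\<close>, so both spectra have the same limiting Stieltjes transform. Their second moments have
  the same limit too, and it agrees with the one encoded in the limiting Stieltjes transform, so no mass of the
  second moment escapes to infinity. For sorted sequences this forces mean square closeness
  (\<open>sorted_spectra_close\<close>).

  For \<open>\<sigma>hat > \<sigma>\<close>, suppose that the error tends to \<open>0\<close> along a subsequence. Near-optimal \<open>T\<close> have bounded second
  moments, so their empirical distributions have a weak limit \<open>\<nu>\<close>, and both spectra have the same limiting
  transform \<open>m\<close>, whence \<open>m\<^sub>H(z + \<sigma>\<^sup>2 m) = m = m\<^sub>\<nu>(z + \<sigma>hat\<^sup>2 m)\<close>. With \<open>w = z + \<sigma>\<^sup>2 m\<close> this reads
  \<open>m\<^sub>H(w) = m\<^sub>\<nu>(w + (\<sigma>hat\<^sup>2 - \<sigma>\<^sup>2) m\<^sub>H(w))\<close>, which says that \<open>H\<close> is the free convolution of \<open>\<nu>\<close> with a semicircular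
  distribution of variance \<open>\<sigma>hat\<^sup>2 - \<sigma>\<^sup>2\<close> (\<open>free_conv_of_equation\<close>).

  The difficulty of this part is that \<open>T\<close> may depend on the realisation, so that \<open>diag T\<close> is not independent of
  \<open>Zhat\<close>. The equation is therefore needed simultaneously for all decreasing \<open>T\<close> of bounded second moment. It
  holds almost surely for countably many deterministic step functions, and these approximate every such \<open>T\<close> in
  mean absolute deviation, with respect to which normalised resolvent traces are Lipschitz continuous
  (\<open>defect_uniform\<close>).
\<close>

section \<open>Resolvents of real symmetric kernels\<close>

definition shifted :: "nat \<Rightarrow> (nat \<Rightarrow> nat \<Rightarrow> real) \<Rightarrow> complex \<Rightarrow> complex mat" where
  "shifted n X z = Matrix.mat n n (\<lambda>(i, j). complex_of_real (X i j) - (if i = j then z else 0))"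

text \<open>Resolvents are functions on index pairs rather than matrices, so that sums over entries can be
  manipulated without carrier conditions; only the inverse itself is taken from the theory of
  matrices.\<close>

definition resolvent :: "nat \<Rightarrow> (nat \<Rightarrow> nat \<Rightarrow> real) \<Rightarrow> complex \<Rightarrow> nat \<Rightarrow> nat \<Rightarrow> complex" where
  "resolvent n X z i j = adj_mat (shifted n X z) $$ (i, j) / det (shifted n X z)"

text \<open>Only the upper left \<open>n \<times> n\<close> block of a kernel is ever relevant.\<close>

definition symk :: "nat \<Rightarrow> (nat \<Rightarrow> nat \<Rightarrow> 'a) \<Rightarrow> bool" where
  "symk n X \<longleftrightarrow> (\<forall>i<n. \<forall>j<n. X i j = X j i)"

definition kprod :: "nat \<Rightarrow> (nat \<Rightarrow> nat \<Rightarrow> complex) \<Rightarrow> (nat \<Rightarrow> nat \<Rightarrow> complex) \<Rightarrow> nat \<Rightarrow> nat \<Rightarrow> complex" where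
  "kprod n K L i j = (\<Sum>k<n. K i k * L k j)"

text \<open>An operator norm bound, in the form in which it is multiplicative and bounds rows and columns in the
  Euclidean norm.\<close>

definition op_bdd :: "nat \<Rightarrow> (nat \<Rightarrow> nat \<Rightarrow> complex) \<Rightarrow> real \<Rightarrow> bool" where
  "op_bdd n K c \<longleftrightarrow> 0 \<le> c \<and>
     (\<forall>y. (\<Sum>i<n. (cmod (\<Sum>j<n. K i j * y j))\<^sup>2) \<le> c\<^sup>2 * (\<Sum>j<n. (cmod (y j))\<^sup>2))"

lemma shifted_carrier [simp]: "shifted n X z \<in> carrier_mat n n"
  by (simp add: shifted_def)

lemma norm_sum_mult_le_L2: 
  "cmod (\<Sum>i\<in>I. f i * g i) \<le> L2_set (\<lambda>i. cmod (f i)) I * L2_set (\<lambda>i. cmod (g i)) I"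
proof -
  have "cmod (\<Sum>i\<in>I. f i * g i) \<le> (\<Sum>i\<in>I. \<bar>cmod (f i)\<bar> * \<bar>cmod (g i)\<bar>)"
    by (rule order_trans[OF norm_sum]) (simp add: norm_mult)
  also have "\<dots> \<le> L2_set (\<lambda>i. cmod (f i)) I * L2_set (\<lambda>i. cmod (g i)) I"
    by (rule L2_set_mult_ineq)
  finally show ?thesis .
qed

text \<open>The imaginary part of the quadratic form of \<open>X - z\<close> is that of \<open>-z\<close>, since \<open>X\<close> is
  symmetric and real.\<close>

lemma Im_shifted_form:
  assumes X: "symk n X"
  shows "Im (\<Sum>i<n. cnj (y i) * (\<Sum>j<n. (complex_of_real (X i j) - (if i = j then z else 0)) * y j))
     = - Im z * (\<Sum>i<n. (cmod (y i))\<^sup>2)"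
proof -
  define u where "u i = (\<Sum>j<n. (complex_of_real (X i j) - (if i = j then z else 0)) * y j)" for i
  define N where "N = (\<Sum>i<n. (cmod (y i))\<^sup>2)"
  have u: "u i = (\<Sum>j<n. complex_of_real (X i j) * y j) - z * y i" if "i < n" for i
  proof -
    have "u i = (\<Sum>j<n. complex_of_real (X i j) * y j - (if j = i then z * y i else 0))"
      unfolding u_def by (intro sum.cong) (auto simp: algebra_simps)
    then show ?thesis using that by (simp add: sum_subtractf)
  qed
  define q where "q = (\<Sum>i<n. \<Sum>j<n. cnj (y i) * complex_of_real (X i j) * y j)"
  have "cnj q = (\<Sum>i<n. \<Sum>j<n. y i * complex_of_real (X i j) * cnj (y j))"
    by (simp add: q_def)
  also have "\<dots> = (\<Sum>j<n. \<Sum>i<n. y i * complex_of_real (X i j) * cnj (y j))"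
    by (rule sum.swap)
  also have "\<dots> = q" unfolding q_def
    by (intro sum.cong) (use X in \<open>auto simp: symk_def algebra_simps\<close>)
  finally have imq: "Im q = 0" by (simp add: complex_eq_iff)
  have "(\<Sum>i<n. cnj (y i) * u i) = (\<Sum>i<n. (\<Sum>j<n. cnj (y i) * complex_of_real (X i j) * y j) - z * (y i * cnj (y i)))"
    by (intro sum.cong) (auto simp: u algebra_simps sum_distrib_left)
  also have "\<dots> = q - z * complex_of_real N"
    by (simp add: q_def sum_subtractf N_def sum_distrib_left complex_norm_square del: of_real_power)
  finally have "Im (\<Sum>i<n. cnj (y i) * u i) = - Im z * N" using imq by simp
  then show ?thesis unfolding u_def N_def .
qed

lemma shifted_expansive:
  assumes X: "symk n X" and z: "Im z > 0"
  shows "(Im z)\<^sup>2 * (\<Sum>i<n. (cmod (y i))\<^sup>2) \<le>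
    (\<Sum>i<n. (cmod (\<Sum>j<n. (complex_of_real (X i j) - (if i = j then z else 0)) * y j))\<^sup>2)"
proof -
  define u where "u i = (\<Sum>j<n. (complex_of_real (X i j) - (if i = j then z else 0)) * y j)" for i
  define N where "N = (\<Sum>i<n. (cmod (y i))\<^sup>2)"
  have "Im (\<Sum>i<n. cnj (y i) * u i) = - Im z * N"
    unfolding u_def N_def by (rule Im_shifted_form[OF X])
  then have "Im z * N \<le> cmod (\<Sum>i<n. cnj (y i) * u i)"
    using abs_Im_le_cmod[of "\<Sum>i<n. cnj (y i) * u i"] by linarith
  also have "\<dots> \<le> L2_set (\<lambda>i. cmod (y i)) {..<n} * L2_set (\<lambda>i. cmod (u i)) {..<n}"
    using norm_sum_mult_le_L2[of "\<lambda>i. cnj (y i)" u "{..<n}"] by simp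
  finally have *: "Im z * N \<le> sqrt N * sqrt (\<Sum>i<n. (cmod (u i))\<^sup>2)"
    by (simp add: L2_set_def N_def)
  have N0: "N \<ge> 0" by (simp add: N_def sum_nonneg)
  have "Im z * sqrt N \<le> sqrt (\<Sum>i<n. (cmod (u i))\<^sup>2)"
  proof (cases "N = 0")
    case False
    then have "sqrt N > 0" using N0 by simp
    moreover have "sqrt N * (Im z * sqrt N) = Im z * N" using N0 by simp
    ultimately show ?thesis using * by (metis mult_le_cancel_left_pos)
  qed (simp add: sum_nonneg)
  then have "(Im z * sqrt N)\<^sup>2 \<le> (sqrt (\<Sum>i<n. (cmod (u i))\<^sup>2))\<^sup>2"
    using z N0 by (intro power_mono) auto
  then show ?thesis
    using N0 by (simp add: power_mult_distrib sum_nonneg N_def u_def)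
qed

lemma det_shifted_nonzero:
  assumes X: "symk n X" and z: "Im z > 0"
  shows "det (shifted n X z) \<noteq> 0"
proof
  assume "det (shifted n X z) = 0"
  from this[unfolded det_0_iff_vec_prod_zero[OF shifted_carrier]]
  obtain v where v: "v \<in> carrier_vec n" "v \<noteq> 0\<^sub>v n" "shifted n X z *\<^sub>v v = 0\<^sub>v n" by blast
  have "(\<Sum>j<n. (complex_of_real (X i j) - (if i = j then z else 0)) * v $ j) = 0" if "i < n" for i
  proof -
    have "(shifted n X z *\<^sub>v v) $ i = (\<Sum>j<n. (complex_of_real (X i j) - (if i = j then z else 0)) * v $ j)"
      using that v(1) by (auto simp: shifted_def scalar_prod_def lessThan_atLeast0 intro!: sum.cong)
    with v(3) that show ?thesis by simp
  qed
  then have "(Im z)\<^sup>2 * (\<Sum>i<n. (cmod (v $ i))\<^sup>2) \<le> 0"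
    using shifted_expansive[OF X z, of "\<lambda>i. v $ i"] by simp
  then have "(\<Sum>i<n. (cmod (v $ i))\<^sup>2) = 0"
    using z by (simp add: mult_le_0_iff sum_nonneg antisym)
  then have "\<forall>i<n. v $ i = 0" by (simp add: sum_nonneg_eq_0_iff)
  with v(1,2) show False by auto
qed

lemma
  assumes X: "symk n X" and z: "Im z > 0" and ij: "i < n" "j < n"
  shows shifted_resolvent: "(\<Sum>k<n. (complex_of_real (X i k) - (if i = k then z else 0)) * resolvent n X z k j)
           = (if i = j then 1 else 0)"
    and resolvent_shifted: "(\<Sum>k<n. resolvent n X z i k * (complex_of_real (X k j) - (if k = j then z else 0)))
           = (if i = j then 1 else 0)"
proof -
  let ?M = "shifted n X z" let ?d = "det ?M"
  note a = adj_mat[OF shifted_carrier[of n X z]]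
  have d: "?d \<noteq> 0" by (rule det_shifted_nonzero[OF X z])
  have "(?M * adj_mat ?M) $$ (i, j) = (\<Sum>k<n. (complex_of_real (X i k) - (if i = k then z else 0)) * adj_mat ?M $$ (k, j))"
    using ij a(1) by (auto simp: shifted_def scalar_prod_def lessThan_atLeast0 intro!: sum.cong)
  then show "(\<Sum>k<n. (complex_of_real (X i k) - (if i = k then z else 0)) * resolvent n X z k j) = (if i = j then 1 else 0)"
    using ij d by (simp add: a resolvent_def sum_divide_distrib[symmetric] split: if_splits)
  have "(adj_mat ?M * ?M) $$ (i, j) = (\<Sum>k<n. adj_mat ?M $$ (i, k) * (complex_of_real (X k j) - (if k = j then z else 0)))"
    using ij a(1) by (auto simp: shifted_def scalar_prod_def lessThan_atLeast0 intro!: sum.cong)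
  then show "(\<Sum>k<n. resolvent n X z i k * (complex_of_real (X k j) - (if k = j then z else 0))) = (if i = j then 1 else 0)"
    using ij d by (simp add: a resolvent_def sum_divide_distrib[symmetric] split: if_splits)
qed

text \<open>The only perturbation formula for resolvents that is used: single entries, diagonals and spectral
  parameters are all varied through it.\<close>

lemma resolvent_identity:
  assumes X: "symk n X" "Im z > 0" and Y: "symk n Y" "Im w > 0" and ij: "i < n" "j < n"
  shows "resolvent n X z i j - resolvent n Y w i j =
    (\<Sum>k<n. \<Sum>l<n. resolvent n X z i k *
        (complex_of_real (Y k l - X k l) - (if k = l then w - z else 0)) * resolvent n Y w l j)"
proof -
  let ?G = "resolvent n X z" let ?R = "resolvent n Y w"
  let ?x = "\<lambda>k l. complex_of_real (X k l) - (if k = l then z else 0)"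
  let ?y = "\<lambda>k l. complex_of_real (Y k l) - (if k = l then w else 0)"
  have "(\<Sum>k<n. \<Sum>l<n. ?G i k * (complex_of_real (Y k l - X k l) - (if k = l then w - z else 0)) * ?R l j)
     = (\<Sum>k<n. \<Sum>l<n. ?G i k * ?y k l * ?R l j - ?G i k * ?x k l * ?R l j)"
    by (intro sum.cong refl) (simp add: algebra_simps)
  also have "\<dots> = (\<Sum>k<n. ?G i k * (\<Sum>l<n. ?y k l * ?R l j)) - (\<Sum>k<n. \<Sum>l<n. ?G i k * ?x k l * ?R l j)"
    by (simp only: sum_subtractf sum_distrib_left mult.assoc)
  also have "(\<Sum>k<n. \<Sum>l<n. ?G i k * ?x k l * ?R l j) = (\<Sum>l<n. \<Sum>k<n. ?G i k * ?x k l * ?R l j)"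
    by (rule sum.swap)
  also have "\<dots> = (\<Sum>l<n. (\<Sum>k<n. ?G i k * ?x k l) * ?R l j)"
    by (simp add: sum_distrib_right)
  also have "\<dots> = (\<Sum>l<n. (if i = l then 1 else 0) * ?R l j)"
    using ij by (intro sum.cong refl) (simp add: resolvent_shifted[OF X])
  also have "\<dots> = (\<Sum>l<n. if l = i then ?R l j else 0)"
    by (intro sum.cong) auto
  also have "\<dots> = ?R i j" using ij by simp
  also have "(\<Sum>k<n. ?G i k * (\<Sum>l<n. ?y k l * ?R l j)) = (\<Sum>k<n. if k = j then ?G i k else 0)"
    using ij by (intro sum.cong refl) (simp add: shifted_resolvent[OF Y])
  also have "\<dots> = ?G i j" using ij by simp
  finally show ?thesis by simp
qed

lemma resolvent_sym:
  assumes X: "symk n X" "Im z > 0" shows "symk n (resolvent n X z)"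
  unfolding symk_def
proof (intro allI impI)
  fix i j assume ij: "i < n" "j < n"
  let ?G = "resolvent n X z" let ?x = "\<lambda>k l. complex_of_real (X k l) - (if k = l then z else 0)"
  have "?G j i = (\<Sum>k<n. if k = j then ?G k i else 0)" using ij by simp
  also have "\<dots> = (\<Sum>k<n. (if k = j then 1 else 0) * ?G k i)"
    by (intro sum.cong) auto
  also have "\<dots> = (\<Sum>k<n. (\<Sum>l<n. ?x k l * ?G l j) * ?G k i)"
    using ij by (intro sum.cong refl) (simp add: shifted_resolvent[OF X])
  also have "\<dots> = (\<Sum>k<n. \<Sum>l<n. ?x k l * ?G l j * ?G k i)"
    by (simp add: sum_distrib_right)
  also have "\<dots> = (\<Sum>l<n. \<Sum>k<n. ?x k l * ?G l j * ?G k i)" by (rule sum.swap)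
  also have "\<dots> = (\<Sum>l<n. ?G l j * (\<Sum>k<n. ?x l k * ?G k i))"
    using X by (auto simp: sum_distrib_left symk_def algebra_simps intro!: sum.cong)
  also have "\<dots> = (\<Sum>l<n. if l = i then ?G l j else 0)"
    using ij by (intro sum.cong refl) (simp add: shifted_resolvent[OF X])
  also have "\<dots> = ?G i j" using ij by simp
  finally show "?G i j = ?G j i" by simp
qed

lemma resolvent_op_bdd:
  assumes X: "symk n X" and z: "Im z > 0"
  shows "op_bdd n (resolvent n X z) (1 / Im z)"
  unfolding op_bdd_def
proof (intro conjI allI)
  show "0 \<le> 1 / Im z" using z by simp
  fix y
  let ?G = "resolvent n X z"
  define u where "u k = (\<Sum>j<n. ?G k j * y j)" for k
  have "(\<Sum>k<n. (complex_of_real (X i k) - (if i = k then z else 0)) * u k) = y i" if "i < n" for i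
  proof -
    have "(\<Sum>k<n. (complex_of_real (X i k) - (if i = k then z else 0)) * u k) =
      (\<Sum>k<n. \<Sum>j<n. (complex_of_real (X i k) - (if i = k then z else 0)) * ?G k j * y j)"
      by (simp add: u_def sum_distrib_left mult.assoc)
    also have "\<dots> = (\<Sum>j<n. \<Sum>k<n. (complex_of_real (X i k) - (if i = k then z else 0)) * ?G k j * y j)"
      by (rule sum.swap)
    also have "\<dots> = (\<Sum>j<n. (if i = j then 1 else 0) * y j)"
      unfolding sum_distrib_right[symmetric] using that
      by (intro sum.cong refl) (simp add: shifted_resolvent[OF X z])
    also have "\<dots> = (\<Sum>j<n. if j = i then y j else 0)" by (intro sum.cong) auto
    finally show ?thesis using that by simp
  qed
  then have "(Im z)\<^sup>2 * (\<Sum>i<n. (cmod (u i))\<^sup>2) \<le> (\<Sum>i<n. (cmod (y i))\<^sup>2)"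
    using shifted_expansive[OF X z, of u] by simp
  then show "(\<Sum>i<n. (cmod (\<Sum>j<n. ?G i j * y j))\<^sup>2) \<le> (1 / Im z)\<^sup>2 * (\<Sum>j<n. (cmod (y j))\<^sup>2)"
    using z unfolding u_def[symmetric] by (simp add: field_simps)
qed

lemma Im_resolvent_diag:
  assumes X: "symk n X" and z: "Im z > 0" and i: "i < n"
  shows "Im (resolvent n X z i i) \<ge> 0"
proof -
  let ?u = "\<lambda>k. resolvent n X z k i"
  have "(\<Sum>k<n. cnj (?u k) * (\<Sum>j<n. (complex_of_real (X k j) - (if k = j then z else 0)) * ?u j))
      = (\<Sum>k<n. if k = i then cnj (?u k) else 0)"
    using i by (intro sum.cong refl) (simp add: shifted_resolvent[OF X z])
  also have "\<dots> = cnj (?u i)" using i by simp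
  finally have "Im (cnj (?u i)) = - Im z * (\<Sum>k<n. (cmod (?u k))\<^sup>2)"
    using Im_shifted_form[OF X, of ?u z] by simp
  then show ?thesis using z by (simp add: sum_nonneg)
qed

lemma op_bdd_mono: "op_bdd n K c \<Longrightarrow> c \<le> d \<Longrightarrow> op_bdd n K d"
  unfolding op_bdd_def by (meson mult_right_mono order_trans power_mono sum_nonneg zero_le_power2)

lemma op_bdd_kprod:
  assumes K: "op_bdd n K c" and L: "op_bdd n L d"
  shows "op_bdd n (kprod n K L) (c * d)"
  unfolding op_bdd_def
proof (intro conjI allI)
  show "0 \<le> c * d" using K L by (auto simp: op_bdd_def)
  fix y
  have eq: "(\<Sum>j<n. kprod n K L i j * y j) = (\<Sum>k<n. K i k * (\<Sum>j<n. L k j * y j))" for i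
  proof -
    have "(\<Sum>j<n. kprod n K L i j * y j) = (\<Sum>j<n. \<Sum>k<n. K i k * L k j * y j)"
      by (simp add: kprod_def sum_distrib_right)
    also have "\<dots> = (\<Sum>k<n. \<Sum>j<n. K i k * L k j * y j)" by (rule sum.swap)
    finally show ?thesis by (simp add: sum_distrib_left mult.assoc)
  qed
  have "(\<Sum>i<n. (cmod (\<Sum>k<n. K i k * (\<Sum>j<n. L k j * y j)))\<^sup>2) \<le> c\<^sup>2 * (\<Sum>k<n. (cmod (\<Sum>j<n. L k j * y j))\<^sup>2)"
    using K[unfolded op_bdd_def, THEN conjunct2, rule_format, of "\<lambda>k. \<Sum>j<n. L k j * y j"] .
  also have "\<dots> \<le> c\<^sup>2 * (d\<^sup>2 * (\<Sum>j<n. (cmod (y j))\<^sup>2))"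
    using L unfolding op_bdd_def by (intro mult_left_mono) auto
  finally show "(\<Sum>i<n. (cmod (\<Sum>j<n. kprod n K L i j * y j))\<^sup>2) \<le> (c * d)\<^sup>2 * (\<Sum>j<n. (cmod (y j))\<^sup>2)"
    unfolding eq by (simp add: power_mult_distrib mult.assoc)
qed

lemma op_bdd_col:
  assumes K: "op_bdd n K c" and j: "j < n"
  shows "(\<Sum>i<n. (cmod (K i j))\<^sup>2) \<le> c\<^sup>2"
proof -
  have *: "(\<Sum>k<n. K i k * (if k = j then 1 else 0)) = K i j" for i
    using j by (simp add: if_distrib cong: if_cong)
  have **: "(\<Sum>k<n. (cmod (if k = j then 1 else 0))\<^sup>2) = 1"
    using j by (simp add: if_distrib[of cmod] if_distrib[of "\<lambda>x. x\<^sup>2"] cong: if_cong)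
  show ?thesis
    using K[unfolded op_bdd_def, THEN conjunct2, rule_format, of "\<lambda>k. if k = j then 1 else 0"]
    unfolding * ** by simp
qed

lemma op_bdd_entry:
  assumes K: "op_bdd n K c" and "i < n" "j < n"
  shows "cmod (K i j) \<le> c"
proof -
  have "(cmod (K i j))\<^sup>2 \<le> (\<Sum>i<n. (cmod (K i j))\<^sup>2)"
    using assms by (intro member_le_sum) auto
  also have "\<dots> \<le> c\<^sup>2" by (rule op_bdd_col) fact+
  finally show ?thesis using K by (simp add: op_bdd_def power2_le_iff_abs_le)
qed

lemma op_bdd_sum_all:
  assumes "op_bdd n K c" shows "(\<Sum>i<n. \<Sum>j<n. (cmod (K i j))\<^sup>2) \<le> real n * c\<^sup>2"
proof -
  have "(\<Sum>i<n. \<Sum>j<n. (cmod (K i j))\<^sup>2) = (\<Sum>j<n. \<Sum>i<n. (cmod (K i j))\<^sup>2)" by (rule sum.swap)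
  also have "\<dots> \<le> (\<Sum>j<n. c\<^sup>2)" by (intro sum_mono op_bdd_col assms) auto
  finally show ?thesis by simp
qed

lemma det_measurable:
  assumes "\<And>i j. i < n \<Longrightarrow> j < n \<Longrightarrow> (\<lambda>x. F x i j) \<in> borel_measurable M"
  shows "(\<lambda>x. det (Matrix.mat n n (\<lambda>(i, j). F x i j :: complex))) \<in> borel_measurable M"
proof -
  have eq: "det (Matrix.mat n n (\<lambda>(i, j). F x i j)) =
     (\<Sum>p\<in>{p. p permutes {0..<n}}. signof p * (\<Prod>i = 0..<n. F x i (p i)))" for x
  proof -
    have "(\<Prod>i = 0..<n. Matrix.mat n n (\<lambda>(i, j). F x i j) $$ (i, p i)) = (\<Prod>i = 0..<n. F x i (p i))"
      if "p permutes {0..<n}" for p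
      using permutes_in_image[OF that] by (intro prod.cong) auto
    then show ?thesis by (simp add: det_def)
  qed
  show ?thesis unfolding eq
  proof (intro borel_measurable_sum borel_measurable_times borel_measurable_const borel_measurable_prod assms)
    fix p i assume "p \<in> {p. p permutes {0..<n}}" "i \<in> {0..<n}"
    then show "i < n" "p i < n" using permutes_in_image[of p "{0..<n}" i] by auto
  qed
qed

lemma resolvent_measurable:
  assumes X: "\<And>i j. i < n \<Longrightarrow> j < n \<Longrightarrow> (\<lambda>x. X x i j) \<in> borel_measurable M"
    and z: "z \<in> borel_measurable M" and ij: "i < n" "j < n"
  shows "(\<lambda>x. resolvent n (X x) (z x) i j) \<in> borel_measurable M"
proof -
  let ?F = "\<lambda>x i j. complex_of_real (X x i j) - (if i = j then z x else 0)"
  have F: "(\<lambda>x. ?F x k l) \<in> borel_measurable M" if "k < n" "l < n" for k l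
    using X[OF that] z by (cases "k = l") auto
  have del: "mat_delete (shifted n (X x) (z x)) j i =
     Matrix.mat (n - 1) (n - 1) (\<lambda>(k, l). ?F x (if k < j then k else Suc k) (if l < i then l else Suc l))" for x
    by (rule eq_matI) (auto simp: mat_delete_def shifted_def)
  have "(\<lambda>x. det (mat_delete (shifted n (X x) (z x)) j i)) \<in> borel_measurable M"
    unfolding del
  proof (rule det_measurable)
    fix k l assume "k < n - 1" "l < n - 1"
    then show "(\<lambda>x. ?F x (if k < j then k else Suc k) (if l < i then l else Suc l)) \<in> borel_measurable M"
      by (intro F) auto
  qed
  moreover have "(\<lambda>x. det (shifted n (X x) (z x))) \<in> borel_measurable M"
    unfolding shifted_def using F by (rule det_measurable)
  ultimately show ?thesis
    using ij by (auto simp: resolvent_def adj_mat_def cofactor_def shifted_def)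
qed

section \<open>Resampling one coordinate of a product measure\<close>

lemma (in prob_space) bounded_integrable:
  fixes u :: "'a \<Rightarrow> 'b :: {banach, second_countable_topology}"
  assumes "u \<in> borel_measurable M" "\<And>x. x \<in> space M \<Longrightarrow> norm (u x) \<le> B"
  shows "integrable M u"
  using assms by (intro integrable_const_bound[of _ B]) auto

lemma (in prob_space) integral_square_shift:
  fixes u :: "'a \<Rightarrow> real"
  assumes u: "u \<in> borel_measurable M" "\<And>x. x \<in> space M \<Longrightarrow> \<bar>u x\<bar> \<le> B"
  shows "(\<integral>x. (u x - c)\<^sup>2 \<partial>M) = (\<integral>x. (u x - expectation u)\<^sup>2 \<partial>M) + (expectation u - c)\<^sup>2"
proof -
  have iu: "integrable M u" using u by (intro bounded_integrable[of _ B]) auto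
  have iu2: "integrable M (\<lambda>x. (u x)\<^sup>2)"
  proof (rule bounded_integrable[of _ "B\<^sup>2"])
    fix x assume "x \<in> space M"
    then have "\<bar>u x\<bar>\<^sup>2 \<le> B\<^sup>2" using u(2) by (intro power_mono) auto
    then show "norm ((u x)\<^sup>2) \<le> B\<^sup>2" by simp
  qed (use u in auto)
  have *: "(\<integral>x. (u x - d)\<^sup>2 \<partial>M) = (\<integral>x. (u x)\<^sup>2 \<partial>M) - 2 * d * expectation u + d\<^sup>2" for d
    using iu iu2 by (simp add: power2_diff prob_space algebra_simps)
  show ?thesis unfolding * by (simp add: power2_eq_square algebra_simps)
qed

lemma (in prob_space) integral_square_ge:
  fixes u :: "'a \<Rightarrow> real"
  assumes u: "u \<in> borel_measurable M" "\<And>x. x \<in> space M \<Longrightarrow> \<bar>u x\<bar> \<le> B"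
  shows "(expectation u)\<^sup>2 \<le> (\<integral>x. (u x)\<^sup>2 \<partial>M)"
  using integral_square_shift[OF u, of 0] by simp

text \<open>A coordinate may be replaced by an independent copy without changing the law.\<close>

lemma (in finite_product_prob_space) distr_resample:
  assumes e: "e \<in> I"
  shows "distr (Pi\<^sub>M I M \<Otimes>\<^sub>M M e) (Pi\<^sub>M I M) (\<lambda>(g, y). g(e := y)) = Pi\<^sub>M I M"
proof (rule PiM_eqI)
  have [measurable]: "(\<lambda>(g, y). g(e := y)) \<in> measurable (Pi\<^sub>M I M \<Otimes>\<^sub>M M e) (Pi\<^sub>M I M)"
    using measurable_add_dim[of e I M] e by (simp add: insert_absorb)
  interpret Q: prob_space "Pi\<^sub>M I M" by (rule prob_space_PiM) (rule M.prob_space_axioms)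
  interpret Me: prob_space "M e" by (rule M.prob_space_axioms)
  fix A assume A: "\<And>i. i \<in> I \<Longrightarrow> A i \<in> sets (M i)"
  have "(\<lambda>(g, y). g(e := y)) -` Pi\<^sub>E I A \<inter> space (Pi\<^sub>M I M \<Otimes>\<^sub>M M e)
      = Pi\<^sub>E I (A(e := space (M e))) \<times> A e" (is "?L = ?R")
  proof (rule Set.set_eqI)
    fix p :: "('a \<Rightarrow> 'b) \<times> 'b"
    obtain g y where p: "p = (g, y)" by (cases p)
    have sub: "A i \<subseteq> space (M i)" if "i \<in> I" for i using sets.sets_into_space[OF A[OF that]] .
    show "p \<in> ?L \<longleftrightarrow> p \<in> ?R"
      using e sub by (fastforce simp: p space_pair_measure space_PiM PiE_iff extensional_def split: if_splits)
  qed
  moreover have "emeasure (Pi\<^sub>M I M \<Otimes>\<^sub>M M e) (Pi\<^sub>E I (A(e := space (M e))) \<times> A e)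
      = (\<Prod>i\<in>I. emeasure (M i) ((A(e := space (M e))) i)) * emeasure (M e) (A e)"
    using A e by (subst sigma_finite_measure.emeasure_pair_measure_Times[OF M.sigma_finite_measure_axioms]) (auto intro!: sets_PiM_I_finite simp: finite_index measure_times)
  moreover have "\<dots> = (\<Prod>i\<in>I. emeasure (M i) (A i))"
    using e finite_index by (simp add: prod.remove[of I e] M.emeasure_space_1 mult.commute)
  ultimately show "emeasure (distr (Pi\<^sub>M I M \<Otimes>\<^sub>M M e) (Pi\<^sub>M I M) (\<lambda>(g, y). g(e := y))) (Pi\<^sub>E I A)
      = (\<Prod>i\<in>I. emeasure (M i) (A i))"
    using A by (subst emeasure_distr) (auto intro!: sets_PiM_I_finite simp: finite_index)
qed (auto simp: finite_index)

lemma (in finite_product_prob_space) integrable_coord: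
  fixes h :: "'b \<Rightarrow> 'c :: {banach, second_countable_topology}"
  assumes e: "e \<in> I" and h: "integrable (M e) h"
  shows "integrable (Pi\<^sub>M I M) (\<lambda>g. h (g e))"
    and "(\<integral>g. h (g e) \<partial>Pi\<^sub>M I M) = (\<integral>x. h x \<partial>M e)"
proof -
  have d: "distr (Pi\<^sub>M I M) (M e) (\<lambda>g. g e) = M e"
    using e finite_index M.prob_space_axioms by (intro distr_PiM_component) auto
  have m: "(\<lambda>g. g e) \<in> measurable (Pi\<^sub>M I M) (M e)" using e by simp
  show "integrable (Pi\<^sub>M I M) (\<lambda>g. h (g e))"
    using h m by (subst integrable_distr_eq[symmetric, of _ _ "M e"]) (auto simp: d)
  show "(\<integral>g. h (g e) \<partial>Pi\<^sub>M I M) = (\<integral>x. h x \<partial>M e)"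
    using h m by (subst integral_distr[symmetric, of _ _ "M e"]) (auto simp: d)
qed

text \<open>A function that ignores the coordinate \<open>e\<close> is independent of that coordinate.\<close>

lemma (in finite_product_prob_space) integral_coord_times:
  fixes h :: "'b \<Rightarrow> 'c :: {banach, second_countable_topology, real_normed_field}"
  assumes e: "e \<in> I" and h: "integrable (M e) h"
    and F: "F \<in> borel_measurable (Pi\<^sub>M I M)" "\<And>g. g \<in> space (Pi\<^sub>M I M) \<Longrightarrow> norm (F g) \<le> B"
    and inv: "\<And>g y. F (g(e := y)) = F g"
  shows "integrable (Pi\<^sub>M I M) (\<lambda>g. h (g e) * F g)"
    and "(\<integral>g. h (g e) * F g \<partial>Pi\<^sub>M I M) = (\<integral>x. h x \<partial>M e) * (\<integral>g. F g \<partial>Pi\<^sub>M I M)"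
proof -
  interpret Q: prob_space "Pi\<^sub>M I M" by (rule prob_space_PiM) (rule M.prob_space_axioms)
  interpret Me: prob_space "M e" by (rule M.prob_space_axioms)
  interpret QM: pair_prob_space "Pi\<^sub>M I M" "M e" ..
  have B: "0 \<le> B" proof -
    obtain g where "g \<in> space (Pi\<^sub>M I M)" using P.not_empty by blast
    with F(2)[of g] show ?thesis using norm_ge_zero[of "F g"] by linarith
  qed
  have hm [measurable]: "h \<in> borel_measurable (M e)" using h by simp
  have Fm [measurable]: "F \<in> borel_measurable (Pi\<^sub>M I M)" by fact
  have co [measurable]: "(\<lambda>g. g e) \<in> measurable (Pi\<^sub>M I M) (M e)" using e by simp
  have up [measurable]: "(\<lambda>(g, y). g(e := y)) \<in> measurable (Pi\<^sub>M I M \<Otimes>\<^sub>M M e) (Pi\<^sub>M I M)"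
    using measurable_add_dim[of e I M] e by (simp add: insert_absorb)
  show int: "integrable (Pi\<^sub>M I M) (\<lambda>g. h (g e) * F g)"
  proof (rule Bochner_Integration.integrable_bound)
    show "integrable (Pi\<^sub>M I M) (\<lambda>g. B * norm (h (g e)))"
      using integrable_coord(1)[OF e h] by simp
    show "AE g in Pi\<^sub>M I M. norm (h (g e) * F g) \<le> norm (B * norm (h (g e)))"
    proof (rule AE_I2)
      fix g assume g: "g \<in> space (Pi\<^sub>M I M)"
      have "norm (h (g e)) * norm (F g) \<le> norm (h (g e)) * B" using F(2)[OF g] by (rule mult_left_mono) simp
      then show "norm (h (g e) * F g) \<le> norm (B * norm (h (g e)))"
        using B by (simp add: norm_mult mult.commute)
    qed
  qed simp
  have int2: "integrable (Pi\<^sub>M I M \<Otimes>\<^sub>M M e) (\<lambda>p. h (((\<lambda>(g, y). g(e := y)) p) e) * F ((\<lambda>(g, y). g(e := y)) p))"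
    by (subst integrable_distr_eq[OF up, symmetric]) (auto simp: distr_resample[OF e] int)
  have "(\<integral>g. h (g e) * F g \<partial>Pi\<^sub>M I M) = (\<integral>g. h (g e) * F g \<partial>distr (Pi\<^sub>M I M \<Otimes>\<^sub>M M e) (Pi\<^sub>M I M) (\<lambda>(g, y). g(e := y)))"
    by (simp add: distr_resample[OF e])
  also have "\<dots> = (\<integral>p. h (((\<lambda>(g, y). g(e := y)) p) e) * F ((\<lambda>(g, y). g(e := y)) p) \<partial>(Pi\<^sub>M I M \<Otimes>\<^sub>M M e))"
    by (subst integral_distr[OF up]) auto
  also have "\<dots> = (\<integral>g. \<integral>y. h y * F g \<partial>M e \<partial>Pi\<^sub>M I M)"
    using QM.integral_fst'[OF int2] by (simp add: inv)
  also have "\<dots> = (\<integral>g. (\<integral>y. h y \<partial>M e) * F g \<partial>Pi\<^sub>M I M)" by (simp add: h)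
  also have "\<dots> = (\<integral>x. h x \<partial>M e) * (\<integral>g. F g \<partial>Pi\<^sub>M I M)"
    using P.bounded_integrable[OF F] by simp
  finally show "(\<integral>g. h (g e) * F g \<partial>Pi\<^sub>M I M) = (\<integral>x. h x \<partial>M e) * (\<integral>g. F g \<partial>Pi\<^sub>M I M)" .
qed

text \<open>Induction on the coordinates: splitting off one of them decomposes the variance into the mean
  conditional variance, which is at most the mean square deviation from the value at the fixed point
  \<open>a\<close>, and the variance of the conditional mean, to which the induction hypothesis
  applies by Jensen's inequality. Setting a coordinate to a constant instead of resampling it suits
  resolvents, where the constant is \<open>0\<close>.\<close>

theorem (in product_prob_space) efron_stein:
  fixes f :: "('i \<Rightarrow> 'a) \<Rightarrow> real"
  assumes "finite J" and f: "f \<in> borel_measurable (Pi\<^sub>M J M)" "\<And>g. \<bar>f g\<bar> \<le> B"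
    and a: "\<And>e. e \<in> J \<Longrightarrow> a e \<in> space (M e)"
  shows "(\<integral>g. (f g - (\<integral>g. f g \<partial>Pi\<^sub>M J M))\<^sup>2 \<partial>Pi\<^sub>M J M) \<le> (\<Sum>e\<in>J. \<integral>g. (f g - f (g(e := a e)))\<^sup>2 \<partial>Pi\<^sub>M J M)"
  using assms
proof (induction J arbitrary: f rule: finite_induct)
  case empty
  then show ?case 
  proof -
    interpret R: prob_space "Pi\<^sub>M {} M" by (rule prob_space_PiM) (rule M.prob_space_axioms)
    have *: "(\<integral>g. F g \<partial>Pi\<^sub>M {} M) = F (\<lambda>_. undefined)" for F :: "_ \<Rightarrow> real"
    proof -
      have "(\<integral>g. F g \<partial>Pi\<^sub>M {} M) = (\<integral>g. F (\<lambda>_. undefined) \<partial>Pi\<^sub>M {} M)"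
        by (rule Bochner_Integration.integral_cong) (auto simp: space_PiM_empty)
      then show ?thesis by (simp add: R.prob_space)
    qed
    show ?thesis unfolding * by simp
  qed
next
  case (insert i J)
  let ?P = "Pi\<^sub>M (insert i J) M" let ?Q = "Pi\<^sub>M J M"
  interpret R: prob_space ?P by (rule prob_space_PiM) (rule M.prob_space_axioms)
  interpret Q: prob_space ?Q by (rule prob_space_PiM) (rule M.prob_space_axioms)
  interpret Mi: prob_space "M i" by (rule M.prob_space_axioms)
  have fm [measurable]: "f \<in> borel_measurable ?P" and B: "\<And>g. \<bar>f g\<bar> \<le> B" by fact+
  have ad [measurable]: "(\<lambda>(x, y). x(i := y)) \<in> measurable (?Q \<Otimes>\<^sub>M M i) ?P"
    by (rule measurable_add_dim)
  have fxy [measurable]: "(\<lambda>(x, y). f (x(i := y))) \<in> borel_measurable (?Q \<Otimes>\<^sub>M M i)"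
    using measurable_comp[OF ad fm] by (simp add: comp_def case_prod_unfold)
  have fy: "(\<lambda>y. f (x(i := y))) \<in> borel_measurable (M i)" if "x \<in> space ?Q" for x
    using measurable_Pair2[OF fxy that] by simp
  have ai: "a i \<in> space (M i)" using insert.prems by simp
  define h where "h x = (\<integral>y. f (x(i := y)) \<partial>M i)" for x
  have hm [measurable]: "h \<in> borel_measurable ?Q" unfolding h_def
    using fxy by (rule sigma_finite_measure.borel_measurable_lebesgue_integral[OF M.sigma_finite_measure_axioms])
  have hB: "\<bar>h x\<bar> \<le> B" for x
  proof (cases "integrable (M i) (\<lambda>y. f (x(i := y)))")
    case True
    have "\<bar>h x\<bar> \<le> (\<integral>y. \<bar>f (x(i := y))\<bar> \<partial>M i)" unfolding h_def by (rule integral_abs_bound)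
    also have "\<dots> \<le> (\<integral>y. B \<partial>M i)" using True B by (intro integral_mono) auto
    finally show ?thesis by (simp add: M.prob_space)
  next
    case False
    then show ?thesis using B[of x] by (simp add: h_def not_integrable_integral_eq)
  qed
  have sqB: "(u - v)\<^sup>2 \<le> (2 * B)\<^sup>2" if "\<bar>u\<bar> \<le> B" "\<bar>v\<bar> \<le> B" for u v :: real
    using that by (intro power2_le_iff_abs_le[THEN iffD2]) auto
  have ins: "(\<integral>g. F g \<partial>?P) = (\<integral>x. \<integral>y. F (x(i := y)) \<partial>M i \<partial>?Q)"
    if "F \<in> borel_measurable ?P" "\<And>g. \<bar>F g\<bar> \<le> C" for F :: "('i \<Rightarrow> 'a) \<Rightarrow> real" and C
    using insert.hyps that by (intro product_integral_insert R.bounded_integrable[of _ C]) auto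
  have meas_in: "(\<lambda>x. \<integral>y. F (x(i := y)) \<partial>M i) \<in> borel_measurable ?Q"
    if "F \<in> borel_measurable ?P" for F :: "('i \<Rightarrow> 'a) \<Rightarrow> real"
    using measurable_comp[OF ad that] 
    by (intro sigma_finite_measure.borel_measurable_lebesgue_integral[OF M.sigma_finite_measure_axioms]) (simp add: comp_def case_prod_unfold)
  have bd_in: "\<bar>\<integral>y. F (x(i := y)) \<partial>M i\<bar> \<le> C" if "\<And>g. \<bar>F g\<bar> \<le> C" for F :: "('i \<Rightarrow> 'a) \<Rightarrow> real" and C x
  proof (cases "integrable (M i) (\<lambda>y. F (x(i := y)))")
    case True
    have "\<bar>\<integral>y. F (x(i := y)) \<partial>M i\<bar> \<le> (\<integral>y. \<bar>F (x(i := y))\<bar> \<partial>M i)" by (rule integral_abs_bound)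
    also have "\<dots> \<le> (\<integral>y. C \<partial>M i)" using True that by (intro integral_mono) auto
    finally show ?thesis by (simp add: M.prob_space)
  next
    case False
    then show ?thesis using that[of x] by (simp add: not_integrable_integral_eq)
  qed
  have int_in: "integrable ?Q (\<lambda>x. \<integral>y. F (x(i := y)) \<partial>M i)"
    if "F \<in> borel_measurable ?P" "\<And>g. \<bar>F g\<bar> \<le> C" for F :: "('i \<Rightarrow> 'a) \<Rightarrow> real" and C
    by (rule Q.bounded_integrable[OF meas_in[OF that(1)], of C]) (unfold real_norm_def, rule bd_in, rule that(2))
  define m where "m = (\<integral>g. f g \<partial>?P)"
  have m: "m = (\<integral>x. h x \<partial>?Q)" unfolding m_def h_def using fm B by (rule ins)
  have mB: "\<bar>m\<bar> \<le> B"
  proof -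
    have B0: "0 \<le> B" using B[of undefined] by linarith
    have "\<bar>m\<bar> \<le> (\<integral>g. \<bar>f g\<bar> \<partial>?P)" unfolding m_def by (rule integral_abs_bound)
    also have "\<dots> \<le> (\<integral>g. B \<partial>?P)" using B B0 by (intro integral_mono R.bounded_integrable[of _ B]) auto
    finally show ?thesis by (simp add: R.prob_space)
  qed
  define D where "D e g = (f g - f (g(e := a e)))\<^sup>2" for e g
  have Dm [measurable]: "D e \<in> borel_measurable ?P" if "e \<in> insert i J" for e
  proof -
    have "(\<lambda>g. g(e := a e)) \<in> measurable ?P ?P"
      using insert.prems(3)[OF that] that by (intro measurable_fun_upd[where J="insert i J"]) auto
    from measurable_comp[OF this fm] have "(\<lambda>g. f (g(e := a e))) \<in> borel_measurable ?P" by (simp add: comp_def)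
    then show ?thesis unfolding D_def by simp
  qed
  have DB: "\<bar>D e g\<bar> \<le> (2 * B)\<^sup>2" for e g unfolding D_def using sqB[OF B B] by simp
  have int_D: "integrable ?Q (\<lambda>x. \<integral>y. D e (x(i := y)) \<partial>M i)" if "e \<in> insert i J" for e
    using Dm[OF that] DB by (rule int_in)
  have int_hm: "integrable ?Q (\<lambda>x. (h x - m)\<^sup>2)"
    using sqB[OF hB mB] by (intro Q.bounded_integrable[of _ "(2 * B)\<^sup>2"]) auto
  have "(\<integral>g. (f g - m)\<^sup>2 \<partial>?P) = (\<integral>x. \<integral>y. (f (x(i := y)) - m)\<^sup>2 \<partial>M i \<partial>?Q)"
    using sqB[OF B mB] by (intro ins[of _ "(2 * B)\<^sup>2"]) auto
  also have "\<dots> \<le> (\<integral>x. (\<integral>y. D i (x(i := y)) \<partial>M i) + (h x - m)\<^sup>2 \<partial>?Q)"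
  proof (rule integral_mono)
    show "integrable ?Q (\<lambda>x. \<integral>y. (f (x(i := y)) - m)\<^sup>2 \<partial>M i)"
      using sqB[OF B mB] by (intro int_in[of "\<lambda>g. (f g - m)\<^sup>2" "(2 * B)\<^sup>2"]) auto
    show "integrable ?Q (\<lambda>x. (\<integral>y. D i (x(i := y)) \<partial>M i) + (h x - m)\<^sup>2)"
      using int_hm int_D[of i] by simp
    fix x assume x: "x \<in> space ?Q"
    have u: "(\<lambda>y. f (x(i := y))) \<in> borel_measurable (M i)" "\<And>y. \<bar>f (x(i := y))\<bar> \<le> B"
      using fy[OF x] B by auto
    have "(\<integral>y. (f (x(i := y)) - m)\<^sup>2 \<partial>M i) = (\<integral>y. (f (x(i := y)) - h x)\<^sup>2 \<partial>M i) + (h x - m)\<^sup>2"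
      unfolding h_def using u by (rule M.integral_square_shift)
    moreover have "(\<integral>y. (f (x(i := y)) - h x)\<^sup>2 \<partial>M i) \<le> (\<integral>y. (f (x(i := y)) - f (x(i := a i)))\<^sup>2 \<partial>M i)"
      unfolding h_def using M.integral_square_shift[OF u, of "f (x(i := a i))"] by simp
    ultimately show "(\<integral>y. (f (x(i := y)) - m)\<^sup>2 \<partial>M i) \<le> (\<integral>y. D i (x(i := y)) \<partial>M i) + (h x - m)\<^sup>2"
      by (simp add: D_def)
  qed
  also have "\<dots> = (\<integral>x. \<integral>y. D i (x(i := y)) \<partial>M i \<partial>?Q) + (\<integral>x. (h x - m)\<^sup>2 \<partial>?Q)"
    using int_hm int_D[of i] by simp
  also have "(\<integral>x. \<integral>y. D i (x(i := y)) \<partial>M i \<partial>?Q) = (\<integral>g. D i g \<partial>?P)"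
    using DB Dm by (intro ins[symmetric, of _ "(2 * B)\<^sup>2"]) auto
  also have "(\<integral>x. (h x - m)\<^sup>2 \<partial>?Q) \<le> (\<Sum>e\<in>J. \<integral>x. (h x - h (x(e := a e)))\<^sup>2 \<partial>?Q)"
    unfolding m using hm hB insert.prems(3) by (intro insert.IH) auto
  also have "\<dots> \<le> (\<Sum>e\<in>J. \<integral>g. D e g \<partial>?P)"
  proof (rule sum_mono)
    fix e assume e: "e \<in> J"
    have ne: "e \<noteq> i" using e insert.hyps by auto
    have upe: "(\<lambda>g. g(e := a e)) \<in> measurable ?Q ?Q"
      using insert.prems(3) e by (intro measurable_fun_upd[where J=J]) auto
    from measurable_comp[OF this hm] have hme [measurable]: "(\<lambda>x. h (x(e := a e))) \<in> borel_measurable ?Q" by (simp add: comp_def)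
    have "(\<integral>x. (h x - h (x(e := a e)))\<^sup>2 \<partial>?Q) \<le> (\<integral>x. \<integral>y. D e (x(i := y)) \<partial>M i \<partial>?Q)"
    proof (rule integral_mono)
      show "integrable ?Q (\<lambda>x. (h x - h (x(e := a e)))\<^sup>2)"
        using sqB[OF hB hB] by (intro Q.bounded_integrable[of _ "(2 * B)\<^sup>2"]) auto
      show "integrable ?Q (\<lambda>x. \<integral>y. D e (x(i := y)) \<partial>M i)"
        using int_D[of e] e by simp
      fix x assume x: "x \<in> space ?Q"
      have xe: "x(e := a e) \<in> space ?Q" using measurable_space[OF upe x] .
      have u: "(\<lambda>y. f (x(i := y))) \<in> borel_measurable (M i)" "(\<lambda>y. f (x(e := a e, i := y))) \<in> borel_measurable (M i)"
        using fy[OF x] fy[OF xe] .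
      have iu: "integrable (M i) (\<lambda>y. f (x(i := y)))" "integrable (M i) (\<lambda>y. f (x(e := a e, i := y)))"
        using u B by (auto intro!: M.bounded_integrable[where B=B])
      have "(h x - h (x(e := a e)))\<^sup>2 = (\<integral>y. f (x(i := y)) - f (x(e := a e, i := y)) \<partial>M i)\<^sup>2"
        using iu by (simp add: h_def)
      also have "\<dots> \<le> (\<integral>y. (f (x(i := y)) - f (x(e := a e, i := y)))\<^sup>2 \<partial>M i)"
      proof (rule M.integral_square_ge[where B="2 * B"])
        show "\<bar>f (x(i := y)) - f (x(e := a e, i := y))\<bar> \<le> 2 * B" for y
          using B[of "x(i := y)"] B[of "x(e := a e, i := y)"] by linarith
      qed (use u in auto)
      also have "\<dots> = (\<integral>y. D e (x(i := y)) \<partial>M i)"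
        using ne by (simp add: D_def fun_upd_twist)
      finally show "(h x - h (x(e := a e)))\<^sup>2 \<le> (\<integral>y. D e (x(i := y)) \<partial>M i)" .
    qed
    also have "\<dots> = (\<integral>g. D e g \<partial>?P)"
      using DB Dm e by (intro ins[symmetric, of _ "(2 * B)\<^sup>2"]) auto
    finally show "(\<integral>x. (h x - h (x(e := a e)))\<^sup>2 \<partial>?Q) \<le> (\<integral>g. D e g \<partial>?P)" .
  qed
  finally show ?case using insert.hyps by (simp add: m_def D_def fun_upd_def)
qed

section \<open>Removing one matrix entry\<close>

definition edges :: "nat \<Rightarrow> (nat \<times> nat) set" where
  "edges n = {(i, j). i \<le> j \<and> j < n}"

definition wk :: "(nat \<times> nat \<Rightarrow> real) \<Rightarrow> nat \<Rightarrow> nat \<Rightarrow> real" where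
  "wk g i j = g (min i j, max i j)"

definition pert :: "(nat \<Rightarrow> nat \<Rightarrow> real) \<Rightarrow> real \<Rightarrow> (nat \<times> nat \<Rightarrow> real) \<Rightarrow> nat \<Rightarrow> nat \<Rightarrow> real" where
  "pert B c g i j = B i j + c * wk g i j"

text \<open>Diagonal entries would otherwise be counted twice when sums over all positions are
  rewritten as sums over the independent entries.\<close>

definition half_diag :: "nat \<times> nat \<Rightarrow> complex" where
  "half_diag e = (if fst e = snd e then 1/2 else 1)"

definition ntrace :: "nat \<Rightarrow> (nat \<Rightarrow> nat \<Rightarrow> complex) \<Rightarrow> complex" where
  "ntrace n K = (\<Sum>i<n. K i i) / of_nat n"

lemma finite_edges [simp]: "finite (edges n)"
  by (rule finite_subset[of _ "{..<n} \<times> {..<n}"]) (auto simp: edges_def)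

lemma card_edges: "card (edges n) \<le> n\<^sup>2"
proof -
  have "card (edges n) \<le> card ({..<n} \<times> {..<n})"
    by (rule card_mono) (auto simp: edges_def)
  then show ?thesis by (simp add: power2_eq_square)
qed

lemma sum_edges:
  "(\<Sum>k<n. \<Sum>l<n. f k l) = (\<Sum>(i, j)\<in>edges n. half_diag (i, j) * (f i j + f j i))"
proof -
  let ?U = "{(i, j). i < j \<and> j < n}" let ?D = "(\<lambda>i. (i, i)) ` {..<n}"
  let ?L = "(\<lambda>(i, j). (j, i)) ` ?U"
  have fin: "finite ?U" by (rule finite_subset[OF _ finite_edges[of n]]) (auto simp: edges_def)
  have E: "edges n = ?U \<union> ?D" by (auto simp: edges_def)
  have all: "{..<n} \<times> {..<n} = (?U \<union> ?D) \<union> ?L" by (auto simp: image_iff) 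
  have "(\<Sum>k<n. \<Sum>l<n. f k l) = (\<Sum>p\<in>{..<n} \<times> {..<n}. f (fst p) (snd p))"
    by (simp add: sum.cartesian_product case_prod_unfold)
  also have "\<dots> = (\<Sum>p\<in>?U \<union> ?D. f (fst p) (snd p)) + (\<Sum>p\<in>?L. f (fst p) (snd p))"
    unfolding all using fin by (intro sum.union_disjoint) auto
  also have "(\<Sum>p\<in>?U \<union> ?D. f (fst p) (snd p)) = (\<Sum>p\<in>?U. f (fst p) (snd p)) + (\<Sum>p\<in>?D. f (fst p) (snd p))"
    using fin by (intro sum.union_disjoint) auto
  also have "(\<Sum>p\<in>?L. f (fst p) (snd p)) = (\<Sum>p\<in>?U. f (snd p) (fst p))"
    by (subst sum.reindex) (auto simp: inj_on_def case_prod_unfold)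
  finally have 1: "(\<Sum>k<n. \<Sum>l<n. f k l) = (\<Sum>p\<in>?U. f (fst p) (snd p) + f (snd p) (fst p)) + (\<Sum>p\<in>?D. f (fst p) (snd p))"
    by (simp add: sum.distrib)
  have "(\<Sum>(i, j)\<in>edges n. half_diag (i, j) * (f i j + f j i)) =
    (\<Sum>(i, j)\<in>?U. half_diag (i, j) * (f i j + f j i)) + (\<Sum>(i, j)\<in>?D. half_diag (i, j) * (f i j + f j i))"
    unfolding E using fin by (intro sum.union_disjoint) auto
  also have "(\<Sum>(i, j)\<in>?U. half_diag (i, j) * (f i j + f j i)) = (\<Sum>p\<in>?U. f (fst p) (snd p) + f (snd p) (fst p))"
    by (intro sum.cong) (auto simp: half_diag_def)
  also have "(\<Sum>(i, j)\<in>?D. half_diag (i, j) * (f i j + f j i)) = (\<Sum>p\<in>?D. f (fst p) (snd p))"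
    by (intro sum.cong) (auto simp: half_diag_def)
  finally show ?thesis using 1 by simp
qed

lemma symk_pert: "symk n B \<Longrightarrow> symk n (pert B c g)"
  by (auto simp: symk_def pert_def wk_def min.commute max.commute)

lemma double_sum_pick:
  fixes u w :: "nat \<Rightarrow> complex"
  assumes "i < n" "j < n"
  shows "(\<Sum>k<n. \<Sum>l<n. u k * (if k = i \<and> l = j then t else 0) * w l) = t * (u i * w j)"
proof -
  have inner: "(\<Sum>l<n. u k * (if k = i \<and> l = j then t else 0) * w l) = (if k = i then u k * t * w j else 0)" for k
  proof (cases "k = i")
    case True
    then have "(\<Sum>l<n. u k * (if k = i \<and> l = j then t else 0) * w l) = (\<Sum>l<n. if l = j then u k * t * w l else 0)"
      by (intro sum.cong) auto
    then show ?thesis using assms True by simp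
  qed simp
  show ?thesis unfolding inner using assms by simp
qed

lemma norm_half_diag: "cmod (half_diag e) \<le> 1"
  by (simp add: half_diag_def)

lemma ntrace_resolvent_lipschitz:
  assumes B: "symk n B" and w: "Im w \<ge> v" "Im w' \<ge> v" "v > 0"
  shows "cmod (ntrace n (resolvent n B w) - ntrace n (resolvent n B w')) \<le> cmod (w - w') / v\<^sup>2"
proof -
  let ?G = "resolvent n B w" let ?R = "resolvent n B w'"
  have wp: "Im w > 0" "Im w' > 0" using w by auto
  have bG: "op_bdd n ?G (1/v)"
    by (rule op_bdd_mono[OF resolvent_op_bdd[OF B wp(1)]]) (use w in \<open>simp add: frac_le\<close>)
  have bR: "op_bdd n ?R (1/v)"
    by (rule op_bdd_mono[OF resolvent_op_bdd[OF B wp(2)]]) (use w in \<open>simp add: frac_le\<close>)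
  have d: "?G i i - ?R i i = (w - w') * kprod n ?G ?R i i" if "i < n" for i
  proof -
    have "?G i i - ?R i i = (\<Sum>k<n. \<Sum>l<n. ?G i k * (complex_of_real (B k l - B k l) - (if k = l then w' - w else 0)) * ?R l i)"
      by (rule resolvent_identity) (use B wp that in auto)
    also have "\<dots> = (\<Sum>k<n. \<Sum>l<n. if l = k then (w - w') * (?G i k * ?R l i) else 0)"
      by (intro sum.cong refl) (auto simp: algebra_simps)
    finally show ?thesis by (simp add: kprod_def sum_distrib_left)
  qed
  have "cmod ((\<Sum>i<n. ?G i i) - (\<Sum>i<n. ?R i i)) = cmod (\<Sum>i<n. (w - w') * kprod n ?G ?R i i)"
    by (simp add: sum_subtractf[symmetric] d)
  also have "\<dots> \<le> (\<Sum>i<n. cmod (w - w') * (1/v * (1/v)))"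
    using op_bdd_entry[OF op_bdd_kprod[OF bG bR]]
    by (intro sum_norm_le) (auto simp only: norm_mult lessThan_iff intro!: mult_left_mono norm_ge_zero)
  also have "\<dots> = real n * (cmod (w - w') / v\<^sup>2)" by (simp add: power2_eq_square)
  finally have *: "cmod ((\<Sum>i<n. ?G i i) - (\<Sum>i<n. ?R i i)) \<le> real n * (cmod (w - w') / v\<^sup>2)" .
  show ?thesis
  proof (cases "n = 0")
    case False
    then show ?thesis using * by (simp add: ntrace_def diff_divide_distrib[symmetric] norm_divide divide_le_eq mult.commute)
  qed (simp add: ntrace_def)
qed

lemma norm_ntrace_resolvent:
  assumes B: "symk n B" and w: "Im w > 0"
  shows "cmod (ntrace n (resolvent n B w)) \<le> 1 / Im w"
proof (cases "n = 0")
  case False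
  have "cmod (\<Sum>i<n. resolvent n B w i i) \<le> (\<Sum>i<n. 1 / Im w)"
    by (rule sum_norm_le) (auto intro!: op_bdd_entry[OF resolvent_op_bdd[OF B w]])
  then show ?thesis using False by (simp add: ntrace_def norm_divide divide_le_eq mult.commute)
qed (use w in \<open>simp add: ntrace_def\<close>)

lemma Im_ntrace_resolvent:
  assumes B: "symk n B" and w: "Im w > 0"
  shows "Im (ntrace n (resolvent n B w)) \<ge> 0"
proof -
  have "Im (\<Sum>i<n. resolvent n B w i i) \<ge> 0"
    unfolding Im_sum by (intro sum_nonneg Im_resolvent_diag[OF B w]) auto
  then show ?thesis by (simp add: ntrace_def Im_divide_of_nat)
qed

text \<open>Everything in this context is about one fixed realisation.\<close>

locale entry_removal =
  fixes n :: nat and B :: "nat \<Rightarrow> nat \<Rightarrow> real" and c :: real and z :: complex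
    and g :: "nat \<times> nat \<Rightarrow> real" and i j :: nat
  assumes B: "symk n B" and z: "Im z > 0" and e: "(i, j) \<in> edges n"
begin

abbreviation "v \<equiv> Im z"
abbreviation "h \<equiv> g((i, j) := 0)"
abbreviation "G \<equiv> resolvent n (pert B c g) z"
abbreviation "G0 \<equiv> resolvent n (pert B c h) z"
definition t :: complex where "t = of_real (c * g (i, j)) * half_diag (i, j)"

lemma ij: "i < n" "j < n" "i \<le> j" using e by (auto simp: edges_def)

lemma norm_t: "cmod t \<le> \<bar>c * g (i, j)\<bar>"
proof -
  have "cmod t = \<bar>c * g (i, j)\<bar> * cmod (half_diag (i, j))"
    unfolding t_def norm_mult norm_of_real ..
  also have "\<dots> \<le> \<bar>c * g (i, j)\<bar> * 1" by (intro mult_left_mono norm_half_diag) simp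
  finally show ?thesis by simp
qed

lemma G_bdd: "op_bdd n G (1/v)" and G0_bdd: "op_bdd n G0 (1/v)"
  using resolvent_op_bdd[OF symk_pert[OF B] z] by auto

lemma G_sym: "symk n G" and G0_sym: "symk n G0"
  using resolvent_sym[OF symk_pert[OF B] z] by auto

text \<open>Setting the entry \<open>(i, j)\<close> to zero is a perturbation of rank at most two. The factor
  \<open>half_diag\<close> in \<open>t\<close> makes the formula valid on the diagonal, where the
  two terms coincide.\<close>

lemma G_diff:
  assumes ab: "a < n" "b < n"
  shows "G a b - G0 a b = - t * (G0 a i * G j b + G0 a j * G i b)"
proof -
  have dif: "complex_of_real (pert B c g k l - pert B c h k l) - (if k = l then z - z else 0)
     = (if k = i \<and> l = j then t else 0) + (if k = j \<and> l = i then t else 0)" if "k < n" "l < n" for k l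
  proof -
    have "pert B c g k l - pert B c h k l = (if (min k l, max k l) = (i, j) then c * g (i, j) else 0)"
      by (auto simp: pert_def wk_def)
    moreover have "(min k l, max k l) = (i, j) \<longleftrightarrow> (k = i \<and> l = j) \<or> (k = j \<and> l = i)"
      using ij(3) by (auto simp: min_def max_def)
    ultimately have D: "pert B c g k l - pert B c h k l = (if (k = i \<and> l = j) \<or> (k = j \<and> l = i) then c * g (i, j) else 0)"
      by simp
    have T: "t = of_real (c * g (i, j)) * (if i = j then 1/2 else 1)"
      by (simp only: t_def half_diag_def fst_conv snd_conv)
    have aux: "complex_of_real x - (if k = l then z - z else 0) = (if k = i \<and> l = j then T else 0) + (if k = j \<and> l = i then T else 0)"
      if "x = (if (k = i \<and> l = j) \<or> (k = j \<and> l = i) then y else 0)" "T = of_real y * (if i = j then 1/2 else 1)" for x y T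
      unfolding that by (cases "i = j"; cases "k = i"; cases "l = j"; cases "k = j"; cases "l = i") simp_all
    show ?thesis by (rule aux[OF D T])
  qed
  have "G0 a b - G a b = (\<Sum>k<n. \<Sum>l<n. G0 a k * (complex_of_real (pert B c g k l - pert B c h k l) - (if k = l then z - z else 0)) * G l b)"
    by (rule resolvent_identity[OF symk_pert[OF B] z symk_pert[OF B] z ab])
  also have "\<dots> = (\<Sum>k<n. \<Sum>l<n. G0 a k * (if k = i \<and> l = j then t else 0) * G l b + G0 a k * (if k = j \<and> l = i then t else 0) * G l b)"
  proof (intro sum.cong refl)
    fix k l assume "k \<in> {..<n}" "l \<in> {..<n}"
    then have "k < n" "l < n" by auto
    from dif[OF this] show "G0 a k * (complex_of_real (pert B c g k l - pert B c h k l) - (if k = l then z - z else 0)) * G l b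
      = G0 a k * (if k = i \<and> l = j then t else 0) * G l b + G0 a k * (if k = j \<and> l = i then t else 0) * G l b"
      by (simp only: distrib_left distrib_right)
  qed
  also have "\<dots> = t * (G0 a i * G j b) + t * (G0 a j * G i b)"
    unfolding sum.distrib double_sum_pick[OF ij(1,2)] double_sum_pick[OF ij(2,1)] ..
  finally show ?thesis by (simp add: algebra_simps)
qed

lemma kprod_diff_left:
  assumes ab: "a < n" "b < n"
  shows "kprod n G L a b - kprod n G0 L a b = - t * (G0 a i * kprod n G L j b + G0 a j * kprod n G L i b)"
proof -
  have "kprod n G L a b - kprod n G0 L a b = (\<Sum>k<n. (G a k - G0 a k) * L k b)"
    by (simp add: kprod_def sum_subtractf algebra_simps)
  also have "\<dots> = (\<Sum>k<n. - t * (G0 a i * (G j k * L k b) + G0 a j * (G i k * L k b)))"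
    using ab by (intro sum.cong refl) (simp add: G_diff algebra_simps)
  also have "\<dots> = - t * (G0 a i * kprod n G L j b + G0 a j * kprod n G L i b)"
    by (simp only: kprod_def sum_distrib_left[symmetric] sum.distrib)
  finally show ?thesis .
qed

lemma kprod_diff_right:
  assumes ab: "a < n" "b < n"
  shows "kprod n L G a b - kprod n L G0 a b = - t * (kprod n L G0 a i * G j b + kprod n L G0 a j * G i b)"
proof -
  have "kprod n L G a b - kprod n L G0 a b = (\<Sum>k<n. L a k * (G k b - G0 k b))"
    by (simp add: kprod_def sum_subtractf algebra_simps)
  also have "\<dots> = (\<Sum>k<n. - t * (L a k * G0 k i * G j b + L a k * G0 k j * G i b))"
  proof (intro sum.cong refl)
    fix k assume "k \<in> {..<n}"
    then have "G k b - G0 k b = - t * (G0 k i * G j b + G0 k j * G i b)" using ab by (intro G_diff) auto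
    then show "L a k * (G k b - G0 k b) = - t * (L a k * G0 k i * G j b + L a k * G0 k j * G i b)"
      by (simp only:) (simp add: algebra_simps)
  qed
  also have "\<dots> = - t * (kprod n L G0 a i * G j b + kprod n L G0 a j * G i b)"
    by (simp only: kprod_def sum_distrib_right sum.distrib[symmetric] sum_distrib_left)
  finally show ?thesis .
qed

lemma norm_two_terms:
  assumes "cmod a \<le> p" "cmod b \<le> q" "cmod a' \<le> p" "cmod b' \<le> q" "0 \<le> p" "0 \<le> q"
  shows "cmod (- t * (a * b + a' * b')) \<le> \<bar>c * g (i, j)\<bar> * (2 * (p * q))"
proof -
  have "cmod (a * b + a' * b') \<le> cmod a * cmod b + cmod a' * cmod b'"
    using norm_triangle_ineq[of "a * b" "a' * b'"] by (simp add: norm_mult)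
  also have "\<dots> \<le> p * q + p * q" using assms by (intro add_mono mult_mono) auto
  finally have "cmod (a * b + a' * b') \<le> 2 * (p * q)" by simp
  then have "cmod t * cmod (a * b + a' * b') \<le> \<bar>c * g (i, j)\<bar> * (2 * (p * q))"
    using norm_t by (intro mult_mono) auto
  then show ?thesis by (simp add: norm_mult)
qed

lemma G_diff_norm:
  assumes ab: "a < n" "b < n"
  shows "cmod (G a b - G0 a b) \<le> 2 * \<bar>c * g (i, j)\<bar> / v^2"
proof -
  have "cmod (G a b - G0 a b) \<le> \<bar>c * g (i, j)\<bar> * (2 * (1/v * (1/v)))"
    unfolding G_diff[OF ab] using ab ij z
    by (intro norm_two_terms op_bdd_entry[OF G_bdd] op_bdd_entry[OF G0_bdd]) auto
  then show ?thesis by (simp add: power2_eq_square field_simps)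
qed

lemma kprod_diff_left_norm:
  assumes ab: "a < n" "b < n" and L: "op_bdd n L (1/v)"
  shows "cmod (kprod n G L a b - kprod n G0 L a b) \<le> 2 * \<bar>c * g (i, j)\<bar> / v^3"
proof -
  have "cmod (kprod n G L a b - kprod n G0 L a b) \<le> \<bar>c * g (i, j)\<bar> * (2 * (1/v * (1/v * (1/v))))"
    unfolding kprod_diff_left[OF ab] using ab ij z
    by (intro norm_two_terms op_bdd_entry[OF op_bdd_kprod[OF G_bdd L]] op_bdd_entry[OF G0_bdd]) auto
  then show ?thesis by (simp add: power3_eq_cube field_simps)
qed

lemma kprod_diff_right_norm:
  assumes ab: "a < n" "b < n" and L: "op_bdd n L (1/v)"
  shows "cmod (kprod n L G a b - kprod n L G0 a b) \<le> 2 * \<bar>c * g (i, j)\<bar> / v^3"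
proof -
  have "cmod (kprod n L G a b - kprod n L G0 a b) \<le> \<bar>c * g (i, j)\<bar> * (2 * (1/v * (1/v) * (1/v)))"
    unfolding kprod_diff_right[OF ab] using ab ij z
    by (intro norm_two_terms op_bdd_entry[OF op_bdd_kprod[OF L G0_bdd]] op_bdd_entry[OF G_bdd]) auto
  then show ?thesis by (simp add: power3_eq_cube field_simps)
qed

lemma ntrace_diff:
  "of_nat n * (ntrace n G - ntrace n G0) = - t * (kprod n G G0 j i + kprod n G G0 i j)"
proof (cases "n = 0")
  case False
  have "of_nat n * (ntrace n G - ntrace n G0) = (\<Sum>a<n. G a a - G0 a a)"
    using False by (simp add: ntrace_def sum_subtractf right_diff_distrib)
  also have "\<dots> = (\<Sum>a<n. - t * (G j a * G0 a i + G i a * G0 a j))"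
    by (intro sum.cong refl) (simp add: G_diff algebra_simps)
  also have "\<dots> = - t * (kprod n G G0 j i + kprod n G G0 i j)"
    by (simp only: kprod_def sum_distrib_left[symmetric] sum.distrib)
  finally show ?thesis .
qed (use ij in auto)

lemma kprod_G0_sym: "kprod n G0 G0 j i = kprod n G0 G0 i j"
  unfolding kprod_def using G0_sym ij by (intro sum.cong) (auto simp: symk_def)

text \<open>The change of the trace is of order \<open>c/n\<close> times an entry of the squared resolvent. Keeping this
  entry, instead of its maximal size, gains a factor \<open>n\<close> when squares are summed over all entries,
  because the rows of the squared resolvent are square summable.\<close>

lemma ntrace_diff_square:
  "(cmod (ntrace n G - ntrace n G0))\<^sup>2 \<le>
     8 * c\<^sup>2 / (real n)\<^sup>2 * ((g (i, j))\<^sup>2 * (cmod (kprod n G0 G0 i j))\<^sup>2) + 32 * c^4 / ((real n)\<^sup>2 * v^6) * (g (i, j)) ^ 4"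
proof -
  let ?x = "\<bar>c * g (i, j)\<bar>" let ?p = "cmod (kprod n G0 G0 i j)"
  have n: "real n > 0" using ij by simp
  have "cmod (kprod n G G0 j i + kprod n G G0 i j) \<le> cmod (kprod n G G0 j i) + cmod (kprod n G G0 i j)"
    by (rule norm_triangle_ineq)
  also have "\<dots> \<le> (?p + 2 * ?x / v^3) + (?p + 2 * ?x / v^3)"
  proof (rule add_mono)
    show "cmod (kprod n G G0 j i) \<le> ?p + 2 * ?x / v^3"
      using kprod_diff_left_norm[OF ij(2,1) G0_bdd] norm_triangle_ineq2[of "kprod n G G0 j i" "kprod n G0 G0 j i"]
      by (simp add: kprod_G0_sym)
    show "cmod (kprod n G G0 i j) \<le> ?p + 2 * ?x / v^3"
      using kprod_diff_left_norm[OF ij(1,2) G0_bdd] norm_triangle_ineq2[of "kprod n G G0 i j" "kprod n G0 G0 i j"]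
      by simp
  qed
  finally have 1: "cmod (kprod n G G0 j i + kprod n G G0 i j) \<le> 2 * ?p + 4 * ?x / v^3" by simp
  have "real n * cmod (ntrace n G - ntrace n G0) = cmod t * cmod (kprod n G G0 j i + kprod n G G0 i j)"
    using ntrace_diff[THEN arg_cong[where f=cmod]] by (simp add: norm_mult)
  also have "\<dots> \<le> ?x * (2 * ?p + 4 * ?x / v^3)"
    using norm_t 1 by (intro mult_mono) auto
  finally have "(real n * cmod (ntrace n G - ntrace n G0))\<^sup>2 \<le> (?x * (2 * ?p + 4 * ?x / v^3))\<^sup>2"
    by (intro power_mono) auto
  also have "\<dots> \<le> ?x\<^sup>2 * (2 * (2 * ?p)\<^sup>2 + 2 * (4 * ?x / v^3)\<^sup>2)"
    unfolding power_mult_distrib by (intro mult_left_mono) (use sum_squares_bound[of "2 * ?p" "4 * ?x / v^3"] in \<open>auto simp: power2_sum algebra_simps\<close>)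
  also have "\<dots> = 8 * c\<^sup>2 * ((g (i, j))\<^sup>2 * ?p\<^sup>2) + 32 * c^4 / v^6 * (g (i, j)) ^ 4"
    by (simp add: power_mult_distrib abs_mult power_divide algebra_simps power4_eq_xxxx power2_eq_square flip: power_mult)
  finally have "(cmod (ntrace n G - ntrace n G0))\<^sup>2 \<le> (8 * c\<^sup>2 * ((g (i, j))\<^sup>2 * ?p\<^sup>2) + 32 * c^4 / v^6 * (g (i, j)) ^ 4) / (real n)\<^sup>2"
    using n by (simp add: power_mult_distrib pos_le_divide_eq mult.commute)
  then show ?thesis by (simp add: add_divide_distrib mult.commute)
qed

text \<open>Sums over all entries are available for the squared resolvent of the full matrix only, so the one
  with the entry removed has to be traded for it.\<close>

lemma kprod_square_diff:
  "(cmod (kprod n G0 G0 i j))\<^sup>2 \<le> 2 * (cmod (kprod n G G i j))\<^sup>2 + 32 * c\<^sup>2 / v^6 * (g (i, j))\<^sup>2"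
proof -
  let ?x = "\<bar>c * g (i, j)\<bar>"
  have "cmod (kprod n G0 G0 i j - kprod n G G i j) \<le> cmod (kprod n G0 G0 i j - kprod n G0 G i j) + cmod (kprod n G0 G i j - kprod n G G i j)"
    using norm_triangle_ineq[of "kprod n G0 G0 i j - kprod n G0 G i j" "kprod n G0 G i j - kprod n G G i j"] by simp
  then have 1: "cmod (kprod n G0 G0 i j - kprod n G G i j) \<le> 4 * ?x / v^3"
    using kprod_diff_left_norm[OF ij(1,2) G_bdd] kprod_diff_right_norm[OF ij(1,2) G0_bdd]
    by (simp add: norm_minus_commute)
  have "cmod (kprod n G0 G0 i j) \<le> cmod (kprod n G G i j) + 4 * ?x / v^3"
    using 1 norm_triangle_ineq2[of "kprod n G0 G0 i j" "kprod n G G i j"] by simp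
  then have "(cmod (kprod n G0 G0 i j))\<^sup>2 \<le> (cmod (kprod n G G i j) + 4 * ?x / v^3)\<^sup>2"
    by (intro power_mono) auto
  also have "\<dots> \<le> 2 * (cmod (kprod n G G i j))\<^sup>2 + 2 * (4 * ?x / v^3)\<^sup>2"
    using sum_squares_bound[of "cmod (kprod n G G i j)" "4 * ?x / v^3"] by (simp add: power2_sum)
  also have "2 * (4 * ?x / v^3)\<^sup>2 = 32 * c\<^sup>2 / v^6 * (g (i, j))\<^sup>2"
    by (simp add: power_mult_distrib abs_mult power_divide flip: power_mult)
  finally show ?thesis .
qed

end

section \<open>Wigner noise: fluctuations of the normalised trace\<close>

lemma integral_lincomb:
  fixes f h :: "'a \<Rightarrow> real"
  assumes "integrable M f" "integrable M h"
  shows "(\<integral>x. a * f x + b * h x \<partial>M) = a * (\<integral>x. f x \<partial>M) + b * (\<integral>x. h x \<partial>M)"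
  using assms by simp

text \<open>Diagonal variances are only bounded, through \<open>K\<close>, because they are negligible in the
  limit; this covers both a matrix with identically distributed entries and the Gaussian orthogonal
  ensemble.\<close>

locale wigner = finite_product_prob_space D "edges n" for D :: "nat \<times> nat \<Rightarrow> real measure" and n :: nat +
  fixes K :: real
  assumes sets_D: "\<And>e. sets (D e) = sets borel"
    and fourth_int: "\<And>e. e \<in> edges n \<Longrightarrow> integrable (D e) (\<lambda>x. x ^ 4)"
    and fourth_le: "\<And>e. e \<in> edges n \<Longrightarrow> (\<integral>x. x ^ 4 \<partial>D e) \<le> K"
    and mean_zero: "\<And>e. e \<in> edges n \<Longrightarrow> (\<integral>x. x \<partial>D e) = 0"
    and var_one: "\<And>i j. i < j \<Longrightarrow> j < n \<Longrightarrow> (\<integral>x. x\<^sup>2 \<partial>D (i, j)) = 1"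
begin

abbreviation "\<P> \<equiv> Pi\<^sub>M (edges n) D"

lemma D_measurable: "f \<in> borel_measurable borel \<Longrightarrow> f \<in> borel_measurable (D e)"
  using measurable_cong_sets[OF sets_D refl] by blast

lemma space_D: "space (D e) = UNIV"
  using sets_eq_imp_space_eq[OF sets_D] by simp

lemma coord_measurable: "e \<in> edges n \<Longrightarrow> (\<lambda>g. g e) \<in> borel_measurable \<P>"
  using measurable_component_singleton[of e "edges n" D] measurable_cong_sets[OF refl sets_D] by blast

lemma abs_power_le: "\<bar>x::real\<bar> ^ k \<le> 1 + x ^ 4" if "k \<le> 4"
proof (cases "\<bar>x\<bar> \<le> 1")
  case True
  then have "\<bar>x\<bar> ^ k \<le> 1" by (simp add: power_le_one)
  then show ?thesis by (simp add: add_increasing2)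
next
  case False
  then have "\<bar>x\<bar> ^ k \<le> \<bar>x\<bar> ^ 4" using that by (intro power_increasing) auto
  then show ?thesis by simp
qed

lemma moment:
  assumes e: "e \<in> edges n" and k: "k \<le> 4"
  shows "integrable (D e) (\<lambda>x. \<bar>x\<bar> ^ k)" "(\<integral>x. \<bar>x\<bar> ^ k \<partial>D e) \<le> 1 + K"
proof -
  have i1: "integrable (D e) (\<lambda>x. 1 + x ^ 4)" using fourth_int[OF e] by simp
  show int: "integrable (D e) (\<lambda>x. \<bar>x\<bar> ^ k)"
    by (rule Bochner_Integration.integrable_bound[OF i1])
       (use abs_power_le[OF k] in \<open>auto intro!: D_measurable AE_I2\<close>)
  have "(\<integral>x. \<bar>x\<bar> ^ k \<partial>D e) \<le> (\<integral>x. 1 + x ^ 4 \<partial>D e)"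
    using int i1 abs_power_le[OF k] by (rule integral_mono)
  also have "\<dots> = 1 + (\<integral>x. x ^ 4 \<partial>D e)" using fourth_int[OF e] by (simp add: M.prob_space)
  finally show "(\<integral>x. \<bar>x\<bar> ^ k \<partial>D e) \<le> 1 + K" using fourth_le[OF e] by simp
qed

lemma coord_moment:
  assumes e: "e \<in> edges n" and k: "k \<le> 4"
  shows "integrable \<P> (\<lambda>g. \<bar>g e\<bar> ^ k)" "(\<integral>g. \<bar>g e\<bar> ^ k \<partial>\<P>) \<le> 1 + K"
  using integrable_coord[OF e moment(1)[OF e k]] moment(2)[OF e k] by auto

definition m2 :: "nat \<times> nat \<Rightarrow> real" where "m2 e = (\<integral>x. x\<^sup>2 \<partial>D e)"

lemma m2: assumes "e \<in> edges n" shows "0 \<le> m2 e" "m2 e \<le> 1 + K"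
  using moment(2)[OF assms, of 2] by (auto simp: m2_def)

lemma K_nonneg: assumes "e \<in> edges n" shows "0 \<le> K"
proof -
  have "0 \<le> (\<integral>x. x ^ 4 \<partial>D e)" by (rule integral_nonneg_AE) simp
  then show ?thesis using fourth_le[OF assms] by linarith
qed

end

locale deformed_wigner = wigner +
  fixes B :: "nat \<Rightarrow> nat \<Rightarrow> real" and \<tau> :: real and z :: complex
  assumes B: "symk n B" and z: "Im z > 0" and n: "n \<ge> 1" and tau: "\<tau> \<ge> 0"
begin

abbreviation "v \<equiv> Im z"
definition c :: real where "c = \<tau> / sqrt (real n)"
definition G :: "(nat \<times> nat \<Rightarrow> real) \<Rightarrow> nat \<Rightarrow> nat \<Rightarrow> complex" where "G g = resolvent n (pert B c g) z"
definition s :: "(nat \<times> nat \<Rightarrow> real) \<Rightarrow> complex" where "s g = ntrace n (G g)"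
definition m :: complex where "m = (\<integral>g. s g \<partial>\<P>)"

lemma c2: "c\<^sup>2 = \<tau>\<^sup>2 / real n" "c \<ge> 0"
  using n tau by (auto simp: c_def power_divide)

lemma K0: "0 \<le> K"
  by (rule K_nonneg[of "(0, 0)"]) (use n in \<open>auto simp: edges_def\<close>)

lemma removal: "(i, j) \<in> edges n \<Longrightarrow> entry_removal n B z i j"
  using B z by unfold_locales

lemma G_bdd: "op_bdd n (G g) (1/v)" unfolding G_def by (rule resolvent_op_bdd[OF symk_pert[OF B] z])
lemma G_sym: "symk n (G g)" unfolding G_def by (rule resolvent_sym[OF symk_pert[OF B] z])

lemma G_measurable:
  assumes "i < n" "j < n" shows "(\<lambda>g. G g i j) \<in> borel_measurable \<P>"
  unfolding G_def
proof (rule resolvent_measurable)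
  fix k l assume "k < n" "l < n"
  then have "(min k l, max k l) \<in> edges n" by (auto simp: edges_def)
  from coord_measurable[OF this] show "(\<lambda>g. pert B c g k l) \<in> borel_measurable \<P>"
    unfolding pert_def wk_def by simp
qed (use assms in auto)

lemma upd_measurable:
  assumes "e \<in> edges n" shows "(\<lambda>g. g(e := 0)) \<in> measurable \<P> \<P>"
  by (rule measurable_fun_upd[where J="edges n"]) (use assms space_D in auto)

lemma comp_upd_measurable:
  assumes "e \<in> edges n" "f \<in> borel_measurable \<P>" shows "(\<lambda>g. f (g(e := 0))) \<in> borel_measurable \<P>"
  using measurable_comp[OF upd_measurable[OF assms(1)] assms(2)] by (simp add: comp_def)

lemma kprod_measurable:
  assumes "\<And>i j. i < n \<Longrightarrow> j < n \<Longrightarrow> (\<lambda>g. F g i j) \<in> borel_measurable \<P>"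
    "\<And>i j. i < n \<Longrightarrow> j < n \<Longrightarrow> (\<lambda>g. L g i j) \<in> borel_measurable \<P>" "i < n" "j < n"
  shows "(\<lambda>g. kprod n (F g) (L g) i j) \<in> borel_measurable \<P>"
  unfolding kprod_def by (intro borel_measurable_sum borel_measurable_times assms) (use assms in auto)

lemma s_measurable: "s \<in> borel_measurable \<P>"
  unfolding s_def ntrace_def
  by (intro borel_measurable_divide borel_measurable_sum borel_measurable_const G_measurable) auto

lemma s_bound: "cmod (s g) \<le> 1/v"
  unfolding s_def G_def by (rule norm_ntrace_resolvent[OF symk_pert[OF B] z])

lemma s_integrable: "integrable \<P> s"
  by (rule P.bounded_integrable[OF s_measurable s_bound])

lemma Re_m: "Re m = (\<integral>g. Re (s g) \<partial>\<P>)" and Im_m: "Im m = (\<integral>g. Im (s g) \<partial>\<P>)"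
  unfolding m_def using s_integrable by auto

lemma Im_s: "Im (s g) \<ge> 0"
  unfolding s_def G_def by (rule Im_ntrace_resolvent[OF symk_pert[OF B] z])

lemma Im_m_nonneg: "Im m \<ge> 0"
  unfolding Im_m by (rule integral_nonneg_AE) (simp add: Im_s)

subsection \<open>Variance\<close>

text \<open>The entry is independent of the resolvent from which it is removed, so its moments factor out.\<close>

lemma edge_variance:
  assumes e: "(i, j) \<in> edges n"
  shows "(\<integral>g. (cmod (s g - s (g((i, j) := 0))))\<^sup>2 \<partial>\<P>) \<le>
     16 * c\<^sup>2 * (1 + K) / (real n)\<^sup>2 * (\<integral>g. (cmod (kprod n (G g) (G g) i j))\<^sup>2 \<partial>\<P>) + 288 * c ^ 4 * (1 + K)\<^sup>2 / ((real n)\<^sup>2 * v ^ 6)"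
proof -
  let ?e = "(i, j)"
  let ?p = "\<lambda>g. (cmod (kprod n (G g) (G g) i j))\<^sup>2"
  let ?pz = "\<lambda>g. ?p (g(?e := 0))"
  have ij: "i < n" "j < n" using e by (auto simp: edges_def)
  have pm [measurable]: "?p \<in> borel_measurable \<P>"
    using kprod_measurable[where F=G and L=G, OF G_measurable G_measurable ij] by simp
  have p0m [measurable]: "?pz \<in> borel_measurable \<P>" using comp_upd_measurable[OF e pm] .
  have pb: "\<bar>?p g\<bar> \<le> (1/v * (1/v))\<^sup>2" for g
    using op_bdd_entry[OF op_bdd_kprod[OF G_bdd[of g] G_bdd[of g]] ij] by (simp add: power_mono)
  have pint: "integrable \<P> ?p" by (rule P.bounded_integrable[OF pm, of "(1/v * (1/v))\<^sup>2"]) (use pb in simp)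
  have sq: "integrable (D ?e) (\<lambda>x. x\<^sup>2)" using moment(1)[OF e, of 2] by simp
  have inv: "?pz (g(?e := y)) = ?pz g" for g y by simp
  have b0: "norm (?pz g) \<le> (1/v * (1/v))\<^sup>2" for g using pb[of "g(?e := 0)"] by simp
  note ct = integral_coord_times[OF e sq p0m b0 inv]
  have m: "(\<integral>g. (g ?e)\<^sup>2 \<partial>\<P>) \<le> 1 + K" "integrable \<P> (\<lambda>g. (g ?e)\<^sup>2)" using coord_moment[OF e, of 2] by auto
  have m4: "(\<integral>g. (g ?e)^4 \<partial>\<P>) \<le> 1 + K" "integrable \<P> (\<lambda>g. (g ?e)^4)" using coord_moment[OF e, of 4] by auto
  have K1: "1 \<le> 1 + K" using K0 by simp
  have "(\<integral>g. ?pz g \<partial>\<P>) \<le> (\<integral>g. 2 * ?p g + 32 * c\<^sup>2 / v^6 * (g ?e)\<^sup>2 \<partial>\<P>)"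
  proof (rule integral_mono)
    show "integrable \<P> ?pz" by (rule P.bounded_integrable[OF p0m, of "(1/v * (1/v))\<^sup>2"]) (use b0 in simp)
    show "integrable \<P> (\<lambda>g. 2 * ?p g + 32 * c\<^sup>2 / v^6 * (g ?e)\<^sup>2)" using pint m(2) by simp
    show "?pz g \<le> 2 * ?p g + 32 * c\<^sup>2 / v^6 * (g ?e)\<^sup>2" for g
      using entry_removal.kprod_square_diff[OF removal[OF e], of c g] by (simp only: G_def)
  qed
  also have "\<dots> = 2 * (\<integral>g. ?p g \<partial>\<P>) + 32 * c\<^sup>2 / v^6 * (\<integral>g. (g ?e)\<^sup>2 \<partial>\<P>)"
    using pint m(2) by simp
  also have "\<dots> \<le> 2 * (\<integral>g. ?p g \<partial>\<P>) + 32 * c\<^sup>2 / v^6 * (1 + K)"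
    using m(1) z by (intro add_left_mono mult_left_mono) auto
  finally have p0: "(\<integral>g. ?pz g \<partial>\<P>) \<le> 2 * (\<integral>g. ?p g \<partial>\<P>) + 32 * c\<^sup>2 / v^6 * (1 + K)" .
  have "(\<integral>g. (g ?e)\<^sup>2 * ?pz g \<partial>\<P>) = m2 ?e * (\<integral>g. ?pz g \<partial>\<P>)"
    unfolding m2_def by (rule ct(2))
  also have "\<dots> \<le> (1 + K) * (2 * (\<integral>g. ?p g \<partial>\<P>) + 32 * c\<^sup>2 / v^6 * (1 + K))"
    using p0 m2[OF e] by (intro mult_mono) (auto intro!: integral_nonneg_AE)
  finally have gp: "(\<integral>g. (g ?e)\<^sup>2 * ?pz g \<partial>\<P>) \<le> (1 + K) * (2 * (\<integral>g. ?p g \<partial>\<P>) + 32 * c\<^sup>2 / v^6 * (1 + K))" .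
  have "(\<integral>g. (cmod (s g - s (g(?e := 0))))\<^sup>2 \<partial>\<P>) \<le>
     (\<integral>g. 8 * c\<^sup>2 / (real n)\<^sup>2 * ((g ?e)\<^sup>2 * ?pz g) + 32 * c^4 / ((real n)\<^sup>2 * v^6) * (g ?e) ^ 4 \<partial>\<P>)"
  proof (rule integral_mono)
    have "cmod (s g - s (g(?e := 0))) \<le> 1/v + 1/v" for g
      using norm_triangle_ineq4[of "s g" "s (g(?e := 0))"] s_bound[of g] s_bound[of "g(?e := 0)"] by linarith
    then have "norm ((cmod (s g - s (g(?e := 0))))\<^sup>2) \<le> (1/v + 1/v)\<^sup>2" for g by (simp add: power_mono del: power2_sum)
    then show "integrable \<P> (\<lambda>g. (cmod (s g - s (g(?e := 0))))\<^sup>2)"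
      using s_measurable comp_upd_measurable[OF e s_measurable] by (intro P.bounded_integrable) auto
    show "integrable \<P> (\<lambda>g. 8 * c\<^sup>2 / (real n)\<^sup>2 * ((g ?e)\<^sup>2 * ?pz g) + 32 * c^4 / ((real n)\<^sup>2 * v^6) * (g ?e) ^ 4)"
      by (intro Bochner_Integration.integrable_add integrable_mult_right ct(1) m4(2))
    show "(cmod (s g - s (g(?e := 0))))\<^sup>2 \<le> 8 * c\<^sup>2 / (real n)\<^sup>2 * ((g ?e)\<^sup>2 * ?pz g) + 32 * c^4 / ((real n)\<^sup>2 * v^6) * (g ?e) ^ 4" for g
      using entry_removal.ntrace_diff_square[OF removal[OF e], of c g] by (simp only: s_def G_def)
  qed
  also have "\<dots> = 8 * c\<^sup>2 / (real n)\<^sup>2 * (\<integral>g. (g ?e)\<^sup>2 * ?pz g \<partial>\<P>) + 32 * c^4 / ((real n)\<^sup>2 * v^6) * (\<integral>g. (g ?e) ^ 4 \<partial>\<P>)"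
    by (rule integral_lincomb[OF ct(1) m4(2)])
  also have "\<dots> \<le> 8 * c\<^sup>2 / (real n)\<^sup>2 * ((1 + K) * (2 * (\<integral>g. ?p g \<partial>\<P>) + 32 * c\<^sup>2 / v^6 * (1 + K))) + 32 * c^4 / ((real n)\<^sup>2 * v^6) * ((1 + K) * (1 + K))"
  proof -
    have "(1 + K) * 1 \<le> (1 + K) * (1 + K)" using K1 by (intro mult_left_mono) auto
    then have m4': "(\<integral>g. (g ?e) ^ 4 \<partial>\<P>) \<le> (1 + K) * (1 + K)" using m4(1) by (metis mult.right_neutral order_trans)
    have "0 \<le> 8 * c\<^sup>2 / (real n)\<^sup>2" "0 \<le> 32 * c ^ 4 / ((real n)\<^sup>2 * v ^ 6)" using z by auto
    then show ?thesis by (intro add_mono mult_left_mono gp m4')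
  qed
  also have "\<dots> = 16 * c\<^sup>2 * (1 + K) / (real n)\<^sup>2 * (\<integral>g. ?p g \<partial>\<P>) + 288 * c ^ 4 * (1 + K)\<^sup>2 / ((real n)\<^sup>2 * v ^ 6)"
  proof -
    have alg: "8 * x / N * (k * (2 * I + 32 * x / V * k)) + 32 * (x * x) / (N * V) * (k * k)
       = 16 * x * k / N * I + 288 * (x * x) * (k * k) / (N * V)" if "N \<noteq> 0" "V \<noteq> 0" for x N V I k :: real
      using that by (simp add: field_simps)
    have c4: "c ^ 4 = c\<^sup>2 * c\<^sup>2" by (simp add: power2_eq_square power4_eq_xxxx)
    have nz: "(real n)\<^sup>2 \<noteq> 0" "v ^ 6 \<noteq> 0" using n z by auto
    show ?thesis unfolding c4 power2_eq_square[of "1 + K"] by (rule alg[OF nz])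
  qed
  finally show ?thesis .
qed

definition VC :: real where "VC = 16 * \<tau>\<^sup>2 * (1 + K) / v ^ 4 + 288 * \<tau> ^ 4 * (1 + K)\<^sup>2 / v ^ 6"

text \<open>In the Efron-Stein sum, the leading terms add up to \<open>c\<^sup>2 / n\<^sup>2\<close> times the
  squared Hilbert-Schmidt norm of the squared resolvent, which is at most \<open>n /
  v\<^sup>4\<close>; as \<open>c\<^sup>2\<close> is of order \<open>1 / n\<close>, the total is of
  order \<open>n\<^sup>-\<^sup>2\<close>.\<close>

lemma variance_bound: "(\<integral>g. (cmod (s g - m))\<^sup>2 \<partial>\<P>) \<le> VC / (real n)\<^sup>2"
proof -
  have n0: "real n > 0" using n by simp
  have sm [measurable]: "s \<in> borel_measurable \<P>" by (rule s_measurable)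
  have mb: "cmod m \<le> 1/v"
  proof -
    have "cmod m \<le> (\<integral>g. cmod (s g) \<partial>\<P>)" unfolding m_def by simp
    also have "\<dots> \<le> (\<integral>g. 1/v \<partial>\<P>)" using s_bound s_integrable by (intro integral_mono) auto
    finally show ?thesis by (simp add: P.prob_space)
  qed
  have bd: "cmod a \<le> 1/v \<Longrightarrow> cmod b \<le> 1/v \<Longrightarrow> (cmod (a - b))\<^sup>2 \<le> (2/v)\<^sup>2 \<and> (Re a - Re b)\<^sup>2 \<le> (2/v)\<^sup>2 \<and> (Im a - Im b)\<^sup>2 \<le> (2/v)\<^sup>2" for a b
  proof -
    assume "cmod a \<le> 1/v" "cmod b \<le> 1/v"
    then have "cmod (a - b) \<le> 2/v" using norm_triangle_ineq4[of a b] by linarith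
    moreover have "\<bar>Re a - Re b\<bar> \<le> cmod (a - b)" "\<bar>Im a - Im b\<bar> \<le> cmod (a - b)"
      using abs_Re_le_cmod[of "a - b"] abs_Im_le_cmod[of "a - b"] by auto
    ultimately have "\<bar>cmod (a - b)\<bar> \<le> \<bar>2/v\<bar>" "\<bar>Re a - Re b\<bar> \<le> \<bar>2/v\<bar>" "\<bar>Im a - Im b\<bar> \<le> \<bar>2/v\<bar>" by linarith+
    then show ?thesis by (metis power2_abs abs_ge_zero power_mono)
  qed
  have bs: "(cmod (s g - m))\<^sup>2 \<le> (2/v)\<^sup>2 \<and> (Re (s g) - Re m)\<^sup>2 \<le> (2/v)\<^sup>2 \<and> (Im (s g) - Im m)\<^sup>2 \<le> (2/v)\<^sup>2" for g
    by (rule bd[OF s_bound mb])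
  let ?h = "\<lambda>e g. g(e := 0)"
  have bh: "(cmod (s g - s (?h e g)))\<^sup>2 \<le> (2/v)\<^sup>2 \<and> (Re (s g) - Re (s (?h e g)))\<^sup>2 \<le> (2/v)\<^sup>2 \<and> (Im (s g) - Im (s (?h e g)))\<^sup>2 \<le> (2/v)\<^sup>2" for g e
    by (rule bd[OF s_bound s_bound])
  have split: "(cmod a)\<^sup>2 = (Re a)\<^sup>2 + (Im a)\<^sup>2" for a by (simp add: cmod_power2)
  have mh [measurable]: "(\<lambda>g. s (?h e g)) \<in> borel_measurable \<P>" if "e \<in> edges n" for e
    using comp_upd_measurable[OF that sm] .
  have "(\<integral>g. (cmod (s g - m))\<^sup>2 \<partial>\<P>) = (\<integral>g. (Re (s g) - Re m)\<^sup>2 \<partial>\<P>) + (\<integral>g. (Im (s g) - Im m)\<^sup>2 \<partial>\<P>)"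
    unfolding split minus_complex.sel using bs by (intro Bochner_Integration.integral_add P.bounded_integrable[of _ "(2/v)\<^sup>2"]) auto
  also have "\<dots> \<le> (\<Sum>e\<in>edges n. \<integral>g. (Re (s g) - Re (s (?h e g)))\<^sup>2 \<partial>\<P>) + (\<Sum>e\<in>edges n. \<integral>g. (Im (s g) - Im (s (?h e g)))\<^sup>2 \<partial>\<P>)"
  proof (rule add_mono)
    have "\<bar>Re (s g)\<bar> \<le> 1/v" "\<bar>Im (s g)\<bar> \<le> 1/v" for g
      using s_bound[of g] abs_Re_le_cmod[of "s g"] abs_Im_le_cmod[of "s g"] by linarith+
    then show "(\<integral>g. (Re (s g) - Re m)\<^sup>2 \<partial>\<P>) \<le> (\<Sum>e\<in>edges n. \<integral>g. (Re (s g) - Re (s (?h e g)))\<^sup>2 \<partial>\<P>)"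
      "(\<integral>g. (Im (s g) - Im m)\<^sup>2 \<partial>\<P>) \<le> (\<Sum>e\<in>edges n. \<integral>g. (Im (s g) - Im (s (?h e g)))\<^sup>2 \<partial>\<P>)"
      unfolding Re_m Im_m using space_D
      by (auto intro!: efron_stein[where a="\<lambda>_. 0" and B="1/v"])
  qed
  also have "\<dots> = (\<Sum>e\<in>edges n. \<integral>g. (cmod (s g - s (?h e g)))\<^sup>2 \<partial>\<P>)"
    unfolding sum.distrib[symmetric] split minus_complex.sel using bh
    by (intro sum.cong refl Bochner_Integration.integral_add[symmetric] P.bounded_integrable[of _ "(2/v)\<^sup>2"]) auto
  also have "\<dots> \<le> (\<Sum>(i, j)\<in>edges n. 16 * c\<^sup>2 * (1 + K) / (real n)\<^sup>2 * (\<integral>g. (cmod (kprod n (G g) (G g) i j))\<^sup>2 \<partial>\<P>) + 288 * c ^ 4 * (1 + K)\<^sup>2 / ((real n)\<^sup>2 * v ^ 6))"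
    by (intro sum_mono) (use edge_variance in auto)
  also have "\<dots> = 16 * c\<^sup>2 * (1 + K) / (real n)\<^sup>2 * (\<Sum>(i, j)\<in>edges n. \<integral>g. (cmod (kprod n (G g) (G g) i j))\<^sup>2 \<partial>\<P>) + real (card (edges n)) * (288 * c ^ 4 * (1 + K)\<^sup>2 / ((real n)\<^sup>2 * v ^ 6))"
    by (simp add: case_prod_unfold sum.distrib sum_distrib_left)
  also have "\<dots> \<le> 16 * c\<^sup>2 * (1 + K) / (real n)\<^sup>2 * (real n / v ^ 4) + (real n)\<^sup>2 * (288 * c ^ 4 * (1 + K)\<^sup>2 / ((real n)\<^sup>2 * v ^ 6))"
  proof (intro add_mono mult_left_mono mult_right_mono)
    let ?p = "\<lambda>g i j. (cmod (kprod n (G g) (G g) i j))\<^sup>2"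
    have pint: "integrable \<P> (\<lambda>g. ?p g i j)" if ij: "i < n" "j < n" for i j
    proof (rule P.bounded_integrable[of _ "(1/v * (1/v))\<^sup>2"])
      show "(\<lambda>g. ?p g i j) \<in> borel_measurable \<P>"
        using kprod_measurable[where F=G and L=G, OF G_measurable G_measurable ij] by simp
      show "norm (?p g i j) \<le> (1/v * (1/v))\<^sup>2" for g
        using op_bdd_entry[OF op_bdd_kprod[OF G_bdd[of g] G_bdd[of g]] ij] by (simp add: power_mono)
    qed
    have ed: "fst e < n" "snd e < n" if "e \<in> edges n" for e using that by (auto simp: edges_def)
    have "(\<Sum>(i, j)\<in>edges n. \<integral>g. ?p g i j \<partial>\<P>) = (\<integral>g. (\<Sum>e\<in>edges n. ?p g (fst e) (snd e)) \<partial>\<P>)"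
      using ed by (subst Bochner_Integration.integral_sum) (auto simp: case_prod_unfold intro!: pint)
    also have "\<dots> \<le> (\<integral>g. real n / v ^ 4 \<partial>\<P>)"
    proof (rule integral_mono)
      show "integrable \<P> (\<lambda>g. \<Sum>e\<in>edges n. ?p g (fst e) (snd e))"
        using ed by (intro Bochner_Integration.integrable_sum pint)
      fix g
      have "(\<Sum>e\<in>edges n. ?p g (fst e) (snd e)) \<le> (\<Sum>e\<in>{..<n} \<times> {..<n}. ?p g (fst e) (snd e))"
        by (rule sum_mono2) (auto simp: edges_def)
      also have "\<dots> = (\<Sum>i<n. \<Sum>j<n. ?p g i j)" by (simp add: sum.cartesian_product case_prod_unfold)
      also have "\<dots> \<le> real n * (1/v * (1/v))\<^sup>2" by (rule op_bdd_sum_all[OF op_bdd_kprod[OF G_bdd G_bdd]])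
      also have "\<dots> = real n / v ^ 4" by (simp add: power2_eq_square power4_eq_xxxx)
      finally show "(\<Sum>e\<in>edges n. ?p g (fst e) (snd e)) \<le> real n / v ^ 4" .
    qed simp
    finally show "(\<Sum>(i, j)\<in>edges n. \<integral>g. ?p g i j \<partial>\<P>) \<le> real n / v ^ 4" by (simp add: P.prob_space)
    show "real (card (edges n)) \<le> (real n)\<^sup>2" using card_edges[of n] by (metis of_nat_le_iff of_nat_power)
  qed (use K0 z in auto)
  also have "\<dots> = VC / (real n)\<^sup>2"
  proof -
    have "c ^ 4 = (c\<^sup>2)\<^sup>2" by (simp flip: power_mult)
    then have c4: "c ^ 4 = \<tau> ^ 4 / (real n)\<^sup>2" by (simp add: c2 power_divide flip: power_mult)
    have "16 * c\<^sup>2 * (1 + K) / (real n)\<^sup>2 * (real n / v ^ 4) = 16 * \<tau>\<^sup>2 * (1 + K) / v ^ 4 / (real n)\<^sup>2"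
      using n0 unfolding c2 by (simp add: power2_eq_square)
    moreover have "(real n)\<^sup>2 * (288 * c ^ 4 * (1 + K)\<^sup>2 / ((real n)\<^sup>2 * v ^ 6)) = 288 * \<tau> ^ 4 * (1 + K)\<^sup>2 / v ^ 6 / (real n)\<^sup>2"
    proof -
      have "x * (288 * (t / x) * k / (x * V)) = 288 * t * k / V / x" if "x \<noteq> 0" for x t k V :: real
        using that by (cases "V = 0") (simp_all add: field_simps)
      note aux = this[of "(real n)\<^sup>2" "\<tau> ^ 4" "(1 + K)\<^sup>2" "v ^ 6"]
      have "(real n)\<^sup>2 \<noteq> 0" using n0 by simp
      from aux[OF this] show ?thesis unfolding c4 .
    qed
    ultimately show ?thesis by (simp add: VC_def add_divide_distrib)
  qed
  finally show ?thesis .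
qed

end

section \<open>Wigner noise: the approximate fixed-point equation for the mean\<close>

lemma prod_diff_prod: "a * b - a' * b' = (a - a') * b + a' * (b - b')" for a b a' b' :: complex
  by (simp add: algebra_simps)

lemma two_over_powers: "2 * x / v\<^sup>2 * (1/v * (1/v)) + 1/v * (2 * x / v ^ 3) = 4 * x / v ^ 4" if "v > 0" for x v :: real
proof -
  have p: "v ^ 4 = v\<^sup>2 * (v * v)" "v ^ 4 = v * v ^ 3" by (simp_all add: power2_eq_square power3_eq_cube power4_eq_xxxx)
  have "2 * x / v\<^sup>2 * (1/v * (1/v)) = 2 * x / v ^ 4" unfolding p(1) by (simp only: times_divide_times_eq mult_1_right)
  moreover have "1/v * (2 * x / v ^ 3) = 2 * x / v ^ 4" unfolding p(2) by (simp only: times_divide_times_eq mult_1_left)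
  ultimately have "2 * x / v\<^sup>2 * (1/v * (1/v)) + 1/v * (2 * x / v ^ 3) = 2 * x / v ^ 4 + 2 * x / v ^ 4" by (simp only:)
  then show ?thesis by simp
qed

lemma collect_powers:
  fixes N u c t k q r :: real
  assumes "N \<noteq> 0" "u \<noteq> 0"
  shows "c * (N\<^sup>2 * (24 * (t / N) * k / u ^ 4)) + t / N * (N * q / u ^ 3) + t * (r / N * (N * (1/u * (1/u))))
    = N * (c * (24 * t * k / u ^ 4) + t / N * (q / u ^ 3) + t * r / u\<^sup>2 / N)"
proof -
  have "c * (N\<^sup>2 * (24 * (t / N) * k / u ^ 4)) = N * (c * (24 * t * k / u ^ 4))"
    using assms by (simp add: power2_eq_square)
  moreover have "t / N * (N * q / u ^ 3) = N * (t / N * (q / u ^ 3))" using assms by simp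
  moreover have "t * (r / N * (N * (1/u * (1/u)))) = N * (t * r / u\<^sup>2 / N)"
    using assms by (simp add: power2_eq_square)
  ultimately show ?thesis by (simp only: distrib_left)
qed

lemma collect_over_sqrt:
  fixes x w k q r a b d :: real
  shows "x / w * (24 * x\<^sup>2 * k / a) + x\<^sup>2 / w * (q / b) + x\<^sup>2 * r / d / w
    = (24 * x ^ 3 * k / a + x\<^sup>2 * q / b + x\<^sup>2 * r / d) / w"
  by (simp add: add_divide_distrib power3_eq_cube power2_eq_square mult_ac)

lemma eight_over_power: "4 * (1/v * (2 * (x * y) / v ^ 3)) = 8 * x / v ^ 4 * y" for x y v :: real
  by (simp add: power4_eq_xxxx power3_eq_cube)

context deformed_wigner
begin

subsection \<open>Bias\<close>

text \<open>Integration by parts up to a remainder: the expectation of \<open>g (i, j)\<close> times a function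
  of it is the variance times the expected derivative, as in the first step of a cumulant expansion.
  Here \<open>- c L\<close> is the derivative of \<open>y\<close> with respect to the entry.\<close>

lemma bias_edge:
  assumes e: "(i, j) \<in> edges n" and Q: "op_bdd n Q (1/v)"
  defines "Y \<equiv> \<lambda>g. kprod n (G g) Q"
  defines "L \<equiv> \<lambda>g. (half_diag (i, j))\<^sup>2 * (G g j i * Y g j i + G g j j * Y g i i + G g i i * Y g j j + G g i j * Y g i j)"
  defines "y \<equiv> \<lambda>g. half_diag (i, j) * (Y g j i + Y g i j)"
  shows "integrable \<P> (\<lambda>g. of_real (g (i, j)) * y g)" "integrable \<P> L"
    "cmod ((\<integral>g. of_real (g (i, j)) * y g \<partial>\<P>) + of_real c * of_real (m2 (i, j)) * (\<integral>g. L g \<partial>\<P>)) \<le> 24 * c\<^sup>2 * (1 + K)\<^sup>2 / v ^ 4"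
proof -
  let ?e = "(i, j)" let ?k = "half_diag ?e"
  let ?up = "\<lambda>g :: nat \<times> nat \<Rightarrow> real. g(?e := 0)"
  have ij: "i < n" "j < n" using e by (auto simp: edges_def)
  have vp: "v > 0" by (rule z)
  define M where "M g = ?k\<^sup>2 * (G (?up g) j i * Y g j i + G (?up g) j j * Y g i i + G (?up g) i i * Y g j j + G (?up g) i j * Y g i j)" for g
  have Gb: "cmod (G g a b) \<le> 1/v" if "a < n" "b < n" for g a b using op_bdd_entry[OF G_bdd that] .
  have Yb: "cmod (Y g a b) \<le> 1/v * (1/v)" if "a < n" "b < n" for g a b
    unfolding Y_def using op_bdd_entry[OF op_bdd_kprod[OF G_bdd Q] that] .
  have Ym: "(\<lambda>g. Y g a b) \<in> borel_measurable \<P>" if "a < n" "b < n" for a b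
    unfolding Y_def using that by (intro kprod_measurable G_measurable) auto
  have k2: "cmod (?k\<^sup>2) \<le> 1" using norm_half_diag[of ?e] by (simp add: norm_power power_le_one)
  have four: "cmod (?k\<^sup>2 * (x1 + x2 + x3 + x4)) \<le> 4 * p"
    if "cmod x1 \<le> p" "cmod x2 \<le> p" "cmod x3 \<le> p" "cmod x4 \<le> p" for x1 x2 x3 x4 p
  proof -
    have "cmod (x1 + x2 + x3 + x4) \<le> cmod x1 + cmod x2 + cmod x3 + cmod x4"
      using norm_triangle_ineq[of "x1 + x2 + x3" x4] norm_triangle_ineq[of "x1 + x2" x3]
        norm_triangle_ineq[of x1 x2] by linarith
    then have 1: "cmod (x1 + x2 + x3 + x4) \<le> 4 * p" using that by linarith
    have "cmod (?k\<^sup>2) * cmod (x1 + x2 + x3 + x4) \<le> 1 * (4 * p)"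
      using k2 1 by (intro mult_mono) auto
    then show ?thesis by (simp add: norm_mult)
  qed
  have prodb: "cmod (a * b) \<le> p * q" if "cmod a \<le> p" "cmod b \<le> q" for a b p q
    unfolding norm_mult using that by (intro mult_mono) (auto intro: order_trans[OF norm_ge_zero])
  have Lb: "cmod (L g) \<le> 4 * (1/v * (1/v * (1/v)))" for g
    unfolding L_def by (intro four prodb Gb Yb ij)
  have Lm: "L \<in> borel_measurable \<P>"
    unfolding L_def by (intro borel_measurable_times borel_measurable_add borel_measurable_const G_measurable Ym ij)
  show Li: "integrable \<P> L" by (rule P.bounded_integrable[OF Lm Lb])
  have yb: "cmod (y g) \<le> 1 * (1/v * (1/v) + 1/v * (1/v))" for g
    unfolding y_def by (intro prodb norm_half_diag order_trans[OF norm_triangle_ineq] add_mono Yb ij)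
  have ym: "y \<in> borel_measurable \<P>"
    unfolding y_def by (intro borel_measurable_times borel_measurable_add borel_measurable_const Ym ij)
  have rm: "entry_removal n B z i j" by (rule removal[OF e])
  have dG: "cmod (G g a b - G (?up g) a b) \<le> 2 * \<bar>c * g ?e\<bar> / v^2" if "a < n" "b < n" for a b g
    unfolding G_def by (rule entry_removal.G_diff_norm[OF rm that])
  have dY: "cmod (Y g a b - Y (?up g) a b) \<le> 2 * \<bar>c * g ?e\<bar> / v^3" if "a < n" "b < n" for a b g
    unfolding Y_def G_def by (rule entry_removal.kprod_diff_left_norm[OF rm that Q])
  have dY': "cmod (Y (?up g) a b - Y g a b) \<le> 2 * \<bar>c * g ?e\<bar> / v^3" if "a < n" "b < n" for a b g
    using dY[OF that, of g] by (simp only: norm_minus_commute)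
  \<comment> \<open>Expanding the dependence on the entry to first order; the remainder is the difference of \<open>M\<close> and \<open>L\<close>.\<close>
  have yexp: "y g = y (?up g) - of_real (c * g ?e) * M g" for g
  proof -
    let ?t = "of_real (c * g ?e) * ?k"
    have 1: "Y g j i - Y (?up g) j i = - ?t * (G (?up g) j i * Y g j i + G (?up g) j j * Y g i i)"
      using entry_removal.kprod_diff_left[OF rm ij(2,1), of c g Q] by (simp only: Y_def G_def entry_removal.t_def[OF rm])
    have 2: "Y g i j - Y (?up g) i j = - ?t * (G (?up g) i i * Y g j j + G (?up g) i j * Y g i j)"
      using entry_removal.kprod_diff_left[OF rm ij(1,2), of c g Q] by (simp only: Y_def G_def entry_removal.t_def[OF rm])
    have gen: "k * (- (C * k) * (a + b) + - (C * k) * (d + f)) = - C * (k * k * (a + b + d + f))" for k C a b d f :: complex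
      by (simp add: algebra_simps)
    have "y g - y (?up g) = ?k * ((Y g j i - Y (?up g) j i) + (Y g i j - Y (?up g) i j))"
      unfolding y_def by (simp only: ring_distribs) (simp add: algebra_simps)
    also have "\<dots> = - of_real (c * g ?e) * M g"
      unfolding 1 2 M_def power2_eq_square by (rule gen)
    finally show ?thesis by (simp add: algebra_simps)
  qed
  have dML: "cmod (L (?up g) - M g) \<le> 8 * \<bar>c\<bar> / v^4 * \<bar>g ?e\<bar>" for g
  proof -
    have gen: "k * (a1 * b1 + a2 * b2 + a3 * b3 + a4 * b4) - k * (a1 * c1 + a2 * c2 + a3 * c3 + a4 * c4)
        = k * (a1 * (b1 - c1) + a2 * (b2 - c2) + a3 * (b3 - c3) + a4 * (b4 - c4))"
      for k a1 a2 a3 a4 b1 b2 b3 b4 c1 c2 c3 c4 :: complex by (simp add: algebra_simps)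
    have eq: "L (?up g) - M g = ?k\<^sup>2 * (G (?up g) j i * (Y (?up g) j i - Y g j i) + G (?up g) j j * (Y (?up g) i i - Y g i i)
       + G (?up g) i i * (Y (?up g) j j - Y g j j) + G (?up g) i j * (Y (?up g) i j - Y g i j))"
      unfolding L_def M_def by (rule gen)
    have "cmod (L (?up g) - M g) \<le> 4 * (1/v * (2 * \<bar>c * g ?e\<bar> / v^3))"
      unfolding eq by (rule four[OF prodb[OF Gb[OF ij(2,1)] dY'[OF ij(2,1)]] prodb[OF Gb[OF ij(2,2)] dY'[OF ij(1,1)]]
            prodb[OF Gb[OF ij(1,1)] dY'[OF ij(2,2)]] prodb[OF Gb[OF ij(1,2)] dY'[OF ij(1,2)]]])
    also have "\<dots> = 8 * \<bar>c\<bar> / v^4 * \<bar>g ?e\<bar>" unfolding abs_mult by (rule eight_over_power)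
    finally show ?thesis .
  qed
  have LL: "cmod (L g - L (?up g)) \<le> 16 * \<bar>c\<bar> / v^4 * \<bar>g ?e\<bar>" for g
  proof -
    have pd: "cmod (G g a b * Y g a' b' - G (?up g) a b * Y (?up g) a' b') \<le> 4 * \<bar>c * g ?e\<bar> / v^4"
      if "a < n" "b < n" "a' < n" "b' < n" for a b a' b'
    proof -
      have "cmod (G g a b * Y g a' b' - G (?up g) a b * Y (?up g) a' b') \<le> 2 * \<bar>c * g ?e\<bar> / v^2 * (1/v * (1/v)) + 1/v * (2 * \<bar>c * g ?e\<bar> / v^3)"
        unfolding prod_diff_prod[of "G g a b"]
        by (rule order_trans[OF norm_triangle_ineq add_mono[OF prodb[OF dG[OF that(1,2)] Yb[OF that(3,4)]] prodb[OF Gb[OF that(1,2)] dY[OF that(3,4)]]]])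
      also have "\<dots> = 4 * \<bar>c * g ?e\<bar> / v^4" by (rule two_over_powers[OF vp])
      finally show ?thesis .
    qed
    have gen: "k * (a1 + a2 + a3 + a4) - k * (c1 + c2 + c3 + c4) = k * ((a1 - c1) + (a2 - c2) + (a3 - c3) + (a4 - c4))"
      for k a1 a2 a3 a4 c1 c2 c3 c4 :: complex by (simp add: algebra_simps)
    have eq: "L g - L (?up g) = ?k\<^sup>2 * ((G g j i * Y g j i - G (?up g) j i * Y (?up g) j i) + (G g j j * Y g i i - G (?up g) j j * Y (?up g) i i)
       + (G g i i * Y g j j - G (?up g) i i * Y (?up g) j j) + (G g i j * Y g i j - G (?up g) i j * Y (?up g) i j))"
      unfolding L_def by (rule gen)
    have "cmod (L g - L (?up g)) \<le> 4 * (4 * \<bar>c * g ?e\<bar> / v^4)"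
      unfolding eq by (rule four[OF pd[OF ij(2,1) ij(2,1)] pd[OF ij(2,2) ij(1,1)] pd[OF ij(1,1) ij(2,2)] pd[OF ij(1,2) ij(1,2)]])
    also have "\<dots> = 16 * \<bar>c\<bar> / v^4 * \<bar>g ?e\<bar>" by (simp add: abs_mult)
    finally show ?thesis .
  qed
  have Lum: "(\<lambda>g. L (?up g)) \<in> borel_measurable \<P>" by (rule comp_upd_measurable[OF e Lm])
  have Lui: "integrable \<P> (\<lambda>g. L (?up g))" by (rule P.bounded_integrable[OF Lum Lb])
  have Lub: "norm (L (?up g)) \<le> 4 * (1/v * (1/v * (1/v)))" for g by (rule Lb)
  have Linv: "L (?up (g(?e := x))) = L (?up g)" for g x by simp
  have yum: "(\<lambda>g. y (?up g)) \<in> borel_measurable \<P>" by (rule comp_upd_measurable[OF e ym])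
  have yub: "norm (y (?up g)) \<le> 1 * (1/v * (1/v) + 1/v * (1/v))" for g by (rule yb)
  have yinv: "y (?up (g(?e := x))) = y (?up g)" for g x by simp
  have i1: "integrable (D ?e) (\<lambda>x. complex_of_real x)"
  proof -
    have "integrable (D ?e) (\<lambda>x. x)"
      by (rule Bochner_Integration.integrable_bound[OF moment(1)[OF e, of 1]]) (auto intro: D_measurable)
    then show ?thesis by (rule integrable_of_real)
  qed
  have i2: "integrable (D ?e) (\<lambda>x. complex_of_real (x\<^sup>2))"
    using moment(1)[OF e, of 2] by (intro integrable_of_real) simp
  note c1 = integral_coord_times[OF e i1 yum yub yinv]
  note c2' = integral_coord_times[OF e i2 Lum Lub Linv]
  have z1: "(\<integral>g. of_real (g ?e) * y (?up g) \<partial>\<P>) = 0"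
    unfolding c1(2) using mean_zero[OF e] by (simp del: integral_complex_of_real add: integral_complex_of_real)
  have z2: "(\<integral>g. of_real ((g ?e)\<^sup>2) * L (?up g) \<partial>\<P>) = of_real (m2 ?e) * (\<integral>g. L (?up g) \<partial>\<P>)"
    unfolding c2'(2) m2_def integral_complex_of_real ..
  have gm: "(\<lambda>g. g ?e) \<in> borel_measurable \<P>" by (rule coord_measurable[OF e])
  define \<Delta> where "\<Delta> g = of_real ((g ?e)\<^sup>2) * (L (?up g) - M g)" for g
  have Mm: "M \<in> borel_measurable \<P>"
    unfolding M_def by (intro borel_measurable_times borel_measurable_add borel_measurable_const comp_upd_measurable[OF e] G_measurable Ym ij)
  have \<Delta>m: "\<Delta> \<in> borel_measurable \<P>" unfolding \<Delta>_def using gm Lum Mm by simp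
  have \<Delta>b: "cmod (\<Delta> g) \<le> 8 * \<bar>c\<bar> / v^4 * \<bar>g ?e\<bar> ^ 3" for g
  proof -
    have "cmod (\<Delta> g) = (g ?e)\<^sup>2 * cmod (L (?up g) - M g)" unfolding \<Delta>_def norm_mult norm_of_real by simp
    also have "\<dots> \<le> (g ?e)\<^sup>2 * (8 * \<bar>c\<bar> / v^4 * \<bar>g ?e\<bar>)" by (intro mult_left_mono dML) simp
    also have "\<dots> = 8 * \<bar>c\<bar> / v^4 * \<bar>g ?e\<bar> ^ 3" by (simp add: power3_eq_cube power2_eq_square algebra_simps)
    finally show ?thesis .
  qed
  note m3 = coord_moment[OF e, of 3, simplified]
  note m1 = coord_moment[OF e, of 1, simplified]
  have \<Delta>i: "integrable \<P> \<Delta>"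
    by (rule Bochner_Integration.integrable_bound[OF integrable_mult_right[OF m3(1), of "8 * \<bar>c\<bar> / v^4"] \<Delta>m]) (intro AE_I2 order_trans[OF \<Delta>b], simp)
  have exp: "of_real (g ?e) * y g = of_real (g ?e) * y (?up g) - of_real c * (of_real ((g ?e)\<^sup>2) * L (?up g)) + of_real c * \<Delta> g" for g
    unfolding \<Delta>_def by (subst yexp) (simp add: power2_eq_square algebra_simps)
  show "integrable \<P> (\<lambda>g. of_real (g ?e) * y g)"
    unfolding exp using c1(1) c2'(1) \<Delta>i
    by (intro Bochner_Integration.integrable_add Bochner_Integration.integrable_diff integrable_mult_right)
  have "(\<integral>g. of_real (g ?e) * y g \<partial>\<P>) = (\<integral>g. of_real (g ?e) * y (?up g) \<partial>\<P>) - of_real c * (\<integral>g. of_real ((g ?e)\<^sup>2) * L (?up g) \<partial>\<P>) + of_real c * (\<integral>g. \<Delta> g \<partial>\<P>)"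
    unfolding exp
    apply (subst Bochner_Integration.integral_add[OF Bochner_Integration.integrable_diff[OF c1(1) integrable_mult_right[OF c2'(1)]] integrable_mult_right[OF \<Delta>i]])
    apply (subst Bochner_Integration.integral_diff[OF c1(1) integrable_mult_right[OF c2'(1)]])
    by (simp only: integral_mult_right_zero)
  also have "\<dots> = - of_real c * of_real (m2 ?e) * (\<integral>g. L (?up g) \<partial>\<P>) + of_real c * (\<integral>g. \<Delta> g \<partial>\<P>)"
    unfolding z1 z2 by simp
  finally have main: "(\<integral>g. of_real (g ?e) * y g \<partial>\<P>) + of_real c * of_real (m2 ?e) * (\<integral>g. L g \<partial>\<P>)
    = of_real c * of_real (m2 ?e) * (\<integral>g. L g - L (?up g) \<partial>\<P>) + of_real c * (\<integral>g. \<Delta> g \<partial>\<P>)"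
    unfolding Bochner_Integration.integral_diff[OF Li Lui] by (simp add: algebra_simps)
  have b1: "cmod (\<integral>g. L g - L (?up g) \<partial>\<P>) \<le> 16 * \<bar>c\<bar> / v^4 * (1 + K)"
  proof -
    have "cmod (\<integral>g. L g - L (?up g) \<partial>\<P>) \<le> (\<integral>g. cmod (L g - L (?up g)) \<partial>\<P>)" by simp
    also have "\<dots> \<le> (\<integral>g. 16 * \<bar>c\<bar> / v^4 * \<bar>g ?e\<bar> \<partial>\<P>)"
      using Li Lui m1(1) LL by (intro integral_mono integrable_norm Bochner_Integration.integrable_diff integrable_mult_right)
    also have "\<dots> = 16 * \<bar>c\<bar> / v^4 * (\<integral>g. \<bar>g ?e\<bar> \<partial>\<P>)" by (rule integral_mult_right_zero)
    also have "\<dots> \<le> 16 * \<bar>c\<bar> / v^4 * (1 + K)" using m1(2) vp by (intro mult_left_mono) auto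
    finally show ?thesis .
  qed
  have b2: "cmod (\<integral>g. \<Delta> g \<partial>\<P>) \<le> 8 * \<bar>c\<bar> / v^4 * (1 + K)"
  proof -
    have "cmod (\<integral>g. \<Delta> g \<partial>\<P>) \<le> (\<integral>g. cmod (\<Delta> g) \<partial>\<P>)" by simp
    also have "\<dots> \<le> (\<integral>g. 8 * \<bar>c\<bar> / v^4 * \<bar>g ?e\<bar> ^ 3 \<partial>\<P>)"
      using \<Delta>i m3(1) \<Delta>b by (intro integral_mono integrable_norm integrable_mult_right)
    also have "\<dots> = 8 * \<bar>c\<bar> / v^4 * (\<integral>g. \<bar>g ?e\<bar> ^ 3 \<partial>\<P>)" by (rule integral_mult_right_zero)
    also have "\<dots> \<le> 8 * \<bar>c\<bar> / v^4 * (1 + K)" using m3(2) vp by (intro mult_left_mono) auto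
    finally show ?thesis .
  qed
  have "cmod (of_real c * of_real (m2 ?e) * (\<integral>g. L g - L (?up g) \<partial>\<P>) + of_real c * (\<integral>g. \<Delta> g \<partial>\<P>))
     \<le> \<bar>c\<bar> * (1 + K) * (16 * \<bar>c\<bar> / v^4 * (1 + K)) + \<bar>c\<bar> * (8 * \<bar>c\<bar> / v^4 * (1 + K))"
    using m2[OF e] by (intro order_trans[OF norm_triangle_ineq] add_mono prodb b1 b2) auto
  also have "\<dots> \<le> 24 * c\<^sup>2 * (1 + K)\<^sup>2 / v ^ 4"
  proof -
    have "\<bar>c\<bar> * (8 * \<bar>c\<bar> / v^4 * (1 + K)) * 1 \<le> \<bar>c\<bar> * (8 * \<bar>c\<bar> / v^4 * (1 + K)) * (1 + K)"
      using K0 vp by (intro mult_left_mono) auto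
    moreover have "\<bar>c\<bar> * (1 + K) * (16 * \<bar>c\<bar> / v^4 * (1 + K)) + \<bar>c\<bar> * (8 * \<bar>c\<bar> / v^4 * (1 + K)) * (1 + K) = 24 * (\<bar>c\<bar> * \<bar>c\<bar>) * ((1 + K) * (1 + K)) / v ^ 4"
      using vp by (simp add: field_simps)
    ultimately show ?thesis unfolding power2_eq_square abs_mult_self_eq mult_1_right by linarith
  qed
  finally show "cmod ((\<integral>g. of_real (g ?e) * y g \<partial>\<P>) + of_real c * of_real (m2 ?e) * (\<integral>g. L g \<partial>\<P>)) \<le> 24 * c\<^sup>2 * (1 + K)\<^sup>2 / v ^ 4"
    unfolding main .
qed


text \<open>The resolvent identity between the noisy matrix at \<open>z\<close> and \<open>B\<close> at
  \<open>w\<close>. The choice \<open>w = z + \<tau>\<^sup>2 m\<close> will make the two terms on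
  the right cancel in expectation, up to small errors.\<close>

lemma trace_resolvent_difference:
  assumes w: "Im w > 0"
  defines "Q \<equiv> resolvent n B w"
  shows "of_nat n * (s g - ntrace n Q) =
    - of_real c * (\<Sum>(i, j)\<in>edges n. of_real (g (i, j)) * (half_diag (i, j) * (kprod n (G g) Q j i + kprod n (G g) Q i j)))
    - (w - z) * (\<Sum>i<n. kprod n (G g) Q i i)"
proof -
  have n0: "n > 0" using n by simp
  have Qs: "symk n Q" unfolding Q_def by (rule resolvent_sym[OF B w])
  have d: "G g i i - Q i i = (\<Sum>k<n. \<Sum>l<n. - of_real c * (of_real (wk g k l) * (G g i k * Q l i))) - (w - z) * (\<Sum>k<n. G g i k * Q k i)"
    if i: "i < n" for i
  proof -
    have "G g i i - Q i i = (\<Sum>k<n. \<Sum>l<n. G g i k * (complex_of_real (B k l - pert B c g k l) - (if k = l then w - z else 0)) * Q l i)"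
      unfolding G_def Q_def by (rule resolvent_identity[OF symk_pert[OF B] z B w i i])
    also have "\<dots> = (\<Sum>k<n. \<Sum>l<n. - of_real c * (of_real (wk g k l) * (G g i k * Q l i)) - (if l = k then (w - z) * (G g i k * Q l i) else 0))"
      by (intro sum.cong refl) (auto simp: pert_def algebra_simps)
    also have "\<dots> = (\<Sum>k<n. \<Sum>l<n. - of_real c * (of_real (wk g k l) * (G g i k * Q l i))) - (\<Sum>k<n. \<Sum>l<n. if l = k then (w - z) * (G g i k * Q l i) else 0)"
      by (simp only: sum_subtractf)
    also have "(\<Sum>k<n. \<Sum>l<n. if l = k then (w - z) * (G g i k * Q l i) else 0) = (w - z) * (\<Sum>k<n. G g i k * Q k i)"
      by (simp add: sum_distrib_left)
    finally show ?thesis .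
  qed
  have "of_nat n * (s g - ntrace n Q) = (\<Sum>i<n. G g i i - Q i i)"
    using n0 by (simp add: s_def ntrace_def sum_subtractf right_diff_distrib)
  also have "\<dots> = (\<Sum>i<n. \<Sum>k<n. \<Sum>l<n. - of_real c * (of_real (wk g k l) * (G g i k * Q l i))) - (w - z) * (\<Sum>i<n. kprod n (G g) Q i i)"
    by (simp add: d sum_subtractf sum_distrib_left kprod_def)
  also have "(\<Sum>i<n. \<Sum>k<n. \<Sum>l<n. - of_real c * (of_real (wk g k l) * (G g i k * Q l i)))
     = (\<Sum>k<n. \<Sum>l<n. \<Sum>i<n. - of_real c * (of_real (wk g k l) * (G g i k * Q l i)))"
    by (subst sum.swap) (intro sum.cong refl sum.swap)
  also have "\<dots> = (\<Sum>k<n. \<Sum>l<n. - of_real c * (of_real (wk g k l) * kprod n (G g) Q k l))"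
    by (intro sum.cong refl) (use G_sym[of g] Qs in \<open>auto simp: kprod_def symk_def sum_distrib_left intro!: sum.cong\<close>)
  also have "\<dots> = - of_real c * (\<Sum>k<n. \<Sum>l<n. of_real (wk g k l) * kprod n (G g) Q k l)"
    by (simp only: sum_distrib_left)
  also have "(\<Sum>k<n. \<Sum>l<n. of_real (wk g k l) * kprod n (G g) Q k l)
     = (\<Sum>(i, j)\<in>edges n. of_real (g (i, j)) * (half_diag (i, j) * (kprod n (G g) Q j i + kprod n (G g) Q i j)))"
    unfolding sum_edges
  proof (intro sum.cong refl)
    fix e assume "e \<in> edges n"
    then obtain i j where e: "e = (i, j)" "i \<le> j" by (auto simp: edges_def)
    then have "wk g i j = g (i, j)" "wk g j i = g (i, j)" by (auto simp: wk_def min_def max_def)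
    then show "(case e of (i, j) \<Rightarrow> half_diag (i, j) * (of_real (wk g i j) * kprod n (G g) Q i j + of_real (wk g j i) * kprod n (G g) Q j i))
      = (case e of (i, j) \<Rightarrow> of_real (g (i, j)) * (half_diag (i, j) * (kprod n (G g) Q j i + kprod n (G g) Q i j)))"
      by (simp add: e algebra_simps)
  qed
  finally show ?thesis .
qed

text \<open>The terms in which both indices of the resolvent agree form the product of two traces. The remaining
  ones form the trace of a product, which is smaller by a factor \<open>n\<close>, and so are the
  corrections on the diagonal.\<close>

lemma sum_L_close:
  assumes Q: "op_bdd n Q (1/v)"
  defines "Y \<equiv> \<lambda>g. kprod n (G g) Q"
  shows "cmod ((\<Sum>(i, j)\<in>edges n. of_real (m2 (i, j)) * ((half_diag (i, j))\<^sup>2 * (G g j i * Y g j i + G g j j * Y g i i + G g i i * Y g j j + G g i j * Y g i j)))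
     - (\<Sum>i<n. G g i i) * (\<Sum>i<n. Y g i i)) \<le> real n * (4 + K) / v ^ 3"
proof -
  let ?s = "\<lambda>i j. G g j i * Y g j i + G g j j * Y g i i + G g i i * Y g j j + G g i j * Y g i j"
  have vp: "v > 0" by (rule z)
  have Yb: "op_bdd n (Y g) (1/v * (1/v))" unfolding Y_def by (rule op_bdd_kprod[OF G_bdd Q])
  have sum1: "(\<Sum>k<n. \<Sum>l<n. G g k k * Y g l l + G g k l * Y g k l) = (\<Sum>(i, j)\<in>edges n. half_diag (i, j) * ?s i j)"
    unfolding sum_edges by (intro sum.cong refl) (auto simp: algebra_simps)
  have eq: "(\<Sum>(i, j)\<in>edges n. of_real (m2 (i, j)) * ((half_diag (i, j))\<^sup>2 * ?s i j)) =
     (\<Sum>(i, j)\<in>edges n. half_diag (i, j) * ?s i j) + (\<Sum>i<n. (of_real (m2 (i, i)) - 2) * (G g i i * Y g i i))"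
  proof -
    have "(\<Sum>(i, j)\<in>edges n. of_real (m2 (i, j)) * ((half_diag (i, j))\<^sup>2 * ?s i j)) - (\<Sum>(i, j)\<in>edges n. half_diag (i, j) * ?s i j)
       = (\<Sum>(i, j)\<in>edges n. if i = j then (of_real (m2 (i, i)) - 2) * (G g i i * Y g i i) else 0)"
      unfolding sum_subtractf[symmetric]
    proof (intro sum.cong refl)
      fix e assume "e \<in> edges n"
      then obtain i j where e: "e = (i, j)" "i \<le> j" "j < n" by (auto simp: edges_def)
      show "(case e of (i, j) \<Rightarrow> of_real (m2 (i, j)) * ((half_diag (i, j))\<^sup>2 * ?s i j)) - (case e of (i, j) \<Rightarrow> half_diag (i, j) * ?s i j)
        = (case e of (i, j) \<Rightarrow> if i = j then (of_real (m2 (i, i)) - 2) * (G g i i * Y g i i) else 0)"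
      proof (cases "i = j")
        case True
        then show ?thesis by (simp add: e half_diag_def power2_eq_square algebra_simps)
      next
        case False
        then have "m2 (i, j) = 1" unfolding m2_def using e by (intro var_one) auto
        then show ?thesis using False by (simp add: e half_diag_def)
      qed
    qed
    also have "\<dots> = (\<Sum>(i, j)\<in>(\<lambda>i. (i, i)) ` {..<n}. if i = j then (of_real (m2 (i, i)) - 2) * (G g i i * Y g i i) else 0)"
      by (rule sum.mono_neutral_right) (use finite_edges[of n] in \<open>auto simp: edges_def\<close>)
    also have "\<dots> = (\<Sum>i<n. (of_real (m2 (i, i)) - 2) * (G g i i * Y g i i))"
      by (subst sum.reindex) (auto simp: inj_on_def)
    finally show ?thesis by (simp add: algebra_simps)
  qed
  have sq: "(\<Sum>k<n. \<Sum>l<n. G g k k * Y g l l + G g k l * Y g k l) = (\<Sum>i<n. G g i i) * (\<Sum>i<n. Y g i i) + (\<Sum>k<n. \<Sum>l<n. G g k l * Y g k l)"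
    by (simp add: sum.distrib sum_product)
  have "cmod (\<Sum>k<n. \<Sum>l<n. G g k l * Y g k l) \<le> (\<Sum>k<n. \<Sum>l<n. ((1/v) * (cmod (G g k l))\<^sup>2 + v * (cmod (Y g k l))\<^sup>2) / 2)"
  proof (intro sum_norm_le)
    fix k l
    define a b where "a = cmod (G g k l)" and "b = cmod (Y g k l)"
    have "0 \<le> (a - v * b)\<^sup>2 / v" using vp by simp
    also have "(a - v * b)\<^sup>2 / v = (1/v) * a\<^sup>2 + v * b\<^sup>2 - 2 * (a * b)"
      using vp by (simp add: power2_eq_square field_simps)
    finally show "cmod (G g k l * Y g k l) \<le> ((1/v) * (cmod (G g k l))\<^sup>2 + v * (cmod (Y g k l))\<^sup>2) / 2"
      by (simp add: a_def b_def norm_mult)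
  qed
  also have "\<dots> = ((1/v) * (\<Sum>k<n. \<Sum>l<n. (cmod (G g k l))\<^sup>2) + v * (\<Sum>k<n. \<Sum>l<n. (cmod (Y g k l))\<^sup>2)) / 2"
    by (simp only: sum_divide_distrib[symmetric] sum.distrib sum_distrib_left[symmetric])
  also have "\<dots> \<le> ((1/v) * (real n * (1/v)\<^sup>2) + v * (real n * (1/v * (1/v))\<^sup>2)) / 2"
    using vp by (intro divide_right_mono add_mono mult_left_mono op_bdd_sum_all G_bdd Yb) auto
  also have "\<dots> = real n / v ^ 3" using vp by (simp add: power2_eq_square power3_eq_cube field_simps)
  finally have b1: "cmod (\<Sum>k<n. \<Sum>l<n. G g k l * Y g k l) \<le> real n / v ^ 3" .
  have "cmod (\<Sum>i<n. (of_real (m2 (i, i)) - 2) * (G g i i * Y g i i)) \<le> (\<Sum>i<n. (3 + K) * (1/v * (1/v * (1/v))))"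
  proof (intro sum_norm_le)
    fix i assume "i \<in> {..<n}"
    then have i: "i < n" and e: "(i, i) \<in> edges n" by (auto simp: edges_def)
    have "cmod (of_real (m2 (i, i)) - 2) \<le> 3 + K"
      using m2[OF e] norm_triangle_ineq4[of "complex_of_real (m2 (i, i))" 2] by simp
    then show "cmod ((of_real (m2 (i, i)) - 2) * (G g i i * Y g i i)) \<le> (3 + K) * (1/v * (1/v * (1/v)))"
      unfolding norm_mult using vp K0 op_bdd_entry[OF G_bdd i i, of g] op_bdd_entry[OF Yb i i]
      by (intro mult_mono) auto
  qed
  then have b2: "cmod (\<Sum>i<n. (of_real (m2 (i, i)) - 2) * (G g i i * Y g i i)) \<le> real n * (3 + K) / v ^ 3"
    by (simp add: power3_eq_cube)
  have "(\<Sum>(i, j)\<in>edges n. of_real (m2 (i, j)) * ((half_diag (i, j))\<^sup>2 * ?s i j)) - (\<Sum>i<n. G g i i) * (\<Sum>i<n. Y g i i)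
     = (\<Sum>k<n. \<Sum>l<n. G g k l * Y g k l) + (\<Sum>i<n. (of_real (m2 (i, i)) - 2) * (G g i i * Y g i i))"
    unfolding eq sum1[symmetric] sq by simp
  then have "cmod ((\<Sum>(i, j)\<in>edges n. of_real (m2 (i, j)) * ((half_diag (i, j))\<^sup>2 * ?s i j)) - (\<Sum>i<n. G g i i) * (\<Sum>i<n. Y g i i))
     \<le> real n / v ^ 3 + real n * (3 + K) / v ^ 3"
    using norm_triangle_le[OF add_mono[OF b1 b2]] by simp
  also have "\<dots> = real n * (4 + K) / v ^ 3" by (simp add: add_divide_distrib[symmetric] algebra_simps)
  finally show ?thesis .
qed


definition BC :: real where "BC = 24 * \<tau> ^ 3 * (1 + K)\<^sup>2 / v ^ 4 + \<tau>\<^sup>2 * (4 + K) / v ^ 3 + \<tau>\<^sup>2 * sqrt VC / v\<^sup>2"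

lemma VC_nonneg: "0 \<le> VC" using K0 z by (simp add: VC_def)

lemma mean_abs_deviation: "integrable \<P> (\<lambda>g. cmod (s g - m))" "(\<integral>g. cmod (s g - m) \<partial>\<P>) \<le> sqrt VC / real n"
proof -
  have b: "cmod (s g - m) \<le> 1/v + cmod m" for g
    using norm_triangle_ineq4[of "s g" m] s_bound[of g] by linarith
  have me: "(\<lambda>g. cmod (s g - m)) \<in> borel_measurable \<P>" using s_measurable by simp
  show "integrable \<P> (\<lambda>g. cmod (s g - m))" by (rule P.bounded_integrable[OF me, of "1/v + cmod m"]) (use b in simp)
  have "(\<integral>g. cmod (s g - m) \<partial>\<P>)\<^sup>2 \<le> (\<integral>g. (cmod (s g - m))\<^sup>2 \<partial>\<P>)"
    by (rule P.integral_square_ge[OF me, of "1/v + cmod m"]) (use b in simp)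
  also have "\<dots> \<le> VC / (real n)\<^sup>2" by (rule variance_bound)
  also have "\<dots> = (sqrt VC / real n)\<^sup>2" using VC_nonneg by (simp add: power_divide)
  finally show "(\<integral>g. cmod (s g - m) \<partial>\<P>) \<le> sqrt VC / real n"
    by (rule power2_le_imp_le) (use VC_nonneg in simp)
qed

text \<open>The derivative terms add up to \<open>\<tau>\<^sup>2 s\<close> times a trace, and the shift of the
  spectral parameter contributes \<open>- \<tau>\<^sup>2 m\<close> times the same trace. What is
  left is the covariance of \<open>s\<close> with that trace, bounded by the deviation of
  \<open>s\<close>, and the errors of the preceding estimates.\<close>

lemma bias_bound: "cmod (m - ntrace n (resolvent n B (z + of_real (\<tau>\<^sup>2) * m))) \<le> BC / sqrt (real n)"
proof -
  define w where "w = z + of_real (\<tau>\<^sup>2) * m"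
  define Q where "Q = resolvent n B w"
  have vp: "v > 0" by (rule z)
  have n0: "real n > 0" using n by simp
  have wv: "Im w \<ge> v" using Im_m_nonneg by (simp add: w_def)
  then have w0: "Im w > 0" using vp by linarith
  have Q: "op_bdd n Q (1/v)" unfolding Q_def
    by (rule op_bdd_mono[OF resolvent_op_bdd[OF B w0]]) (use wv vp in \<open>simp add: frac_le\<close>)
  define Y where "Y g = kprod n (G g) Q" for g
  define L where "L e g = (half_diag e)\<^sup>2 * (G g (snd e) (fst e) * Y g (snd e) (fst e) + G g (snd e) (snd e) * Y g (fst e) (fst e)
     + G g (fst e) (fst e) * Y g (snd e) (snd e) + G g (fst e) (snd e) * Y g (fst e) (snd e))" for e g
  define y where "y e g = half_diag e * (Y g (snd e) (fst e) + Y g (fst e) (snd e))" for e g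
  define tY where "tY g = (\<Sum>i<n. Y g i i)" for g
  have be: "integrable \<P> (\<lambda>g. of_real (g e) * y e g)" "integrable \<P> (L e)"
    "cmod ((\<integral>g. of_real (g e) * y e g \<partial>\<P>) + of_real c * of_real (m2 e) * (\<integral>g. L e g \<partial>\<P>)) \<le> 24 * c\<^sup>2 * (1 + K)\<^sup>2 / v ^ 4"
    if "e \<in> edges n" for e
    using bias_edge[of "fst e" "snd e" Q] that Q unfolding y_def[abs_def] L_def[abs_def] Y_def by auto
  have Ym: "(\<lambda>g. Y g a b) \<in> borel_measurable \<P>" if "a < n" "b < n" for a b
    unfolding Y_def using that by (intro kprod_measurable G_measurable) auto
  have Yb: "cmod (Y g a b) \<le> 1/v * (1/v)" if "a < n" "b < n" for g a b
    unfolding Y_def using op_bdd_entry[OF op_bdd_kprod[OF G_bdd Q] that] .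
  have tYm: "tY \<in> borel_measurable \<P>" unfolding tY_def by (intro borel_measurable_sum Ym) auto
  have tYb: "cmod (tY g) \<le> real n * (1/v * (1/v))" for g
    unfolding tY_def using sum_norm_le[of "{..<n}" "\<lambda>i. Y g i i" "\<lambda>_. 1/v * (1/v)"] Yb by simp
  have tYi: "integrable \<P> tY" by (rule P.bounded_integrable[OF tYm tYb])
  have stYb: "cmod (s g * tY g) \<le> 1/v * (real n * (1/v * (1/v)))" for g
    unfolding norm_mult using s_bound tYb vp by (intro mult_mono) auto
  have stYi: "integrable \<P> (\<lambda>g. s g * tY g)"
    by (rule P.bounded_integrable[OF _ stYb]) (use s_measurable tYm in simp)
  have id: "of_nat n * (s g - ntrace n Q) = - of_real c * (\<Sum>e\<in>edges n. of_real (g e) * y e g) - (of_real (\<tau>\<^sup>2) * m) * tY g" for g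
    using trace_resolvent_difference[OF w0, of g] unfolding Q_def[symmetric] Y_def[symmetric] tY_def[symmetric]
    by (simp add: w_def y_def case_prod_unfold)
  have si: "integrable \<P> (\<lambda>g. \<Sum>e\<in>edges n. of_real (g e) * y e g)" by (intro Bochner_Integration.integrable_sum be(1))
  have "of_nat n * (m - ntrace n Q) = (\<integral>g. of_nat n * (s g - ntrace n Q) \<partial>\<P>)"
    using s_integrable by (simp add: m_def P.prob_space)
  also have "\<dots> = - of_real c * (\<integral>g. (\<Sum>e\<in>edges n. of_real (g e) * y e g) \<partial>\<P>) - (of_real (\<tau>\<^sup>2) * m) * (\<integral>g. tY g \<partial>\<P>)"
    unfolding id using si tYi by (subst Bochner_Integration.integral_diff) auto
  also have "(\<integral>g. (\<Sum>e\<in>edges n. of_real (g e) * y e g) \<partial>\<P>) = (\<Sum>e\<in>edges n. (\<integral>g. of_real (g e) * y e g \<partial>\<P>))"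
    using be(1) by (rule Bochner_Integration.integral_sum)
  finally have main0: "of_nat n * (m - ntrace n Q) = - of_real c * (\<Sum>e\<in>edges n. (\<integral>g. of_real (g e) * y e g \<partial>\<P>)) - (of_real (\<tau>\<^sup>2) * m) * (\<integral>g. tY g \<partial>\<P>)" .
  define err where "err = (\<Sum>e\<in>edges n. (\<integral>g. of_real (g e) * y e g \<partial>\<P>) + of_real c * of_real (m2 e) * (\<integral>g. L e g \<partial>\<P>))"
  define S where "S = (\<Sum>e\<in>edges n. of_real (m2 e) * (\<integral>g. L e g \<partial>\<P>))"
  have s1: "(\<Sum>e\<in>edges n. (\<integral>g. of_real (g e) * y e g \<partial>\<P>)) = err - of_real c * S"
    by (simp add: err_def S_def sum.distrib sum_distrib_left mult.assoc)
  have S_eq: "S = (\<integral>g. (\<Sum>e\<in>edges n. of_real (m2 e) * L e g) \<partial>\<P>)"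
    unfolding S_def using be(2) by (subst Bochner_Integration.integral_sum) auto
  have Si: "integrable \<P> (\<lambda>g. \<Sum>e\<in>edges n. of_real (m2 e) * L e g)" using be(2) by auto
  have nc: "of_real (c\<^sup>2) * of_nat n = (of_real (\<tau>\<^sup>2) :: complex)" using n0 c2(1) by simp
  have main: "of_nat n * (m - ntrace n Q) = - of_real c * err + of_real (c\<^sup>2) * (S - (\<integral>g. of_nat n * (s g * tY g) \<partial>\<P>)) + of_real (\<tau>\<^sup>2) * (\<integral>g. (s g - m) * tY g \<partial>\<P>)"
  proof -
    have "(\<integral>g. (s g - m) * tY g \<partial>\<P>) = (\<integral>g. s g * tY g - m * tY g \<partial>\<P>)" by (simp add: algebra_simps)
    also have "\<dots> = (\<integral>g. s g * tY g \<partial>\<P>) - m * (\<integral>g. tY g \<partial>\<P>)" using stYi tYi by simp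
    finally have 1: "(\<integral>g. (s g - m) * tY g \<partial>\<P>) = (\<integral>g. s g * tY g \<partial>\<P>) - m * (\<integral>g. tY g \<partial>\<P>)" .
    have 2: "(\<integral>g. of_nat n * (s g * tY g) \<partial>\<P>) = of_nat n * (\<integral>g. s g * tY g \<partial>\<P>)" by simp
    have gen: "- C * (E - C * S') - T * M' * Z = - C * E + C\<^sup>2 * (S' - N * J) + T * (J - M' * Z)"
      if "C\<^sup>2 * N = T" for C E S' T M' Z N J :: complex
      unfolding that[symmetric] by (simp add: algebra_simps power2_eq_square)
    show ?thesis unfolding main0 s1 1 2 of_real_power by (rule gen) (use nc in simp)
  qed
  have e1: "cmod err \<le> (real n)\<^sup>2 * (24 * c\<^sup>2 * (1 + K)\<^sup>2 / v ^ 4)"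
  proof -
    have "cmod err \<le> real (card (edges n)) * (24 * c\<^sup>2 * (1 + K)\<^sup>2 / v ^ 4)"
      unfolding err_def by (rule sum_norm_bound) (rule be(3))
    also have "\<dots> \<le> (real n)\<^sup>2 * (24 * c\<^sup>2 * (1 + K)\<^sup>2 / v ^ 4)"
      using card_edges[of n] vp by (intro mult_right_mono) (auto simp flip: of_nat_power)
    finally show ?thesis .
  qed
  have e2: "cmod (S - (\<integral>g. of_nat n * (s g * tY g) \<partial>\<P>)) \<le> real n * (4 + K) / v ^ 3"
  proof -
    have ni: "integrable \<P> (\<lambda>g. of_nat n * (s g * tY g))" using stYi by simp
    have "S - (\<integral>g. of_nat n * (s g * tY g) \<partial>\<P>) = (\<integral>g. (\<Sum>e\<in>edges n. of_real (m2 e) * L e g) - of_nat n * (s g * tY g) \<partial>\<P>)"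
      unfolding S_eq by (rule Bochner_Integration.integral_diff[symmetric, OF Si ni])
    also have "cmod \<dots> \<le> (\<integral>g. cmod ((\<Sum>e\<in>edges n. of_real (m2 e) * L e g) - of_nat n * (s g * tY g)) \<partial>\<P>)"
      by simp
    also have "\<dots> \<le> (\<integral>g. real n * (4 + K) / v ^ 3 \<partial>\<P>)"
    proof (rule integral_mono)
      show "integrable \<P> (\<lambda>g. cmod ((\<Sum>e\<in>edges n. of_real (m2 e) * L e g) - of_nat n * (s g * tY g)))"
        by (intro integrable_norm Bochner_Integration.integrable_diff Si ni)
      fix g
      have ns: "of_nat n * (s g * tY g) = (\<Sum>i<n. G g i i) * (\<Sum>i<n. Y g i i)"
        using n0 by (simp add: s_def ntrace_def tY_def)
      show "cmod ((\<Sum>e\<in>edges n. of_real (m2 e) * L e g) - of_nat n * (s g * tY g)) \<le> real n * (4 + K) / v ^ 3"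
        using sum_L_close[OF Q, of g] unfolding ns Y_def[symmetric] L_def by (simp add: case_prod_unfold)
    qed simp
    finally show ?thesis by (simp add: P.prob_space)
  qed
  have e3: "cmod (\<integral>g. (s g - m) * tY g \<partial>\<P>) \<le> sqrt VC / real n * (real n * (1/v * (1/v)))"
  proof -
    have "cmod (\<integral>g. (s g - m) * tY g \<partial>\<P>) \<le> (\<integral>g. cmod ((s g - m) * tY g) \<partial>\<P>)" by simp
    also have "\<dots> \<le> (\<integral>g. cmod (s g - m) * (real n * (1/v * (1/v))) \<partial>\<P>)"
    proof (rule integral_mono)
      have "integrable \<P> (\<lambda>g. (s g - m) * tY g)" unfolding left_diff_distrib using stYi tYi by simp
      then show "integrable \<P> (\<lambda>g. cmod ((s g - m) * tY g))" by (rule integrable_norm)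
      show "integrable \<P> (\<lambda>g. cmod (s g - m) * (real n * (1/v * (1/v))))" using mean_abs_deviation(1) by (rule integrable_mult_left)
      show "cmod ((s g - m) * tY g) \<le> cmod (s g - m) * (real n * (1/v * (1/v)))" for g
        unfolding norm_mult by (intro mult_left_mono tYb) simp
    qed
    also have "\<dots> = (\<integral>g. cmod (s g - m) \<partial>\<P>) * (real n * (1/v * (1/v)))" by (rule integral_mult_left_zero)
    also have "\<dots> \<le> sqrt VC / real n * (real n * (1/v * (1/v)))"
      using mean_abs_deviation(2) vp by (intro mult_right_mono) auto
    finally show ?thesis .
  qed
  have c0: "c \<ge> 0" by (rule c2(2))
  have "real n * cmod (m - ntrace n Q) = cmod (of_nat n * (m - ntrace n Q))" by (simp add: norm_mult)
  also have "\<dots> \<le> c * cmod err + c\<^sup>2 * cmod (S - (\<integral>g. of_nat n * (s g * tY g) \<partial>\<P>)) + \<tau>\<^sup>2 * cmod (\<integral>g. (s g - m) * tY g \<partial>\<P>)"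
  proof -
    have "cmod (- of_real c * a + of_real (c\<^sup>2) * b + of_real (\<tau>\<^sup>2) * d) \<le> c * cmod a + c\<^sup>2 * cmod b + \<tau>\<^sup>2 * cmod d" for a b d
    proof -
      have "cmod (- of_real c * a) = c * cmod a" "cmod (of_real (c\<^sup>2) * b) = c\<^sup>2 * cmod b" "cmod (of_real (\<tau>\<^sup>2) * d) = \<tau>\<^sup>2 * cmod d"
        using c0 by (simp_all add: norm_mult norm_power)
      then show ?thesis
        using norm_triangle_ineq[of "- of_real c * a + of_real (c\<^sup>2) * b" "of_real (\<tau>\<^sup>2) * d"] norm_triangle_ineq[of "- of_real c * a" "of_real (c\<^sup>2) * b"] by linarith
    qed
    then show ?thesis unfolding main .
  qed
  also have "\<dots> \<le> c * ((real n)\<^sup>2 * (24 * c\<^sup>2 * (1 + K)\<^sup>2 / v ^ 4)) + c\<^sup>2 * (real n * (4 + K) / v ^ 3) + \<tau>\<^sup>2 * (sqrt VC / real n * (real n * (1/v * (1/v))))"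
    using c0 by (intro add_mono mult_left_mono e1 e2 e3) auto
  also have "\<dots> = real n * (c * (24 * \<tau>\<^sup>2 * (1 + K)\<^sup>2 / v ^ 4) + \<tau>\<^sup>2 / real n * ((4 + K) / v ^ 3) + \<tau>\<^sup>2 * sqrt VC / v\<^sup>2 / real n)"
    unfolding c2(1) by (rule collect_powers) (use n0 vp in auto)
  finally have "cmod (m - ntrace n Q) \<le> c * (24 * \<tau>\<^sup>2 * (1 + K)\<^sup>2 / v ^ 4) + \<tau>\<^sup>2 / real n * ((4 + K) / v ^ 3) + \<tau>\<^sup>2 * sqrt VC / v\<^sup>2 / real n"
    using n0 by (simp only: mult_le_cancel_left_pos)
  also have "\<dots> \<le> c * (24 * \<tau>\<^sup>2 * (1 + K)\<^sup>2 / v ^ 4) + \<tau>\<^sup>2 / sqrt (real n) * ((4 + K) / v ^ 3) + \<tau>\<^sup>2 * sqrt VC / v\<^sup>2 / sqrt (real n)"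
  proof -
    have "sqrt (real n) \<le> real n"
    proof -
      have "sqrt (real n) * 1 \<le> sqrt (real n) * sqrt (real n)" using n by (intro mult_left_mono) auto
      then show ?thesis by simp
    qed
    then show ?thesis using K0 vp n0 VC_nonneg
      by (intro add_mono mult_right_mono divide_left_mono order_refl) auto
  qed
  also have "\<dots> = BC / sqrt (real n)"
    unfolding BC_def c_def by (rule collect_over_sqrt)
  finally show ?thesis unfolding Q_def w_def .
qed

definition pastur_defect :: "(nat \<times> nat \<Rightarrow> real) \<Rightarrow> real" where
  "pastur_defect g = cmod (s g - ntrace n (resolvent n B (z + of_real (\<tau>\<^sup>2) * s g)))"

lemma pastur_defect_le: "pastur_defect g \<le> (1 + \<tau>\<^sup>2 / v\<^sup>2) * cmod (s g - m) + BC / sqrt (real n)"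
proof -
  let ?q = "\<lambda>a. ntrace n (resolvent n B (z + of_real (\<tau>\<^sup>2) * a))"
  have "cmod (?q m - ?q (s g)) \<le> cmod ((z + of_real (\<tau>\<^sup>2) * m) - (z + of_real (\<tau>\<^sup>2) * s g)) / v\<^sup>2"
    by (rule ntrace_resolvent_lipschitz[OF B]) (use Im_m_nonneg Im_s[of g] z in auto)
  also have "(z + of_real (\<tau>\<^sup>2) * m) - (z + of_real (\<tau>\<^sup>2) * s g) = of_real (\<tau>\<^sup>2) * (m - s g)"
    by (simp add: algebra_simps)
  also have "cmod (of_real (\<tau>\<^sup>2) * (m - s g)) = \<tau>\<^sup>2 * cmod (s g - m)"
    by (simp only: norm_mult norm_of_real norm_minus_commute) simp
  finally have 1: "cmod (?q m - ?q (s g)) \<le> \<tau>\<^sup>2 / v\<^sup>2 * cmod (s g - m)" by simp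
  have "cmod (s g - ?q (s g)) \<le> cmod (s g - m) + cmod (m - ?q m) + cmod (?q m - ?q (s g))"
    using norm_triangle_ineq[of "s g - m" "m - ?q (s g)"] norm_triangle_ineq[of "m - ?q m" "?q m - ?q (s g)"] by simp
  then show ?thesis using 1 bias_bound unfolding pastur_defect_def distrib_right mult_1_left by linarith
qed

text \<open>The bias is deterministic and may converge slowly. Subtracting it leaves a quantity with summable
  mean squares.\<close>

theorem pastur_defect_mean_square:
  "(\<integral>\<^sup>+g. ennreal ((max 0 (pastur_defect g - BC / sqrt (real n)))\<^sup>2) \<partial>\<P>) \<le> ennreal ((1 + \<tau>\<^sup>2 / v\<^sup>2)\<^sup>2 * VC / (real n)\<^sup>2)"
proof -
  let ?a = "1 + \<tau>\<^sup>2 / v\<^sup>2"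
  have "(max 0 (pastur_defect g - BC / sqrt (real n)))\<^sup>2 \<le> ?a\<^sup>2 * (cmod (s g - m))\<^sup>2" for g
  proof -
    have "(max 0 (pastur_defect g - BC / sqrt (real n)))\<^sup>2 \<le> (?a * cmod (s g - m))\<^sup>2"
      using pastur_defect_le[of g] by (intro power_mono) auto
    then show ?thesis by (simp only: power_mult_distrib)
  qed
  then have "(\<integral>\<^sup>+g. ennreal ((max 0 (pastur_defect g - BC / sqrt (real n)))\<^sup>2) \<partial>\<P>) \<le> (\<integral>\<^sup>+g. ennreal (?a\<^sup>2 * (cmod (s g - m))\<^sup>2) \<partial>\<P>)"
    by (intro nn_integral_mono ennreal_leI)
  also have "\<dots> = ennreal (\<integral>g. ?a\<^sup>2 * (cmod (s g - m))\<^sup>2 \<partial>\<P>)"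
  proof (rule nn_integral_eq_integral)
    have b: "cmod (s g - m) \<le> 1/v + cmod m" for g
      using norm_triangle_ineq4[of "s g" m] s_bound[of g] by linarith
    have "integrable \<P> (\<lambda>g. (cmod (s g - m))\<^sup>2)"
      by (rule P.bounded_integrable[of _ "(1/v + cmod m)\<^sup>2"]) (use b s_measurable in \<open>auto intro!: power_mono\<close>)
    then show "integrable \<P> (\<lambda>g. ?a\<^sup>2 * (cmod (s g - m))\<^sup>2)" by (rule integrable_mult_right)
  qed simp
  also have "(\<integral>g. ?a\<^sup>2 * (cmod (s g - m))\<^sup>2 \<partial>\<P>) = ?a\<^sup>2 * (\<integral>g. (cmod (s g - m))\<^sup>2 \<partial>\<P>)" by (rule integral_mult_right_zero)
  also have "ennreal \<dots> \<le> ennreal (?a\<^sup>2 * (VC / (real n)\<^sup>2))"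
    by (intro ennreal_leI mult_left_mono variance_bound) simp
  finally show ?thesis by simp
qed

end

section \<open>Eigenvalues and the trace of the resolvent\<close>

definition stj :: "nat \<Rightarrow> (nat \<Rightarrow> real) \<Rightarrow> complex \<Rightarrow> complex" where
  "stj n x z = (\<Sum>j<n. 1 / (of_real (x j) - z)) / of_nat n"

abbreviation mk_fun :: "real mat \<Rightarrow> nat \<Rightarrow> nat \<Rightarrow> real" where
  "mk_fun X \<equiv> (\<lambda>i j. X $$ (i, j))"

lemma poly_char_poly_shift:
  assumes A: "(A :: complex mat) \<in> carrier_mat m m"
  shows "poly (char_poly A) z = (-1) ^ m * det (Matrix.mat m m (\<lambda>(i, j). A $$ (i, j) - (if i = j then z else 0)))"
proof -
  let ?M = "Matrix.mat m m (\<lambda>(i, j). A $$ (i, j) - (if i = j then z else 0))"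
  have "poly (char_poly A) z = det ((-1) \<cdot>\<^sub>m ?M)"
    unfolding char_poly_def
    by (rule poly_det_cong[of _ m]) (use A in \<open>auto simp: char_poly_matrix_def\<close>)
  also have "\<dots> = (-1) ^ m * det ?M" by (subst det_smult) auto
  finally show ?thesis .
qed

lemma symk_mk_fun:
  assumes "X \<in> carrier_mat n n" "transpose_mat X = X" shows "symk n (mk_fun X)"
  unfolding symk_def
proof (intro allI impI)
  fix i j assume "i < n" "j < n"
  then have "transpose_mat X $$ (i, j) = X $$ (j, i)" using assms(1) by auto
  then show "X $$ (i, j) = X $$ (j, i)" using assms(2) by simp
qed

lemma map_poly_linear_factors:
  "map_poly complex_of_real (\<Prod>l\<leftarrow>ls. [:- l, 1:]) = (\<Prod>l\<leftarrow>map complex_of_real ls. [:- l, 1:])"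
proof -
  interpret mp: map_poly_inj_idom_hom complex_of_real ..
  show ?thesis by (induction ls) (simp_all add: mp.hom_mult del: mult_pCons_left)
qed

text \<open>The complex characteristic polynomial splits. A root off the real axis would make the shifted matrix
  singular, at this root or at its conjugate, contradicting the invertibility in the upper half
  plane.\<close>

lemma char_poly_real_split:
  assumes X: "X \<in> carrier_mat n n" and sym: "symk n (mk_fun X)"
  obtains ls where "length ls = n" "char_poly X = (\<Prod>l\<leftarrow>ls. [:- l, 1:])"
proof -
  interpret mp: map_poly_inj_idom_hom complex_of_real ..
  let ?C = "map_mat complex_of_real X"
  have C: "?C \<in> carrier_mat n n" using X by simp
  obtain as where as: "char_poly ?C = (\<Prod>a\<leftarrow>as. [:- a, 1:])" "length as = n"
    using char_poly_factorized[OF C] by blast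
  have cp: "char_poly ?C = map_poly complex_of_real (char_poly X)"
    by (rule of_real_hom.char_poly_hom[OF X])
  have nonroot: "poly (char_poly ?C) z \<noteq> 0" if "Im z > 0" for z
  proof -
    have "Matrix.mat n n (\<lambda>(i, j). ?C $$ (i, j) - (if i = j then z else 0)) = shifted n (mk_fun X) z"
      by (rule eq_matI) (use X in \<open>auto simp: shifted_def\<close>)
    then show ?thesis using det_shifted_nonzero[OF sym that] by (simp add: poly_char_poly_shift[OF C])
  qed
  have real: "a \<in> \<real>" if "a \<in> set as" for a
  proof -
    have root: "poly (char_poly ?C) a = 0"
      unfolding as(1) using that by (simp add: poly_prod_list prod_list_zero_iff image_iff)
    have "poly (char_poly ?C) (cnj a) = cnj (poly (char_poly ?C) a)"
      unfolding cp by (simp add: poly_cnj map_poly_map_poly o_def)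
    then have "poly (char_poly ?C) (cnj a) = 0" using root by simp
    then have "\<not> Im a > 0" "\<not> Im (cnj a) > 0" using nonroot root by blast+
    then show ?thesis by (simp add: complex_is_Real_iff)
  qed
  define ls where "ls = map Re as"
  have asls: "as = map complex_of_real ls"
    unfolding ls_def using real by (simp add: map_idI complex_is_Real_iff complex_eq_iff)
  have "map_poly complex_of_real (char_poly X) = map_poly complex_of_real (\<Prod>l\<leftarrow>ls. [:- l, 1:])"
    unfolding cp[symmetric] as(1) map_poly_linear_factors by (simp only: asls[symmetric])
  then have "char_poly X = (\<Prod>l\<leftarrow>ls. [:- l, 1:])" by (rule mp.injectivity)
  moreover have "length ls = n" by (simp add: ls_def as(2))
  ultimately show ?thesis using that by blast
qed

lemma proots_linear_factors: "proots (\<Prod>l\<leftarrow>ls. [:- l, 1 :: 'a :: idom:]) = mset ls"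
proof (induction ls)
  case (Cons a ls)
  have "(\<Prod>l\<leftarrow>ls. [:- l, 1:]) \<noteq> 0" by (auto simp: prod_list_zero_iff)
  then show ?case using Cons by (simp add: proots_mult del: mult_pCons_left)
qed simp

lemma
  assumes X: "X \<in> carrier_mat n n" and sym: "symk n (mk_fun X)"
  shows length_eigs: "length (eigs X) = n"
    and char_poly_eigs: "char_poly X = (\<Prod>l\<leftarrow>eigs X. [:- l, 1:])"
    and eigs_decreasing: "sorted_wrt (\<ge>) (eigs X)"
proof -
  obtain ls where ls: "length ls = n" "char_poly X = (\<Prod>l\<leftarrow>ls. [:- l, 1:])"
    using char_poly_real_split[OF X sym] .
  have e: "mset (eigs X) = mset ls" by (simp add: eigs_def ls(2) proots_linear_factors)
  then show "length (eigs X) = n" using ls(1) by (metis size_mset)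
  have "prod_list (map f (eigs X)) = prod_list (map f ls)" for f :: "real \<Rightarrow> real poly"
    using e by (metis mset_map prod_mset_prod_list)
  then show "char_poly X = (\<Prod>l\<leftarrow>eigs X. [:- l, 1:])" using ls(2) by simp
  show "sorted_wrt (\<ge>) (eigs X)"
    unfolding eigs_def sorted_wrt_rev using sorted_sorted_list_of_multiset by (simp add: sorted_wrt_iff_nth_less)
qed

lemma eigs_antimono:
  assumes X: "X \<in> carrier_mat n n" and sym: "symk n (mk_fun X)"
  shows "antimono_on {..<n} (\<lambda>j. eigs X ! j)"
proof (rule monotone_onI)
  fix i j assume "i \<in> {..<n}" "j \<in> {..<n}" "i \<le> j"
  then show "eigs X ! j \<le> eigs X ! i"
    using eigs_decreasing[OF X sym] length_eigs[OF X sym]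
    by (cases "i = j") (auto simp: sorted_wrt_iff_nth_less)
qed

lemma eigs_eigenvalue:
  assumes X: "X \<in> carrier_mat n n" and sym: "symk n (mk_fun X)" and j: "j < n"
  shows "eigenvalue X (eigs X ! j)"
proof -
  have "eigs X ! j \<in> set (eigs X)" using j length_eigs[OF X sym] by auto
  then have "poly (char_poly X) (eigs X ! j) = 0"
    by (subst char_poly_eigs[OF X sym]) (simp add: poly_prod_list prod_list_zero_iff image_iff)
  then show ?thesis using eigenvalue_root_char_poly[OF X] by simp
qed

lemma sum_list_nth_lessThan: "length xs = n \<Longrightarrow> sum_list (map f xs) = (\<Sum>j<n. f (xs ! j))"
  by (simp add: sum_list_sum_nth lessThan_atLeast0)

text \<open>The logarithmic derivative of the characteristic polynomial is, on the one hand, the sum of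
  \<open>1 / (z - \<lambda>)\<close> over the eigenvalues, and on the other hand, by Jacobi's formula, the trace of the
  adjugate divided by the determinant.\<close>

lemma trace_resolvent_eigs:
  assumes X: "X \<in> carrier_mat n n" and sym: "symk n (mk_fun X)" and z: "Im z > 0"
  shows "ntrace n (resolvent n (mk_fun X) z) = stj n (\<lambda>j. eigs X ! j) z"
proof -
  let ?C = "map_mat complex_of_real X" let ?M = "shifted n (mk_fun X) z"
  have C: "?C \<in> carrier_mat n n" using X by simp
  let ?es = "map complex_of_real (eigs X)"
  have cp: "char_poly ?C = map_poly complex_of_real (char_poly X)"
    by (rule of_real_hom.char_poly_hom[OF X])
  have cpe: "char_poly ?C = (\<Prod>l\<leftarrow>?es. [:- l, 1:])"
    unfolding cp char_poly_eigs[OF X sym] map_poly_linear_factors ..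
  have logder: "poly (pderiv (\<Prod>l\<leftarrow>ls. [:- l, 1:])) z = poly (\<Prod>l\<leftarrow>ls. [:- l, 1:]) z * (\<Sum>l\<leftarrow>ls. 1 / (z - l))"
    if "z \<notin> set ls" for ls
    using that
  proof (induction ls)
    case (Cons a ls)
    then have "z - a \<noteq> 0" by auto
    then show ?case using Cons by (simp add: pderiv_mult pderiv_pCons field_simps del: mult_pCons_left)
  qed simp
  have znot: "z \<notin> set ?es" using z by auto
  have Me: "Matrix.mat n n (\<lambda>(i, j). ?C $$ (i, j) - (if i = j then z else 0)) = ?M"
    by (rule eq_matI) (use X in \<open>auto simp: shifted_def\<close>)
  have p: "poly (char_poly ?C) z = (-1) ^ n * det ?M" by (simp add: poly_char_poly_shift[OF C] Me)
  have dM: "det ?M \<noteq> 0" by (rule det_shifted_nonzero[OF sym z])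
  have del: "poly (char_poly (mat_delete ?C i i)) z = (-1) ^ (n - 1) * cofactor ?M i i" if i: "i < n" for i
  proof -
    have c: "mat_delete ?C i i \<in> carrier_mat (n - 1) (n - 1)" using X by (intro carrier_matI) (auto simp: mat_delete_def)
    have "Matrix.mat (n - 1) (n - 1) (\<lambda>(k, l). mat_delete ?C i i $$ (k, l) - (if k = l then z else 0)) = mat_delete ?M i i"
      by (rule eq_matI) (use X i in \<open>auto simp: mat_delete_def shifted_def\<close>)
    then show ?thesis unfolding poly_char_poly_shift[OF c] cofactor_def by simp
  qed
  have "poly (pderiv (char_poly ?C)) z = (\<Sum>i<n. (-1) ^ (n - 1) * cofactor ?M i i)"
    unfolding pderiv_char_poly[OF C] poly_sum by (intro sum.cong refl) (simp add: del)
  also have "\<dots> = (-1) ^ (n - 1) * (\<Sum>i<n. cofactor ?M i i)" by (simp add: sum_distrib_left)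
  finally have d1: "poly (pderiv (char_poly ?C)) z = (-1) ^ (n - 1) * (\<Sum>i<n. cofactor ?M i i)" .
  have tr: "(\<Sum>i<n. resolvent n (mk_fun X) z i i) = (\<Sum>i<n. cofactor ?M i i) / det ?M"
    unfolding sum_divide_distrib by (intro sum.cong refl) (auto simp: resolvent_def adj_mat_def shifted_def)
  have d2: "poly (pderiv (char_poly ?C)) z = (-1) ^ n * det ?M * (\<Sum>l\<leftarrow>?es. 1 / (z - l))"
    using logder[OF znot] p unfolding cpe by simp
  have "(\<Sum>l\<leftarrow>?es. 1 / (z - l)) = - (\<Sum>j<n. 1 / (of_real (eigs X ! j) - z))"
  proof -
    have "(\<Sum>l\<leftarrow>?es. 1 / (z - l)) = (\<Sum>l\<leftarrow>eigs X. 1 / (z - of_real l))" by (simp add: o_def)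
    also have "\<dots> = (\<Sum>j<n. 1 / (z - of_real (eigs X ! j)))" by (rule sum_list_nth_lessThan[OF length_eigs[OF X sym]])
    also have "\<dots> = (\<Sum>j<n. - (1 / (of_real (eigs X ! j) - z)))"
      by (intro sum.cong refl) (metis minus_diff_eq minus_divide_right)
    finally show ?thesis by (simp add: sum_negf)
  qed
  then have key: "(-1) ^ (n - 1) * (\<Sum>i<n. cofactor ?M i i) = - ((-1) ^ n) * det ?M * (\<Sum>j<n. 1 / (of_real (eigs X ! j) - z))"
    using d1 d2 by simp
  have "(\<Sum>i<n. resolvent n (mk_fun X) z i i) = (\<Sum>j<n. 1 / (of_real (eigs X ! j) - z))"
  proof (cases n)
    case (Suc k)
    have cancel: "c / d = e" if "(-1) ^ k * c = - ((-1) ^ Suc k) * d * e" "d \<noteq> 0" for c d e :: complex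
    proof -
      have "(-1) ^ k * c = (-1) ^ k * (d * e)" using that(1) by simp
      then show ?thesis using that(2) by (simp add: divide_eq_eq mult.commute)
    qed
    show ?thesis unfolding tr by (rule cancel[OF _ dM]) (use key Suc in \<open>simp only: diff_Suc_1\<close>)
  qed simp
  then show ?thesis by (simp add: ntrace_def stj_def)
qed

lemma sum_diag_mult_comm:
  assumes "A \<in> carrier_mat n m" "B \<in> carrier_mat m n"
  shows "(\<Sum>i<n. (A * B) $$ (i, i)) = (\<Sum>i<m. (B * A) $$ (i, i) :: complex)"
proof -
  have "(\<Sum>i<n. (A * B) $$ (i, i)) = (\<Sum>i<n. \<Sum>k<m. A $$ (i, k) * B $$ (k, i))"
    using assms by (intro sum.cong refl) (auto simp: scalar_prod_def lessThan_atLeast0 intro!: sum.cong)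
  also have "\<dots> = (\<Sum>k<m. \<Sum>i<n. B $$ (k, i) * A $$ (i, k))" by (subst sum.swap) (simp add: mult.commute)
  also have "\<dots> = (\<Sum>i<m. (B * A) $$ (i, i))"
    using assms by (intro sum.cong refl) (auto simp: scalar_prod_def lessThan_atLeast0 intro!: sum.cong)
  finally show ?thesis .
qed

text \<open>By Schur triangularisation, the trace of the square is the sum of the squared eigenvalues.\<close>

lemma sum_eigs_square:
  assumes X: "X \<in> carrier_mat n n" and sym: "symk n (mk_fun X)"
  shows "(\<Sum>j<n. (eigs X ! j)\<^sup>2) = (\<Sum>i<n. \<Sum>j<n. (X $$ (i, j))\<^sup>2)"
proof -
  let ?C = "map_mat complex_of_real X"
  have C: "?C \<in> carrier_mat n n" using X by simp
  let ?es = "map complex_of_real (eigs X)"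
  have cp: "char_poly ?C = map_poly complex_of_real (char_poly X)"
    by (rule of_real_hom.char_poly_hom[OF X])
  have cpe: "char_poly ?C = (\<Prod>l\<leftarrow>?es. [:- l, 1:])"
    unfolding cp char_poly_eigs[OF X sym] map_poly_linear_factors ..
  obtain B P Q where BPQ: "schur_decomposition ?C ?es = (B, P, Q)" by (cases "schur_decomposition ?C ?es") auto
  from schur_decomposition[OF C cpe BPQ] have sim: "similar_mat_wit ?C B P Q" and ut: "upper_triangular B" and dB: "diag_mat B = ?es" by auto
  note w = similar_mat_witD2[OF C sim]
  have cc: "(\<Sum>i<n. (?C * ?C) $$ (i, i)) = (\<Sum>i<n. (B * B) $$ (i, i))"
  proof -
    have "?C * ?C = P * B * (Q * P) * B * Q"
      unfolding w(3) using w(5-7) by (simp add: assoc_mult_mat[of _ n n _ n _ n])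
    also have "\<dots> = P * (B * B * Q)" using w(5-7) unfolding w(2) by (simp add: assoc_mult_mat[of _ n n _ n _ n])
    finally have "(\<Sum>i<n. (?C * ?C) $$ (i, i)) = (\<Sum>i<n. (B * B * Q * P) $$ (i, i))"
      using w(5-7) by (simp only:) (rule sum_diag_mult_comm[of _ n n], auto)
    also have "B * B * Q * P = B * B" using w(5-7) by (simp add: assoc_mult_mat[of _ n n _ n _ n] w(2))
    finally show ?thesis .
  qed
  have l: "(\<Sum>i<n. (?C * ?C) $$ (i, i)) = of_real (\<Sum>i<n. \<Sum>j<n. (X $$ (i, j))\<^sup>2)"
    unfolding of_real_sum
  proof (intro sum.cong refl)
    fix i assume i: "i \<in> {..<n}"
    have "(?C * ?C) $$ (i, i) = (\<Sum>k<n. ?C $$ (i, k) * ?C $$ (k, i))"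
      using i X by (auto simp: scalar_prod_def lessThan_atLeast0 intro!: sum.cong)
    also have "\<dots> = (\<Sum>k<n. of_real ((X $$ (i, k))\<^sup>2))"
      by (intro sum.cong refl) (use i X sym in \<open>auto simp: symk_def power2_eq_square\<close>)
    finally show "(?C * ?C) $$ (i, i) = (\<Sum>k<n. of_real ((X $$ (i, k))\<^sup>2))" .
  qed
  have dBi: "B $$ (i, i) = of_real (eigs X ! i)" if "i < n" for i
  proof -
    have "diag_mat B ! i = B $$ (i, i)" using that w(5) by (simp add: diag_mat_def)
    then show ?thesis using that length_eigs[OF X sym] unfolding dB by simp
  qed
  have r: "(\<Sum>i<n. (B * B) $$ (i, i)) = of_real (\<Sum>j<n. (eigs X ! j)\<^sup>2)"
    unfolding of_real_sum
  proof (intro sum.cong refl)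
    fix i assume i: "i \<in> {..<n}"
    have "(B * B) $$ (i, i) = (\<Sum>k<n. B $$ (i, k) * B $$ (k, i))"
      using i w(5) by (auto simp: scalar_prod_def lessThan_atLeast0 intro!: sum.cong)
    also have "\<dots> = (\<Sum>k<n. if k = i then (B $$ (i, i))\<^sup>2 else 0)"
    proof (intro sum.cong refl)
      fix k assume k: "k \<in> {..<n}"
      have "k < i \<Longrightarrow> B $$ (i, k) = 0" "i < k \<Longrightarrow> B $$ (k, i) = 0"
        using ut i k w(5) unfolding upper_triangular_def by auto
      then show "B $$ (i, k) * B $$ (k, i) = (if k = i then (B $$ (i, i))\<^sup>2 else 0)"
        by (cases k i rule: linorder_cases) (auto simp: power2_eq_square)
    qed
    also have "\<dots> = of_real ((eigs X ! i)\<^sup>2)" using i by (simp add: dBi)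
    finally show "(B * B) $$ (i, i) = of_real ((eigs X ! i)\<^sup>2)" .
  qed
  have "complex_of_real (\<Sum>j<n. (eigs X ! j)\<^sup>2) = of_real (\<Sum>i<n. \<Sum>j<n. (X $$ (i, j))\<^sup>2)"
    using cc l r by simp
  then show ?thesis by (simp only: of_real_eq_iff)
qed

section \<open>Mean squares of linear and quadratic statistics\<close>

context wigner
begin

lemma integral_two_coords:
  fixes h :: "nat \<times> nat \<Rightarrow> real \<Rightarrow> real"
  assumes e: "e \<in> edges n" "e' \<in> edges n" "e \<noteq> e'"
    and int: "\<And>i. i \<in> edges n \<Longrightarrow> integrable (D i) (h i)"
  shows "integrable \<P> (\<lambda>g. h e (g e) * h e' (g e'))"
    and "(\<integral>g. h e (g e) * h e' (g e') \<partial>\<P>) = (\<integral>x. h e x \<partial>D e) * (\<integral>x. h e' x \<partial>D e')"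
proof -
  define f where "f i = (if i = e \<or> i = e' then h i else (\<lambda>_. 1))" for i
  have fin: "finite (edges n)" by simp
  have fi: "integrable (D i) (f i)" if "i \<in> edges n" for i using int[OF that] by (simp add: f_def)
  have split: "(\<Prod>i\<in>edges n. u i) = u e * u e'" if "\<And>i. i \<noteq> e \<Longrightarrow> i \<noteq> e' \<Longrightarrow> u i = 1" for u :: "nat \<times> nat \<Rightarrow> real"
  proof -
    have "(\<Prod>i\<in>edges n. u i) = (\<Prod>i\<in>{e, e'}. u i)"
      by (rule prod.mono_neutral_right) (use e that in auto)
    then show ?thesis using e(3) by simp
  qed
  have p: "(\<Prod>i\<in>edges n. f i (g i)) = h e (g e) * h e' (g e')" for g
    by (subst split) (auto simp: f_def)
  show "integrable \<P> (\<lambda>g. h e (g e) * h e' (g e'))"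
    using product_integrable_prod[OF fin, of f] fi unfolding p by blast
  show "(\<integral>g. h e (g e) * h e' (g e') \<partial>\<P>) = (\<integral>x. h e x \<partial>D e) * (\<integral>x. h e' x \<partial>D e')"
  proof -
    have "(\<integral>g. h e (g e) * h e' (g e') \<partial>\<P>) = (\<Prod>i\<in>edges n. \<integral>x. f i x \<partial>D i)"
      using product_integral_prod[OF fin, of f] fi unfolding p by blast
    also have "\<dots> = (\<integral>x. f e x \<partial>D e) * (\<integral>x. f e' x \<partial>D e')"
      by (rule split) (simp add: f_def M.prob_space)
    finally show ?thesis by (simp add: f_def)
  qed
qed

text \<open>Distinct entries are independent and centred, so mixed products integrate to zero.\<close>

lemma centred_sum_mean_square:
  fixes h :: "nat \<times> nat \<Rightarrow> real \<Rightarrow> real"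
  assumes E: "E \<subseteq> edges n"
    and int: "\<And>i. i \<in> edges n \<Longrightarrow> integrable (D i) (h i)"
    and int2: "\<And>i. i \<in> edges n \<Longrightarrow> integrable (D i) (\<lambda>x. (h i x)\<^sup>2)"
    and zero: "\<And>i. i \<in> E \<Longrightarrow> (\<integral>x. h i x \<partial>D i) = 0"
  shows "(\<integral>\<^sup>+g. ennreal ((\<Sum>e\<in>E. h e (g e))\<^sup>2) \<partial>\<P>) = ennreal (\<Sum>e\<in>E. \<integral>x. (h e x)\<^sup>2 \<partial>D e)"
proof -
  have fE: "finite E" using E by (rule finite_subset) simp
  have eE: "e \<in> edges n" if "e \<in> E" for e using E that by auto
  have sq: "(\<Sum>e\<in>E. h e (g e))\<^sup>2 = (\<Sum>e\<in>E. \<Sum>e'\<in>E. h e (g e) * h e' (g e'))" for g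
    by (simp add: power2_eq_square sum_product)
  have i: "integrable \<P> (\<lambda>g. h e (g e) * h e' (g e'))" and
    v: "(\<integral>g. h e (g e) * h e' (g e') \<partial>\<P>) = (if e' = e then (\<integral>x. (h e x)\<^sup>2 \<partial>D e) else 0)" if "e \<in> E" "e' \<in> E" for e e'
  proof -
    have "integrable \<P> (\<lambda>g. h e (g e) * h e' (g e')) \<and> (\<integral>g. h e (g e) * h e' (g e') \<partial>\<P>) = (if e' = e then (\<integral>x. (h e x)\<^sup>2 \<partial>D e) else 0)"
    proof (cases "e' = e")
      case True
      then show ?thesis using integrable_coord[OF eE[OF that(1)] int2[OF eE[OF that(1)]]] by (simp add: power2_eq_square)
    next
      case False
      then have ne: "e \<noteq> e'" by simp
      show ?thesis using integral_two_coords[OF eE[OF that(1)] eE[OF that(2)] ne int] False zero[OF that(1)] by simp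
    qed
    then show "integrable \<P> (\<lambda>g. h e (g e) * h e' (g e'))" "(\<integral>g. h e (g e) * h e' (g e') \<partial>\<P>) = (if e' = e then (\<integral>x. (h e x)\<^sup>2 \<partial>D e) else 0)" by auto
  qed
  have "(\<integral>\<^sup>+g. ennreal ((\<Sum>e\<in>E. h e (g e))\<^sup>2) \<partial>\<P>) = ennreal (\<integral>g. (\<Sum>e\<in>E. h e (g e))\<^sup>2 \<partial>\<P>)"
  proof (rule nn_integral_eq_integral)
    show "integrable \<P> (\<lambda>g. (\<Sum>e\<in>E. h e (g e))\<^sup>2)"
      unfolding sq by (intro Bochner_Integration.integrable_sum i)
  qed simp
  also have "(\<integral>g. (\<Sum>e\<in>E. h e (g e))\<^sup>2 \<partial>\<P>) = (\<Sum>e\<in>E. \<Sum>e'\<in>E. \<integral>g. h e (g e) * h e' (g e') \<partial>\<P>)"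
    unfolding sq by (simp add: Bochner_Integration.integral_sum Bochner_Integration.integrable_sum i)
  also have "\<dots> = (\<Sum>e\<in>E. \<integral>x. (h e x)\<^sup>2 \<partial>D e)"
    using fE by (intro sum.cong refl) (simp add: v)
  finally show ?thesis .
qed

lemma offdiag_squares:
  "(\<integral>\<^sup>+g. ennreal ((\<Sum>e\<in>{e \<in> edges n. fst e \<noteq> snd e}. (g e)\<^sup>2 - 1)\<^sup>2) \<partial>\<P>) \<le> ennreal ((real n)\<^sup>2 * K)"
proof -
  let ?E = "{e \<in> edges n. fst e \<noteq> snd e}"
  have i2: "integrable (D e) (\<lambda>x. x\<^sup>2)" if "e \<in> edges n" for e using moment(1)[OF that, of 2] by simp
  have one: "(\<integral>x. x\<^sup>2 \<partial>D e) = 1" if "e \<in> ?E" for e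
    using that var_one[of "fst e" "snd e"] by (auto simp: edges_def)
  have sq: "(x\<^sup>2 - 1)\<^sup>2 = x ^ 4 - 2 * x\<^sup>2 + 1" for x :: real
    by (simp add: power2_eq_square power4_eq_xxxx algebra_simps)
  have "(\<integral>\<^sup>+g. ennreal ((\<Sum>e\<in>?E. (g e)\<^sup>2 - 1)\<^sup>2) \<partial>\<P>) = ennreal (\<Sum>e\<in>?E. \<integral>x. (x\<^sup>2 - 1)\<^sup>2 \<partial>D e)"
    by (rule centred_sum_mean_square) (use i2 fourth_int one in \<open>auto simp: sq M.prob_space\<close>)
  also have "\<dots> \<le> ennreal ((real n)\<^sup>2 * K)"
  proof (rule ennreal_leI)
    have "(\<Sum>e\<in>?E. \<integral>x. (x\<^sup>2 - 1)\<^sup>2 \<partial>D e) \<le> (\<Sum>e\<in>?E. K)"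
    proof (rule sum_mono)
      fix e assume e: "e \<in> ?E"
      then have "(\<integral>x. (x\<^sup>2 - 1)\<^sup>2 \<partial>D e) = (\<integral>x. x ^ 4 \<partial>D e) - 1"
        unfolding sq using i2 fourth_int one[OF e] by (simp add: M.prob_space)
      then show "(\<integral>x. (x\<^sup>2 - 1)\<^sup>2 \<partial>D e) \<le> K" using fourth_le[of e] e by simp
    qed
    also have "\<dots> = real (card ?E) * K" by simp
    also have "\<dots> \<le> (real n)\<^sup>2 * K"
    proof (cases "edges n = {}")
      case False
      then obtain e where "e \<in> edges n" by auto
      then have "0 \<le> K" by (rule K_nonneg)
      moreover have "card ?E \<le> n\<^sup>2" using card_mono[of "edges n" ?E] card_edges[of n] by auto
      ultimately show ?thesis by (intro mult_right_mono) (auto simp flip: of_nat_power)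
    next
      case True
      have "n = 0" using True by (cases n) (auto simp: edges_def)
      then show ?thesis using True by simp
    qed
    finally show "(\<Sum>e\<in>?E. \<integral>x. (x\<^sup>2 - 1)\<^sup>2 \<partial>D e) \<le> (real n)\<^sup>2 * K" .
  qed
  finally show ?thesis .
qed

lemma sum_square_le: "(\<Sum>i<n. a i)\<^sup>2 \<le> real n * (\<Sum>i<n. (a i :: real)\<^sup>2)"
proof -
  have "(\<Sum>i<n. a i) = (\<Sum>i<n. a i * 1)" by simp
  also have "\<bar>\<dots>\<bar> \<le> L2_set a {..<n} * L2_set (\<lambda>_. 1) {..<n}"
    by (rule order_trans[OF sum_abs order_trans[OF _ L2_set_mult_ineq]]) (simp add: abs_mult)
  also have "\<dots> = sqrt (real n * (\<Sum>i<n. (a i)\<^sup>2))" by (simp add: L2_set_def real_sqrt_mult)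
  finally have "\<bar>\<Sum>i<n. a i\<bar>\<^sup>2 \<le> (sqrt (real n * (\<Sum>i<n. (a i)\<^sup>2)))\<^sup>2" by (intro power_mono) auto
  then show ?thesis by (simp add: sum_nonneg)
qed

lemma diag_squares:
  "(\<integral>\<^sup>+g. ennreal ((\<Sum>i<n. (g (i, i))\<^sup>2)\<^sup>2) \<partial>\<P>) \<le> ennreal ((real n)\<^sup>2 * K)"
proof -
  have e: "(i, i) \<in> edges n" if "i < n" for i using that by (auto simp: edges_def)
  have int: "integrable \<P> (\<lambda>g. (g (i, i))^4)" "(\<integral>g. (g (i, i))^4 \<partial>\<P>) \<le> K" if "i < n" for i
    using integrable_coord[OF e[OF that] fourth_int[OF e[OF that]]] fourth_le[OF e[OF that]] by auto
  have "(\<integral>\<^sup>+g. ennreal ((\<Sum>i<n. (g (i, i))\<^sup>2)\<^sup>2) \<partial>\<P>) \<le> (\<integral>\<^sup>+g. ennreal (real n * (\<Sum>i<n. (g (i, i))^4)) \<partial>\<P>)"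
  proof (intro nn_integral_mono ennreal_leI)
    fix g show "(\<Sum>i<n. (g (i, i))\<^sup>2)\<^sup>2 \<le> real n * (\<Sum>i<n. (g (i, i)) ^ 4)"
      using sum_square_le[of "\<lambda>i. (g (i, i))\<^sup>2"] by (simp flip: power_mult)
  qed
  also have "\<dots> = ennreal (\<integral>g. real n * (\<Sum>i<n. (g (i, i))^4) \<partial>\<P>)"
    by (rule nn_integral_eq_integral)
       (auto intro!: mult_nonneg_nonneg sum_nonneg Bochner_Integration.integrable_sum int AE_I2)
  also have "(\<integral>g. real n * (\<Sum>i<n. (g (i, i))^4) \<partial>\<P>) = real n * (\<Sum>i<n. \<integral>g. (g (i, i))^4 \<partial>\<P>)"
    using int by (simp add: Bochner_Integration.integral_sum)
  also have "ennreal \<dots> \<le> ennreal (real n * (\<Sum>i<n. K))"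
    by (intro ennreal_leI mult_left_mono sum_mono int) auto
  finally show ?thesis by (simp add: power2_eq_square[of "real n"] mult.assoc)
qed

lemma linear_form_mean_square:
  assumes b: "symk n b"
  shows "(\<integral>\<^sup>+g. ennreal ((\<Sum>i<n. \<Sum>j<n. b i j * wk g i j)\<^sup>2) \<partial>\<P>) \<le> ennreal (4 * (1 + K) * (\<Sum>i<n. \<Sum>j<n. (b i j)\<^sup>2))"
proof -
  define \<beta> where "\<beta> e = (if fst e = snd e then 1 else 2) * b (fst e) (snd e)" for e
  have conv: "(\<Sum>i<n. \<Sum>j<n. b i j * wk g i j) = (\<Sum>e\<in>edges n. \<beta> e * g e)" for g
  proof -
    have "complex_of_real (\<Sum>i<n. \<Sum>j<n. b i j * wk g i j) = (\<Sum>i<n. \<Sum>j<n. of_real (b i j * wk g i j))" by simp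
    also have "\<dots> = (\<Sum>e\<in>edges n. of_real (\<beta> e * g e))"
      unfolding sum_edges
    proof (intro sum.cong refl)
      fix e assume "e \<in> edges n"
      then obtain i j where e: "e = (i, j)" "i \<le> j" "j < n" by (auto simp: edges_def)
      then have "wk g i j = g (i, j)" "wk g j i = g (i, j)" "b j i = b i j"
        using b by (auto simp: wk_def min_def max_def symk_def)
      then show "(case e of (i, j) \<Rightarrow> half_diag (i, j) * (complex_of_real (b i j * wk g i j) + complex_of_real (b j i * wk g j i))) = of_real (\<beta> e * g e)"
        by (simp add: e \<beta>_def half_diag_def)
    qed
    also have "\<dots> = complex_of_real (\<Sum>e\<in>edges n. \<beta> e * g e)" by simp
    finally show ?thesis by (simp only: of_real_eq_iff)
  qed
  have i1: "integrable (D e) (\<lambda>x. x)" if "e \<in> edges n" for e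
    by (rule Bochner_Integration.integrable_bound[OF moment(1)[OF that, of 1]]) (auto intro: D_measurable)
  have i2: "integrable (D e) (\<lambda>x. x\<^sup>2)" if "e \<in> edges n" for e using moment(1)[OF that, of 2] by simp
  have "(\<integral>\<^sup>+g. ennreal ((\<Sum>i<n. \<Sum>j<n. b i j * wk g i j)\<^sup>2) \<partial>\<P>) = ennreal (\<Sum>e\<in>edges n. \<integral>x. (\<beta> e * x)\<^sup>2 \<partial>D e)"
    unfolding conv
    by (rule centred_sum_mean_square[where h="\<lambda>e x. \<beta> e * x"])
       (use i1 i2 mean_zero in \<open>auto simp: power_mult_distrib\<close>)
  also have "\<dots> \<le> ennreal (4 * (1 + K) * (\<Sum>i<n. \<Sum>j<n. (b i j)\<^sup>2))"
  proof (rule ennreal_leI)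
    have "(\<Sum>e\<in>edges n. \<integral>x. (\<beta> e * x)\<^sup>2 \<partial>D e) \<le> (\<Sum>e\<in>edges n. 4 * (1 + K) * (b (fst e) (snd e))\<^sup>2)"
    proof (rule sum_mono)
      fix e assume e: "e \<in> edges n"
      have "(\<integral>x. (\<beta> e * x)\<^sup>2 \<partial>D e) = (\<beta> e)\<^sup>2 * m2 e" by (simp add: power_mult_distrib m2_def)
      also have "\<dots> \<le> (4 * (b (fst e) (snd e))\<^sup>2) * (1 + K)"
        using m2[OF e] by (intro mult_mono) (auto simp: \<beta>_def power_mult_distrib)
      finally show "(\<integral>x. (\<beta> e * x)\<^sup>2 \<partial>D e) \<le> 4 * (1 + K) * (b (fst e) (snd e))\<^sup>2" by (simp only: mult_ac)
    qed
    also have "\<dots> \<le> (\<Sum>e\<in>{..<n} \<times> {..<n}. 4 * (1 + K) * (b (fst e) (snd e))\<^sup>2)"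
    proof (rule sum_mono2)
      fix e assume "e \<in> {..<n} \<times> {..<n} - edges n"
      then have "(0, 0) \<in> edges n" by (auto simp: edges_def)
      then show "0 \<le> 4 * (1 + K) * (b (fst e) (snd e))\<^sup>2" using K_nonneg by fastforce
    qed (auto simp: edges_def)
    also have "\<dots> = 4 * (1 + K) * (\<Sum>i<n. \<Sum>j<n. (b i j)\<^sup>2)"
      by (simp add: sum.cartesian_product case_prod_unfold sum_distrib_left)
    finally show "(\<Sum>e\<in>edges n. \<integral>x. (\<beta> e * x)\<^sup>2 \<partial>D e) \<le> 4 * (1 + K) * (\<Sum>i<n. \<Sum>j<n. (b i j)\<^sup>2)" .
  qed
  finally show ?thesis .
qed

end

text \<open>The expectation of the sum of all terms is finite, so the sum is almost surely finite and its terms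
  tend to zero, whatever their joint law is.\<close>

lemma AE_tendsto_zero_of_summable:
  fixes f :: "nat \<Rightarrow> 'a \<Rightarrow> real"
  assumes m: "\<And>n. f n \<in> borel_measurable M" and nn: "\<And>n x. 0 \<le> f n x"
    and b: "\<And>n. n \<ge> 1 \<Longrightarrow> (\<integral>\<^sup>+x. ennreal (f n x) \<partial>M) \<le> ennreal (C / (real n)\<^sup>2)"
  shows "AE x in M. (\<lambda>n. f n x) \<longlonglongrightarrow> 0"
proof -
  have C: "C / (real (Suc n))\<^sup>2 \<le> \<bar>C\<bar> * (1 / (real (Suc n))\<^sup>2)" for n
    by (simp add: divide_right_mono)
  have sm: "summable (\<lambda>n. \<bar>C\<bar> * (1 / (real (Suc n))\<^sup>2))"
    using inverse_power_summable[of 2, where 'a=real]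
    by (intro summable_mult) (subst summable_Suc_iff, simp add: inverse_eq_divide)
  have "(\<integral>\<^sup>+x. (\<Sum>n. ennreal (f (Suc n) x)) \<partial>M) = (\<Sum>n. \<integral>\<^sup>+x. ennreal (f (Suc n) x) \<partial>M)"
    using m by (intro nn_integral_suminf) simp
  also have "\<dots> \<le> (\<Sum>n. ennreal (\<bar>C\<bar> * (1 / (real (Suc n))\<^sup>2)))"
    by (intro suminf_le summableI order_trans[OF b ennreal_leI[OF C]]) auto
  also have "\<dots> < \<infinity>" using sm by (subst suminf_ennreal2) auto
  finally have "(\<integral>\<^sup>+x. (\<Sum>n. ennreal (f (Suc n) x)) \<partial>M) \<noteq> \<infinity>" by simp
  then have "AE x in M. (\<Sum>n. ennreal (f (Suc n) x)) \<noteq> \<infinity>"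
    using m by (intro nn_integral_PInf_AE) auto
  then show ?thesis
  proof (rule AE_mp, intro AE_I2 impI)
    fix x assume "(\<Sum>n. ennreal (f (Suc n) x)) \<noteq> \<infinity>"
    then have "summable (\<lambda>n. f (Suc n) x)" using nn by (intro summable_suminf_not_top) auto
    then have "(\<lambda>n. f (Suc n) x) \<longlonglongrightarrow> 0" by (rule summable_LIMSEQ_zero)
    then show "(\<lambda>n. f n x) \<longlonglongrightarrow> 0" by (rule LIMSEQ_imp_Suc)
  qed
qed

lemma space_borel_mat: "space (borel_mat n) = carrier_mat n n"
  by (simp add: borel_mat_def)

lemma borel_mat_entry:
  assumes "i < n" "j < n" shows "(\<lambda>A. A $$ (i, j)) \<in> borel_measurable (borel_mat n)"
proof -
  let ?f = "\<lambda>A :: real mat. \<lambda>(i, j)\<in>{..<n} \<times> {..<n}. A $$ (i, j)"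
  have "?f \<in> measurable (borel_mat n) (\<Pi>\<^sub>M _\<in>{..<n} \<times> {..<n}. borel)"
    unfolding borel_mat_def by (rule measurable_vimage_algebra1) (auto simp: space_PiM)
  from measurable_compose[OF this measurable_component_singleton[of "(i, j)"]]
  show ?thesis using assms by simp
qed

lemma measurable_borel_mat:
  assumes "\<And>x. x \<in> space N \<Longrightarrow> f x \<in> carrier_mat n n"
    and "\<And>i j. i < n \<Longrightarrow> j < n \<Longrightarrow> (\<lambda>x. f x $$ (i, j)) \<in> borel_measurable N"
  shows "f \<in> measurable N (borel_mat n)"
  unfolding borel_mat_def
proof (rule measurable_vimage_algebra2)
  show "f \<in> space N \<rightarrow> carrier_mat n n" using assms(1) by auto
  have "(\<lambda>x. \<lambda>p\<in>{..<n} \<times> {..<n}. f x $$ p) \<in> measurable N (\<Pi>\<^sub>M _\<in>{..<n} \<times> {..<n}. borel)"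
    by (rule measurable_restrict) (use assms(2) in auto)
  then show "(\<lambda>x. \<lambda>(i, j)\<in>{..<n} \<times> {..<n}. f x $$ (i, j)) \<in> measurable N (\<Pi>\<^sub>M _\<in>{..<n} \<times> {..<n}. borel)"
    by (simp add: case_prod_unfold)
qed

definition sym_mat :: "nat \<Rightarrow> (nat \<times> nat \<Rightarrow> real) \<Rightarrow> real mat" where
  "sym_mat n g = Matrix.mat n n (\<lambda>(i, j). g (min i j, max i j))"

lemma resolvent_cong:
  assumes "\<And>i j. i < n \<Longrightarrow> j < n \<Longrightarrow> X i j = Y i j"
  shows "resolvent n X z = resolvent n Y z"
proof -
  have "shifted n X z = shifted n Y z" by (rule eq_matI) (auto simp: shifted_def assms)
  then show ?thesis by (intro ext) (simp add: resolvent_def)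
qed

section \<open>Almost sure behaviour of deformed Wigner matrices\<close>

lemma sum_symmetric_real:
  fixes f :: "nat \<Rightarrow> nat \<Rightarrow> real"
  assumes f: "symk n f"
  shows "(\<Sum>i<n. \<Sum>j<n. f i j) = 2 * (\<Sum>e\<in>{e \<in> edges n. fst e \<noteq> snd e}. f (fst e) (snd e)) + (\<Sum>i<n. f i i)"
proof -
  let ?O = "{e \<in> edges n. fst e \<noteq> snd e}" let ?D = "(\<lambda>i. (i, i)) ` {..<n}"
  have E: "edges n = ?O \<union> ?D" by (auto simp: edges_def)
  have fin: "finite ?O" by simp
  have "complex_of_real (\<Sum>i<n. \<Sum>j<n. f i j) = (\<Sum>(i, j)\<in>edges n. half_diag (i, j) * (of_real (f i j) + of_real (f j i)))"
    using sum_edges[of "\<lambda>i j. complex_of_real (f i j)" n] by simp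
  also have "\<dots> = (\<Sum>(i, j)\<in>?O \<union> ?D. half_diag (i, j) * (of_real (f i j) + of_real (f j i)))"
    by (rule sum.cong[OF E refl])
  also have "\<dots> = (\<Sum>(i, j)\<in>?O. half_diag (i, j) * (of_real (f i j) + of_real (f j i))) + (\<Sum>(i, j)\<in>?D. half_diag (i, j) * (of_real (f i j) + of_real (f j i)))"
    using fin by (intro sum.union_disjoint) auto
  also have "(\<Sum>(i, j)\<in>?O. half_diag (i, j) * (of_real (f i j) + of_real (f j i))) = (\<Sum>e\<in>?O. 2 * of_real (f (fst e) (snd e)))"
    by (intro sum.cong) (use f in \<open>auto simp: half_diag_def symk_def edges_def\<close>)
  also have "(\<Sum>(i, j)\<in>?D. half_diag (i, j) * (of_real (f i j) + of_real (f j i))) = (\<Sum>i<n. complex_of_real (f i i))"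
    by (subst sum.reindex) (auto simp: inj_on_def half_diag_def)
  finally have "complex_of_real (\<Sum>i<n. \<Sum>j<n. f i j) = of_real (2 * (\<Sum>e\<in>?O. f (fst e) (snd e)) + (\<Sum>i<n. f i i))"
    by (simp add: sum_distrib_left)
  then show ?thesis by (simp only: of_real_eq_iff)
qed

definition ST :: "nat \<Rightarrow> (nat \<Rightarrow> nat \<Rightarrow> real) \<Rightarrow> complex \<Rightarrow> complex" where
  "ST n X z = ntrace n (resolvent n X z)"

text \<open>The error with which the deformation \<open>X\<close> of \<open>B\<close> by noise of level
  \<open>\<tau>\<close> satisfies the fixed-point equation.\<close>

definition defect :: "nat \<Rightarrow> (nat \<Rightarrow> nat \<Rightarrow> real) \<Rightarrow> (nat \<Rightarrow> nat \<Rightarrow> real) \<Rightarrow> real \<Rightarrow> complex \<Rightarrow> real" where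
  "defect n B X \<tau> z = cmod (ST n X z - ST n B (z + of_real (\<tau>\<^sup>2) * ST n X z))"

lemma ST_lipschitz:
  "symk n X \<Longrightarrow> Im w \<ge> v \<Longrightarrow> Im w' \<ge> v \<Longrightarrow> v > 0 \<Longrightarrow> cmod (ST n X w - ST n X w') \<le> cmod (w - w') / v\<^sup>2"
  unfolding ST_def by (rule ntrace_resolvent_lipschitz)

lemma ST_bound: "symk n X \<Longrightarrow> Im w > 0 \<Longrightarrow> cmod (ST n X w) \<le> 1 / Im w"
  unfolding ST_def by (rule norm_ntrace_resolvent)

lemma Im_ST: "symk n X \<Longrightarrow> Im w > 0 \<Longrightarrow> Im (ST n X w) \<ge> 0"
  unfolding ST_def by (rule Im_ntrace_resolvent)

lemma ST_cong: "(\<And>i j. i < n \<Longrightarrow> j < n \<Longrightarrow> X i j = Y i j) \<Longrightarrow> ST n X z = ST n Y z"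
  unfolding ST_def by (subst resolvent_cong) auto

lemma defect_cong:
  assumes "\<And>i j. i < n \<Longrightarrow> j < n \<Longrightarrow> X i j = Y i j"
  shows "defect n B X \<tau> z = defect n B Y \<tau> z"
  using ST_cong[of n X Y, OF assms] by (simp add: defect_def)

text \<open>Approximations of the undeformed kernel, of the noise and of the spectral parameter can be transferred to
  the defect at the cost of their effect on normalised traces.\<close>

lemma defect_le:
  assumes S: "symk n B" "symk n X" "symk n X'" and z: "Im z \<ge> v" "Im z' \<ge> v" "v > 0"
    and X: "cmod (ST n X z - ST n X' z') \<le> a"
    and B: "\<And>w. Im w \<ge> v \<Longrightarrow> cmod (ST n B w - ST n B' w) \<le> b"
  shows "defect n B X \<tau> z \<le> defect n B' X' \<tau> z' + a + b + (cmod (z - z') + \<tau>\<^sup>2 * a) / v\<^sup>2"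
proof -
  let ?w = "z + of_real (\<tau>\<^sup>2) * ST n X z" let ?w' = "z' + of_real (\<tau>\<^sup>2) * ST n X' z'"
  have zp: "Im z > 0" "Im z' > 0" using z by auto
  have w: "Im ?w \<ge> v" "Im ?w' \<ge> v" using z Im_ST[OF S(2) zp(1)] Im_ST[OF S(3) zp(2)] by (auto intro: add_increasing2)
  have "?w - ?w' = (z - z') + of_real (\<tau>\<^sup>2) * (ST n X z - ST n X' z')" by (simp add: algebra_simps)
  then have "cmod (?w - ?w') \<le> cmod (z - z') + cmod (of_real (\<tau>\<^sup>2) * (ST n X z - ST n X' z'))"
    by (simp only: norm_triangle_ineq)
  also have "cmod (of_real (\<tau>\<^sup>2) * (ST n X z - ST n X' z')) = \<tau>\<^sup>2 * cmod (ST n X z - ST n X' z')"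
    unfolding norm_mult norm_of_real by simp
  also have "\<dots> \<le> \<tau>\<^sup>2 * a" using X by (intro mult_left_mono) auto
  finally have ww: "cmod (?w - ?w') \<le> cmod (z - z') + \<tau>\<^sup>2 * a" by simp
  have "cmod (ST n B ?w - ST n B ?w') \<le> cmod (?w - ?w') / v\<^sup>2" by (rule ST_lipschitz[OF S(1) w z(3)])
  also have "\<dots> \<le> (cmod (z - z') + \<tau>\<^sup>2 * a) / v\<^sup>2" using ww by (intro divide_right_mono) auto
  finally have 1: "cmod (ST n B ?w - ST n B ?w') \<le> (cmod (z - z') + \<tau>\<^sup>2 * a) / v\<^sup>2" .
  have 2: "cmod (ST n B ?w' - ST n B' ?w') \<le> b" using B w(2) .
  have tri: "cmod (x - y) \<le> cmod (x' - y') + cmod (x - x') + cmod (y0 - y') + cmod (y - y0)" for x y x' y' y0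
    using norm_triangle_ineq[of "x - x'" "x' - y'"] norm_triangle_ineq4[of "x - y'" "y - y'"] norm_triangle_ineq[of "y - y0" "y0 - y'"]
    by simp
  show ?thesis unfolding defect_def
    using tri[of "ST n X z" "ST n B ?w" "ST n X' z'" "ST n B' ?w'" "ST n B ?w'"] X 1 2 by linarith
qed

text \<open>The noise \<open>N\<close> is compared with \<open>\<tau>\<close> times a Wigner matrix through expectations only. The
  decoupling condition covers both a random \<open>B\<close> independent of \<open>N\<close> and a deterministic one.\<close>

locale noise = prob_space M for M :: "'w measure" +
  fixes D :: "nat \<Rightarrow> nat \<times> nat \<Rightarrow> real measure" and K \<tau> :: real and B N :: "nat \<Rightarrow> 'w \<Rightarrow> real mat"
  assumes wig: "\<And>n. n \<ge> 1 \<Longrightarrow> wigner (D n) n K"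
    and tau: "\<tau> \<ge> 0"
    and Bm: "\<And>n. B n \<in> measurable M (borel_mat n)" and Nm: "\<And>n. N n \<in> measurable M (borel_mat n)"
    and Bsym: "\<And>n \<omega>. \<omega> \<in> space M \<Longrightarrow> symk n (mk_fun (B n \<omega>))"
    and dec: "\<And>n \<phi> C. \<phi> \<in> borel_measurable (borel_mat n \<Otimes>\<^sub>M borel_mat n) \<Longrightarrow>
       (\<And>b. b \<in> carrier_mat n n \<Longrightarrow> symk n (mk_fun b) \<Longrightarrow>
          (\<integral>\<^sup>+g. \<phi> (b, \<tau> \<cdot>\<^sub>m sym_mat n g) \<partial>Pi\<^sub>M (edges n) (D n)) \<le> C) \<Longrightarrow>
       (\<integral>\<^sup>+\<omega>. \<phi> (B n \<omega>, N n \<omega>) \<partial>M) \<le> (C :: ennreal)"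
begin

lemma fst_entry: "i < n \<Longrightarrow> j < n \<Longrightarrow> (\<lambda>p. fst p $$ (i, j)) \<in> borel_measurable (borel_mat n \<Otimes>\<^sub>M borel_mat n)"
  by (rule measurable_compose[OF measurable_fst borel_mat_entry])

lemma snd_entry: "i < n \<Longrightarrow> j < n \<Longrightarrow> (\<lambda>p. snd p $$ (i, j)) \<in> borel_measurable (borel_mat n \<Otimes>\<^sub>M borel_mat n)"
  by (rule measurable_compose[OF measurable_snd borel_mat_entry])

lemma BN_measurable: "(\<lambda>\<omega>. (B n \<omega>, N n \<omega>)) \<in> measurable M (borel_mat n \<Otimes>\<^sub>M borel_mat n)"
  using Bm Nm by simp

lemma scaled_entry: "i < n \<Longrightarrow> j < n \<Longrightarrow> (\<tau> \<cdot>\<^sub>m sym_mat n g) $$ (i, j) = \<tau> * wk g i j"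
  by (simp add: sym_mat_def wk_def)

lemma tendsto_zero:
  fixes f :: "nat \<Rightarrow> real mat \<times> real mat \<Rightarrow> real"
  assumes m: "\<And>n. f n \<in> borel_measurable (borel_mat n \<Otimes>\<^sub>M borel_mat n)" and nn: "\<And>n p. 0 \<le> f n p"
    and b: "\<And>n b. n \<ge> 1 \<Longrightarrow> b \<in> carrier_mat n n \<Longrightarrow> symk n (mk_fun b) \<Longrightarrow>
       (\<integral>\<^sup>+g. ennreal (f n (b, \<tau> \<cdot>\<^sub>m sym_mat n g)) \<partial>Pi\<^sub>M (edges n) (D n)) \<le> ennreal (C / (real n)\<^sup>2)"
  shows "AE \<omega> in M. (\<lambda>n. f n (B n \<omega>, N n \<omega>)) \<longlonglongrightarrow> 0"
proof (rule AE_tendsto_zero_of_summable)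
  show "(\<lambda>\<omega>. f n (B n \<omega>, N n \<omega>)) \<in> borel_measurable M" for n
    using measurable_compose[OF BN_measurable m] .
  show "0 \<le> f n (B n \<omega>, N n \<omega>)" for n \<omega> by (rule nn)
  show "(\<integral>\<^sup>+\<omega>. ennreal (f n (B n \<omega>, N n \<omega>)) \<partial>M) \<le> ennreal (C / (real n)\<^sup>2)" if "n \<ge> 1" for n
    by (rule dec[where \<phi>="\<lambda>p. ennreal (f n p)"]) (use m b[OF that] in auto)
qed

lemma square_tendsto_zeroD: "(\<lambda>n. (x n :: real)\<^sup>2) \<longlonglongrightarrow> 0 \<Longrightarrow> x \<longlonglongrightarrow> 0"
  using tendsto_real_sqrt[of "\<lambda>n. (x n)\<^sup>2" 0 sequentially] by (simp add: tendsto_rabs_zero_iff)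

lemma diag_noise: "AE \<omega> in M. (\<lambda>n. (\<Sum>i<n. (N n \<omega> $$ (i, i))\<^sup>2) / (real n)\<^sup>2) \<longlonglongrightarrow> 0"
proof -
  define f where "f n p = ((\<Sum>i<n. (snd p $$ (i, i))\<^sup>2) / (real n)\<^sup>2)\<^sup>2" for n and p :: "real mat \<times> real mat"
  have "AE \<omega> in M. (\<lambda>n. f n (B n \<omega>, N n \<omega>)) \<longlonglongrightarrow> 0"
  proof (rule tendsto_zero[where C="\<tau> ^ 4 * K"])
    show "f n \<in> borel_measurable (borel_mat n \<Otimes>\<^sub>M borel_mat n)" for n
      unfolding f_def by (intro borel_measurable_power borel_measurable_divide borel_measurable_sum borel_measurable_const snd_entry) auto
    show "0 \<le> f n p" for n p by (simp add: f_def)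
    fix n :: nat and b :: "real mat" assume n: "n \<ge> 1"
    interpret wigner "D n" n K by (rule wig[OF n])
    have t0: "0 \<le> \<tau> ^ 4 / (real n)^4" by simp
    have feq: "f n (b, \<tau> \<cdot>\<^sub>m sym_mat n g) = \<tau> ^ 4 / (real n)^4 * (\<Sum>i<n. (g (i, i))\<^sup>2)\<^sup>2" for g
    proof -
      have "(\<Sum>i<n. ((\<tau> \<cdot>\<^sub>m sym_mat n g) $$ (i, i))\<^sup>2) = \<tau>\<^sup>2 * (\<Sum>i<n. (g (i, i))\<^sup>2)"
        unfolding sum_distrib_left by (intro sum.cong refl) (simp add: scaled_entry wk_def power_mult_distrib)
      then show ?thesis by (simp add: f_def power_divide power_mult_distrib flip: power_mult)
    qed
    have "(\<integral>\<^sup>+g. ennreal (f n (b, \<tau> \<cdot>\<^sub>m sym_mat n g)) \<partial>\<P>) = (\<integral>\<^sup>+g. ennreal (\<tau> ^ 4 / (real n)^4) * ennreal ((\<Sum>i<n. (g (i, i))\<^sup>2)\<^sup>2) \<partial>\<P>)"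
      unfolding feq ennreal_mult'[OF t0] ..
    also have "\<dots> = ennreal (\<tau> ^ 4 / (real n)^4) * (\<integral>\<^sup>+g. ennreal ((\<Sum>i<n. (g (i, i))\<^sup>2)\<^sup>2) \<partial>\<P>)"
    proof (rule nn_integral_cmult)
      have "(\<lambda>g. g (i, i)) \<in> borel_measurable \<P>" if "i < n" for i
        by (rule coord_measurable) (use that in \<open>auto simp: edges_def\<close>)
      then show "(\<lambda>g. ennreal ((\<Sum>i<n. (g (i, i))\<^sup>2)\<^sup>2)) \<in> borel_measurable \<P>" by (auto intro!: measurable_compose[OF _ measurable_ennreal])
    qed
    also have "\<dots> \<le> ennreal (\<tau> ^ 4 / (real n)^4) * ennreal ((real n)\<^sup>2 * K)" by (intro mult_left_mono diag_squares) simp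
    also have "\<dots> = ennreal (\<tau> ^ 4 * K / (real n)\<^sup>2)"
    proof -
      have "(0, 0) \<in> edges n" using n by (auto simp: edges_def)
      then have "0 \<le> K" by (rule K_nonneg)
      then have "ennreal (\<tau> ^ 4 / (real n)^4) * ennreal ((real n)\<^sup>2 * K) = ennreal (\<tau> ^ 4 / (real n)^4 * ((real n)\<^sup>2 * K))"
        by (intro ennreal_mult[symmetric]) auto
      also have "\<tau> ^ 4 / (real n)^4 * ((real n)\<^sup>2 * K) = \<tau> ^ 4 * K / (real n)\<^sup>2"
        using n by (simp add: power4_eq_xxxx power2_eq_square)
      finally show ?thesis .
    qed
    finally show "(\<integral>\<^sup>+g. ennreal (f n (b, \<tau> \<cdot>\<^sub>m sym_mat n g)) \<partial>\<P>) \<le> ennreal (\<tau> ^ 4 * K / (real n)\<^sup>2)" .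
  qed
  then show ?thesis
  proof (rule AE_mp, intro AE_I2 impI)
    fix \<omega> assume "(\<lambda>n. f n (B n \<omega>, N n \<omega>)) \<longlonglongrightarrow> 0"
    then show "(\<lambda>n. (\<Sum>i<n. (N n \<omega> $$ (i, i))\<^sup>2) / (real n)\<^sup>2) \<longlonglongrightarrow> 0"
      unfolding f_def snd_conv by (rule square_tendsto_zeroD)
  qed
qed

lemma offdiag_noise:
  "AE \<omega> in M. (\<lambda>n. (\<Sum>e\<in>{e \<in> edges n. fst e \<noteq> snd e}. (N n \<omega> $$ e)\<^sup>2 - \<tau>\<^sup>2) / (real n)\<^sup>2) \<longlonglongrightarrow> 0"
proof -
  let ?O = "\<lambda>n. {e \<in> edges n. fst e \<noteq> snd e}"
  have O: "fst e < n" "snd e < n" "wk g (fst e) (snd e) = g e" if "e \<in> ?O n" for e n g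
    using that by (auto simp: edges_def wk_def min_def max_def)
  define f where "f n p = ((\<Sum>e\<in>?O n. (snd p $$ e)\<^sup>2 - \<tau>\<^sup>2) / (real n)\<^sup>2)\<^sup>2" for n and p :: "real mat \<times> real mat"
  have "AE \<omega> in M. (\<lambda>n. f n (B n \<omega>, N n \<omega>)) \<longlonglongrightarrow> 0"
  proof (rule tendsto_zero[where C="\<tau> ^ 4 * K"])
    show "f n \<in> borel_measurable (borel_mat n \<Otimes>\<^sub>M borel_mat n)" for n
    proof -
      have "(\<lambda>p. snd p $$ e) \<in> borel_measurable (borel_mat n \<Otimes>\<^sub>M borel_mat n)" if "e \<in> ?O n" for e
        using snd_entry[OF O(1,2)[OF that]] by simp
      then show ?thesis
        unfolding f_def by (intro borel_measurable_power borel_measurable_divide borel_measurable_sum borel_measurable_diff borel_measurable_const) auto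
    qed
    show "0 \<le> f n p" for n p by (simp add: f_def)
    fix n :: nat and b :: "real mat" assume n: "n \<ge> 1"
    interpret wigner "D n" n K by (rule wig[OF n])
    have t0: "0 \<le> \<tau> ^ 4 / (real n)^4" by simp
    have feq: "f n (b, \<tau> \<cdot>\<^sub>m sym_mat n g) = \<tau> ^ 4 / (real n)^4 * (\<Sum>e\<in>?O n. (g e)\<^sup>2 - 1)\<^sup>2" for g
    proof -
      have "(\<Sum>e\<in>?O n. ((\<tau> \<cdot>\<^sub>m sym_mat n g) $$ e)\<^sup>2 - \<tau>\<^sup>2) = \<tau>\<^sup>2 * (\<Sum>e\<in>?O n. (g e)\<^sup>2 - 1)"
        unfolding sum_distrib_left
      proof (intro sum.cong refl)
        fix e assume e: "e \<in> ?O n"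
        have "(\<tau> \<cdot>\<^sub>m sym_mat n g) $$ e = \<tau> * g e"
          using scaled_entry[OF O(1,2)[OF e], of g] O(3)[OF e, of g] by simp
        then show "((\<tau> \<cdot>\<^sub>m sym_mat n g) $$ e)\<^sup>2 - \<tau>\<^sup>2 = \<tau>\<^sup>2 * ((g e)\<^sup>2 - 1)" by (simp add: power_mult_distrib algebra_simps)
      qed
      then show ?thesis by (simp add: f_def power_divide power_mult_distrib flip: power_mult)
    qed
    have "(\<integral>\<^sup>+g. ennreal (f n (b, \<tau> \<cdot>\<^sub>m sym_mat n g)) \<partial>\<P>) = (\<integral>\<^sup>+g. ennreal (\<tau> ^ 4 / (real n)^4) * ennreal ((\<Sum>e\<in>?O n. (g e)\<^sup>2 - 1)\<^sup>2) \<partial>\<P>)"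
      unfolding feq ennreal_mult'[OF t0] ..
    also have "\<dots> = ennreal (\<tau> ^ 4 / (real n)^4) * (\<integral>\<^sup>+g. ennreal ((\<Sum>e\<in>?O n. (g e)\<^sup>2 - 1)\<^sup>2) \<partial>\<P>)"
    proof (rule nn_integral_cmult)
      have "(\<lambda>g. g e) \<in> borel_measurable \<P>" if "e \<in> ?O n" for e
        by (rule coord_measurable) (use that in auto)
      then show "(\<lambda>g. ennreal ((\<Sum>e\<in>?O n. (g e)\<^sup>2 - 1)\<^sup>2)) \<in> borel_measurable \<P>"
        by (intro measurable_compose[OF _ measurable_ennreal] borel_measurable_power borel_measurable_sum borel_measurable_diff borel_measurable_const)
    qed
    also have "\<dots> \<le> ennreal (\<tau> ^ 4 / (real n)^4) * ennreal ((real n)\<^sup>2 * K)" by (intro mult_left_mono offdiag_squares) simp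
    also have "\<dots> = ennreal (\<tau> ^ 4 * K / (real n)\<^sup>2)"
    proof -
      have "(0, 0) \<in> edges n" using n by (auto simp: edges_def)
      then have "0 \<le> K" by (rule K_nonneg)
      then have "ennreal (\<tau> ^ 4 / (real n)^4) * ennreal ((real n)\<^sup>2 * K) = ennreal (\<tau> ^ 4 / (real n)^4 * ((real n)\<^sup>2 * K))"
        by (intro ennreal_mult[symmetric]) auto
      also have "\<tau> ^ 4 / (real n)^4 * ((real n)\<^sup>2 * K) = \<tau> ^ 4 * K / (real n)\<^sup>2"
        using n by (simp add: power4_eq_xxxx power2_eq_square)
      finally show ?thesis .
    qed
    finally show "(\<integral>\<^sup>+g. ennreal (f n (b, \<tau> \<cdot>\<^sub>m sym_mat n g)) \<partial>\<P>) \<le> ennreal (\<tau> ^ 4 * K / (real n)\<^sup>2)" .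
  qed
  then show ?thesis
  proof (rule AE_mp, intro AE_I2 impI)
    fix \<omega> assume "(\<lambda>n. f n (B n \<omega>, N n \<omega>)) \<longlonglongrightarrow> 0"
    then show "(\<lambda>n. (\<Sum>e\<in>?O n. (N n \<omega> $$ e)\<^sup>2 - \<tau>\<^sup>2) / (real n)\<^sup>2) \<longlonglongrightarrow> 0"
      unfolding f_def snd_conv by (rule square_tendsto_zeroD)
  qed
qed

lemma noise_sym: "AE \<omega> in M. \<forall>n. symk n (mk_fun (N n \<omega>))"
proof -
  have "AE \<omega> in M. \<forall>n i j. i < n \<longrightarrow> j < n \<longrightarrow> N n \<omega> $$ (i, j) = N n \<omega> $$ (j, i)"
    unfolding AE_all_countable
  proof (intro allI)
    fix n i j
    show "AE \<omega> in M. i < n \<longrightarrow> j < n \<longrightarrow> N n \<omega> $$ (i, j) = N n \<omega> $$ (j, i)"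
    proof (cases "i < n \<and> j < n")
      case True
      then have ij: "i < n" "j < n" by auto
      define \<phi> where "\<phi> p = ennreal \<bar>snd p $$ (i, j) - snd p $$ (j, i)\<bar>" for p :: "real mat \<times> real mat"
      have m: "\<phi> \<in> borel_measurable (borel_mat n \<Otimes>\<^sub>M borel_mat n)"
        unfolding \<phi>_def by (intro measurable_compose[OF _ measurable_ennreal] borel_measurable_abs borel_measurable_diff snd_entry ij)
      have "(\<integral>\<^sup>+\<omega>. \<phi> (B n \<omega>, N n \<omega>) \<partial>M) \<le> 0"
      proof (rule dec[OF m])
        fix b
        have "\<phi> (b, \<tau> \<cdot>\<^sub>m sym_mat n g) = 0" for g
          unfolding \<phi>_def snd_conv scaled_entry[OF ij] scaled_entry[OF ij(2,1)] wk_def min.commute[of j i] max.commute[of j i] by simp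
        then show "(\<integral>\<^sup>+g. \<phi> (b, \<tau> \<cdot>\<^sub>m sym_mat n g) \<partial>Pi\<^sub>M (edges n) (D n)) \<le> 0" by simp
      qed
      then have "AE \<omega> in M. \<phi> (B n \<omega>, N n \<omega>) = 0"
        using nn_integral_0_iff_AE[OF measurable_compose[OF BN_measurable m]] by simp
      then show ?thesis by (rule AE_mp) (intro AE_I2, simp add: \<phi>_def ennreal_eq_0_iff)
    qed auto
  qed
  then show ?thesis by (rule AE_mp) (intro AE_I2, simp add: symk_def)
qed

lemma noise_energy: "AE \<omega> in M. (\<lambda>n. (\<Sum>i<n. \<Sum>j<n. (N n \<omega> $$ (i, j))\<^sup>2) / (real n)\<^sup>2) \<longlonglongrightarrow> \<tau>\<^sup>2"
  using diag_noise offdiag_noise noise_sym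
proof eventually_elim
  case (elim \<omega>)
  let ?O = "\<lambda>n. {e \<in> edges n. fst e \<noteq> snd e}"
  define S where "S n = (\<Sum>e\<in>?O n. (N n \<omega> $$ e)\<^sup>2 - \<tau>\<^sup>2)" for n
  define T where "T n = (\<Sum>i<n. (N n \<omega> $$ (i, i))\<^sup>2)" for n
  have eq: "(\<Sum>i<n. \<Sum>j<n. (N n \<omega> $$ (i, j))\<^sup>2) = 2 * S n + \<tau>\<^sup>2 * ((real n)\<^sup>2 - real n) + T n" for n
  proof -
    have s1: "symk n (\<lambda>i j. (N n \<omega> $$ (i, j))\<^sup>2)" using elim(3) by (simp add: symk_def)
    have s2: "symk n (\<lambda>i j. 1 :: real)" by (simp add: symk_def)
    have c: "2 * real (card (?O n)) = (real n)\<^sup>2 - real n"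
      using sum_symmetric_real[OF s2] by (simp add: power2_eq_square)
    have "(\<Sum>i<n. \<Sum>j<n. (N n \<omega> $$ (i, j))\<^sup>2) = 2 * (\<Sum>e\<in>?O n. (N n \<omega> $$ e)\<^sup>2) + T n"
      unfolding sum_symmetric_real[OF s1] T_def by simp
    also have "(\<Sum>e\<in>?O n. (N n \<omega> $$ e)\<^sup>2) = S n + real (card (?O n)) * \<tau>\<^sup>2" by (simp add: S_def sum_subtractf)
    finally have "(\<Sum>i<n. \<Sum>j<n. (N n \<omega> $$ (i, j))\<^sup>2) = 2 * S n + \<tau>\<^sup>2 * (2 * real (card (?O n))) + T n" by (simp add: algebra_simps)
    then show ?thesis unfolding c .
  qed
  have "(\<lambda>n. 2 * (S n / (real n)\<^sup>2) + \<tau>\<^sup>2 * (1 - 1 / real n) + T n / (real n)\<^sup>2) \<longlonglongrightarrow> 2 * 0 + \<tau>\<^sup>2 * (1 - 0) + 0"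
    using elim(1,2) unfolding S_def T_def by (intro tendsto_intros lim_1_over_n) auto
  then have "(\<lambda>n. 2 * (S n / (real n)\<^sup>2) + \<tau>\<^sup>2 * (1 - 1 / real n) + T n / (real n)\<^sup>2) \<longlonglongrightarrow> \<tau>\<^sup>2" by simp
  moreover have "\<forall>\<^sub>F n in sequentially. 2 * (S n / (real n)\<^sup>2) + \<tau>\<^sup>2 * (1 - 1 / real n) + T n / (real n)\<^sup>2 = (\<Sum>i<n. \<Sum>j<n. (N n \<omega> $$ (i, j))\<^sup>2) / (real n)\<^sup>2"
    using eventually_gt_at_top[of 0]
  proof eventually_elim
    case (elim n)
    then have "((real n)\<^sup>2 - real n) / (real n)\<^sup>2 = 1 - 1 / real n" by (simp add: diff_divide_distrib power2_eq_square)
    then have "2 * (S n / (real n)\<^sup>2) + \<tau>\<^sup>2 * (1 - 1 / real n) + T n / (real n)\<^sup>2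
        = 2 * (S n / (real n)\<^sup>2) + \<tau>\<^sup>2 * (((real n)\<^sup>2 - real n) / (real n)\<^sup>2) + T n / (real n)\<^sup>2" by simp
    also have "\<dots> = (2 * S n + \<tau>\<^sup>2 * ((real n)\<^sup>2 - real n) + T n) / (real n)\<^sup>2"
      by (simp only: add_divide_distrib times_divide_eq_right)
    finally show ?case unfolding eq .
  qed
  ultimately show ?case by (rule Lim_transform_eventually)
qed

text \<open>The linear form in the noise has variance proportional to the energy of \<open>B\<close>, which is
  random; hence the normalisation.\<close>

lemma cross_term:
  "AE \<omega> in M. (\<lambda>n. ((\<Sum>i<n. \<Sum>j<n. B n \<omega> $$ (i, j) * N n \<omega> $$ (i, j)) / (real n * sqrt (real n)))\<^sup>2
      / (1 + (\<Sum>i<n. \<Sum>j<n. (B n \<omega> $$ (i, j))\<^sup>2) / real n)) \<longlonglongrightarrow> 0"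
proof -
  define f where "f n p = ((\<Sum>i<n. \<Sum>j<n. fst p $$ (i, j) * snd p $$ (i, j)) / (real n * sqrt (real n)))\<^sup>2
      / (1 + (\<Sum>i<n. \<Sum>j<n. (fst p $$ (i, j))\<^sup>2) / real n)" for n and p :: "real mat \<times> real mat"
  have den: "0 < 1 + (\<Sum>i<n. \<Sum>j<n. (b $$ (i, j))\<^sup>2) / real n" for n and b :: "real mat"
  proof -
    have "0 \<le> (\<Sum>i<n. \<Sum>j<n. (b $$ (i, j))\<^sup>2) / real n" by (simp add: sum_nonneg)
    then show ?thesis by linarith
  qed
  have "AE \<omega> in M. (\<lambda>n. f n (B n \<omega>, N n \<omega>)) \<longlonglongrightarrow> 0"
  proof (rule tendsto_zero[where C="4 * \<tau>\<^sup>2 * (1 + K)"])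
    show "f n \<in> borel_measurable (borel_mat n \<Otimes>\<^sub>M borel_mat n)" for n
      unfolding f_def
      by (intro borel_measurable_power borel_measurable_divide borel_measurable_sum borel_measurable_const borel_measurable_add
          borel_measurable_times snd_entry fst_entry) auto
    show "0 \<le> f n p" for n p unfolding f_def using den[of "fst p" n] by simp
    fix n :: nat and b :: "real mat" assume n: "n \<ge> 1" and b: "symk n (mk_fun b)"
    interpret wigner "D n" n K by (rule wig[OF n])
    define \<beta> where "\<beta> = (\<Sum>i<n. \<Sum>j<n. (b $$ (i, j))\<^sup>2)"
    define a where "a = \<tau>\<^sup>2 / (real n)^3 / (1 + \<beta> / real n)"
    have \<beta>: "0 \<le> \<beta>" by (simp add: \<beta>_def sum_nonneg)
    have np: "real n > 0" using n by simp
    have a0: "0 \<le> a" using \<beta> by (simp add: a_def)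
    have K: "0 \<le> K" by (rule K_nonneg[of "(0, 0)"]) (use n in \<open>auto simp: edges_def\<close>)
    have "f n (b, \<tau> \<cdot>\<^sub>m sym_mat n g) = a * (\<Sum>i<n. \<Sum>j<n. b $$ (i, j) * wk g i j)\<^sup>2" for g
    proof -
      have "(\<Sum>i<n. \<Sum>j<n. b $$ (i, j) * (\<tau> \<cdot>\<^sub>m sym_mat n g) $$ (i, j)) = \<tau> * (\<Sum>i<n. \<Sum>j<n. b $$ (i, j) * wk g i j)"
        unfolding sum_distrib_left by (intro sum.cong refl) (simp add: scaled_entry)
      moreover have "(real n * sqrt (real n))\<^sup>2 = (real n)^3" by (simp add: power_mult_distrib power3_eq_cube power2_eq_square)
      ultimately show ?thesis by (simp add: f_def a_def \<beta>_def power_divide power_mult_distrib)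
    qed
    then have "(\<integral>\<^sup>+g. ennreal (f n (b, \<tau> \<cdot>\<^sub>m sym_mat n g)) \<partial>\<P>) = (\<integral>\<^sup>+g. ennreal a * ennreal ((\<Sum>i<n. \<Sum>j<n. b $$ (i, j) * wk g i j)\<^sup>2) \<partial>\<P>)"
      using a0 by (simp add: ennreal_mult)
    also have "\<dots> = ennreal a * (\<integral>\<^sup>+g. ennreal ((\<Sum>i<n. \<Sum>j<n. b $$ (i, j) * wk g i j)\<^sup>2) \<partial>\<P>)"
    proof (rule nn_integral_cmult)
      have "(\<lambda>g. wk g i j) \<in> borel_measurable \<P>" if "i < n" "j < n" for i j
        unfolding wk_def by (rule coord_measurable) (use that in \<open>auto simp: edges_def\<close>)
      then show "(\<lambda>g. ennreal ((\<Sum>i<n. \<Sum>j<n. b $$ (i, j) * wk g i j)\<^sup>2)) \<in> borel_measurable \<P>"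
        by (intro measurable_compose[OF _ measurable_ennreal] borel_measurable_power borel_measurable_sum borel_measurable_times borel_measurable_const) auto
    qed
    also have "\<dots> \<le> ennreal a * ennreal (4 * (1 + K) * \<beta>)" unfolding \<beta>_def by (intro mult_left_mono linear_form_mean_square b) simp
    also have "\<dots> = ennreal (a * (4 * (1 + K) * \<beta>))" using a0 K \<beta> by (intro ennreal_mult[symmetric]) auto
    also have "\<dots> \<le> ennreal (4 * \<tau>\<^sup>2 * (1 + K) / (real n)\<^sup>2)"
    proof (rule ennreal_leI)
      have "\<beta> / (1 + \<beta> / real n) \<le> real n" using \<beta> np by (simp add: pos_divide_le_eq add_pos_nonneg distrib_left)
      then have "4 * \<tau>\<^sup>2 * (1 + K) / (real n)^3 * (\<beta> / (1 + \<beta> / real n)) \<le> 4 * \<tau>\<^sup>2 * (1 + K) / (real n)^3 * real n"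
        using K by (intro mult_left_mono) auto
      also have "\<dots> = 4 * \<tau>\<^sup>2 * (1 + K) / (real n)\<^sup>2" using np by (simp add: power3_eq_cube power2_eq_square)
      finally have le: "4 * \<tau>\<^sup>2 * (1 + K) / (real n)^3 * (\<beta> / (1 + \<beta> / real n)) \<le> 4 * \<tau>\<^sup>2 * (1 + K) / (real n)\<^sup>2" .
      have "a * (4 * k * \<beta>) = 4 * \<tau>\<^sup>2 * k / (real n)^3 * (\<beta> / (1 + \<beta> / real n))" for k by (simp add: a_def mult_ac)
      then show "a * (4 * (1 + K) * \<beta>) \<le> 4 * \<tau>\<^sup>2 * (1 + K) / (real n)\<^sup>2" using le by (simp only:)
    qed
    finally show "(\<integral>\<^sup>+g. ennreal (f n (b, \<tau> \<cdot>\<^sub>m sym_mat n g)) \<partial>\<P>) \<le> ennreal (4 * \<tau>\<^sup>2 * (1 + K) / (real n)\<^sup>2)" .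
  qed
  then show ?thesis by (simp add: f_def)
qed

abbreviation X :: "nat \<Rightarrow> 'w \<Rightarrow> nat \<Rightarrow> nat \<Rightarrow> real" where
  "X n \<omega> \<equiv> (\<lambda>i j. B n \<omega> $$ (i, j) + N n \<omega> $$ (i, j) / sqrt (real n))"

lemma defect_tendsto_pointwise:
  assumes z: "Im z > 0"
  shows "AE \<omega> in M. (\<lambda>n. defect n (mk_fun (B n \<omega>)) (X n \<omega>) \<tau> z) \<longlonglongrightarrow> 0"
proof -
  define c where "c = deformed_wigner.BC K \<tau> z"
  define C where "C = (1 + \<tau>\<^sup>2 / (Im z)\<^sup>2)\<^sup>2 * deformed_wigner.VC K \<tau> z"
  define d where "d n p = defect n (mk_fun (fst p)) (\<lambda>i j. fst p $$ (i, j) + snd p $$ (i, j) / sqrt (real n)) \<tau> z" for n p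
  define f where "f n p = (max 0 (d n p - c / sqrt (real n)))\<^sup>2" for n p
  have "AE \<omega> in M. (\<lambda>n. f n (B n \<omega>, N n \<omega>)) \<longlonglongrightarrow> 0"
  proof (rule tendsto_zero[where C=C])
    show "f n \<in> borel_measurable (borel_mat n \<Otimes>\<^sub>M borel_mat n)" for n
    proof -
      let ?P = "borel_mat n \<Otimes>\<^sub>M borel_mat n"
      have nt: "(\<lambda>p. ntrace n (F p)) \<in> borel_measurable ?P"
        if "\<And>i j. i < n \<Longrightarrow> j < n \<Longrightarrow> (\<lambda>p. F p i j) \<in> borel_measurable ?P" for F
        unfolding ntrace_def using that by (intro borel_measurable_divide borel_measurable_sum borel_measurable_const) auto
      have s: "(\<lambda>p. ST n (\<lambda>i j. fst p $$ (i, j) + snd p $$ (i, j) / sqrt (real n)) z) \<in> borel_measurable ?P"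
        unfolding ST_def
        by (intro nt resolvent_measurable borel_measurable_add borel_measurable_divide borel_measurable_const fst_entry snd_entry)
      have "(\<lambda>p. ST n (mk_fun (fst p)) (z + of_real (\<tau>\<^sup>2) * ST n (\<lambda>i j. fst p $$ (i, j) + snd p $$ (i, j) / sqrt (real n)) z)) \<in> borel_measurable ?P"
        unfolding ST_def[of n "mk_fun _"] using s
        by (intro nt resolvent_measurable fst_entry borel_measurable_add borel_measurable_times borel_measurable_const)
      with s have "d n \<in> borel_measurable ?P" unfolding d_def defect_def by simp
      then show ?thesis unfolding f_def by simp
    qed
    show "0 \<le> f n p" for n p by (simp add: f_def)
    fix n :: nat and b :: "real mat" assume n: "n \<ge> 1" and b: "symk n (mk_fun b)"
    interpret wigner "D n" n K by (rule wig[OF n])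
    interpret dw: deformed_wigner "D n" n K "mk_fun b" \<tau> z
      by unfold_locales (use b z n tau in auto)
    have "d n (b, \<tau> \<cdot>\<^sub>m sym_mat n g) = dw.pastur_defect g" for g
    proof -
      have "d n (b, \<tau> \<cdot>\<^sub>m sym_mat n g) = defect n (mk_fun b) (pert (mk_fun b) dw.c g) \<tau> z"
        unfolding d_def fst_conv snd_conv
        by (rule defect_cong) (simp add: pert_def dw.c_def sym_mat_def wk_def)
      then show ?thesis by (simp add: dw.pastur_defect_def defect_def ST_def dw.s_def dw.G_def)
    qed
    then show "(\<integral>\<^sup>+g. ennreal (f n (b, \<tau> \<cdot>\<^sub>m sym_mat n g)) \<partial>\<P>) \<le> ennreal (C / (real n)\<^sup>2)"
      using dw.pastur_defect_mean_square by (simp add: f_def c_def C_def)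
  qed
  then show ?thesis
  proof (rule AE_mp, intro AE_I2 impI)
    fix \<omega> assume "(\<lambda>n. f n (B n \<omega>, N n \<omega>)) \<longlonglongrightarrow> 0"
    then have "(\<lambda>n. max 0 (d n (B n \<omega>, N n \<omega>) - c / sqrt (real n))) \<longlonglongrightarrow> 0"
      unfolding f_def by (rule square_tendsto_zeroD)
    moreover have "(\<lambda>n. \<bar>c\<bar> / sqrt (real n)) \<longlonglongrightarrow> 0"
      by (intro real_tendsto_divide_at_top[OF tendsto_const] filterlim_compose[OF sqrt_at_top filterlim_real_sequentially])
    ultimately have lim: "(\<lambda>n. max 0 (d n (B n \<omega>, N n \<omega>) - c / sqrt (real n)) + \<bar>c\<bar> / sqrt (real n)) \<longlonglongrightarrow> 0"
      using tendsto_add by fastforce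
    have "d n (B n \<omega>, N n \<omega>) \<le> max 0 (d n (B n \<omega>, N n \<omega>) - c / sqrt (real n)) + \<bar>c\<bar> / sqrt (real n)" for n
    proof -
      have "c / sqrt (real n) \<le> \<bar>c\<bar> / sqrt (real n)" by (intro divide_right_mono) auto
      then show ?thesis by linarith
    qed
    then have "(\<lambda>n. d n (B n \<omega>, N n \<omega>)) \<longlonglongrightarrow> 0"
      by (intro tendsto_sandwich[OF _ _ tendsto_const lim]) (auto simp: d_def defect_def)
    then show "(\<lambda>n. defect n (mk_fun (B n \<omega>)) (X n \<omega>) \<tau> z) \<longlonglongrightarrow> 0" by (simp add: d_def)
  qed
qed

text \<open>Both traces are Lipschitz continuous in \<open>z\<close> away from the real axis, so rational points
  suffice, and exceptional null sets can be united.\<close>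

lemma defect_tendsto:
  "AE \<omega> in M. \<forall>z. Im z > 0 \<longrightarrow> (\<lambda>n. defect n (mk_fun (B n \<omega>)) (X n \<omega>) \<tau> z) \<longlonglongrightarrow> 0"
proof -
  let ?z = "\<lambda>(p, q). Complex (of_rat p) (of_rat q)"
  have "AE \<omega> in M. \<forall>r. Im (?z r) > 0 \<longrightarrow> (\<lambda>n. defect n (mk_fun (B n \<omega>)) (X n \<omega>) \<tau> (?z r)) \<longlonglongrightarrow> 0"
    unfolding AE_all_countable
  proof
    fix r :: "rat \<times> rat"
    show "AE \<omega> in M. Im (?z r) > 0 \<longrightarrow> (\<lambda>n. defect n (mk_fun (B n \<omega>)) (X n \<omega>) \<tau> (?z r)) \<longlonglongrightarrow> 0"
      using defect_tendsto_pointwise[of "?z r"] by (cases "Im (?z r) > 0") auto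
  qed
  then show ?thesis using noise_sym AE_space
  proof eventually_elim
    case (elim \<omega>)
    show ?case
    proof (intro allI impI)
      fix z assume z: "Im z > 0"
      define v where "v = Im z / 2"
      have v: "v > 0" using z by (simp add: v_def)
      define L where "L = 1 / v\<^sup>2 + (1 + \<tau>\<^sup>2 / v\<^sup>2) / v\<^sup>2"
      have L: "L > 0" using v by (simp add: L_def add_pos_nonneg)
      have Xs: "symk n (X n \<omega>)" and Bs: "symk n (mk_fun (B n \<omega>))" for n
        using elim(2) Bsym[OF elim(3)] by (auto simp: symk_def)
      show "(\<lambda>n. defect n (mk_fun (B n \<omega>)) (X n \<omega>) \<tau> z) \<longlonglongrightarrow> 0"
      proof (rule LIMSEQ_I)
        fix \<epsilon> :: real assume e: "\<epsilon> > 0"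
        define \<delta> where "\<delta> = min v (\<epsilon> / (2 * L)) / 2"
        have \<delta>: "\<delta> > 0" using v e L by (simp add: \<delta>_def)
        obtain p q :: rat where p: "\<bar>Re z - of_rat p\<bar> < \<delta>" and q: "\<bar>Im z - of_rat q\<bar> < \<delta>"
        proof -
          obtain p where "Re z - \<delta> < of_rat p" "of_rat p < Re z + \<delta>" using of_rat_dense[of "Re z - \<delta>" "Re z + \<delta>"] \<delta> by auto
          moreover obtain q where "Im z - \<delta> < of_rat q" "of_rat q < Im z + \<delta>" using of_rat_dense[of "Im z - \<delta>" "Im z + \<delta>"] \<delta> by auto
          ultimately show ?thesis by (intro that[of p q]) auto
        qed
        let ?r = "Complex (of_rat p) (of_rat q)"
        have "cmod (z - ?r) \<le> \<bar>Re (z - ?r)\<bar> + \<bar>Im (z - ?r)\<bar>" by (rule cmod_le)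
        also have "\<dots> < \<delta> + \<delta>" using p q by (intro add_strict_mono) auto
        finally have dz: "cmod (z - ?r) < min v (\<epsilon> / (2 * L))" by (simp add: \<delta>_def)
        have "\<bar>Im z - Im ?r\<bar> \<le> cmod (z - ?r)" using abs_Im_le_cmod[of "z - ?r"] by simp
        then have Imr: "Im ?r \<ge> v" "Im z \<ge> v" using dz z by (auto simp: v_def)
        then have Imr0: "Im ?r > 0" using v by linarith
        have le: "defect n (mk_fun (B n \<omega>)) (X n \<omega>) \<tau> z \<le> defect n (mk_fun (B n \<omega>)) (X n \<omega>) \<tau> ?r + L * cmod (z - ?r)" for n
        proof -
          have "defect n (mk_fun (B n \<omega>)) (X n \<omega>) \<tau> z \<le> defect n (mk_fun (B n \<omega>)) (X n \<omega>) \<tau> ?r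
             + cmod (z - ?r) / v\<^sup>2 + 0 + (cmod (z - ?r) + \<tau>\<^sup>2 * (cmod (z - ?r) / v\<^sup>2)) / v\<^sup>2"
            by (rule defect_le[OF Bs Xs Xs Imr(2,1) v ST_lipschitz[OF Xs Imr(2,1) v]]) simp
          then show ?thesis by (simp add: L_def add_divide_distrib algebra_simps)
        qed
        have "L * cmod (z - ?r) < L * (\<epsilon> / (2 * L))" using dz L by (intro mult_strict_left_mono) auto
        then have half: "L * cmod (z - ?r) < \<epsilon> / 2" using L by simp
        have "(\<lambda>n. defect n (mk_fun (B n \<omega>)) (X n \<omega>) \<tau> ?r) \<longlonglongrightarrow> 0" using elim(1)[rule_format, of "(p, q)"] Imr0 by simp
        from LIMSEQ_D[OF this, of "\<epsilon> / 2"] e obtain n0 where n0: "\<And>n. n \<ge> n0 \<Longrightarrow> \<bar>defect n (mk_fun (B n \<omega>)) (X n \<omega>) \<tau> ?r\<bar> < \<epsilon> / 2" by auto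
        have "norm (defect n (mk_fun (B n \<omega>)) (X n \<omega>) \<tau> z - 0) < \<epsilon>" if "n \<ge> n0" for n
        proof -
          have "0 \<le> defect n (mk_fun (B n \<omega>)) (X n \<omega>) \<tau> z" by (simp add: defect_def)
          then show ?thesis using le[of n] half n0[OF that] by simp
        qed
        then show "\<exists>no. \<forall>n\<ge>no. norm (defect n (mk_fun (B n \<omega>)) (X n \<omega>) \<tau> z - 0) < \<epsilon>" by blast
      qed
    qed
  qed
qed

end

section \<open>Stieltjes transforms and the fixed-point equation\<close>

text \<open>The Stieltjes transform, that is the negative of the Cauchy transform; its imaginary part is
  positive in the upper half plane.\<close>

definition SM :: "real measure \<Rightarrow> complex \<Rightarrow> complex" where
  "SM \<mu> z = (LINT x|\<mu>. 1 / (complex_of_real x - z))"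

definition emp :: "nat \<Rightarrow> (nat \<Rightarrow> real) \<Rightarrow> real measure" where
  "emp n x = distr (uniform_count_measure {..<n}) borel x"

lemma norm_inverse_shift:
  assumes "Im z > 0" shows "cmod (1 / (complex_of_real x - z)) \<le> 1 / Im z"
proof -
  have "\<bar>Im (complex_of_real x - z)\<bar> \<le> cmod (complex_of_real x - z)" by (rule abs_Im_le_cmod)
  then have "Im z \<le> cmod (complex_of_real x - z)" using assms by simp
  then show ?thesis using assms by (simp add: norm_divide frac_le)
qed

lemma shift_nonzero: "Im z > 0 \<Longrightarrow> complex_of_real x - z \<noteq> 0"
  by (auto simp: complex_eq_iff)

lemma Im_inverse_shift: "Im (1 / (complex_of_real x - z)) = Im z * (1 / (cmod (complex_of_real x - z))\<^sup>2)"
  by (simp add: Im_divide cmod_power2)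

context real_distribution
begin

lemma borel_measurable_M: "f \<in> borel_measurable borel \<Longrightarrow> f \<in> borel_measurable M"
  using measurable_cong_sets[OF events_eq_borel refl] by blast

lemma prob_UNIV: "prob UNIV = 1" using prob_space by simp

lemma SM_integrable:
  assumes "Im z > 0" shows "integrable M (\<lambda>x. 1 / (complex_of_real x - z))"
  by (rule integrable_const_bound[of _ "1 / Im z"]) (auto intro!: AE_I2 norm_inverse_shift[OF assms] borel_measurable_M)

lemma SM_bound: "Im z > 0 \<Longrightarrow> cmod (SM M z) \<le> 1 / Im z"
proof -
  assume z: "Im z > 0"
  have "cmod (SM M z) \<le> (LINT x|M. cmod (1 / (complex_of_real x - z)))"
    unfolding SM_def by (rule integral_norm_bound)
  also have "\<dots> \<le> (LINT x|M. 1 / Im z)"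
    by (intro integral_mono integrable_norm SM_integrable z norm_inverse_shift) simp
  finally show ?thesis by (simp add: prob_UNIV)
qed

lemma inverse_square_integrable:
  assumes z: "Im z > 0" shows "integrable M (\<lambda>x. 1 / (cmod (complex_of_real x - z))\<^sup>2)"
proof (rule integrable_const_bound[of _ "(1 / Im z)\<^sup>2"])
  have "norm (1 / (cmod (complex_of_real x - z))\<^sup>2) \<le> (1 / Im z)\<^sup>2" for x
  proof -
    have "(cmod (1 / (complex_of_real x - z)))\<^sup>2 \<le> (1 / Im z)\<^sup>2"
      using norm_inverse_shift[OF z] by (intro power_mono) auto
    then show ?thesis by (simp add: norm_divide power_divide)
  qed
  then show "AE x in M. norm (1 / (cmod (complex_of_real x - z))\<^sup>2) \<le> (1 / Im z)\<^sup>2" by simp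
qed (intro borel_measurable_M, simp)

lemma Im_SM:
  assumes z: "Im z > 0" shows "Im (SM M z) = Im z * (LINT x|M. 1 / (cmod (complex_of_real x - z))\<^sup>2)"
proof -
  have "Im (SM M z) = (LINT x|M. Im (1 / (complex_of_real x - z)))"
    unfolding SM_def using SM_integrable[OF z] by (rule integral_Im[symmetric])
  also have "\<dots> = (LINT x|M. Im z * (1 / (cmod (complex_of_real x - z))\<^sup>2))" unfolding Im_inverse_shift ..
  also have "\<dots> = Im z * (LINT x|M. 1 / (cmod (complex_of_real x - z))\<^sup>2)" by (rule integral_mult_right_zero)
  finally show ?thesis .
qed

lemma Im_SM_nonneg: assumes z: "Im z > 0" shows "Im (SM M z) \<ge> 0"
  unfolding Im_SM[OF z] using z by (intro mult_nonneg_nonneg integral_nonneg_AE) auto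

lemma SM_diff:
  assumes z: "Im z > 0" "Im w > 0"
  shows "SM M z - SM M w = (z - w) * (LINT x|M. 1 / ((complex_of_real x - z) * (complex_of_real x - w)))"
proof -
  have "SM M z - SM M w = (LINT x|M. 1 / (complex_of_real x - z) - 1 / (complex_of_real x - w))"
    unfolding SM_def using SM_integrable z by simp
  also have "\<dots> = (LINT x|M. (z - w) * (1 / ((complex_of_real x - z) * (complex_of_real x - w))))"
    using shift_nonzero[OF z(1)] shift_nonzero[OF z(2)] by (intro Bochner_Integration.integral_cong refl) (simp add: field_simps)
  also have "\<dots> = (z - w) * (LINT x|M. 1 / ((complex_of_real x - z) * (complex_of_real x - w)))" by (rule integral_mult_right_zero)
  finally show ?thesis .
qed

lemma SM_diff_kernel_bound:
  assumes z: "Im z > 0" "Im w > 0"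
  shows "cmod (LINT x|M. 1 / ((complex_of_real x - z) * (complex_of_real x - w))) \<le>
    ((LINT x|M. 1 / (cmod (complex_of_real x - z))\<^sup>2) + (LINT x|M. 1 / (cmod (complex_of_real x - w))\<^sup>2)) / 2"
proof -
  have b: "cmod (1 / ((complex_of_real x - z) * (complex_of_real x - w))) \<le>
      (1 / (cmod (complex_of_real x - z))\<^sup>2 + 1 / (cmod (complex_of_real x - w))\<^sup>2) / 2" for x
  proof -
    let ?a = "1 / cmod (complex_of_real x - z)" let ?b = "1 / cmod (complex_of_real x - w)"
    have "2 * ?a * ?b \<le> ?a\<^sup>2 + ?b\<^sup>2" by (rule sum_squares_bound)
    then show ?thesis by (simp add: norm_divide norm_mult power_divide)
  qed
  note i = inverse_square_integrable[OF z(1)] inverse_square_integrable[OF z(2)]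
  have i2: "integrable M (\<lambda>x. (1 / (cmod (complex_of_real x - z))\<^sup>2 + 1 / (cmod (complex_of_real x - w))\<^sup>2) / 2)"
    using i by simp
  have "cmod (LINT x|M. 1 / ((complex_of_real x - z) * (complex_of_real x - w))) \<le> (LINT x|M. cmod (1 / ((complex_of_real x - z) * (complex_of_real x - w))))"
    by (rule integral_norm_bound)
  also have "\<dots> \<le> (LINT x|M. (1 / (cmod (complex_of_real x - z))\<^sup>2 + 1 / (cmod (complex_of_real x - w))\<^sup>2) / 2)"
  proof (rule integral_mono[OF _ i2 b])
    show "integrable M (\<lambda>x. cmod (1 / ((complex_of_real x - z) * (complex_of_real x - w))))"
      by (rule Bochner_Integration.integrable_bound[OF i2]) (use b in \<open>auto intro!: borel_measurable_M AE_I2 order_trans[OF _ abs_ge_self]\<close>)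
  qed
  also have "\<dots> = ((LINT x|M. 1 / (cmod (complex_of_real x - z))\<^sup>2) + (LINT x|M. 1 / (cmod (complex_of_real x - w))\<^sup>2)) / 2"
    using i by simp
  finally show ?thesis .
qed

lemma inverse_square_le:
  assumes z: "Im z \<ge> v" "v > 0" shows "(LINT x|M. 1 / (cmod (complex_of_real x - z))\<^sup>2) \<le> 1 / v\<^sup>2"
proof -
  have zp: "Im z > 0" using z by simp
  have "(LINT x|M. 1 / (cmod (complex_of_real x - z))\<^sup>2) \<le> (LINT x|M. 1 / v\<^sup>2)"
  proof (rule integral_mono[OF inverse_square_integrable[OF zp]])
    fix x
    have "\<bar>Im (complex_of_real x - z)\<bar> \<le> cmod (complex_of_real x - z)" by (rule abs_Im_le_cmod)
    then have "v \<le> cmod (complex_of_real x - z)" using z by simp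
    then show "1 / (cmod (complex_of_real x - z))\<^sup>2 \<le> 1 / v\<^sup>2" using z by (intro frac_le power_mono) auto
  qed simp
  then show ?thesis by (simp add: prob_UNIV)
qed

lemma SM_lipschitz:
  assumes "Im z \<ge> v" "Im w \<ge> v" "v > 0"
  shows "cmod (SM M z - SM M w) \<le> cmod (z - w) / v\<^sup>2"
proof -
  have z: "Im z > 0" "Im w > 0" using assms by auto
  have "cmod (LINT x|M. 1 / ((complex_of_real x - z) * (complex_of_real x - w))) \<le> 1 / v\<^sup>2"
    using SM_diff_kernel_bound[OF z] inverse_square_le[OF assms(1,3)] inverse_square_le[OF assms(2,3)] by simp
  then have "cmod (z - w) * cmod (LINT x|M. 1 / ((complex_of_real x - z) * (complex_of_real x - w))) \<le> cmod (z - w) * (1 / v\<^sup>2)"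
    by (rule mult_left_mono) simp
  then show ?thesis by (simp add: SM_diff[OF z] norm_mult)
qed

text \<open>Two solutions differ by \<open>t\<close> times an integral times themselves. That integral is controlled by
  the imaginary part of the equation, which says that \<open>t \<integral> |x - w|\<^sup>-\<^sup>2 = 1 - Im z / Im w < 1\<close>.\<close>

lemma pastur_unique:
  assumes z: "Im z > 0" and t: "t \<ge> 0"
    and m: "Im m \<ge> 0" "m = SM M (z + of_real t * m)"
    and p: "Im p \<ge> 0" "p = SM M (z + of_real t * p)"
  shows "m = p"
proof (rule ccontr)
  assume ne: "m \<noteq> p"
  let ?I = "\<lambda>w. LINT x|M. 1 / (cmod (complex_of_real x - w))\<^sup>2"
  have one: "Im (z + of_real t * q) > 0 \<and> t * ?I (z + of_real t * q) < 1"
    if q: "Im q \<ge> 0" "q = SM M (z + of_real t * q)" for q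
  proof -
    let ?w = "z + of_real t * q"
    have w: "Im ?w = Im z + t * Im q" by simp
    have wp: "Im ?w > 0" unfolding w using z t q(1) by (simp add: add_pos_nonneg)
    have "Im q = Im ?w * ?I ?w" using Im_SM[OF wp] q(2) by simp
    then have "Im ?w * (t * ?I ?w) = t * Im q" by (simp only: mult.left_commute)
    also have "\<dots> < Im ?w * 1" unfolding w using z by simp
    finally show ?thesis using wp by (simp only: mult_less_cancel_left_pos)
  qed
  let ?w = "z + of_real t * m" let ?u = "z + of_real t * p"
  have w: "Im ?w > 0" "t * ?I ?w < 1" and u: "Im ?u > 0" "t * ?I ?u < 1" using one[OF m] one[OF p] by auto
  let ?J = "LINT x|M. 1 / ((complex_of_real x - ?w) * (complex_of_real x - ?u))"
  have "m - p = SM M ?w - SM M ?u" using m(2) p(2) by simp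
  also have "\<dots> = (?w - ?u) * ?J" by (rule SM_diff[OF w(1) u(1)])
  also have "\<dots> = (m - p) * (of_real t * ?J)" by (simp add: algebra_simps)
  finally have "(m - p) * (of_real t * ?J) = (m - p) * 1" by simp
  then have "of_real t * ?J = 1" using ne by (simp only: mult_cancel_left) simp
  then have "1 = t * cmod ?J" using t by (metis norm_mult norm_of_real norm_one abs_of_nonneg)
  also have "\<dots> \<le> t * ((?I ?w + ?I ?u) / 2)" by (intro mult_left_mono SM_diff_kernel_bound w u t)
  also have "\<dots> = (t * ?I ?w + t * ?I ?u) / 2" by (simp add: algebra_simps)
  also have "\<dots> < 1" using w(2) u(2) by simp
  finally show False by simp
qed

text \<open>The map \<open>m \<mapsto> m\<^sub>\<mu>(z + t m)\<close> sends a half disc of radius \<open>1 / Im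
  z\<close> into itself; Brouwer's fixed point theorem applies.\<close>

lemma pastur_exists:
  assumes z: "Im z > 0" and t: "t \<ge> 0"
  obtains m where "Im m \<ge> 0" "m = SM M (z + of_real t * m)"
proof -
  let ?S = "{m. Im m \<ge> 0} \<inter> cball 0 (1 / Im z)"
  let ?f = "\<lambda>m. SM M (z + of_real t * m)"
  have w: "Im (z + of_real t * m) \<ge> Im z" if "Im m \<ge> 0" for m using t that by simp
  obtain m where "m \<in> ?S" "?f m = m"
  proof (rule brouwer)
    show "compact ?S" by (intro closed_Int_compact closed_halfspace_Im_ge compact_cball)
    show "convex ?S" by (intro convex_Int convex_halfspace_Im_ge convex_cball)
    have "0 \<in> ?S" using z by simp
    then show "?S \<noteq> {}" by blast
    show "continuous_on ?S ?f"
    proof (rule lipschitz_on_continuous_on, rule lipschitz_onI)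
      fix p m assume p: "p \<in> ?S" and m: "m \<in> ?S"
      have "cmod (?f p - ?f m) \<le> cmod ((z + of_real t * p) - (z + of_real t * m)) / (Im z)\<^sup>2"
        using m p by (intro SM_lipschitz w z) auto
      also have "(z + of_real t * p) - (z + of_real t * m) = of_real t * (p - m)" by (simp add: algebra_simps)
      also have "cmod (of_real t * (p - m)) = t * cmod (p - m)" unfolding norm_mult norm_of_real using t by simp
      finally show "dist (?f p) (?f m) \<le> t / (Im z)\<^sup>2 * dist p m" by (simp add: dist_norm)
    qed (use t in simp)
    show "?f \<in> ?S \<rightarrow> ?S"
    proof
      fix m assume m: "m \<in> ?S"
      then have wz: "Im (z + of_real t * m) \<ge> Im z" using w by auto
      then have wp: "Im (z + of_real t * m) > 0" using z by linarith
      have "1 / Im (z + of_real t * m) \<le> 1 / Im z" using wz z by (intro frac_le) auto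
      then have "cmod (?f m) \<le> 1 / Im z" using SM_bound[OF wp] by linarith
      then show "?f m \<in> ?S" using Im_SM_nonneg[OF wp] by simp
    qed
  qed (rule that)
  then show ?thesis using that[of m] by simp
qed

end

lemma bounded_unique_limit_point:
  fixes s :: "nat \<Rightarrow> complex"
  assumes b: "\<And>n. cmod (s n) \<le> R"
    and u: "\<And>r p. strict_mono r \<Longrightarrow> (s \<circ> r) \<longlonglongrightarrow> p \<Longrightarrow> p = m"
  shows "s \<longlonglongrightarrow> m"
proof (rule ccontr)
  assume "\<not> s \<longlonglongrightarrow> m"
  then obtain e where e: "e > 0" "\<not> (\<forall>\<^sub>F n in sequentially. dist (s n) m < e)"
    unfolding tendsto_iff by blast
  have "infinite {n. \<not> dist (s n) m < e}"
    using e(2) unfolding cofinite_eq_sequentially[symmetric] eventually_cofinite .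
  then obtain r :: "nat \<Rightarrow> nat" where r: "strict_mono r" "\<And>n. r n \<in> {n. \<not> dist (s n) m < e}"
    using infinite_enumerate by blast
  have "bounded (range (s \<circ> r))" using b by (auto simp: bounded_iff)
  then obtain l q where q: "strict_mono (q :: nat \<Rightarrow> nat)" "((s \<circ> r) \<circ> q) \<longlonglongrightarrow> l"
    using bounded_imp_convergent_subsequence by blast
  have "l = m" by (rule u[of "r \<circ> q"]) (use r q in \<open>auto simp: o_assoc strict_mono_o\<close>)
  then have "\<forall>\<^sub>F n in sequentially. dist (((s \<circ> r) \<circ> q) n) m < e" using q(2) e(1) by (simp add: tendsto_iff)
  then obtain n where "dist (s (r (q n))) m < e" by (auto simp: eventually_sequentially)
  then show False using r(2)[of "q n"] by simp
qed

lemma pastur_limit_point: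
  fixes s :: "nat \<Rightarrow> complex" and F :: "nat \<Rightarrow> complex \<Rightarrow> complex"
  assumes z: "Im z > 0" and t: "t \<ge> 0" and s: "\<And>n. Im (s n) \<ge> 0" "s \<longlonglongrightarrow> p"
    and lip: "\<And>n w w'. Im w \<ge> Im z \<Longrightarrow> Im w' \<ge> Im z \<Longrightarrow> cmod (F n w - F n w') \<le> cmod (w - w') / (Im z)\<^sup>2"
    and lim: "\<And>w. Im w > 0 \<Longrightarrow> (\<lambda>n. F n w) \<longlonglongrightarrow> F' w"
    and d: "(\<lambda>n. cmod (s n - F n (z + of_real t * s n))) \<longlonglongrightarrow> 0"
  shows "Im p \<ge> 0 \<and> p = F' (z + of_real t * p)"
proof -
  have Imp: "Im p \<ge> 0"
    by (rule tendsto_lowerbound[OF tendsto_Im[OF s(2)]]) (use s(1) in auto)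
  let ?w = "\<lambda>p. z + of_real t * p"
  have w: "Im (?w q) \<ge> Im z" if "Im q \<ge> 0" for q using t that by simp
  have "(\<lambda>n. s n - F n (?w (s n))) \<longlonglongrightarrow> 0" using d by (rule tendsto_norm_zero_cancel)
  moreover have "(\<lambda>n. F n (?w (s n)) - F n (?w p)) \<longlonglongrightarrow> 0"
  proof (rule tendsto_norm_zero_cancel, rule tendsto_sandwich[OF _ _ tendsto_const])
    show "\<forall>\<^sub>F n in sequentially. 0 \<le> cmod (F n (?w (s n)) - F n (?w p))" by simp
    show "\<forall>\<^sub>F n in sequentially. cmod (F n (?w (s n)) - F n (?w p)) \<le> cmod (?w (s n) - ?w p) / (Im z)\<^sup>2"
      by (intro always_eventually allI lip w s(1) Imp)
    have "(\<lambda>n. cmod (?w (s n) - ?w p) / (Im z)\<^sup>2) \<longlonglongrightarrow> cmod (?w p - ?w p) / (Im z)\<^sup>2"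
      by (intro tendsto_intros s(2)) (use z in auto)
    then show "(\<lambda>n. cmod (?w (s n) - ?w p) / (Im z)\<^sup>2) \<longlonglongrightarrow> 0" by simp
  qed
  moreover have "(\<lambda>n. F n (?w p)) \<longlonglongrightarrow> F' (?w p)" using w[OF Imp] z by (intro lim) linarith
  ultimately have "(\<lambda>n. (s n - F n (?w (s n))) + (F n (?w (s n)) - F n (?w p)) + F n (?w p)) \<longlonglongrightarrow> 0 + 0 + F' (?w p)"
    by (intro tendsto_add)
  then have "s \<longlonglongrightarrow> F' (?w p)" by simp
  then have "p = F' (?w p)" by (rule LIMSEQ_unique[OF s(2)])
  with Imp show ?thesis by blast
qed

lemma real_distribution_emp: "n \<ge> 1 \<Longrightarrow> real_distribution (emp n x)"
proof -
  assume n: "n \<ge> 1"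
  interpret U: prob_space "uniform_count_measure {..<n}"
    by (rule prob_space_uniform_count_measure) (use n in \<open>auto simp: lessThan_empty_iff\<close>)
  have "prob_space (emp n x)" unfolding emp_def by (rule U.prob_space_distr) simp
  then show ?thesis by (simp add: real_distribution_def real_distribution_axioms_def emp_def)
qed

lemma integral_emp:
  fixes f :: "real \<Rightarrow> real"
  assumes f: "f \<in> borel_measurable borel"
  shows "(LINT y|emp n x. f y) = (\<Sum>j<n. f (x j)) / real n"
proof -
  have "(LINT y|emp n x. f y) = (LINT j|uniform_count_measure {..<n}. f (x j))"
    unfolding emp_def using f by (subst integral_distr) auto
  then show ?thesis by (simp add: integral_uniform_count_measure)
qed

lemma SM_emp: "n \<ge> 1 \<Longrightarrow> Im z > 0 \<Longrightarrow> SM (emp n x) z = stj n x z"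
proof -
  assume n: "n \<ge> 1" and z: "Im z > 0"
  interpret E: real_distribution "emp n x" by (rule real_distribution_emp[OF n])
  note i = E.SM_integrable[OF z]
  have c: "(\<lambda>y. 1 / (complex_of_real y - z)) \<in> borel_measurable borel" by simp
  have "Re (SM (emp n x) z) = (LINT y|emp n x. Re (1 / (complex_of_real y - z)))"
    unfolding SM_def using i by (rule integral_Re[symmetric])
  also have "\<dots> = (\<Sum>j<n. Re (1 / (complex_of_real (x j) - z))) / real n" by (rule integral_emp) (use c in measurable)
  also have "\<dots> = Re (stj n x z)" by (simp add: stj_def Re_divide_of_nat)
  finally have 1: "Re (SM (emp n x) z) = Re (stj n x z)" .
  have "Im (SM (emp n x) z) = (LINT y|emp n x. Im (1 / (complex_of_real y - z)))"
    unfolding SM_def using i by (rule integral_Im[symmetric])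
  also have "\<dots> = (\<Sum>j<n. Im (1 / (complex_of_real (x j) - z))) / real n" by (rule integral_emp) (use c in measurable)
  also have "\<dots> = Im (stj n x z)" by (simp add: stj_def Im_divide_of_nat)
  finally show ?thesis using 1 by (simp add: complex_eq_iff)
qed

lemma weak_conv_SM:
  assumes "\<And>n. real_distribution (\<mu> n)" "real_distribution \<nu>" "weak_conv_m \<mu> \<nu>" and z: "Im z > 0"
  shows "(\<lambda>n. SM (\<mu> n) z) \<longlonglongrightarrow> SM \<nu> z"
  unfolding SM_def
proof (rule weak_conv_imp_integral_bdd_continuous_conv[OF assms(1-3)])
  show "isCont (\<lambda>x. 1 / (complex_of_real x - z)) x" for x
    using shift_nonzero[OF z] by (intro continuous_intros)
  show "cmod (1 / (complex_of_real x - z)) \<le> 1 / Im z" for x by (rule norm_inverse_shift[OF z])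
qed

section \<open>Second moments from the fixed-point equation\<close>

lemma tendsto_zero_of_inverse_bound:
  fixes f :: "real \<Rightarrow> 'a :: real_normed_vector"
  assumes "\<And>y. y \<ge> 1 \<Longrightarrow> norm (f y) \<le> C / y"
  shows "(f \<longlongrightarrow> 0) at_top"
proof (rule Lim_null_comparison)
  show "\<forall>\<^sub>F y in at_top. norm (f y) \<le> C / y"
    using eventually_ge_at_top[of 1] by eventually_elim (use assms in auto)
  show "((\<lambda>y. C / y) \<longlongrightarrow> 0) at_top" by (rule real_tendsto_divide_at_top[OF tendsto_const filterlim_ident])
qed

context real_distribution
begin

text \<open>Expanding \<open>1 / (x - w)\<close> in powers of \<open>1 / w\<close> up to the second moment.\<close>

lemma pastur_second_moment:
  assumes supp: "AE x in M. \<bar>x\<bar> \<le> K" and t: "t \<ge> 0"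
    and m: "\<And>y. y > 0 \<Longrightarrow> Im (m y) \<ge> 0 \<and> m y = SM M (Complex 0 y + of_real t * m y)"
  shows "((\<lambda>y. y\<^sup>2 * Re (1 + Complex 0 y * m y)) \<longlongrightarrow> (LINT x|M. x\<^sup>2) + t) at_top"
proof -
  define w where "w y = Complex 0 y + of_real t * m y" for y
  have K: "K \<ge> 0"
  proof (rule ccontr)
    assume neg: "\<not> K \<ge> 0"
    have "AE x in M. False" using supp by eventually_elim (use neg in auto)
    then show False by simp
  qed
  have w: "Im (w y) \<ge> y" "cmod (w y) \<ge> y" if "y > 0" for y
  proof -
    show 1: "Im (w y) \<ge> y" using m[OF that] t by (simp add: w_def)
    show "cmod (w y) \<ge> y" using abs_Im_le_cmod[of "w y"] 1 by linarith
  qed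
  have mb: "cmod (m y) \<le> 1 / y" if "y > 0" for y
  proof -
    have "cmod (SM M (w y)) \<le> 1 / Im (w y)" using w(1)[OF that] that by (intro SM_bound) linarith
    also have "\<dots> \<le> 1 / y" using w(1)[OF that] that by (intro frac_le) auto
    finally show ?thesis using m[OF that] by (simp add: w_def)
  qed
  have pint: "integrable M (\<lambda>x. x ^ k)" for k
  proof (rule integrable_const_bound[of _ "K ^ k"])
    show "AE x in M. norm (x ^ k) \<le> K ^ k"
      using supp by eventually_elim (auto simp: power_abs intro!: power_mono)
  qed (intro borel_measurable_M, simp)
  define \<mu>1 \<mu>2 where "\<mu>1 = (LINT x|M. x)" and "\<mu>2 = (LINT x|M. x\<^sup>2)"
  have i1: "integrable M (\<lambda>x. x)" using pint[of 1] by simp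
  have res_int: "integrable M (\<lambda>x. of_real (x ^ k) / (of_real x - w y))"
    and res_bd: "cmod (LINT x|M. of_real (x ^ k) / (of_real x - w y)) \<le> K ^ k / y" if y: "y > 0" for k y
  proof -
    have wp: "Im (w y) > 0" using w(1)[OF y] y by linarith
    have "cmod (of_real (x ^ k) / (of_real x - w y)) \<le> K ^ k / y" if "\<bar>x\<bar> \<le> K" for x
    proof -
      have "cmod (1 / (complex_of_real x - w y)) \<le> 1 / Im (w y)" by (rule norm_inverse_shift[OF wp])
      also have "\<dots> \<le> 1 / y" using w(1)[OF y] y by (intro frac_le) auto
      finally have "cmod (1 / (complex_of_real x - w y)) \<le> 1 / y" .
      then have "\<bar>x\<bar> ^ k * cmod (1 / (complex_of_real x - w y)) \<le> K ^ k * (1 / y)"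
        using that K by (intro mult_mono power_mono) auto
      then show ?thesis by (simp add: norm_divide norm_power)
    qed
    then have b: "AE x in M. cmod (of_real (x ^ k) / (of_real x - w y)) \<le> K ^ k / y" using supp by auto
    show int: "integrable M (\<lambda>x. of_real (x ^ k) / (of_real x - w y))"
      by (rule integrable_const_bound[OF b]) (intro borel_measurable_M, simp)
    have "cmod (LINT x|M. of_real (x ^ k) / (of_real x - w y)) \<le> (LINT x|M. cmod (of_real (x ^ k) / (of_real x - w y)))"
      by (rule integral_norm_bound)
    also have "\<dots> \<le> (LINT x|M. K ^ k / y)" using int b by (intro integral_mono_AE integrable_norm) auto
    finally show "cmod (LINT x|M. of_real (x ^ k) / (of_real x - w y)) \<le> K ^ k / y" by (simp add: prob_UNIV)
  qed
  define E where "E y = (LINT x|M. of_real (x ^ 3) / (of_real x - w y))" for y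
  define F where "F y = (LINT x|M. of_real (x ^ 1) / (of_real x - w y))" for y
  have wn0: "w y \<noteq> 0" if "y > 0" for y using w(2)[OF that] that by auto
  have sn0: "complex_of_real x - w y \<noteq> 0" if "y > 0" for x y using w(1)[OF that] that by (intro shift_nonzero) linarith
  have meq: "m y = - (1 / w y) + 1 / w y * F y" if y: "y > 0" for y
  proof -
    have "m y = (LINT x|M. 1 / (complex_of_real x - w y))" using m[OF y] by (simp add: w_def SM_def)
    also have "\<dots> = (LINT x|M. - (1 / w y) + 1 / w y * (of_real (x ^ 1) / (of_real x - w y)))"
      using wn0[OF y] sn0[OF y] by (intro Bochner_Integration.integral_cong refl) (simp add: field_simps)
    also have "\<dots> = - (1 / w y) + 1 / w y * F y"
    proof -
      have j: "integrable M (\<lambda>x. 1 / w y * (of_real (x ^ 1) / (of_real x - w y)))" by (intro integrable_mult_right res_int[OF y])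
      show ?thesis unfolding F_def
        by (subst Bochner_Integration.integral_add[OF _ j]) (simp_all only: integrable_const integral_mult_right_zero lebesgue_integral_const space_eq_univ prob_UNIV scaleR_one)
    qed
    finally show ?thesis .
  qed
  have Feq: "F y = - (of_real \<mu>1 / w y) - of_real \<mu>2 / (w y)\<^sup>2 + 1 / (w y)\<^sup>2 * E y" if y: "y > 0" for y
  proof -
    have "F y = (LINT x|M. (- (1 / w y)) * of_real x + ((- (1 / (w y)\<^sup>2)) * of_real (x\<^sup>2) + 1 / (w y)\<^sup>2 * (of_real (x ^ 3) / (of_real x - w y))))"
      unfolding F_def
    proof (intro Bochner_Integration.integral_cong refl)
      fix x
      let ?x = "complex_of_real x"
      have "(- (1 / a)) * b + ((- (1 / a\<^sup>2)) * b\<^sup>2 + 1 / a\<^sup>2 * (b ^ 3 / d)) = b / d" if "a \<noteq> 0" "d \<noteq> 0" "d = b - a" for a b d :: complex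
      proof -
        have "(- (1 / a)) * b + ((- (1 / a\<^sup>2)) * b\<^sup>2 + 1 / a\<^sup>2 * (b ^ 3 / d)) = (- a * b * d - b\<^sup>2 * d + b ^ 3) / (a\<^sup>2 * d)"
          using that(1,2) by (simp add: field_simps power2_eq_square)
        also have "- a * b * d - b\<^sup>2 * d + b ^ 3 = a\<^sup>2 * b"
          unfolding that(3) by (simp add: algebra_simps power2_eq_square power3_eq_cube)
        finally show ?thesis using that(1,2) by simp
      qed
      from this[OF wn0[OF y] sn0[OF y] refl] show "of_real (x ^ 1) / (of_real x - w y) = (- (1 / w y)) * of_real x + ((- (1 / (w y)\<^sup>2)) * of_real (x\<^sup>2) + 1 / (w y)\<^sup>2 * (of_real (x ^ 3) / (of_real x - w y)))"
        by simp
    qed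
    also have "\<dots> = (- (1 / w y)) * of_real \<mu>1 + ((- (1 / (w y)\<^sup>2)) * of_real \<mu>2 + 1 / (w y)\<^sup>2 * E y)"
    proof -
      have j1: "integrable M (\<lambda>x. (- (1 / w y)) * of_real x)" using i1 by (intro integrable_mult_right integrable_of_real)
      have j2: "integrable M (\<lambda>x. (- (1 / (w y)\<^sup>2)) * of_real (x\<^sup>2))" by (intro integrable_mult_right integrable_of_real pint)
      have j3: "integrable M (\<lambda>x. 1 / (w y)\<^sup>2 * (of_real (x ^ 3) / (of_real x - w y)))" by (intro integrable_mult_right res_int[OF y])
      show ?thesis
        unfolding Bochner_Integration.integral_add[OF j1 Bochner_Integration.integrable_add[OF j2 j3]] Bochner_Integration.integral_add[OF j2 j3]
        unfolding integral_mult_right_zero integral_complex_of_real \<mu>1_def \<mu>2_def E_def ..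
    qed
    finally show ?thesis by simp
  qed
  have wy: "((\<lambda>y. w y / of_real y) \<longlongrightarrow> \<i>) at_top"
  proof -
    have "((\<lambda>y. of_real t * m y / of_real y) \<longlongrightarrow> 0) at_top"
    proof (rule tendsto_zero_of_inverse_bound[where C=t])
      fix y :: real assume y: "y \<ge> 1"
      have "cmod (m y) / y \<le> 1 / y" using mb[of y] y by (intro divide_right_mono order_trans[OF mb]) auto
      then show "cmod (of_real t * m y / of_real y) \<le> t / y"
        using t y mult_left_mono[of "cmod (m y) / y" "1 / y" t] by (simp add: norm_mult norm_divide)
    qed
    then have "((\<lambda>y. \<i> + of_real t * m y / of_real y) \<longlongrightarrow> \<i> + 0) at_top" by (intro tendsto_intros)
    moreover have "\<forall>\<^sub>F y in at_top. \<i> + of_real t * m y / of_real y = w y / of_real y"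
      using eventually_gt_at_top[of 0] by eventually_elim (simp add: w_def Complex_eq add_divide_distrib)
    ultimately show ?thesis using Lim_transform_eventually by force
  qed
  then have yw: "((\<lambda>y. of_real y / w y) \<longlongrightarrow> - \<i>) at_top"
    using tendsto_inverse[OF wy] by (simp add: inverse_eq_divide)
  have F0: "(F \<longlongrightarrow> 0) at_top"
    by (rule tendsto_zero_of_inverse_bound[where C=K]) (use res_bd[of _ 1] in \<open>simp add: F_def\<close>)
  have ym: "((\<lambda>y. of_real y * m y) \<longlongrightarrow> \<i>) at_top"
  proof -
    have "((\<lambda>y. - (of_real y / w y) + of_real y / w y * F y) \<longlongrightarrow> - (- \<i>) + (- \<i>) * 0) at_top"
      by (intro tendsto_intros yw F0)
    moreover have "\<forall>\<^sub>F y in at_top. - (of_real y / w y) + of_real y / w y * F y = of_real y * m y"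
      using eventually_gt_at_top[of 0] by eventually_elim (simp add: meq algebra_simps)
    ultimately show ?thesis using Lim_transform_eventually by force
  qed
  have Re1: "((\<lambda>y. y\<^sup>2 * Re (1 / w y)) \<longlongrightarrow> 0) at_top"
  proof (rule tendsto_zero_of_inverse_bound[where C=t])
    fix y :: real assume y1: "y \<ge> 1"
    then have y: "y > 0" by simp
    have "\<bar>Re (w y)\<bar> \<le> t / y"
    proof -
      have "\<bar>Re (w y)\<bar> = t * \<bar>Re (m y)\<bar>" using t by (simp add: w_def abs_mult)
      also have "\<dots> \<le> t * (1 / y)" using abs_Re_le_cmod[of "m y"] mb[OF y] t by (intro mult_left_mono) auto
      finally show ?thesis by simp
    qed
    moreover have "y\<^sup>2 \<le> (cmod (w y))\<^sup>2" using w(2)[OF y] y by (intro power_mono) auto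
    moreover have "Re (1 / w y) = Re (w y) / (cmod (w y))\<^sup>2" by (simp add: Re_divide cmod_power2)
    ultimately have "\<bar>Re (1 / w y)\<bar> \<le> (t / y) / y\<^sup>2" using y t
      by (simp only: abs_divide) (intro frac_le, auto)
    then have "y\<^sup>2 * \<bar>Re (1 / w y)\<bar> \<le> y\<^sup>2 * ((t / y) / y\<^sup>2)" by (intro mult_left_mono) auto
    then show "norm (y\<^sup>2 * Re (1 / w y)) \<le> t / y" using y by (simp add: abs_mult)
  qed
  have E0: "(E \<longlongrightarrow> 0) at_top"
    by (rule tendsto_zero_of_inverse_bound[where C="K ^ 3"]) (use res_bd[of _ 3] in \<open>simp add: E_def\<close>)
  have main: "y\<^sup>2 * Re (1 + Complex 0 y * m y) = - \<mu>1 * (y\<^sup>2 * Re (1 / w y)) - \<mu>2 * Re ((of_real y / w y)\<^sup>2) + Re ((of_real y / w y)\<^sup>2 * E y) - t * Re ((of_real y * m y)\<^sup>2)"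
    if y: "y > 0" for y
  proof -
    have "1 + w y * m y = F y" unfolding meq[OF y] using wn0[OF y] by (simp add: algebra_simps)
    then have "1 + Complex 0 y * m y = F y - of_real t * (m y)\<^sup>2" by (simp add: w_def algebra_simps power2_eq_square)
    then have e: "1 + Complex 0 y * m y = - (of_real \<mu>1 / w y) - of_real \<mu>2 / (w y)\<^sup>2 + 1 / (w y)\<^sup>2 * E y - of_real t * (m y)\<^sup>2"
      unfolding Feq[OF y] .
    have gen: "Y\<^sup>2 * (- (p / W) - q / W\<^sup>2 + 1 / W\<^sup>2 * E' - T * M'\<^sup>2) = - p * (Y\<^sup>2 * (1 / W)) - q * (Y / W)\<^sup>2 + (Y / W)\<^sup>2 * E' - T * (Y * M')\<^sup>2"
      for Y W p q E' T M' :: complex by (simp add: algebra_simps power_divide power_mult_distrib)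
    have "of_real (y\<^sup>2) * (1 + Complex 0 y * m y) = - of_real \<mu>1 * (of_real (y\<^sup>2) * (1 / w y)) - of_real \<mu>2 * (of_real y / w y)\<^sup>2 + (of_real y / w y)\<^sup>2 * E y - of_real t * (of_real y * m y)\<^sup>2"
      unfolding e of_real_power by (rule gen)
    then have "Re (of_real (y\<^sup>2) * (1 + Complex 0 y * m y)) = Re (- of_real \<mu>1 * (of_real (y\<^sup>2) * (1 / w y)) - of_real \<mu>2 * (of_real y / w y)\<^sup>2 + (of_real y / w y)\<^sup>2 * E y - of_real t * (of_real y * m y)\<^sup>2)"
      by (simp only:)
    moreover have re: "Re (of_real r * u) = r * Re u" "Re (- of_real r * u) = - r * Re u" for r u by simp_all
    ultimately show ?thesis by (simp only: re plus_complex.sel minus_complex.sel)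
  qed
  have "((\<lambda>y. - \<mu>1 * (y\<^sup>2 * Re (1 / w y)) - \<mu>2 * Re ((of_real y / w y)\<^sup>2) + Re ((of_real y / w y)\<^sup>2 * E y) - t * Re ((of_real y * m y)\<^sup>2))
     \<longlongrightarrow> - \<mu>1 * 0 - \<mu>2 * Re ((- \<i>)\<^sup>2) + Re ((- \<i>)\<^sup>2 * 0) - t * Re (\<i>\<^sup>2)) at_top"
    by (intro tendsto_intros Re1 yw E0 ym)
  then have "((\<lambda>y. - \<mu>1 * (y\<^sup>2 * Re (1 / w y)) - \<mu>2 * Re ((of_real y / w y)\<^sup>2) + Re ((of_real y / w y)\<^sup>2 * E y) - t * Re ((of_real y * m y)\<^sup>2))
     \<longlongrightarrow> \<mu>2 + t) at_top" by simp
  moreover have "\<forall>\<^sub>F y in at_top. - \<mu>1 * (y\<^sup>2 * Re (1 / w y)) - \<mu>2 * Re ((of_real y / w y)\<^sup>2) + Re ((of_real y / w y)\<^sup>2 * E y) - t * Re ((of_real y * m y)\<^sup>2)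
      = y\<^sup>2 * Re (1 + Complex 0 y * m y)"
    using eventually_gt_at_top[of 0] by eventually_elim (simp only: main)
  ultimately show ?thesis unfolding \<mu>2_def by (rule Lim_transform_eventually)
qed

end

section \<open>Sorted spectra with the same limit are close\<close>

lemma abs_arctan_le: "\<bar>arctan x\<bar> \<le> \<bar>x\<bar>"
proof -
  have pos: "arctan u \<le> u" if "u \<ge> 0" for u
  proof -
    have "(\<lambda>u. u - arctan u) 0 \<le> (\<lambda>u. u - arctan u) u"
    proof (rule DERIV_nonneg_imp_nondecreasing[OF that])
      fix y :: real
      have "((\<lambda>u. u - arctan u) has_real_derivative 1 - inverse (1 + y\<^sup>2)) (at y)"
        by (auto intro!: derivative_eq_intros DERIV_arctan)
      moreover have "0 \<le> 1 - inverse (1 + y\<^sup>2)" by (simp add: inverse_le_1_iff)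
      ultimately show "\<exists>d. ((\<lambda>u. u - arctan u) has_real_derivative d) (at y) \<and> 0 \<le> d" by blast
    qed
    then show ?thesis by simp
  qed
  show ?thesis
  proof (cases "x \<ge> 0")
    case True
    then show ?thesis using pos[of x] by simp
  next
    case False
    then have "arctan (- x) \<le> - x" by (intro pos) simp
    then show ?thesis using False by (simp add: arctan_minus abs_if)
  qed
qed

text \<open>A smoothed counting function: the average of arctangent ramps of width \<open>\<eta>\<close> at
  \<open>c\<close>.\<close>

definition arc_avg :: "nat \<Rightarrow> (nat \<Rightarrow> real) \<Rightarrow> real \<Rightarrow> real \<Rightarrow> real" where
  "arc_avg n x c \<eta> = (\<Sum>j<n. arctan ((x j - c) / \<eta>)) / real n"

text \<open>In the width \<open>\<eta>\<close> of the ramp, the arctangent ramp has the real part of the resolvent as its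
  derivative, so that ramp averages are controlled by Stieltjes transforms on a vertical segment.\<close>

lemma arc_avg_integral:
  assumes "0 < \<eta>" "\<eta> \<le> Y"
  shows "((\<lambda>u. Re (stj n x (Complex c u))) has_integral (arc_avg n x c \<eta> - arc_avg n x c Y)) {\<eta>..Y}"
proof -
  have one: "((\<lambda>u. Re (1 / (of_real a - Complex c u))) has_integral (arctan ((a - c) / \<eta>) - arctan ((a - c) / Y))) {\<eta>..Y}" for a
  proof -
    have "((\<lambda>u. b / (b\<^sup>2 + u\<^sup>2)) has_integral (- arctan (b / Y)) - (- arctan (b / \<eta>))) {\<eta>..Y}" for b
    proof (rule fundamental_theorem_of_calculus[OF assms(2)])
      fix u assume "u \<in> {\<eta>..Y}"
      then have u: "u > 0" using assms by auto
      have d: "((\<lambda>u. - arctan (b / u)) has_real_derivative inverse (1 + (b / u)\<^sup>2) * (b / u\<^sup>2)) (at u within {\<eta>..Y})"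
        using u by (auto intro!: derivative_eq_intros simp: power2_eq_square)
      have "inverse (1 + (b / u)\<^sup>2) * (b / u\<^sup>2) = b / (b\<^sup>2 + u\<^sup>2)"
      proof -
        have "u\<^sup>2 > 0" "b\<^sup>2 + u\<^sup>2 > 0" using u by (auto intro: add_nonneg_pos)
        moreover have "1 + (b / u)\<^sup>2 = (b\<^sup>2 + u\<^sup>2) / u\<^sup>2" using u by (simp add: power_divide add_divide_distrib)
        ultimately show ?thesis by (simp add: inverse_eq_divide)
      qed
      then show "((\<lambda>u. - arctan (b / u)) has_vector_derivative b / (b\<^sup>2 + u\<^sup>2)) (at u within {\<eta>..Y})"
        using d by (simp only: has_real_derivative_iff_has_vector_derivative[symmetric])
    qed
    from this[of "a - c"] have "((\<lambda>u. (a - c) / ((a - c)\<^sup>2 + u\<^sup>2)) has_integral (- arctan ((a - c) / Y)) - (- arctan ((a - c) / \<eta>))) {\<eta>..Y}" .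
    moreover have "Re (1 / (of_real a - Complex c u)) = (a - c) / ((a - c)\<^sup>2 + u\<^sup>2)" for u
      by (simp add: Re_divide)
    ultimately show ?thesis by simp
  qed
  have "((\<lambda>u. (\<Sum>j<n. Re (1 / (of_real (x j) - Complex c u))) / real n) has_integral (\<Sum>j<n. arctan ((x j - c) / \<eta>) - arctan ((x j - c) / Y)) / real n) {\<eta>..Y}"
    by (intro has_integral_divide has_integral_sum one) auto
  moreover have "Re (stj n x (Complex c u)) = (\<Sum>j<n. Re (1 / (of_real (x j) - Complex c u))) / real n" for u
    by (simp add: stj_def Re_divide_of_nat)
  moreover have "(\<Sum>j<n. arctan ((x j - c) / \<eta>) - arctan ((x j - c) / Y)) / real n = arc_avg n x c \<eta> - arc_avg n x c Y"
    by (simp add: arc_avg_def sum_subtractf diff_divide_distrib)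
  ultimately show ?thesis by (simp only:)
qed

lemma norm_stj: "Im z > 0 \<Longrightarrow> cmod (stj n x z) \<le> 1 / Im z"
proof -
  assume z: "Im z > 0"
  have "cmod (\<Sum>j<n. 1 / (of_real (x j) - z)) \<le> (\<Sum>j<n. 1 / Im z)"
    by (intro sum_norm_le norm_inverse_shift[OF z])
  then show ?thesis using z by (cases "n = 0") (auto simp: stj_def norm_divide divide_le_eq mult.commute)
qed

text \<open>Very wide ramps have small averages, because the second moments are bounded. Together with
  \<open>arc_avg_integral\<close> this determines ramp averages from Stieltjes transforms alone.\<close>

lemma arc_avg_small:
  assumes Y: "Y > 0"
  shows "\<bar>arc_avg n x c Y\<bar> \<le> ((\<Sum>j<n. (x j)\<^sup>2) / real n + 1 + \<bar>c\<bar>) / Y"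
proof (cases "n = 0")
  case True
  then show ?thesis using Y by (simp add: arc_avg_def)
next
  case False
  then have n: "real n > 0" by simp
  have "\<bar>\<Sum>j<n. arctan ((x j - c) / Y)\<bar> \<le> (\<Sum>j<n. ((x j)\<^sup>2 + 1 + \<bar>c\<bar>) / Y)"
  proof (rule order_trans[OF sum_abs sum_mono])
    fix j
    have "\<bar>x j\<bar> \<le> (x j)\<^sup>2 + 1"
    proof (cases "\<bar>x j\<bar> \<le> 1")
      case False
      then have "\<bar>x j\<bar> * 1 \<le> \<bar>x j\<bar> * \<bar>x j\<bar>" by (intro mult_left_mono) auto
      then show ?thesis by (simp add: power2_eq_square)
    qed (simp add: add_increasing)
    then have "\<bar>x j - c\<bar> \<le> (x j)\<^sup>2 + 1 + \<bar>c\<bar>" by linarith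
    then have "\<bar>(x j - c) / Y\<bar> \<le> ((x j)\<^sup>2 + 1 + \<bar>c\<bar>) / Y" using Y by (simp add: divide_right_mono)
    then show "\<bar>arctan ((x j - c) / Y)\<bar> \<le> ((x j)\<^sup>2 + 1 + \<bar>c\<bar>) / Y" using abs_arctan_le order_trans by blast
  qed
  also have "\<dots> = ((\<Sum>j<n. (x j)\<^sup>2) + real n * (1 + \<bar>c\<bar>)) / Y"
    unfolding sum_divide_distrib[symmetric] by (simp add: sum.distrib algebra_simps)
  finally have "\<bar>\<Sum>j<n. arctan ((x j - c) / Y)\<bar> / real n \<le> ((\<Sum>j<n. (x j)\<^sup>2) + real n * (1 + \<bar>c\<bar>)) / Y / real n"
    using n by (intro divide_right_mono) auto
  also have "\<dots> = ((\<Sum>j<n. (x j)\<^sup>2) / real n + 1 + \<bar>c\<bar>) / Y" using n by (simp add: field_simps)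
  finally show ?thesis by (simp add: arc_avg_def abs_divide)
qed

text \<open>The last condition says that \<open>m\<close>, as a Stieltjes transform, belongs to a measure with second moment \<open>c2\<close>;
  it is phrased in terms of \<open>m\<close> so that no such measure has to be produced.\<close>

locale spectra =
  fixes x :: "nat \<Rightarrow> nat \<Rightarrow> real" and m :: "complex \<Rightarrow> complex" and c2 :: real
  assumes stj_lim: "\<And>z. Im z > 0 \<Longrightarrow> (\<lambda>n. stj n (x n) z) \<longlonglongrightarrow> m z"
    and sq_lim: "(\<lambda>n. (\<Sum>j<n. (x n j)\<^sup>2) / real n) \<longlonglongrightarrow> c2"
    and sq_m: "((\<lambda>y. y\<^sup>2 * Re (1 + Complex 0 y * m (Complex 0 y))) \<longlongrightarrow> c2) at_top"
begin

text \<open>No second moment escapes to infinity, because the limit of the Stieltjes transforms already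
  accounts for all of it.\<close>

lemma tail_small:
  assumes e: "\<epsilon> > 0"
  shows "\<forall>\<^sub>F y in at_top. \<forall>\<^sub>F n in sequentially. (\<Sum>j<n. if \<bar>x n j\<bar> \<ge> y then (x n j)\<^sup>2 else 0) / real n < \<epsilon>"
proof -
  have "\<forall>\<^sub>F y in at_top. dist (y\<^sup>2 * Re (1 + Complex 0 y * m (Complex 0 y))) c2 < \<epsilon> / 2"
    by (rule tendstoD[OF sq_m]) (use e in simp)
  then show ?thesis using eventually_gt_at_top[of 0]
  proof eventually_elim
    case (elim y)
    then have y: "y > 0" by simp
    define A where "A n = (\<Sum>j<n. (x n j)\<^sup>2) / real n - y\<^sup>2 * Re (1 + Complex 0 y * stj n (x n) (Complex 0 y))" for n
    have "A \<longlonglongrightarrow> c2 - y\<^sup>2 * Re (1 + Complex 0 y * m (Complex 0 y))"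
      unfolding A_def by (intro tendsto_intros sq_lim stj_lim) (use y in simp)
    moreover have "c2 - y\<^sup>2 * Re (1 + Complex 0 y * m (Complex 0 y)) < \<epsilon> / 2" using elim(1) unfolding dist_real_def by linarith
    ultimately have "\<forall>\<^sub>F n in sequentially. A n < \<epsilon> / 2" by (rule order_tendstoD(2))
    then show ?case using eventually_gt_at_top[of 0]
    proof eventually_elim
      case (elim n)
      then have n: "real n > 0" by simp
      have A: "A n = (\<Sum>j<n. (x n j)^4 / ((x n j)\<^sup>2 + y\<^sup>2)) / real n"
      proof -
        have t: "a\<^sup>2 - y\<^sup>2 * Re (1 + Complex 0 y * (1 / (of_real a - Complex 0 y))) = a^4 / (a\<^sup>2 + y\<^sup>2)" for a
        proof -
          have p: "a\<^sup>2 + y\<^sup>2 > 0" using y by (simp add: add_nonneg_pos)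
          have "Re (1 + Complex 0 y * (1 / (of_real a - Complex 0 y))) = 1 - y\<^sup>2 / (a\<^sup>2 + y\<^sup>2)"
            by (simp add: Re_divide Im_divide power2_eq_square)
          also have "\<dots> = a\<^sup>2 / (a\<^sup>2 + y\<^sup>2)"
          proof -
            have "a\<^sup>2 / (a\<^sup>2 + y\<^sup>2) + y\<^sup>2 / (a\<^sup>2 + y\<^sup>2) = (a\<^sup>2 + y\<^sup>2) / (a\<^sup>2 + y\<^sup>2)" by (rule add_divide_distrib[symmetric])
            also have "\<dots> = 1" using p by (intro divide_self) linarith
            finally show ?thesis by linarith
          qed
          finally have r: "Re (1 + Complex 0 y * (1 / (of_real a - Complex 0 y))) = a\<^sup>2 / (a\<^sup>2 + y\<^sup>2)" .
          have pn: "a\<^sup>2 + y\<^sup>2 \<noteq> 0" using p by linarith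
          have "a\<^sup>2 - y\<^sup>2 * (a\<^sup>2 / (a\<^sup>2 + y\<^sup>2)) = (a\<^sup>2 * (a\<^sup>2 + y\<^sup>2) - y\<^sup>2 * a\<^sup>2) / (a\<^sup>2 + y\<^sup>2)" by (simp only: diff_divide_distrib nonzero_mult_div_cancel_right[OF pn] times_divide_eq_right)
          also have "a\<^sup>2 * (a\<^sup>2 + y\<^sup>2) - y\<^sup>2 * a\<^sup>2 = a^4" by (simp add: algebra_simps power2_eq_square power4_eq_xxxx)
          finally show ?thesis unfolding r .
        qed
        have "Re (1 + Complex 0 y * stj n (x n) (Complex 0 y)) = (\<Sum>j<n. Re (1 + Complex 0 y * (1 / (of_real (x n j) - Complex 0 y)))) / real n"
        proof -
          have "1 + Complex 0 y * stj n (x n) (Complex 0 y) = (\<Sum>j<n. 1 + Complex 0 y * (1 / (of_real (x n j) - Complex 0 y))) / of_nat n"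
            unfolding stj_def sum.distrib sum_distrib_left[symmetric] using n by (simp add: add_divide_distrib)
          then show ?thesis by (simp add: Re_divide_of_nat del: Re_divide)
        qed
        then have "A n = ((\<Sum>j<n. (x n j)\<^sup>2) - y\<^sup>2 * (\<Sum>j<n. Re (1 + Complex 0 y * (1 / (of_real (x n j) - Complex 0 y))))) / real n"
          unfolding A_def by (simp only: diff_divide_distrib times_divide_eq_right)
        also have "(\<Sum>j<n. (x n j)\<^sup>2) - y\<^sup>2 * (\<Sum>j<n. Re (1 + Complex 0 y * (1 / (of_real (x n j) - Complex 0 y))))
          = (\<Sum>j<n. (x n j)^4 / ((x n j)\<^sup>2 + y\<^sup>2))"
          unfolding sum_distrib_left sum_subtractf[symmetric] t ..
        finally show ?thesis .
      qed
      have "(if \<bar>a\<bar> \<ge> y then a\<^sup>2 else 0) \<le> 2 * (a^4 / (a\<^sup>2 + y\<^sup>2))" for a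
      proof (cases "\<bar>a\<bar> \<ge> y")
        case True
        then have "y\<^sup>2 \<le> \<bar>a\<bar>\<^sup>2" using y by (intro power_mono) auto
        then have q: "y\<^sup>2 \<le> a\<^sup>2" by simp
        have p: "a\<^sup>2 + y\<^sup>2 > 0" using y by (simp add: add_nonneg_pos)
        have "a\<^sup>2 * (a\<^sup>2 + y\<^sup>2) \<le> a\<^sup>2 * (a\<^sup>2 + a\<^sup>2)" using q by (intro mult_left_mono) auto
        also have "\<dots> = 2 * a^4" by (simp add: power2_eq_square power4_eq_xxxx algebra_simps)
        finally have "a\<^sup>2 \<le> 2 * a^4 / (a\<^sup>2 + y\<^sup>2)" using p by (simp add: pos_le_divide_eq)
        then show ?thesis using True by simp
      qed simp
      then have "(\<Sum>j<n. if \<bar>x n j\<bar> \<ge> y then (x n j)\<^sup>2 else 0) \<le> (\<Sum>j<n. 2 * ((x n j)^4 / ((x n j)\<^sup>2 + y\<^sup>2)))"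
        by (intro sum_mono) blast
      then have "(\<Sum>j<n. if \<bar>x n j\<bar> \<ge> y then (x n j)\<^sup>2 else 0) / real n \<le> 2 * A n"
        unfolding A sum_distrib_left[symmetric] using n by (simp add: divide_right_mono)
      then show ?case using elim(1) by simp
    qed
  qed
qed

end

lemma arc_avg_diff_tendsto:
  assumes "spectra s m c2" "spectra l m c2" and eta: "\<eta> > 0"
  shows "(\<lambda>n. arc_avg n (s n) c \<eta> - arc_avg n (l n) c \<eta>) \<longlonglongrightarrow> 0"
proof (rule LIMSEQ_I)
  interpret S: spectra s m c2 by fact
  interpret L: spectra l m c2 by fact
  fix \<epsilon> :: real assume e: "\<epsilon> > 0"
  have c2: "c2 \<ge> 0" by (rule tendsto_lowerbound[OF S.sq_lim]) (auto simp: sum_nonneg)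
  define C where "C = c2 + 2 + \<bar>c\<bar>"
  have C: "C > 0" using c2 by (simp add: C_def add_nonneg_pos)
  define Y where "Y = max \<eta> (4 * C / \<epsilon>)"
  have Y: "\<eta> \<le> Y" "Y > 0" "C / Y \<le> \<epsilon> / 4"
  proof -
    show "\<eta> \<le> Y" "Y > 0" using eta by (auto simp: Y_def)
    then have "4 * C \<le> \<epsilon> * Y" using e by (simp add: Y_def max_def field_simps split: if_splits)
    then show "C / Y \<le> \<epsilon> / 4" using \<open>Y > 0\<close> by (simp add: field_simps)
  qed
  define d where "d n u = Re (stj n (s n) (Complex c u)) - Re (stj n (l n) (Complex c u))" for n u
  have di: "(d n has_integral ((arc_avg n (s n) c \<eta> - arc_avg n (s n) c Y) - (arc_avg n (l n) c \<eta> - arc_avg n (l n) c Y))) {\<eta>..Y}" for n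
    unfolding d_def by (intro has_integral_diff arc_avg_integral eta Y)
  have "(\<lambda>n. integral {\<eta>..Y} (d n)) \<longlonglongrightarrow> integral {\<eta>..Y} (\<lambda>_. 0)"
  proof (rule dominated_convergence(2)[where h="\<lambda>_. 2 / \<eta>"])
    show "d n integrable_on {\<eta>..Y}" for n using di by blast
    show "norm (d n u) \<le> 2 / \<eta>" if "u \<in> {\<eta>..Y}" for n u
    proof -
      have u: "u > 0" "1 / u \<le> 1 / \<eta>" using that eta by (auto simp: frac_le)
      have "\<bar>Re (stj n a (Complex c u))\<bar> \<le> 1 / \<eta>" for a
        using abs_Re_le_cmod[of "stj n a (Complex c u)"] norm_stj[of "Complex c u" n a] u by simp
      from this[of "s n"] this[of "l n"] show ?thesis by (simp add: d_def)
    qed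
    show "(\<lambda>n. d n u) \<longlonglongrightarrow> 0" if "u \<in> {\<eta>..Y}" for u
    proof -
      have "Im (Complex c u) > 0" using that eta by simp
      then have "(\<lambda>n. d n u) \<longlonglongrightarrow> Re (m (Complex c u)) - Re (m (Complex c u))"
        unfolding d_def by (intro tendsto_intros S.stj_lim L.stj_lim)
      then show ?thesis by simp
    qed
  qed auto
  then have lim: "(\<lambda>n. (arc_avg n (s n) c \<eta> - arc_avg n (s n) c Y) - (arc_avg n (l n) c \<eta> - arc_avg n (l n) c Y)) \<longlonglongrightarrow> 0"
    using integral_unique[OF di] by simp
  have "\<forall>\<^sub>F n in sequentially. \<bar>(arc_avg n (s n) c \<eta> - arc_avg n (s n) c Y) - (arc_avg n (l n) c \<eta> - arc_avg n (l n) c Y)\<bar> < \<epsilon> / 4"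
    using tendstoD[OF lim, of "\<epsilon> / 4"] e by (simp add: dist_real_def)
  moreover have "\<forall>\<^sub>F n in sequentially. (\<Sum>j<n. (s n j)\<^sup>2) / real n < c2 + 1" using S.sq_lim by (rule order_tendstoD) simp
  moreover have "\<forall>\<^sub>F n in sequentially. (\<Sum>j<n. (l n j)\<^sup>2) / real n < c2 + 1" using L.sq_lim by (rule order_tendstoD) simp
  ultimately have "\<forall>\<^sub>F n in sequentially. \<bar>arc_avg n (s n) c \<eta> - arc_avg n (l n) c \<eta>\<bar> < \<epsilon>"
  proof eventually_elim
    case (elim n)
    have b: "\<bar>arc_avg n a c Y\<bar> \<le> \<epsilon> / 4" if "(\<Sum>j<n. (a j)\<^sup>2) / real n < c2 + 1" for a
    proof -
      have "\<bar>arc_avg n a c Y\<bar> \<le> ((\<Sum>j<n. (a j)\<^sup>2) / real n + 1 + \<bar>c\<bar>) / Y" by (rule arc_avg_small[OF Y(2)])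
      also have "\<dots> \<le> C / Y" using that Y(2) by (intro divide_right_mono) (auto simp: C_def)
      finally show ?thesis using Y(3) by linarith
    qed
    show ?case using elim(1) b[OF elim(2)] b[OF elim(3)] e by linarith
  qed
  then show "\<exists>no. \<forall>n\<ge>no. norm (arc_avg n (s n) c \<eta> - arc_avg n (l n) c \<eta> - 0) < \<epsilon>"
    by (simp add: eventually_sequentially)
qed

text \<open>Both sequences are sorted. If one index \<open>j\<close> has \<open>l j \<le> c\<close> and \<open>s j \<ge> c + \<delta>\<close>, then \<open>s\<close> is above
  \<open>c + \<delta>\<close> at all earlier indices and \<open>l\<close> below \<open>c\<close> at all later ones. So a ramp from \<open>c\<close> to \<open>c + \<delta>\<close> is
  larger at \<open>s\<close> than at \<open>l\<close> for every index, and the differences cannot cancel in the average.\<close>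

lemma crossing_bound:
  assumes s: "antimono_on {..<n} s" and l: "antimono_on {..<n} l"
    and eta: "\<eta> > 0" and d: "\<delta> > 0" and r: "arctan (\<delta> / (2 * \<eta>)) \<ge> pi / 2 - \<epsilon>" and e: "\<epsilon> \<ge> 0"
  shows "real (card {j. j < n \<and> l j \<le> c \<and> c + \<delta> \<le> s j}) * (pi - 2 * \<epsilon>) / real n
    \<le> \<bar>arc_avg n s (c + \<delta> / 2) \<eta> - arc_avg n l (c + \<delta> / 2) \<eta>\<bar> + \<epsilon>"
proof -
  let ?J = "{j. j < n \<and> l j \<le> c \<and> c + \<delta> \<le> s j}"
  let ?f = "\<lambda>a. arctan ((a - (c + \<delta> / 2)) / \<eta>)"
  have hi: "?f a \<ge> pi / 2 - \<epsilon>" if "a \<ge> c + \<delta>" for a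
  proof -
    have "\<delta> / (2 * \<eta>) \<le> (a - (c + \<delta> / 2)) / \<eta>" using that eta by (simp add: field_simps)
    then have "arctan (\<delta> / (2 * \<eta>)) \<le> ?f a" by (rule arctan_monotone')
    then show ?thesis using r by linarith
  qed
  have lo: "?f a \<le> - (pi / 2) + \<epsilon>" if "a \<le> c" for a
  proof -
    have "(a - (c + \<delta> / 2)) / \<eta> \<le> - (\<delta> / (2 * \<eta>))" using that eta by (simp add: field_simps)
    then have "?f a \<le> arctan (- (\<delta> / (2 * \<eta>)))" by (rule arctan_monotone')
    then show ?thesis using r by (simp add: arctan_minus)
  qed
  have bd: "- (pi / 2) \<le> ?f a" "?f a \<le> pi / 2" for a using arctan_bounded[of "(a - (c + \<delta> / 2)) / \<eta>"] by linarith+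
  show ?thesis
  proof (cases "?J = {}")
    case True
    show ?thesis unfolding True using e by simp
  next
    case False
    then obtain k where k: "k < n" "l k \<le> c" "c + \<delta> \<le> s k" by blast
    have tm: "(if j \<in> ?J then pi - 2 * \<epsilon> else 0) - \<epsilon> \<le> ?f (s j) - ?f (l j)" if j: "j < n" for j
    proof (cases "j \<in> ?J")
      case True
      then show ?thesis using hi[of "s j"] lo[of "l j"] e by simp
    next
      case False
      have "- \<epsilon> \<le> ?f (s j) - ?f (l j)"
      proof (cases "j \<le> k")
        case True
        then have "s k \<le> s j" using monotone_onD[OF s, of j k] j k by auto
        then have "?f (s j) \<ge> pi / 2 - \<epsilon>" using k by (intro hi) linarith
        then show ?thesis using bd(2)[of "l j"] by linarith
      next
        case False
        then have "l j \<le> l k" using monotone_onD[OF l, of k j] j k by auto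
        then have "?f (l j) \<le> - (pi / 2) + \<epsilon>" using k by (intro lo) linarith
        then show ?thesis using bd(1)[of "s j"] by linarith
      qed
      then show ?thesis unfolding if_not_P[OF False] by simp
    qed
    have n: "real n > 0" using k by simp
    have "(\<Sum>j<n. (if j \<in> ?J then pi - 2 * \<epsilon> else 0) - \<epsilon>) \<le> (\<Sum>j<n. ?f (s j) - ?f (l j))"
      by (intro sum_mono tm) simp
    moreover have "(\<Sum>j<n. (if j \<in> ?J then pi - 2 * \<epsilon> else 0) - \<epsilon>) = real (card ?J) * (pi - 2 * \<epsilon>) - real n * \<epsilon>"
    proof -
      have "(\<Sum>j<n. (if j \<in> ?J then pi - 2 * \<epsilon> else 0)) = (\<Sum>j\<in>?J. pi - 2 * \<epsilon>)"
        by (rule sum.mono_neutral_cong_right) auto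
      then show ?thesis by (simp add: sum_subtractf)
    qed
    moreover have "(\<Sum>j<n. ?f (s j) - ?f (l j)) = real n * (arc_avg n s (c + \<delta> / 2) \<eta> - arc_avg n l (c + \<delta> / 2) \<eta>)"
      using n by (simp add: arc_avg_def sum_subtractf right_diff_distrib)
    moreover have "real n * (arc_avg n s (c + \<delta> / 2) \<eta> - arc_avg n l (c + \<delta> / 2) \<eta>) \<le> real n * \<bar>arc_avg n s (c + \<delta> / 2) \<eta> - arc_avg n l (c + \<delta> / 2) \<eta>\<bar>"
      by (intro mult_left_mono) auto
    ultimately have "real (card ?J) * (pi - 2 * \<epsilon>) \<le> real n * (\<bar>arc_avg n s (c + \<delta> / 2) \<eta> - arc_avg n l (c + \<delta> / 2) \<eta>\<bar> + \<epsilon>)"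
      by (simp add: distrib_left)
    then show ?thesis using n by (simp add: divide_le_eq mult.commute)
  qed
qed

lemma crossings_vanish:
  assumes sp: "spectra s m c2" "spectra l m c2"
    and anti: "\<And>n. antimono_on {..<n} (s n)" "\<And>n. antimono_on {..<n} (l n)" and d: "\<delta> > 0"
  shows "(\<lambda>n. real (card {j. j < n \<and> l n j \<le> c \<and> c + \<delta> \<le> s n j}) / real n) \<longlonglongrightarrow> 0"
proof (rule LIMSEQ_I)
  fix e :: real assume e: "e > 0"
  define \<epsilon> where "\<epsilon> = min (e / 2) 1"
  have \<epsilon>: "\<epsilon> > 0" "\<epsilon> \<le> 1" "\<epsilon> \<le> e / 2" using e by (auto simp: \<epsilon>_def)
  have "\<forall>\<^sub>F y in at_top. arctan y > pi / 2 - \<epsilon>"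
    using tendsto_arctan_at_top by (rule order_tendstoD) (use \<epsilon> in simp)
  then have "\<forall>\<^sub>F y in at_top. arctan y > pi / 2 - \<epsilon> \<and> y > 0" using eventually_gt_at_top[of 0] by eventually_elim auto
  then obtain y where y: "arctan y > pi / 2 - \<epsilon>" "y > 0"
    using eventually_happens'[OF trivial_limit_at_top_linorder] by blast
  define \<eta> where "\<eta> = \<delta> / (2 * y)"
  have \<eta>: "\<eta> > 0" "\<delta> / (2 * \<eta>) = y" using d y by (auto simp: \<eta>_def)
  have "(\<lambda>n. \<bar>arc_avg n (s n) (c + \<delta> / 2) \<eta> - arc_avg n (l n) (c + \<delta> / 2) \<eta>\<bar>) \<longlonglongrightarrow> 0"
    using arc_avg_diff_tendsto[OF sp \<eta>(1)] by (rule tendsto_rabs_zero)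
  then have "\<forall>\<^sub>F n in sequentially. \<bar>arc_avg n (s n) (c + \<delta> / 2) \<eta> - arc_avg n (l n) (c + \<delta> / 2) \<eta>\<bar> < e / 2"
    by (rule order_tendstoD) (use e in simp)
  then have "\<forall>\<^sub>F n in sequentially. norm (real (card {j. j < n \<and> l n j \<le> c \<and> c + \<delta> \<le> s n j}) / real n - 0) < e"
  proof eventually_elim
    case (elim n)
    let ?N = "real (card {j. j < n \<and> l n j \<le> c \<and> c + \<delta> \<le> s n j})"
    have "?N * 1 / real n \<le> ?N * (pi - 2 * \<epsilon>) / real n"
      using pi_gt3 \<epsilon> by (intro divide_right_mono mult_left_mono) auto
    also have "\<dots> \<le> \<bar>arc_avg n (s n) (c + \<delta> / 2) \<eta> - arc_avg n (l n) (c + \<delta> / 2) \<eta>\<bar> + \<epsilon>"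
      by (rule crossing_bound[OF anti \<eta>(1) d]) (use y \<epsilon> \<eta> in auto)
    also have "\<dots> < e" using elim \<epsilon> by linarith
    finally show ?case by simp
  qed
  then show "\<exists>no. \<forall>n\<ge>no. norm (real (card {j. j < n \<and> l n j \<le> c \<and> c + \<delta> \<le> s n j}) / real n - 0) < e"
    by (simp add: eventually_sequentially)
qed

lemma budget:
  fixes p q r d e :: real
  assumes "p < e / 8" "q < e / 16" "r < e / 16" "d = e / 4" "e > 0"
  shows "d + p + 4 * (q + r) < e"
proof -
  have "8 * p < e" "16 * q < e" "16 * r < e" "4 * d = e" using assms by simp_all
  then show ?thesis using assms(5) by argo
qed

text \<open>Where both sequences are below a height \<open>y\<close>, a gap of more than \<open>2
  \<delta>\<close> contains an interval \<open>[c, c + \<delta>]\<close> from a finite grid, and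
  each grid interval is skipped by few indices only. Above \<open>y\<close> the second moments are
  uniformly small.\<close>

theorem sorted_spectra_close:
  assumes sp: "spectra s m c2" "spectra l m c2"
    and anti: "\<And>n. antimono_on {..<n} (s n)" "\<And>n. antimono_on {..<n} (l n)"
  shows "(\<lambda>n. (\<Sum>j<n. (s n j - l n j)\<^sup>2) / real n) \<longlonglongrightarrow> 0"
proof (rule LIMSEQ_I)
  fix e :: real assume e: "e > 0"
  have "\<forall>\<^sub>F y in at_top. (\<forall>\<^sub>F n in sequentially. (\<Sum>j<n. if \<bar>s n j\<bar> \<ge> y then (s n j)\<^sup>2 else 0) / real n < e / 16)
     \<and> (\<forall>\<^sub>F n in sequentially. (\<Sum>j<n. if \<bar>l n j\<bar> \<ge> y then (l n j)\<^sup>2 else 0) / real n < e / 16) \<and> y > 0"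
    using spectra.tail_small[OF sp(1), of "e / 16"] spectra.tail_small[OF sp(2), of "e / 16"] eventually_gt_at_top[of "0::real"] e
    by (intro eventually_conj) auto
  then obtain y where ys: "\<forall>\<^sub>F n in sequentially. (\<Sum>j<n. if \<bar>s n j\<bar> \<ge> y then (s n j)\<^sup>2 else 0) / real n < e / 16"
    and yl: "\<forall>\<^sub>F n in sequentially. (\<Sum>j<n. if \<bar>l n j\<bar> \<ge> y then (l n j)\<^sup>2 else 0) / real n < e / 16" and y: "y > 0"
    using eventually_happens'[OF trivial_limit_at_top_linorder] by blast
  define \<delta> where "\<delta> = sqrt e / 4"
  have \<delta>: "\<delta> > 0" "4 * \<delta>\<^sup>2 = e / 4" using e by (auto simp: \<delta>_def power_divide)
  define N where "N = nat \<lceil>2 * y / \<delta>\<rceil> + 1"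
  define c where "c i = - y + real i * \<delta>" for i
  let ?J = "\<lambda>a b n i. {j. j < n \<and> b n j \<le> c i \<and> c i + \<delta> \<le> a n j}"
  define bad where "bad n = (\<Union>i\<in>{..N}. ?J s l n i \<union> ?J l s n i)" for n
  have bad_fin: "finite (bad n)" for n unfolding bad_def by auto
  have cross: "j \<in> ?J a b n (nat \<lceil>(b n j + y) / \<delta>\<rceil>) \<and> nat \<lceil>(b n j + y) / \<delta>\<rceil> \<le> N"
    if "j < n" "\<bar>a n j\<bar> < y" "\<bar>b n j\<bar> < y" "a n j - b n j > 2 * \<delta>" for a b :: "nat \<Rightarrow> nat \<Rightarrow> real" and n j
  proof -
    let ?q = "(b n j + y) / \<delta>" let ?i = "nat \<lceil>?q\<rceil>"
    have q: "?q > 0" using that \<delta> by (simp add: abs_less_iff)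
    have ri: "real ?i = of_int \<lceil>?q\<rceil>" using q by simp
    then have i: "?q \<le> real ?i" "real ?i < ?q + 1" using ceiling_correct[of ?q] by auto
    have lo: "b n j + y \<le> real ?i * \<delta>" using i(1) \<delta> by (simp add: pos_divide_le_eq)
    have hi: "real ?i * \<delta> < b n j + y + \<delta>"
    proof -
      have "real ?i * \<delta> < (?q + 1) * \<delta>" using i(2) \<delta> by (intro mult_strict_right_mono) auto
      also have "\<dots> = b n j + y + \<delta>" using \<delta> by (simp add: field_simps)
      finally show ?thesis .
    qed
    have N: "?i \<le> N"
    proof -
      have "?q \<le> 2 * y / \<delta>" using that \<delta> by (intro divide_right_mono) (auto simp: abs_less_iff)
      then have "\<lceil>?q\<rceil> \<le> \<lceil>2 * y / \<delta>\<rceil>" by (rule ceiling_mono)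
      from nat_mono[OF this] show ?thesis unfolding N_def by (rule trans_le_add1)
    qed
    have "b n j \<le> c ?i" "c ?i + \<delta> \<le> a n j" unfolding c_def using lo hi that(4) by linarith+
    then show ?thesis using that(1) N by blast
  qed
  have bad_lim: "(\<lambda>n. real (card (bad n)) / real n) \<longlonglongrightarrow> 0"
  proof (rule tendsto_sandwich[OF _ _ tendsto_const])
    show "\<forall>\<^sub>F n in sequentially. real (card (bad n)) / real n \<le> (\<Sum>i\<le>N. real (card (?J s l n i)) / real n + real (card (?J l s n i)) / real n)"
    proof (intro always_eventually allI)
      fix n
      have "card (bad n) \<le> (\<Sum>i\<le>N. card (?J s l n i \<union> ?J l s n i))" unfolding bad_def by (rule card_UN_le) simp
      also have "\<dots> \<le> (\<Sum>i\<le>N. card (?J s l n i) + card (?J l s n i))" by (intro sum_mono card_Un_le)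
      finally have "real (card (bad n)) \<le> real (\<Sum>i\<le>N. card (?J s l n i) + card (?J l s n i))" by (simp only: of_nat_le_iff)
      then have "real (card (bad n)) / real n \<le> real (\<Sum>i\<le>N. card (?J s l n i) + card (?J l s n i)) / real n" by (intro divide_right_mono) auto
      then show "real (card (bad n)) / real n \<le> (\<Sum>i\<le>N. real (card (?J s l n i)) / real n + real (card (?J l s n i)) / real n)"
        by (simp add: sum_divide_distrib add_divide_distrib)
    qed
    have "(\<lambda>n. \<Sum>i\<le>N. real (card (?J s l n i)) / real n + real (card (?J l s n i)) / real n) \<longlonglongrightarrow> (\<Sum>i\<le>N. 0 + 0)"
      by (intro tendsto_sum tendsto_add crossings_vanish[OF sp anti \<delta>(1)] crossings_vanish[OF sp(2,1) anti(2,1) \<delta>(1)])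
    then show "(\<lambda>n. \<Sum>i\<le>N. real (card (?J s l n i)) / real n + real (card (?J l s n i)) / real n) \<longlonglongrightarrow> 0" by simp
  qed auto
  have "(\<lambda>n. 4 * y\<^sup>2 * (real (card (bad n)) / real n)) \<longlonglongrightarrow> 4 * y\<^sup>2 * 0" by (intro tendsto_intros bad_lim)
  then have "\<forall>\<^sub>F n in sequentially. 4 * y\<^sup>2 * (real (card (bad n)) / real n) < e / 8" by (rule order_tendstoD) (use e in simp)
  then have "\<forall>\<^sub>F n in sequentially. norm ((\<Sum>j<n. (s n j - l n j)\<^sup>2) / real n - 0) < e"
    using ys yl eventually_gt_at_top[of 0]
  proof eventually_elim
    case (elim n)
    then have n: "real n > 0" by simp
    let ?ts = "\<lambda>j. if \<bar>s n j\<bar> \<ge> y then (s n j)\<^sup>2 else 0" let ?tl = "\<lambda>j. if \<bar>l n j\<bar> \<ge> y then (l n j)\<^sup>2 else 0"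
    have tm: "(s n j - l n j)\<^sup>2 \<le> 4 * \<delta>\<^sup>2 + 4 * y\<^sup>2 * (if j \<in> bad n then 1 else 0) + 4 * (?ts j + ?tl j)" if j: "j < n" for j
    proof (cases "\<bar>s n j\<bar> < y \<and> \<bar>l n j\<bar> < y")
      case True
      show ?thesis
      proof (cases "\<bar>s n j - l n j\<bar> \<le> 2 * \<delta>")
        case True
        then have "\<bar>s n j - l n j\<bar>\<^sup>2 \<le> (2 * \<delta>)\<^sup>2" by (intro power_mono) auto
        then show ?thesis by (simp add: power_mult_distrib add_increasing2)
      next
        case False
        then have "s n j - l n j > 2 * \<delta> \<or> l n j - s n j > 2 * \<delta>" by linarith
        then have "j \<in> bad n" unfolding bad_def using cross[OF j, of s l] cross[OF j, of l s] True by blast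
        moreover have "\<bar>s n j - l n j\<bar>\<^sup>2 \<le> (2 * y)\<^sup>2" using True by (intro power_mono) linarith+
        ultimately show ?thesis by (simp add: power_mult_distrib add_increasing2 add_increasing)
      qed
    next
      case False
      have sq: "(a - b)\<^sup>2 \<le> 2 * a\<^sup>2 + 2 * b\<^sup>2" for a b :: real
        using zero_le_power2[of "a + b"] by (simp add: power2_sum power2_diff)
      have "(s n j - l n j)\<^sup>2 \<le> 4 * (?ts j + ?tl j)"
      proof (cases "\<bar>s n j\<bar> \<ge> \<bar>l n j\<bar>")
        case True
        then have "\<bar>l n j\<bar>\<^sup>2 \<le> \<bar>s n j\<bar>\<^sup>2" by (intro power_mono) auto
        moreover have "\<bar>s n j\<bar> \<ge> y" using True False by linarith
        ultimately show ?thesis using sq[of "s n j" "l n j"] by (simp add: add_increasing2)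
      next
        case F: False
        then have "\<bar>s n j\<bar>\<^sup>2 \<le> \<bar>l n j\<bar>\<^sup>2" by (intro power_mono) auto
        moreover have "\<bar>l n j\<bar> \<ge> y" using F False by linarith
        ultimately show ?thesis using sq[of "s n j" "l n j"] by (simp add: add_increasing)
      qed
      then show ?thesis by (simp add: add_increasing)
    qed
    have "(\<Sum>j<n. (s n j - l n j)\<^sup>2) \<le> (\<Sum>j<n. 4 * \<delta>\<^sup>2 + 4 * y\<^sup>2 * (if j \<in> bad n then 1 else 0) + 4 * (?ts j + ?tl j))"
      by (intro sum_mono tm) simp
    also have "\<dots> = real n * (4 * \<delta>\<^sup>2) + 4 * y\<^sup>2 * (\<Sum>j<n. if j \<in> bad n then 1 else 0) + 4 * ((\<Sum>j<n. ?ts j) + (\<Sum>j<n. ?tl j))"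
      by (simp only: sum.distrib sum_distrib_left[symmetric] sum_constant card_lessThan)
    also have "(\<Sum>j<n. if j \<in> bad n then 1 else 0) = real (card (bad n))"
    proof -
      have "(\<Sum>j<n. if j \<in> bad n then 1 else 0) = (\<Sum>j\<in>bad n. 1 :: real)"
        by (rule sum.mono_neutral_cong_right) (auto simp: bad_def)
      then show ?thesis by simp
    qed
    finally have "(\<Sum>j<n. (s n j - l n j)\<^sup>2) / real n \<le> (real n * (4 * \<delta>\<^sup>2) + 4 * y\<^sup>2 * real (card (bad n)) + 4 * ((\<Sum>j<n. ?ts j) + (\<Sum>j<n. ?tl j))) / real n"
      using n by (intro divide_right_mono) auto
    also have "\<dots> = 4 * \<delta>\<^sup>2 + 4 * y\<^sup>2 * (real (card (bad n)) / real n) + 4 * ((\<Sum>j<n. ?ts j) / real n + (\<Sum>j<n. ?tl j) / real n)"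
    proof -
      have "(N * a + b * r + 4 * (p + q)) / N = a + b * (r / N) + 4 * (p / N + q / N)" if "N > 0" for N a b r p q :: real
        using that by (simp add: field_simps)
      from this[OF n] show ?thesis .
    qed
    also have "\<dots> < e"
    proof -
      note budget[OF elim(1-3) \<delta>(2) e]
      then show ?thesis .
    qed
    finally show ?case using n by (simp add: sum_nonneg)
  qed
  then show "\<exists>no. \<forall>n\<ge>no. norm ((\<Sum>j<n. (s n j - l n j)\<^sup>2) / real n - 0) < e"
    by (simp add: eventually_sequentially)
qed

section \<open>Free convolution with a semicircular distribution\<close>

lemma sin_kernel_telescope:
  fixes r :: complex and \<theta> :: real
  shows "(1 + 2 * r * of_real (cos \<theta>) + r\<^sup>2) * (\<Sum>k<N. (- r) ^ k * of_real (sin (real (Suc k) * \<theta>)))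
    = of_real (sin \<theta>) - (- r) ^ N * (of_real (sin (real (Suc N) * \<theta>)) + r * of_real (sin (real N * \<theta>)))"
proof (induction N)
  case (Suc N)
  let ?s = "\<lambda>k. complex_of_real (sin (real k * \<theta>))"
  have "sin (real N * \<theta>) + sin (real (Suc (Suc N)) * \<theta>) = 2 * sin (real (Suc N) * \<theta>) * cos \<theta>"
  proof -
    have "real N * \<theta> = real (Suc N) * \<theta> - \<theta>" "real (Suc (Suc N)) * \<theta> = real (Suc N) * \<theta> + \<theta>"
      by (simp_all add: algebra_simps)
    then show ?thesis by (simp only: sin_add sin_diff)
  qed
  then have tri: "?s N + ?s (Suc (Suc N)) = 2 * ?s (Suc N) * of_real (cos \<theta>)"
    by (metis of_real_add of_real_mult of_real_numeral)
  have step: "D * (S + a * b) = s0 - (- r * a) * (d + r * b)"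
    if "D * S = s0 - a * (b + r * e)" "e + d = 2 * b * co" "D = 1 + 2 * r * co + r\<^sup>2" for D S a b s0 d e co :: complex
  proof -
    have "D * (S + a * b) = s0 - a * (b + r * e) + (1 + 2 * r * co + r\<^sup>2) * a * b"
      using that(1) unfolding that(3) by (simp only: distrib_left mult.assoc)
    also have "\<dots> = s0 - a * (r * e - r * (2 * b * co) - r\<^sup>2 * b)" by (simp add: algebra_simps)
    also have "\<dots> = s0 - (- r * a) * (d + r * b)" unfolding that(2)[symmetric] by (simp add: algebra_simps power2_eq_square)
    finally show ?thesis .
  qed
  show ?case
    unfolding sum.lessThan_Suc power_Suc by (rule step[OF Suc.IH tri refl])
qed simp

lemma sin_product_integral:
  "((\<lambda>\<theta>. sin \<theta> * sin (real (Suc k) * \<theta>)) has_integral (if k = 0 then pi / 2 else 0)) {0..pi}"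
proof (cases "k = 0")
  case True
  have "((\<lambda>\<theta>. sin \<theta> * sin \<theta>) has_integral (pi / 2 - sin pi * cos pi / 2) - (0 / 2 - sin 0 * cos 0 / 2)) {0..pi}"
  proof (rule fundamental_theorem_of_calculus)
    fix x :: real
    have "((\<lambda>\<theta>. \<theta> / 2 - sin \<theta> * cos \<theta> / 2) has_real_derivative 1 / 2 - (cos x * cos x + sin x * (- sin x)) / 2) (at x within {0..pi})"
      by (auto intro!: derivative_eq_intros)
    moreover have "1 / 2 - (cos x * cos x + sin x * (- sin x)) / 2 = sin x * sin x"
      using sin_cos_squared_add[of x] by (simp add: power2_eq_square field_simps)
    ultimately show "((\<lambda>\<theta>. \<theta> / 2 - sin \<theta> * cos \<theta> / 2) has_vector_derivative sin x * sin x) (at x within {0..pi})"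
      by (simp only: has_real_derivative_iff_has_vector_derivative)
  qed simp
  then show ?thesis using True by simp
next
  case False
  let ?F = "\<lambda>\<theta>. sin (real k * \<theta>) / (2 * real k) - sin (real (k + 2) * \<theta>) / (2 * real (k + 2))"
  have "((\<lambda>\<theta>. sin \<theta> * sin (real (Suc k) * \<theta>)) has_integral ?F pi - ?F 0) {0..pi}"
  proof (rule fundamental_theorem_of_calculus)
    fix x :: real
    have "(?F has_real_derivative cos (real k * x) * real k / (2 * real k) - cos (real (k + 2) * x) * real (k + 2) / (2 * real (k + 2))) (at x within {0..pi})"
      using False by (auto intro!: derivative_eq_intros)
    moreover have "cos (real k * x) * real k / (2 * real k) - cos (real (k + 2) * x) * real (k + 2) / (2 * real (k + 2)) = sin x * sin (real (Suc k) * x)"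
    proof -
      have c: "a * b / (2 * b) = a / 2" if "b \<noteq> 0" for a b :: real using that by simp
      have "cos (real k * x) * real k / (2 * real k) = cos (real k * x) / 2" "cos (real (k + 2) * x) * real (k + 2) / (2 * real (k + 2)) = cos (real (k + 2) * x) / 2"
        by (rule c, use False in simp)+
      moreover have "cos (real k * x) = cos (real (Suc k) * x - x)" "cos (real (k + 2) * x) = cos (real (Suc k) * x + x)"
        by (simp_all add: algebra_simps)
      moreover have "cos (y - x) / 2 - cos (y + x) / 2 = sin x * sin y" for y by (simp add: cos_add cos_diff field_simps)
      ultimately show ?thesis by (simp only:)
    qed
    ultimately show "(?F has_vector_derivative sin x * sin (real (Suc k) * x)) (at x within {0..pi})"
      by (simp only: has_real_derivative_iff_has_vector_derivative)
  qed simp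
  moreover have "?F pi - ?F 0 = 0" using sin_npi[of k] sin_npi[of "k + 2"] by simp
  ultimately show ?thesis using False by simp
qed

text \<open>Up to an error that decays geometrically, \<open>sin \<theta> / (1 + 2 r cos \<theta> + r\<^sup>2)\<close> is the sine series with
  coefficients \<open>(- r) ^ k\<close>, whose integral against \<open>sin \<theta>\<close> only sees the first term.\<close>

lemma sin_kernel_integral:
  fixes r :: complex
  assumes r: "cmod r < 1"
  shows "((\<lambda>\<theta>. of_real ((sin \<theta>)\<^sup>2) / (1 + 2 * r * of_real (cos \<theta>) + r\<^sup>2)) has_integral of_real (pi / 2)) {0..pi}"
proof -
  let ?D = "\<lambda>\<theta>. 1 + 2 * r * complex_of_real (cos \<theta>) + r\<^sup>2"
  have Dlow: "cmod (?D \<theta>) \<ge> (1 - cmod r)\<^sup>2" for \<theta>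
  proof -
    have "?D \<theta> = (1 + r * cis \<theta>) * (1 + r * cis (- \<theta>))"
      by (simp add: cis_conv_exp[symmetric] algebra_simps power2_eq_square complex_eq_iff)
    moreover have "cmod (1 + r * cis a) \<ge> 1 - cmod r" for a
      using norm_triangle_ineq2[of 1 "- (r * cis a)"] by (simp add: norm_mult)
    ultimately show ?thesis unfolding power2_eq_square using r by (simp add: norm_mult mult_mono)
  qed
  have D0: "?D \<theta> \<noteq> 0" for \<theta> using Dlow[of \<theta>] r by (metis norm_zero not_less zero_less_power diff_gt_0_iff_gt)
  let ?f = "\<lambda>\<theta>. of_real ((sin \<theta>)\<^sup>2) / ?D \<theta>"
  have "?f integrable_on {0..pi}"
    by (intro integrable_continuous_interval continuous_intros) (use D0 in auto)
  then obtain I where I: "(?f has_integral I) {0..pi}" by blast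
  define S where "S N \<theta> = (\<Sum>k<N. (- r) ^ k * of_real (sin \<theta> * sin (real (Suc k) * \<theta>)))" for N \<theta>
  have Sint: "(S (Suc N) has_integral of_real (pi / 2)) {0..pi}" for N
  proof -
    have "(S (Suc N) has_integral (\<Sum>k<Suc N. (- r) ^ k * of_real (if k = 0 then pi / 2 else 0))) {0..pi}"
      unfolding S_def by (intro has_integral_sum has_integral_mult_right has_integral_of_real sin_product_integral) auto
    moreover have "(\<Sum>k<Suc N. (- r) ^ k * of_real (if k = 0 then pi / 2 else 0)) = complex_of_real (pi / 2)"
      by (simp add: if_distrib sum.lessThan_Suc_shift cong: if_cong)
    ultimately show ?thesis by (simp only:)
  qed
  have bound: "cmod (I - of_real (pi / 2)) \<le> 2 * cmod r ^ Suc N / (1 - cmod r)\<^sup>2 * pi" for N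
  proof -
    have "((\<lambda>\<theta>. ?f \<theta> - S (Suc N) \<theta>) has_integral I - of_real (pi / 2)) (cbox 0 pi)"
      using has_integral_diff[OF I Sint] by simp
    moreover have "cmod (?f \<theta> - S (Suc N) \<theta>) \<le> 2 * cmod r ^ Suc N / (1 - cmod r)\<^sup>2" for \<theta>
    proof -
      let ?T = "(\<Sum>k<Suc N. (- r) ^ k * of_real (sin (real (Suc k) * \<theta>)))"
      let ?R = "(- r) ^ Suc N * (of_real (sin (real (Suc (Suc N)) * \<theta>)) + r * of_real (sin (real (Suc N) * \<theta>)))"
      have ST: "S (Suc N) \<theta> = of_real (sin \<theta>) * ?T" unfolding S_def sum_distrib_left by (intro sum.cong) auto
      have "?D \<theta> * ?T = of_real (sin \<theta>) - ?R" by (rule sin_kernel_telescope)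
      then have T: "?T = (of_real (sin \<theta>) - ?R) / ?D \<theta>" using D0[of \<theta>] by (simp only: nonzero_eq_divide_eq mult.commute not_False_eq_True)
      have "?f \<theta> - S (Suc N) \<theta> = of_real (sin \<theta>) * ?R / ?D \<theta>"
        unfolding ST T by (simp only: of_real_power power2_eq_square diff_divide_distrib right_diff_distrib times_divide_eq_right) simp
      then have "cmod (?f \<theta> - S (Suc N) \<theta>) = \<bar>sin \<theta>\<bar> * cmod ?R / cmod (?D \<theta>)" by (simp only: norm_divide norm_mult norm_of_real)
      also have "\<dots> \<le> 1 * (cmod r ^ Suc N * (1 + 1 * 1)) / (1 - cmod r)\<^sup>2"
      proof (intro frac_le mult_mono Dlow)
        have "cmod (of_real (sin (real (Suc (Suc N)) * \<theta>)) + r * of_real (sin (real (Suc N) * \<theta>))) \<le> \<bar>sin (real (Suc (Suc N)) * \<theta>)\<bar> + cmod r * \<bar>sin (real (Suc N) * \<theta>)\<bar>"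
          by (rule order_trans[OF norm_triangle_ineq]) (simp only: norm_mult norm_of_real order_refl)
        also have "\<dots> \<le> 1 + 1 * 1" using r by (intro add_mono mult_mono abs_sin_le_one) auto
        finally have "cmod (- r) ^ Suc N * cmod (of_real (sin (real (Suc (Suc N)) * \<theta>)) + r * of_real (sin (real (Suc N) * \<theta>))) \<le> cmod (- r) ^ Suc N * (1 + 1 * 1)"
          by (intro mult_left_mono) auto
        then show "cmod ?R \<le> cmod r ^ Suc N * (1 + 1 * 1)" by (simp only: norm_mult norm_power norm_minus_cancel)
      qed (use r in auto)
      finally show ?thesis by (simp add: mult.commute)
    qed
    ultimately have "cmod (I - of_real (pi / 2)) \<le> 2 * cmod r ^ Suc N / (1 - cmod r)\<^sup>2 * pi"
      using has_integral_bound[where f="\<lambda>\<theta>. ?f \<theta> - S (Suc N) \<theta>" and a=0 and b=pi and B="2 * cmod r ^ Suc N / (1 - cmod r)\<^sup>2"] by simp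
    then show ?thesis .
  qed
  have "(\<lambda>N. 2 * cmod r ^ Suc N / (1 - cmod r)\<^sup>2 * pi) \<longlonglongrightarrow> 2 * 0 / (1 - cmod r)\<^sup>2 * pi"
    using r by (intro tendsto_intros LIMSEQ_Suc LIMSEQ_realpow_zero) auto
  then have "cmod (I - of_real (pi / 2)) \<le> 0"
    using bound by (intro LIMSEQ_le_const[where X="\<lambda>N. 2 * cmod r ^ Suc N / (1 - cmod r)\<^sup>2 * pi"]) auto
  then have "I = of_real (pi / 2)" by simp
  then show ?thesis using I by (simp only:)
qed

text \<open>The Joukowski parametrisation \<open>z = u + v / u\<close> together with \<open>x = - 2 \<surd>v cos
  \<theta>\<close> turns the integral into the sine kernel above, with \<open>r = \<surd>v /
  u\<close>. In other words, \<open>v / u\<close> is the Voiculescu transform.\<close>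

lemma semicircle_cauchy:
  assumes v: "v > 0" and u: "Im u > 0" "cmod u > sqrt v"
  shows "Im (u + of_real v / u) > 0" and "cauchy_transform (semicircle v) (u + of_real v / u) = 1 / u"
proof -
  define z where "z = u + of_real v / u"
  define a where "a = 2 * sqrt v"
  have a: "a > 0" "a\<^sup>2 = 4 * v" using v by (auto simp: a_def power_mult_distrib)
  have un: "u \<noteq> 0" using u by auto
  have vu: "v < (cmod u)\<^sup>2"
  proof -
    have "(sqrt v)\<^sup>2 < (cmod u)\<^sup>2" using u v by (intro power_strict_mono) auto
    then show ?thesis using v by simp
  qed
  show zp: "Im (u + of_real v / u) > 0"
  proof -
    have "Im (u + of_real v / u) = Im u * (1 - v / (cmod u)\<^sup>2)"
      by (simp add: Im_divide cmod_power2 algebra_simps)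
    then show ?thesis using u vu v by (simp add: divide_less_eq)
  qed
  then have zp': "Im z > 0" by (simp add: z_def)
  let ?h = "\<lambda>x. complex_of_real (sqrt (4 * v - x\<^sup>2) / (2 * pi * v)) * (1 / (z - complex_of_real x))"
  have zn: "z - complex_of_real x \<noteq> 0" for x using shift_nonzero[OF zp', of x] by auto
  have cont: "continuous_on {-a..a} ?h" using v zn by (intro continuous_intros) auto
  have ind: "(if \<bar>x\<bar> \<le> 2 * sqrt v then sqrt (4 * v - x\<^sup>2) / (2 * pi * v) else 0) *\<^sub>R (1 / (z - complex_of_real x)) = indicator {-a..a} x *\<^sub>R ?h x" for x
    by (auto simp: a_def indicator_def scaleR_conv_of_real abs_le_iff)
  have pos: "0 \<le> (if \<bar>x\<bar> \<le> 2 * sqrt v then sqrt (4 * v - x\<^sup>2) / (2 * pi * v) else 0)" for x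
  proof -
    have "x\<^sup>2 \<le> 4 * v" if "\<bar>x\<bar> \<le> 2 * sqrt v"
    proof -
      have "\<bar>x\<bar>\<^sup>2 \<le> (2 * sqrt v)\<^sup>2" using that by (intro power_mono) auto
      then show ?thesis using v by (simp add: power_mult_distrib)
    qed
    then show ?thesis using v by auto
  qed
  have "cauchy_transform (semicircle v) z = (LINT x|lborel. (if \<bar>x\<bar> \<le> 2 * sqrt v then sqrt (4 * v - x\<^sup>2) / (2 * pi * v) else 0) *\<^sub>R (1 / (z - complex_of_real x)))"
    unfolding cauchy_transform_def semicircle_def using pos by (subst integral_density) auto
  also have "\<dots> = (LINT x:{-a..a}|lborel. ?h x)" unfolding ind set_lebesgue_integral_def ..
  also have "\<dots> = integral {-a..a} ?h"
    by (rule set_borel_integral_eq_integral(2)) (unfold set_integrable_def, rule borel_integrable_compact[OF _ cont], simp)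
  finally have G: "cauchy_transform (semicircle v) z = integral {-a..a} ?h" .
  have sub: "((\<lambda>\<theta>. (a * sin \<theta>) *\<^sub>R ?h (- a * cos \<theta>)) has_integral integral {- a * cos 0..- a * cos pi} ?h) {0..pi}"
  proof (rule has_integral_substitution[where c="-a" and d=a])
    show "(\<lambda>\<theta>. - a * cos \<theta>) ` {0..pi} \<subseteq> {- a..a}"
    proof safe
      fix \<theta> :: real
      have "\<bar>a * cos \<theta>\<bar> \<le> a * 1" unfolding abs_mult using a(1) by (intro mult_mono) auto
      then show "- a * cos \<theta> \<in> {- a..a}" by (auto simp: abs_le_iff)
    qed
    show "((\<lambda>\<theta>. - a * cos \<theta>) has_real_derivative a * sin x) (at x within {0..pi})" for x
      by (auto intro!: derivative_eq_intros)
  qed (use a cont in auto)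
  define r where "r = of_real (sqrt v) / u"
  have rn: "cmod r < 1" using u v by (simp add: r_def norm_divide divide_less_eq)
  have eq: "(a * sin \<theta>) *\<^sub>R ?h (- a * cos \<theta>) = of_real (2 / pi) * (1 / u) * (of_real ((sin \<theta>)\<^sup>2) / (1 + 2 * r * of_real (cos \<theta>) + r\<^sup>2))"
    if "\<theta> \<in> {0..pi}" for \<theta>
  proof -
    have s: "sin \<theta> \<ge> 0" using that by (auto intro: sin_ge_zero)
    have "4 * v - (- a * cos \<theta>)\<^sup>2 = (a * sin \<theta>)\<^sup>2"
      unfolding power_mult_distrib power2_minus a(2) using sin_cos_squared_add[of \<theta>] by (simp add: algebra_simps cos_squared_eq)
    then have sq: "sqrt (4 * v - (- a * cos \<theta>)\<^sup>2) = a * sin \<theta>" using s a(1) by simp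
    have den: "z - complex_of_real (- a * cos \<theta>) = u * (1 + 2 * r * of_real (cos \<theta>) + r\<^sup>2)"
    proof -
      have "u * r = of_real (sqrt v)" using un by (simp add: r_def)
      then have "u * (2 * r * of_real (cos \<theta>)) = of_real (a * cos \<theta>)" unfolding a_def of_real_mult of_real_numeral by (metis mult.assoc mult.left_commute)
      moreover have "u * r\<^sup>2 = of_real v / u"
      proof -
        have "(complex_of_real (sqrt v))\<^sup>2 = of_real v" using v by (simp flip: of_real_power)
        then show ?thesis using un by (simp add: r_def power_divide power2_eq_square[of u])
      qed
      ultimately have "u * (1 + 2 * r * of_real (cos \<theta>) + r\<^sup>2) = u + of_real (a * cos \<theta>) + of_real v / u"
        by (simp only: distrib_left mult_1_right)
      then show ?thesis by (simp add: z_def)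
    qed
    have co: "a * sin \<theta> * (a * sin \<theta> / (2 * pi * v)) = 2 / pi * (sin \<theta>)\<^sup>2"
    proof -
      have "a * sin \<theta> * (a * sin \<theta> / (2 * pi * v)) = a\<^sup>2 * (sin \<theta>)\<^sup>2 / (2 * pi * v)" by (simp add: power2_eq_square)
      then show ?thesis unfolding a(2) using v by simp
    qed
    have "(a * sin \<theta>) *\<^sub>R ?h (- a * cos \<theta>) = of_real (a * sin \<theta> * (a * sin \<theta> / (2 * pi * v))) * (1 / (z - complex_of_real (- a * cos \<theta>)))"
      unfolding sq scaleR_conv_of_real of_real_mult by (simp only: mult.assoc)
    also have "\<dots> = of_real (2 / pi) * (1 / u) * (of_real ((sin \<theta>)\<^sup>2) / (1 + 2 * r * of_real (cos \<theta>) + r\<^sup>2))"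
      unfolding co den unfolding of_real_mult by (simp only: times_divide_times_eq mult_1_right mult_1_left mult.assoc divide_divide_eq_left times_divide_eq_right times_divide_eq_left)
    finally show ?thesis .
  qed
  have "((\<lambda>\<theta>. of_real (2 / pi) * (1 / u) * (of_real ((sin \<theta>)\<^sup>2) / (1 + 2 * r * of_real (cos \<theta>) + r\<^sup>2))) has_integral integral {-a..a} ?h) {0..pi}"
    using sub by (subst has_integral_cong[OF eq[symmetric]]) auto
  moreover have "((\<lambda>\<theta>. of_real (2 / pi) * (1 / u) * (of_real ((sin \<theta>)\<^sup>2) / (1 + 2 * r * of_real (cos \<theta>) + r\<^sup>2))) has_integral of_real (2 / pi) * (1 / u) * of_real (pi / 2)) {0..pi}"
    by (intro has_integral_mult_right sin_kernel_integral rn)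
  ultimately have "integral {-a..a} ?h = of_real (2 / pi) * (1 / u) * of_real (pi / 2)" by (rule has_integral_unique)
  then show "cauchy_transform (semicircle v) (u + of_real v / u) = 1 / u" using G by (simp add: z_def)
qed


text \<open>In the variable \<open>\<zeta> = 1 / z\<close> the Cauchy transform is a holomorphic function
  \<open>g\<close> near \<open>0\<close> with \<open>g 0 = 0\<close> and \<open>g' 0 = 1\<close>,
  which can be inverted. Since \<open>g \<zeta> - \<zeta> = O(\<zeta>\<^sup>2)\<close>, the
  transform \<open>\<phi>\<close> is even bounded.\<close>

lemma compact_support_voiculescu:
  assumes "real_distribution H" and K: "K > 0" and supp: "AE x in H. \<bar>x\<bar> \<le> K"
  obtains \<beta> \<phi> where "\<beta> > 0" "\<phi> holomorphic_on {z. cmod z > \<beta>}" "\<And>z. cmod z > \<beta> \<Longrightarrow> cmod (\<phi> z) \<le> 4 * K"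
    "\<And>z. cmod z > \<beta> \<Longrightarrow> cauchy_transform H (z + \<phi> z) = 1 / z"
proof -
  interpret real_distribution H by fact
  let ?B = "ball (0::complex) (1 / (4 * K))"
  let ?k = "\<lambda>x \<zeta>. 1 / (1 - \<zeta> * complex_of_real x)"
  define g where "g \<zeta> = (LINT x|H. \<zeta> * ?k x \<zeta>)" for \<zeta> :: complex
  have B: "4 * K * cmod \<zeta> \<le> 1" if "\<zeta> \<in> ?B" for \<zeta> using that K by (simp add: field_simps)
  have den: "cmod (1 - \<zeta> * complex_of_real x) \<ge> 1 / 2" if "\<zeta> \<in> ?B" "\<bar>x\<bar> \<le> K" for \<zeta> x
  proof -
    have "cmod (\<zeta> * complex_of_real x) \<le> cmod \<zeta> * K" using that(2) by (simp add: norm_mult mult_left_mono)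
    also have "\<dots> \<le> 1 / 4" using B[OF that(1)] by (simp add: algebra_simps)
    finally show ?thesis using norm_triangle_ineq2[of 1 "\<zeta> * complex_of_real x"] by simp
  qed
  have nz: "1 - \<zeta> * complex_of_real x \<noteq> 0" if "\<zeta> \<in> ?B" "\<bar>x\<bar> \<le> K" for \<zeta> x using den[OF that] by auto
  have kb: "cmod (?k x \<zeta>) \<le> 2" if "\<zeta> \<in> ?B" "\<bar>x\<bar> \<le> K" for \<zeta> x
    using den[OF that] by (simp add: norm_divide divide_le_eq)
  have int: "integrable H f" if m: "f \<in> borel_measurable borel" and b: "\<And>x. \<bar>x\<bar> \<le> K \<Longrightarrow> cmod (f x) \<le> c" for f c
  proof (rule integrable_const_bound[of _ c])
    show "AE x in H. norm (f x) \<le> c" using supp by eventually_elim (rule b)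
    show "f \<in> borel_measurable H" using m by (rule borel_measurable_M)
  qed
  have ib: "cmod (LINT x|H. f x) \<le> c" if m: "f \<in> borel_measurable borel" and b: "\<And>x. \<bar>x\<bar> \<le> K \<Longrightarrow> cmod (f x) \<le> c" for f c
  proof -
    have "cmod (LINT x|H. f x) \<le> (LINT x|H. cmod (f x))" by (rule integral_norm_bound)
    also have "\<dots> \<le> (LINT x|H. c)"
      using supp by (intro integral_mono_AE integrable_norm int[OF m b]) (auto elim!: eventually_mono intro: b)
    finally show ?thesis by (simp add: prob_UNIV)
  qed
  have kint: "integrable H (\<lambda>x. \<zeta> * ?k x \<zeta>)" if "\<zeta> \<in> ?B" for \<zeta>
    by (rule int[of _ "cmod \<zeta> * 2"], simp, unfold norm_mult, intro mult_left_mono kb[OF that]) auto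
  have dg: "(g has_field_derivative (LINT x|H. ?k x \<zeta> * ?k x \<zeta>)) (at \<zeta>)" if z: "\<zeta> \<in> ?B" for \<zeta>
    unfolding has_field_derivative_iff
  proof (rule Lim_transform_within_open[OF _ open_ball z])
    fix y assume y: "y \<in> ?B" "y \<noteq> \<zeta>"
    have "g y - g \<zeta> = (LINT x|H. y * ?k x y - \<zeta> * ?k x \<zeta>)"
      unfolding g_def using y z by (intro Bochner_Integration.integral_diff[symmetric] kint)
    also have "\<dots> = (LINT x|H. (y - \<zeta>) * (?k x y * ?k x \<zeta>))"
    proof (rule integral_cong_AE)
      show "AE x in H. y * ?k x y - \<zeta> * ?k x \<zeta> = (y - \<zeta>) * (?k x y * ?k x \<zeta>)"
        using supp by eventually_elim (use nz y z in \<open>simp add: field_simps\<close>)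
    qed (auto intro!: borel_measurable_M)
    also have "\<dots> = (y - \<zeta>) * (LINT x|H. ?k x y * ?k x \<zeta>)" by (rule integral_mult_right_zero)
    finally show "(LINT x|H. ?k x y * ?k x \<zeta>) = (g y - g \<zeta>) / (y - \<zeta>)" using y by simp
  next
    show "((\<lambda>y. LINT x|H. ?k x y * ?k x \<zeta>) \<longlongrightarrow> (LINT x|H. ?k x \<zeta> * ?k x \<zeta>)) (at \<zeta>)"
    proof (rule Lim_transform2[OF tendsto_const], rule Lim_null_comparison)
      have kk: "integrable H (\<lambda>x. ?k x y * ?k x \<zeta>)" if "y \<in> ?B" for y
        by (rule int[of _ "2 * 2"], simp, unfold norm_mult, intro mult_mono kb that z) auto
      have "cmod ((LINT x|H. ?k x \<zeta> * ?k x \<zeta>) - (LINT x|H. ?k x y * ?k x \<zeta>)) \<le> 8 * (cmod (\<zeta> - y) * K)" if y: "y \<in> ?B" for y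
      proof -
        have "(LINT x|H. ?k x \<zeta> * ?k x \<zeta>) - (LINT x|H. ?k x y * ?k x \<zeta>) = (LINT x|H. ?k x \<zeta> * ?k x \<zeta> - ?k x y * ?k x \<zeta>)"
          by (intro Bochner_Integration.integral_diff[symmetric] kk y z)
        moreover have "cmod (LINT x|H. ?k x \<zeta> * ?k x \<zeta> - ?k x y * ?k x \<zeta>) \<le> 8 * (cmod (\<zeta> - y) * K)"
        proof (rule ib)
          fix x assume x: "\<bar>x\<bar> \<le> K"
          have "?k x \<zeta> * ?k x \<zeta> - ?k x y * ?k x \<zeta> = (?k x \<zeta> * ?k x \<zeta> * ?k x y) * ((\<zeta> - y) * of_real x)"
          proof -
            have "1 / a * (1 / a) - 1 / b * (1 / a) = (1 / a * (1 / a) * (1 / b)) * (b - a)" if "a \<noteq> 0" "b \<noteq> 0" for a b :: complex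
              using that by (simp add: field_simps)
            from this[OF nz[OF z x] nz[OF y x]] show ?thesis by (simp only: left_diff_distrib diff_diff_eq2 diff_add_cancel add_diff_cancel_left' diff_diff_eq add_diff_cancel_left) (simp add: algebra_simps)?
          qed
          also have "cmod \<dots> \<le> (2 * 2 * 2) * (cmod (\<zeta> - y) * K)"
            unfolding norm_mult by (intro mult_mono kb z y x) (use x in auto)
          finally show "cmod (?k x \<zeta> * ?k x \<zeta> - ?k x y * ?k x \<zeta>) \<le> 8 * (cmod (\<zeta> - y) * K)" by simp
        qed simp
        ultimately show ?thesis by simp
      qed
      then show "\<forall>\<^sub>F y in at \<zeta>. norm ((LINT x|H. ?k x \<zeta> * ?k x \<zeta>) - (LINT x|H. ?k x y * ?k x \<zeta>)) \<le> 8 * (cmod (\<zeta> - y) * K)"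
        using eventually_at_in_open'[OF open_ball z] by (rule_tac eventually_mono)
      have "((\<lambda>y. 8 * (cmod (\<zeta> - y) * K)) \<longlongrightarrow> 8 * (cmod (\<zeta> - \<zeta>) * K)) (at \<zeta>)" by (intro tendsto_intros)
      then show "((\<lambda>y. 8 * (cmod (\<zeta> - y) * K)) \<longlongrightarrow> 0) (at \<zeta>)" by simp
    qed
  qed
  have hol: "g holomorphic_on ?B" unfolding holomorphic_on_open[OF open_ball] using dg by blast
  have z0: "0 \<in> ?B" using K by simp
  have "deriv g 0 = 1" using DERIV_imp_deriv[OF dg[OF z0]] by (simp add: prob_UNIV)
  then obtain \<rho> where \<rho>: "\<rho> > 0" "ball 0 \<rho> \<subseteq> ?B" "open (g ` ball 0 \<rho>)" "inj_on g (ball 0 \<rho>)"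
    using has_complex_derivative_locally_invertible[OF hol z0 open_ball] by auto
  have holr: "g holomorphic_on ball 0 \<rho>" using hol \<rho>(2) by (rule holomorphic_on_subset)
  obtain k where k: "k holomorphic_on g ` ball 0 \<rho>" "\<And>\<zeta>. \<zeta> \<in> ball 0 \<rho> \<Longrightarrow> k (g \<zeta>) = \<zeta>"
    using holomorphic_has_inverse[OF holr open_ball \<rho>(4)] by metis
  have g0: "g 0 = 0" by (simp add: g_def)
  have "0 \<in> g ` ball 0 \<rho>" using \<rho>(1) g0 by (auto intro!: image_eqI[of _ _ 0])
  then obtain \<delta> where \<delta>: "\<delta> > 0" "ball 0 \<delta> \<subseteq> g ` ball 0 \<rho>" using \<rho>(3) open_contains_ball by metis
  define \<phi> where "\<phi> z = 1 / k (1 / z) - z" for z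
  have main: "1 / z \<in> g ` ball 0 \<rho> \<and> k (1 / z) \<in> ball 0 \<rho> \<and> k (1 / z) \<noteq> 0 \<and> g (k (1 / z)) = 1 / z" if z: "cmod z > 1 / \<delta>" for z
  proof -
    have "cmod z > 0" using z \<delta>(1) by (smt (verit) zero_less_divide_1_iff)
    then have "1 / z \<in> ball 0 \<delta>" "1 / z \<noteq> 0" using z \<delta>(1) by (auto simp: norm_divide field_simps)
    then obtain \<zeta> where h: "\<zeta> \<in> ball 0 \<rho>" "g \<zeta> = 1 / z" using \<delta>(2) by (metis imageE subsetD)
    then have "k (1 / z) = \<zeta>" using k(2)[OF h(1)] by simp
    moreover have "\<zeta> \<noteq> 0" using g0 h(2) \<open>1 / z \<noteq> 0\<close> by metis
    ultimately show ?thesis using h by (metis imageI)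
  qed
  show thesis
  proof (rule that[of "1 / \<delta>" \<phi>])
    show "1 / \<delta> > 0" using \<delta> by simp
    have "(\<lambda>z. k (1 / z)) holomorphic_on {z. cmod z > 1 / \<delta>}"
    proof (rule holomorphic_on_compose_gen[OF _ k(1), unfolded o_def])
      show "(\<lambda>z. 1 / z) holomorphic_on {z. 1 / \<delta> < cmod z}" using \<delta> by (intro holomorphic_intros) auto
      show "(\<lambda>z. 1 / z) ` {z. 1 / \<delta> < cmod z} \<subseteq> g ` ball 0 \<rho>" using main by blast
    qed
    then show "\<phi> holomorphic_on {z. cmod z > 1 / \<delta>}" unfolding \<phi>_def using main by (intro holomorphic_intros) auto
    fix z assume z: "cmod z > 1 / \<delta>"
    define \<zeta> where "\<zeta> = k (1 / z)"
    have \<zeta>: "\<zeta> \<in> ball 0 \<rho>" "\<zeta> \<noteq> 0" "g \<zeta> = 1 / z" using main[OF z] by (simp_all add: \<zeta>_def)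
    have \<zeta>B: "\<zeta> \<in> ?B" using \<zeta>(1) \<rho>(2) by blast
    have zn: "z \<noteq> 0" using z \<delta> by auto
    have zp: "z + \<phi> z = 1 / \<zeta>" by (simp add: \<phi>_def \<zeta>_def)
    have "cauchy_transform H (1 / \<zeta>) = g \<zeta>"
      unfolding cauchy_transform_def g_def
      by (intro Bochner_Integration.integral_cong refl) (use \<zeta>(2) in \<open>simp add: field_simps\<close>)
    then show "cauchy_transform H (z + \<phi> z) = 1 / z" using zp \<zeta>(3) by simp
    have "g \<zeta> - \<zeta> = (LINT x|H. \<zeta> * ?k x \<zeta> - \<zeta>)" unfolding g_def using Bochner_Integration.integral_diff[OF kint[OF \<zeta>B] integrable_const[of \<zeta>]] by (simp add: prob_UNIV)
    also have "\<dots> = (LINT x|H. \<zeta> * \<zeta> * (of_real x * ?k x \<zeta>))"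
    proof (rule integral_cong_AE)
      show "AE x in H. \<zeta> * ?k x \<zeta> - \<zeta> = \<zeta> * \<zeta> * (of_real x * ?k x \<zeta>)"
        using supp by eventually_elim (use nz[OF \<zeta>B] in \<open>simp add: field_simps\<close>)
    qed (auto intro!: borel_measurable_M)
    also have "\<dots> = \<zeta> * \<zeta> * (LINT x|H. of_real x * ?k x \<zeta>)" by (rule integral_mult_right_zero)
    finally have gd: "g \<zeta> - \<zeta> = \<zeta> * \<zeta> * (LINT x|H. of_real x * ?k x \<zeta>)" .
    have I: "cmod (LINT x|H. of_real x * ?k x \<zeta>) \<le> K * 2"
      by (rule ib, simp, unfold norm_mult, intro mult_mono kb \<zeta>B) (use K in auto)
    have "cmod (g \<zeta> - \<zeta>) \<le> cmod \<zeta> * cmod \<zeta> * (K * 2)" unfolding gd norm_mult by (intro mult_left_mono I) auto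
    also have "\<dots> = cmod \<zeta> * (4 * K * cmod \<zeta>) / 2" by simp
    also have "\<dots> \<le> cmod \<zeta> * 1 / 2" using B[OF \<zeta>B] by (intro divide_right_mono mult_left_mono) auto
    finally have "cmod (g \<zeta>) \<ge> cmod \<zeta> / 2" using norm_triangle_ineq2[of \<zeta> "\<zeta> - g \<zeta>"] by (simp add: norm_minus_commute)
    then have "cmod (\<zeta> * g \<zeta>) \<ge> cmod \<zeta> * (cmod \<zeta> / 2)" unfolding norm_mult by (intro mult_left_mono) auto
    moreover have "\<phi> z = (g \<zeta> - \<zeta>) / (\<zeta> * g \<zeta>)"
      using zp \<zeta>(2,3) zn by (simp add: diff_divide_distrib algebra_simps)
    ultimately have "cmod (\<phi> z) \<le> cmod \<zeta> * cmod \<zeta> * (K * 2) / (cmod \<zeta> * (cmod \<zeta> / 2))"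
      using \<open>cmod (g \<zeta> - \<zeta>) \<le> cmod \<zeta> * cmod \<zeta> * (K * 2)\<close> \<zeta>(2) K by (simp only: norm_divide) (intro frac_le, auto)
    also have "\<dots> = 4 * K" using \<zeta>(2) by simp
    finally show "cmod (\<phi> z) \<le> 4 * K" .
  qed
qed

text \<open>The normalisation of Voiculescu transforms at infinity is automatic for bounded ones.\<close>

lemma tendsto_bounded_over_id:
  assumes "\<And>z. cmod z > \<beta> \<Longrightarrow> cmod (f z) \<le> C"
  shows "((\<lambda>z. f z / z) \<longlongrightarrow> 0) (inf at_infinity (principal (S :: complex set)))"
proof (rule filterlim_mono[OF _ order_refl inf_le1])
  show "((\<lambda>z. f z / z) \<longlongrightarrow> 0) at_infinity"
  proof (rule Lim_null_comparison)
    have "\<forall>\<^sub>F z in at_infinity. max \<beta> 0 + 1 \<le> cmod z" unfolding eventually_at_infinity by blast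
    then show "\<forall>\<^sub>F z in at_infinity. norm (f z / z) \<le> C / cmod z"
      by eventually_elim (use assms in \<open>auto simp: norm_divide intro!: divide_right_mono\<close>)
    show "((\<lambda>z. C / cmod z) \<longlongrightarrow> 0) at_infinity" by (intro tendsto_divide_0[OF tendsto_const] filterlim_at_top_imp_at_infinity filterlim_norm_at_top)
  qed
qed

text \<open>Let \<open>\<phi>\<close> be the Voiculescu transform of \<open>H\<close>. At \<open>w = z + \<phi>
  z\<close> the Cauchy transform of \<open>H\<close> is \<open>1 / z\<close>, so the equation says
  that the one of \<open>\<nu>\<close> is \<open>1 / z\<close> at \<open>w - v / z\<close>. Hence
  \<open>\<nu>\<close> has the Voiculescu transform \<open>\<phi> z - v / z\<close>, and \<open>v /
  z\<close> is the one of the semicircular distribution.\<close>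

lemma free_conv_of_equation:
  assumes H: "real_distribution H" and K: "K > 0" and supp: "AE x in H. \<bar>x\<bar> \<le> K" and v: "v > 0"
    and eq: "\<And>W. Im W > c0 \<Longrightarrow> SM H W = SM \<nu> (W + of_real v * SM H W)"
  shows "is_free_additive_convolution (semicircle v) \<nu> H"
proof -
  obtain \<beta>0 \<phi> where \<phi>: "\<beta>0 > 0" "\<phi> holomorphic_on {z. cmod z > \<beta>0}" "\<And>z. cmod z > \<beta>0 \<Longrightarrow> cmod (\<phi> z) \<le> 4 * K"
    "\<And>z. cmod z > \<beta>0 \<Longrightarrow> cauchy_transform H (z + \<phi> z) = 1 / z"
    using compact_support_voiculescu[OF H K supp] by metis
  define \<beta> where "\<beta> = \<beta>0 + 4 * K + \<bar>c0\<bar> + sqrt v"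
  have \<beta>: "\<beta> > 0" "\<beta> > \<beta>0" "\<beta> > 4 * K" "\<beta> > c0 + 4 * K" "\<beta> > sqrt v"
    using \<phi>(1) K real_sqrt_gt_zero[OF v] unfolding \<beta>_def by linarith+
  define \<psi> where "\<psi> z = \<phi> z - of_real v / z" for z
  have cone: "Im z > \<beta> \<and> cmod z > \<beta> \<and> z \<noteq> 0" if "z \<in> truncated_cone 1 \<beta>" for z
    using that \<beta>(1) abs_Im_le_cmod[of z] by (auto simp: truncated_cone_def)
  have GS: "cauchy_transform \<mu> z = - SM \<mu> z" for \<mu> z
    unfolding cauchy_transform_def SM_def Bochner_Integration.integral_minus[symmetric]
    by (intro Bochner_Integration.integral_cong refl) (metis minus_diff_eq divide_minus_right)
  have hsub: "\<phi> holomorphic_on truncated_cone 1 \<beta>"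
    by (rule holomorphic_on_subset[OF \<phi>(2)]) (use cone \<beta>(2) in force)
  have Wim: "Im (z + \<phi> z) > 0 \<and> Im (z + \<phi> z) > c0" if z: "z \<in> truncated_cone 1 \<beta>" for z
  proof -
    have "\<bar>Im (\<phi> z)\<bar> \<le> 4 * K" using \<phi>(3)[of z] cone[OF z] \<beta>(2) abs_Im_le_cmod[of "\<phi> z"] by linarith
    then show ?thesis using cone[OF z] \<beta>(3,4) by (simp add: abs_le_iff)
  qed
  have "voiculescu_transform_on (semicircle v) 1 \<beta> (\<lambda>z. of_real v / z)"
    unfolding voiculescu_transform_on_def
  proof (intro conjI ballI)
    show "(\<lambda>z. of_real v / z) holomorphic_on truncated_cone 1 \<beta>" using cone by (intro holomorphic_intros) auto
    show "((\<lambda>z. of_real v / z / z) \<longlongrightarrow> 0) (inf at_infinity (principal (truncated_cone 1 \<beta>)))"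
    proof (rule tendsto_bounded_over_id[of 1 _ v])
      fix z :: complex assume "cmod z > 1"
      then have "v / cmod z \<le> v / 1" using v by (intro divide_left_mono) auto
      then show "cmod (of_real v / z) \<le> v" using v by (simp add: norm_divide)
    qed
    fix z assume z: "z \<in> truncated_cone 1 \<beta>"
    have u: "Im z > 0" "cmod z > sqrt v" using cone[OF z] \<beta> by auto
    show "0 < Im (z + of_real v / z)" by (rule semicircle_cauchy(1)[OF v u])
    show "reciprocal_cauchy (semicircle v) (z + of_real v / z) = z"
      unfolding reciprocal_cauchy_def semicircle_cauchy(2)[OF v u] by simp
  qed
  moreover have "voiculescu_transform_on \<nu> 1 \<beta> \<psi>"
    unfolding voiculescu_transform_on_def
  proof (intro conjI ballI)
    show "\<psi> holomorphic_on truncated_cone 1 \<beta>" unfolding \<psi>_def using cone by (intro holomorphic_intros hsub) auto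
    show "((\<lambda>z. \<psi> z / z) \<longlongrightarrow> 0) (inf at_infinity (principal (truncated_cone 1 \<beta>)))"
    proof (rule tendsto_bounded_over_id[of "max \<beta>0 1" _ "4 * K + v"])
      fix z :: complex assume z: "cmod z > max \<beta>0 1"
      then have "v / cmod z \<le> v / 1" using v by (intro divide_left_mono) auto
      then have "cmod (of_real v / z) \<le> v" using v by (simp add: norm_divide)
      moreover have "cmod (\<phi> z) \<le> 4 * K" using z \<phi>(3) by simp
      ultimately show "cmod (\<psi> z) \<le> 4 * K + v" unfolding \<psi>_def using norm_triangle_ineq4[of "\<phi> z" "of_real v / z"] by linarith
    qed
    fix z assume z: "z \<in> truncated_cone 1 \<beta>"
    have zn: "z \<noteq> 0" "Im z > 0" "cmod z > \<beta>0" using cone[OF z] \<beta> by auto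
    have "Im (of_real v / z) \<le> 0" using v zn by (simp add: Im_divide divide_nonpos_nonneg)
    then show "0 < Im (z + \<psi> z)" using Wim[OF z] by (simp add: \<psi>_def)
    have S: "SM H (z + \<phi> z) = - (1 / z)" using \<phi>(4)[OF zn(3)] GS[of H "z + \<phi> z"] by (metis minus_minus)
    have "SM \<nu> (z + \<psi> z) = - (1 / z)"
      using eq[of "z + \<phi> z"] Wim[OF z] unfolding S \<psi>_def by (simp add: algebra_simps)
    then show "reciprocal_cauchy \<nu> (z + \<psi> z) = z" by (simp add: reciprocal_cauchy_def GS)
  qed
  moreover have "voiculescu_transform_on H 1 \<beta> (\<lambda>z. of_real v / z + \<psi> z)"
  proof -
    have e: "(\<lambda>z. of_real v / z + \<psi> z) = \<phi>" by (auto simp: \<psi>_def)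
    show ?thesis
      unfolding voiculescu_transform_on_def e
    proof (intro conjI ballI)
      show "((\<lambda>z. \<phi> z / z) \<longlongrightarrow> 0) (inf at_infinity (principal (truncated_cone 1 \<beta>)))"
        by (rule tendsto_bounded_over_id[OF \<phi>(3)])
      fix z assume z: "z \<in> truncated_cone 1 \<beta>"
      show "0 < Im (z + \<phi> z)" using Wim[OF z] by simp
      show "reciprocal_cauchy H (z + \<phi> z) = z" using \<phi>(4)[of z] cone[OF z] \<beta>(2) by (simp add: reciprocal_cauchy_def)
    qed (rule hsub)
  qed
  ultimately show ?thesis
    unfolding is_free_additive_convolution_def using \<beta>(1) by (intro exI[of _ 1] exI[of _ \<beta>] exI[of _ "\<lambda>z. of_real v / z"] exI[of _ \<psi>] conjI) simp_all
qed

section \<open>Decreasing diagonals, uniformly\<close>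

abbreviation dg :: "(nat \<Rightarrow> real) \<Rightarrow> nat \<Rightarrow> nat \<Rightarrow> real" where
  "dg t \<equiv> (\<lambda>i j. if i = j then t i else 0)"

lemma L2_set_le_of_sum: "(\<Sum>i<n. (f i)\<^sup>2) \<le> c\<^sup>2 \<Longrightarrow> 0 \<le> c \<Longrightarrow> L2_set f {..<n} \<le> c"
  unfolding L2_set_def using real_sqrt_le_mono[of "\<Sum>i<n. (f i)\<^sup>2" "c\<^sup>2"] by simp

text \<open>Columns of the first resolvent and rows of the second have Euclidean norm at most \<open>1 /
  v\<close>, so each diagonal position contributes at most \<open>\<bar>d k\<bar> /
  v\<^sup>2\<close>. A bound in mean absolute deviation, not in the maximum, is essential for
  approximating unbounded diagonals.\<close>

lemma ST_diagonal_perturbation: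
  assumes X: "symk n X" and Y: "symk n Y" and z: "Im z \<ge> v" "v > 0"
    and d: "\<And>i j. i < n \<Longrightarrow> j < n \<Longrightarrow> Y i j - X i j = dg d i j"
  shows "cmod (ST n X z - ST n Y z) \<le> (\<Sum>k<n. \<bar>d k\<bar>) / real n / v\<^sup>2"
proof -
  let ?G = "resolvent n X z" let ?H = "resolvent n Y z"
  have zp: "Im z > 0" using z by simp
  have bd: "op_bdd n ?G (1 / v)" "op_bdd n ?H (1 / v)"
    using z by (auto intro!: op_bdd_mono[OF resolvent_op_bdd[OF X zp]] op_bdd_mono[OF resolvent_op_bdd[OF Y zp]] frac_le)
  have "(\<Sum>i<n. ?G i i) - (\<Sum>i<n. ?H i i) = (\<Sum>i<n. \<Sum>k<n. of_real (d k) * (?G i k * ?H k i))"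
    unfolding sum_subtractf[symmetric]
  proof (intro sum.cong refl)
    fix i assume "i \<in> {..<n}"
    then have i: "i < n" by simp
    have "?G i i - ?H i i = (\<Sum>k<n. \<Sum>l<n. ?G i k * (complex_of_real (Y k l - X k l) - (if k = l then z - z else 0)) * ?H l i)"
      by (rule resolvent_identity[OF X zp Y zp i i])
    also have "\<dots> = (\<Sum>k<n. \<Sum>l<n. if l = k then of_real (d k) * (?G i k * ?H k i) else 0)"
      by (intro sum.cong refl) (auto simp: d)
    also have "\<dots> = (\<Sum>k<n. of_real (d k) * (?G i k * ?H k i))" by simp
    finally show "?G i i - ?H i i = (\<Sum>k<n. of_real (d k) * (?G i k * ?H k i))" .
  qed
  also have "\<dots> = (\<Sum>k<n. of_real (d k) * (\<Sum>i<n. ?G i k * ?H k i))"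
    unfolding sum_distrib_left by (rule sum.swap)
  finally have e: "ST n X z - ST n Y z = (\<Sum>k<n. of_real (d k) * (\<Sum>i<n. ?G i k * ?H k i)) / of_nat n"
    unfolding ST_def ntrace_def diff_divide_distrib[symmetric] by (rule arg_cong)
  have "cmod (\<Sum>k<n. of_real (d k) * (\<Sum>i<n. ?G i k * ?H k i)) \<le> (\<Sum>k<n. \<bar>d k\<bar> * (1 / v * (1 / v)))"
  proof (rule sum_norm_le)
    fix k assume "k \<in> {..<n}"
    then have k: "k < n" by simp
    have "(\<Sum>i<n. (cmod (?H k i))\<^sup>2) = (\<Sum>i<n. (cmod (?H i k))\<^sup>2)"
      using resolvent_sym[OF Y zp] k by (intro sum.cong refl) (auto simp: symk_def)
    then have "(\<Sum>i<n. (cmod (?H k i))\<^sup>2) \<le> (1 / v)\<^sup>2" using op_bdd_col[OF bd(2) k] by (simp only:)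
    then have h: "L2_set (\<lambda>i. cmod (?H k i)) {..<n} \<le> 1 / v" using z by (intro L2_set_le_of_sum) auto
    have g: "L2_set (\<lambda>i. cmod (?G i k)) {..<n} \<le> 1 / v"
      using op_bdd_col[OF bd(1) k] z by (intro L2_set_le_of_sum) auto
    have "cmod (\<Sum>i<n. ?G i k * ?H k i) \<le> L2_set (\<lambda>i. cmod (?G i k)) {..<n} * L2_set (\<lambda>i. cmod (?H k i)) {..<n}"
      by (rule norm_sum_mult_le_L2)
    also have "\<dots> \<le> 1 / v * (1 / v)" using z by (intro mult_mono g h) auto
    finally show "cmod (of_real (d k) * (\<Sum>i<n. ?G i k * ?H k i)) \<le> \<bar>d k\<bar> * (1 / v * (1 / v))"
      unfolding norm_mult norm_of_real by (intro mult_left_mono) auto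
  qed
  also have "\<dots> = (\<Sum>k<n. \<bar>d k\<bar>) / v\<^sup>2" by (simp add: sum_distrib_right[symmetric] sum_divide_distrib[symmetric] power2_eq_square)
  finally have "cmod (\<Sum>k<n. of_real (d k) * (\<Sum>i<n. ?G i k * ?H k i)) / real n \<le> (\<Sum>k<n. \<bar>d k\<bar>) / v\<^sup>2 / real n"
    by (rule divide_right_mono) simp
  then show ?thesis unfolding e norm_divide by (simp add: mult.commute)
qed

lemma ST_diagonal:
  assumes z: "Im z > 0" shows "ST n (dg t) z = stj n t z"
proof -
  have s: "symk n (dg t)" by (auto simp: symk_def)
  have "resolvent n (dg t) z i i = 1 / (complex_of_real (t i) - z)" if i: "i < n" for i
  proof -
    have one: "(\<Sum>k<n. (complex_of_real (dg t i k) - (if i = k then z else 0)) * resolvent n (dg t) z k i) = 1"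
      using shifted_resolvent[OF s z i i] by (simp only: refl if_True)
    have "(\<Sum>k<n. (complex_of_real (dg t i k) - (if i = k then z else 0)) * resolvent n (dg t) z k i)
        = (\<Sum>k<n. if k = i then (complex_of_real (t i) - z) * resolvent n (dg t) z i i else 0)"
      by (intro sum.cong refl) auto
    also have "\<dots> = (complex_of_real (t i) - z) * resolvent n (dg t) z i i" using i by (simp only: sum.delta finite_lessThan lessThan_iff if_True)
    finally have "resolvent n (dg t) z i i * (complex_of_real (t i) - z) = 1" using one by (simp only: mult.commute)
    then show ?thesis using shift_nonzero[OF z, of "t i"] by (simp only: nonzero_eq_divide_eq not_False_eq_True)
  qed
  then show ?thesis by (simp add: ST_def ntrace_def stj_def)
qed

lemma stj_perturbation:
  assumes z: "Im z > 0"
  shows "cmod (stj n x z - stj n y z) \<le> sqrt ((\<Sum>j<n. (x j - y j)\<^sup>2) / real n) / (Im z)\<^sup>2"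
proof -
  have s: "symk n (dg x)" "symk n (dg y)" by (auto simp: symk_def)
  let ?d = "(\<Sum>k<n. \<bar>y k - x k\<bar>) / real n"
  have "cmod (ST n (dg x) z - ST n (dg y) z) \<le> ?d / (Im z)\<^sup>2"
    by (rule ST_diagonal_perturbation[OF s order_refl z]) auto
  moreover have "?d \<le> sqrt ((\<Sum>j<n. (x j - y j)\<^sup>2) / real n)"
  proof (rule real_le_rsqrt)
    have "(\<Sum>k<n. \<bar>y k - x k\<bar> * 1)\<^sup>2 \<le> (\<Sum>k<n. \<bar>y k - x k\<bar>\<^sup>2) * (\<Sum>k<n. 1\<^sup>2)" by (rule Cauchy_Schwarz_ineq_sum)
    then have "(\<Sum>k<n. \<bar>y k - x k\<bar>)\<^sup>2 \<le> (\<Sum>k<n. (x k - y k)\<^sup>2) * real n" by (simp add: power2_commute)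
    then have "(\<Sum>k<n. \<bar>y k - x k\<bar>)\<^sup>2 / (real n)\<^sup>2 \<le> ((\<Sum>k<n. (x k - y k)\<^sup>2) * real n) / (real n)\<^sup>2"
      by (rule divide_right_mono) simp
    moreover have "a * b / b\<^sup>2 = a / b" for a b :: real by (simp add: power2_eq_square)
    ultimately show "?d\<^sup>2 \<le> (\<Sum>j<n. (x j - y j)\<^sup>2) / real n" unfolding power_divide by (simp only:)
  qed
  ultimately show ?thesis
    unfolding ST_diagonal[OF z] by (rule order_trans[OF _ divide_right_mono]) simp
qed

text \<open>One of countably many deterministic profiles, stretched to length \<open>n\<close>: block
  \<open>i\<close> of \<open>length ps\<close> blocks, equally long up to rounding, carries the
  rational value \<open>ps ! i / length ps\<close>.\<close>

definition step :: "int list \<Rightarrow> nat \<Rightarrow> nat \<Rightarrow> real" where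
  "step ps n j = real_of_int (ps ! (j * length ps div n)) / real (length ps)"

text \<open>The index \<open>j\<close> is compared with the start of its block, rounded down. The oscillation of
  a decreasing sequence over a block is the difference of its end values, and these differences
  telescope.\<close>

lemma block_oscillation:
  fixes c :: "nat \<Rightarrow> real"
  assumes anti: "antimono c" and n: "n \<ge> 1" and m: "m \<ge> 1"
  shows "(\<Sum>j<n. \<bar>c j - c ((j * m div n) * n div m)\<bar>) \<le> (real n / real m + 2) * (c 0 - c n)"
proof -
  define s where "s i = i * n div m" for i
  let ?b = "\<lambda>j. j * m div n"
  have loc: "s (?b j) \<le> j \<and> j \<le> s (Suc (?b j))" for j
  proof
    have "?b j * n \<le> j * m" by simp
    then show "s (?b j) \<le> j" unfolding s_def using m by (metis div_le_mono nonzero_mult_div_cancel_right not_one_le_zero)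
    have "j * m < Suc (?b j) * n" using n by (metis dividend_less_times_div mult.commute mult_Suc_right not_one_le_zero neq0_conv add.commute)
    then have "j * m \<le> Suc (?b j) * n" by simp
    then show "j \<le> s (Suc (?b j))" unfolding s_def using m by (metis div_le_mono nonzero_mult_div_cancel_right not_one_le_zero)
  qed
  have osc: "\<bar>c j - c (s (?b j))\<bar> \<le> c (s (?b j)) - c (s (Suc (?b j)))" for j
    using antimonoD[OF anti] loc[of j] by fastforce
  have block: "real (card {j. j \<in> {..<n} \<and> ?b j = i}) \<le> real n / real m + 2" for i
  proof -
    have "{j. j \<in> {..<n} \<and> ?b j = i} \<subseteq> {s i..s (Suc i)}" using loc by auto
    then have "card {j. j \<in> {..<n} \<and> ?b j = i} \<le> Suc (s (Suc i)) - s i" using card_mono[of "{s i..s (Suc i)}"] by simp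
    then have "real (card {j. j \<in> {..<n} \<and> ?b j = i}) \<le> real (Suc (s (Suc i)) - s i)" by (simp only: of_nat_le_iff)
    also have "\<dots> = 1 + real (s (Suc i)) - real (s i)"
      unfolding s_def by (subst of_nat_diff) (auto intro!: le_SucI div_le_mono)
    also have "\<dots> \<le> 1 + real (Suc i * n) / real m - (real (i * n) / real m - 1)"
    proof -
      have "real (a div m) \<le> real a / real m \<and> real a / real m - 1 \<le> real (a div m)" for a
      proof -
        have "real (a div m) = of_int \<lfloor>real a / real m\<rfloor>" by (simp add: floor_divide_of_nat_eq)
        then show ?thesis by linarith
      qed
      from this[of "Suc i * n"] this[of "i * n"] show ?thesis unfolding s_def by linarith
    qed
    also have "\<dots> = real n / real m + 2" by (simp add: add_divide_distrib)
    finally show ?thesis .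
  qed
  have "(\<Sum>j<n. \<bar>c j - c (s (?b j))\<bar>) \<le> (\<Sum>j<n. c (s (?b j)) - c (s (Suc (?b j))))" by (intro sum_mono osc)
  also have "\<dots> = (\<Sum>i<m. \<Sum>j\<in>{j. j \<in> {..<n} \<and> ?b j = i}. c (s (?b j)) - c (s (Suc (?b j))))"
  proof (rule sum.group[symmetric])
    show "?b ` {..<n} \<subseteq> {..<m}" using m n by (auto simp: less_mult_imp_div_less mult.commute)
  qed auto
  also have "\<dots> = (\<Sum>i<m. real (card {j. j \<in> {..<n} \<and> ?b j = i}) * (c (s i) - c (s (Suc i))))"
  proof (rule sum.cong[OF refl])
    fix i
    have "(\<Sum>j\<in>{j. j \<in> {..<n} \<and> ?b j = i}. c (s (?b j)) - c (s (Suc (?b j)))) = (\<Sum>j\<in>{j. j \<in> {..<n} \<and> ?b j = i}. c (s i) - c (s (Suc i)))"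
      by (intro sum.cong) auto
    then show "(\<Sum>j\<in>{j. j \<in> {..<n} \<and> ?b j = i}. c (s (?b j)) - c (s (Suc (?b j)))) = real (card {j. j \<in> {..<n} \<and> ?b j = i}) * (c (s i) - c (s (Suc i)))"
      by simp
  qed
  also have "\<dots> \<le> (\<Sum>i<m. (real n / real m + 2) * (c (s i) - c (s (Suc i))))"
  proof (intro sum_mono mult_right_mono block)
    fix i show "0 \<le> c (s i) - c (s (Suc i))" using antimonoD[OF anti, of "s i" "s (Suc i)"] by (simp add: s_def div_le_mono)
  qed
  also have "\<dots> = (real n / real m + 2) * (\<Sum>i<m. c (s i) - c (s (Suc i)))" by (simp only: sum_distrib_left)
  finally have "(\<Sum>j<n. \<bar>c j - c (s (?b j))\<bar>) \<le> (real n / real m + 2) * (\<Sum>i<m. c (s i) - c (s (Suc i)))" .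
  moreover have "(\<Sum>i<m. c (s i) - c (s (Suc i))) = c (s 0) - c (s m)" by (rule sum_lessThan_telescope')
  moreover have "s 0 = 0" "s m = n" using m by (simp_all add: s_def)
  ultimately show ?thesis unfolding s_def by (simp only:)
qed

text \<open>Truncate at height \<open>K\<close>, which costs \<open>C / K\<close> by the second moment, sample one value per block and
  round it to a multiple of \<open>1 / m\<close>: by monotonicity the oscillations over the blocks telescope.\<close>

lemma step_approximation:
  fixes T :: "nat \<Rightarrow> real"
  assumes anti: "antimono_on {..<n} T" and C: "(\<Sum>j<n. (T j)\<^sup>2) / real n \<le> C" and n: "n \<ge> 1" and m: "m \<ge> 1" and K: "(K::nat) \<ge> 1"
  obtains ps where "length ps = m" "set ps \<subseteq> {- int (K * m)..int (K * m)}"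
    "(\<Sum>j<n. \<bar>T j - step ps n j\<bar>) / real n \<le> C / real K + ((1 / real m + 2 / real n) * (2 * real K) + 1 / real m)"
proof -
  define c where "c j = (if j < n then max (- real K) (min (real K) (T j)) else - real K)" for j
  have cK: "\<bar>c j\<bar> \<le> real K" for j by (auto simp: c_def)
  have ca: "antimono c"
  proof (rule antimonoI)
    fix i j :: nat assume ij: "i \<le> j"
    show "c j \<le> c i"
    proof (cases "j < n")
      case True
      then have "T j \<le> T i" using anti ij by (auto simp: monotone_on_def)
      then show ?thesis using True ij by (auto simp: c_def)
    qed (auto simp: c_def)
  qed
  have cT: "\<bar>T j - c j\<bar> \<le> (T j)\<^sup>2 / real K" if "j < n" for j
  proof (cases "\<bar>T j\<bar> \<le> real K")
    case True
    then have "c j = T j" using that by (simp add: c_def abs_le_iff)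
    then show ?thesis by simp
  next
    case False
    then have "T j > real K \<or> T j < - real K" by linarith
    then have "\<bar>T j - c j\<bar> \<le> \<bar>T j\<bar>"
    proof
      assume t: "T j > real K"
      then have "c j = real K" using that by (simp add: c_def)
      then show ?thesis using t by linarith
    next
      assume t: "T j < - real K"
      then have "c j = - real K" using that by (simp add: c_def)
      then show ?thesis using t by linarith
    qed
    also have "\<dots> \<le> (T j)\<^sup>2 / real K"
    proof -
      have "\<bar>T j\<bar> * real K \<le> \<bar>T j\<bar> * \<bar>T j\<bar>" using False by (intro mult_left_mono) auto
      then show ?thesis using K by (simp add: pos_le_divide_eq power2_eq_square)
    qed
    finally show ?thesis .
  qed
  let ?q = "\<lambda>i. c (i * n div m)"
  define ps where "ps = map (\<lambda>i. \<lfloor>real m * ?q i\<rfloor>) [0..<m]"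
  have len: "length ps = m" by (simp add: ps_def)
  have rng: "set ps \<subseteq> {- int (K * m)..int (K * m)}"
  proof
    fix p assume "p \<in> set ps"
    then obtain i where p: "p = \<lfloor>real m * ?q i\<rfloor>" by (auto simp: ps_def)
    have b: "real m * - real K \<le> real m * ?q i" "real m * ?q i \<le> real m * real K"
      using cK[of "i * n div m"] by (intro mult_left_mono; linarith)+
    have "- int (K * m) \<le> p" unfolding p le_floor_iff using b(1) by (simp add: mult.commute)
    moreover have "real_of_int p \<le> real m * real K" using b(2) of_int_floor_le[of "real m * ?q i"] unfolding p by linarith
    then have "real_of_int p \<le> real_of_int (int (K * m))" by (simp add: mult.commute)
    then have "p \<le> int (K * m)" by (simp only: of_int_le_iff)
    ultimately show "p \<in> {- int (K * m)..int (K * m)}" by simp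
  qed
  have rd: "\<bar>?q (j * m div n) - step ps n j\<bar> \<le> 1 / real m" if j: "j < n" for j
  proof -
    have "j * m div n < m" using j m by (simp add: less_mult_imp_div_less mult.commute)
    then have "step ps n j = real_of_int \<lfloor>real m * ?q (j * m div n)\<rfloor> / real m" by (simp add: step_def ps_def)
    moreover have "\<bar>real m * ?q (j * m div n) - real_of_int \<lfloor>real m * ?q (j * m div n)\<rfloor>\<bar> \<le> 1" by linarith
    moreover have "\<bar>x - k / M\<bar> \<le> 1 / M" if "\<bar>M * x - k\<bar> \<le> 1" "M > 0" for x k M :: real
    proof -
      have "\<bar>x - k / M\<bar> = \<bar>M * x - k\<bar> / M" using that(2) by (simp add: abs_if field_simps)
      then show ?thesis using that by (simp add: divide_right_mono)
    qed
    ultimately show ?thesis using m by simp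
  qed
  have "(\<Sum>j<n. \<bar>T j - step ps n j\<bar>) \<le> (\<Sum>j<n. (T j)\<^sup>2 / real K + \<bar>c j - ?q (j * m div n)\<bar> + 1 / real m)"
    using cT rd by (intro sum_mono) fastforce
  also have "\<dots> = (\<Sum>j<n. (T j)\<^sup>2) / real K + (\<Sum>j<n. \<bar>c j - ?q (j * m div n)\<bar>) + real n * (1 / real m)"
    by (simp add: sum.distrib sum_divide_distrib)
  also have "\<dots> \<le> (\<Sum>j<n. (T j)\<^sup>2) / real K + (real n / real m + 2) * (2 * real K) + real n * (1 / real m)"
  proof -
    have "(real n / real m + 2) * (c 0 - c n) \<le> (real n / real m + 2) * (2 * real K)"
      using cK[of 0] cK[of n] by (intro mult_left_mono) (auto simp: abs_le_iff)
    then show ?thesis using block_oscillation[OF ca n m] by linarith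
  qed
  finally have "(\<Sum>j<n. \<bar>T j - step ps n j\<bar>) / real n \<le> ((\<Sum>j<n. (T j)\<^sup>2) / real K + (real n / real m + 2) * (2 * real K) + real n * (1 / real m)) / real n"
    by (rule divide_right_mono) simp
  also have "\<dots> = (\<Sum>j<n. (T j)\<^sup>2) / real n / real K + ((1 / real m + 2 / real n) * (2 * real K) + 1 / real m)"
    using n m K by (simp add: add_divide_distrib distrib_right)
  also have "\<dots> \<le> C / real K + ((1 / real m + 2 / real n) * (2 * real K) + 1 / real m)"
    using C by (intro add_right_mono divide_right_mono) auto
  finally show thesis using that[OF len rng] by blast
qed

text \<open>For a fixed accuracy only finitely many step functions occur, whatever \<open>n\<close> is; so the defect
  vanishes uniformly over all decreasing diagonals of bounded second moment.\<close>

lemma defect_uniform: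
  fixes N :: "nat \<Rightarrow> nat \<Rightarrow> nat \<Rightarrow> real" and T :: "nat \<Rightarrow> nat \<Rightarrow> real"
  assumes N: "\<And>n. symk n (N n)"
    and st: "\<And>ps. (\<lambda>n. defect n (dg (step ps n)) (\<lambda>i j. dg (step ps n) i j + N n i j) \<tau> z) \<longlonglongrightarrow> 0"
    and T: "\<And>n. antimono_on {..<n} (T n)" "\<And>n. (\<Sum>j<n. (T n j)\<^sup>2) / real n \<le> C"
    and z: "Im z > 0"
  shows "(\<lambda>n. defect n (dg (T n)) (\<lambda>i j. dg (T n) i j + N n i j) \<tau> z) \<longlonglongrightarrow> 0"
proof (rule LIMSEQ_I)
  fix e :: real assume e: "e > 0"
  let ?v = "Im z"
  define c where "c = 1 / ?v\<^sup>2 + 1 / ?v\<^sup>2 + \<tau>\<^sup>2 * (1 / ?v\<^sup>2) / ?v\<^sup>2"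
  have c: "c > 0" using z unfolding c_def by (intro add_pos_nonneg) auto
  define \<eta> where "\<eta> = e / (8 * c)"
  have \<eta>: "\<eta> > 0" using e c by (simp add: \<eta>_def)
  have C0: "C \<ge> 0" using T(2)[of 0] by simp
  \<comment> \<open>First the truncation height, then the number of blocks; the error \<open>4 K / n\<close> vanishes as
  \<open>n\<close> grows.\<close>
  obtain K :: nat where K: "K \<ge> 1" "C / real K \<le> \<eta>"
  proof -
    obtain k :: nat where k: "C / \<eta> \<le> real k" using real_arch_simple by blast
    have "C \<le> \<eta> * real k" using k \<eta> by (simp add: pos_divide_le_eq mult.commute)
    also have "\<dots> \<le> \<eta> * real (Suc k)" using \<eta> by (intro mult_left_mono) auto
    finally show thesis using that[of "Suc k"] by (simp add: pos_divide_le_eq)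
  qed
  obtain m :: nat where m: "m \<ge> 1" "(2 * real K + 1) / real m \<le> \<eta>"
  proof -
    obtain k :: nat where k: "(2 * real K + 1) / \<eta> \<le> real k" using real_arch_simple by blast
    have "2 * real K + 1 \<le> \<eta> * real k" using k \<eta> by (simp add: pos_divide_le_eq mult.commute)
    also have "\<dots> \<le> \<eta> * real (Suc k)" using \<eta> by (intro mult_left_mono) auto
    finally show thesis using that[of "Suc k"] by (simp add: pos_divide_le_eq)
  qed
  define P where "P = {ps :: int list. set ps \<subseteq> {- int (K * m)..int (K * m)} \<and> length ps = m}"
  have "finite P" unfolding P_def by (rule finite_lists_length_eq) simp
  moreover have "\<forall>\<^sub>F n in sequentially. defect n (dg (step ps n)) (\<lambda>i j. dg (step ps n) i j + N n i j) \<tau> z < e / 2" for ps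
    by (rule order_tendstoD(2)[OF st]) (use e in simp)
  ultimately have ev: "\<forall>\<^sub>F n in sequentially. \<forall>ps\<in>P. defect n (dg (step ps n)) (\<lambda>i j. dg (step ps n) i j + N n i j) \<tau> z < e / 2"
    by (intro eventually_ball_finite) auto
  have "(\<lambda>n. 2 / real n * (2 * real K)) \<longlonglongrightarrow> 0 * (2 * real K)"
    by (intro tendsto_mult tendsto_const real_tendsto_divide_at_top[OF tendsto_const] filterlim_real_sequentially)
  then have "\<forall>\<^sub>F n in sequentially. 2 / real n * (2 * real K) < \<eta>" by (rule order_tendstoD) (use \<eta> in simp)
  then have "\<forall>\<^sub>F n in sequentially. norm (defect n (dg (T n)) (\<lambda>i j. dg (T n) i j + N n i j) \<tau> z - 0) < e"
    using ev eventually_gt_at_top[of 0]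
  proof eventually_elim
    case (elim n)
    have n: "n \<ge> 1" using elim by simp
    obtain ps where ps: "length ps = m" "set ps \<subseteq> {- int (K * m)..int (K * m)}"
      and d: "(\<Sum>j<n. \<bar>T n j - step ps n j\<bar>) / real n \<le> C / real K + ((1 / real m + 2 / real n) * (2 * real K) + 1 / real m)"
      by (rule step_approximation[OF T(1)[of n] T(2)[of n] n m(1) K(1)])
    define \<delta> where "\<delta> = (\<Sum>j<n. \<bar>step ps n j - T n j\<bar>) / real n"
    have "\<delta> \<le> C / real K + ((2 * real K + 1) / real m + 2 / real n * (2 * real K))"
      using d unfolding \<delta>_def by (simp add: abs_minus_commute add_divide_distrib algebra_simps)
    then have \<delta>: "\<delta> \<le> 3 * \<eta>" using K(2) m(2) elim(1) by linarith
    let ?B = "dg (T n)" let ?B' = "dg (step ps n)"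
    have s: "symk n ?B" "symk n ?B'" "symk n (\<lambda>i j. ?B i j + N n i j)" "symk n (\<lambda>i j. ?B' i j + N n i j)"
      using N[of n] by (auto simp: symk_def)
    have "defect n ?B (\<lambda>i j. ?B i j + N n i j) \<tau> z \<le> defect n ?B' (\<lambda>i j. ?B' i j + N n i j) \<tau> z + \<delta> / ?v\<^sup>2 + \<delta> / ?v\<^sup>2
        + (cmod (z - z) + \<tau>\<^sup>2 * (\<delta> / ?v\<^sup>2)) / ?v\<^sup>2"
    proof (rule defect_le[OF s(1,3,4)])
      show "cmod (ST n (\<lambda>i j. ?B i j + N n i j) z - ST n (\<lambda>i j. ?B' i j + N n i j) z) \<le> \<delta> / ?v\<^sup>2"
        unfolding \<delta>_def by (rule ST_diagonal_perturbation[OF s(3,4) order_refl z]) auto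
      show "cmod (ST n ?B w - ST n ?B' w) \<le> \<delta> / ?v\<^sup>2" if "Im w \<ge> ?v" for w
        unfolding \<delta>_def by (rule ST_diagonal_perturbation[OF s(1,2) that z]) auto
    qed (use z in auto)
    also have "\<dots> = defect n ?B' (\<lambda>i j. ?B' i j + N n i j) \<tau> z + \<delta> * c" by (simp add: c_def algebra_simps)
    also have "\<dots> < e / 2 + e / 2"
    proof -
      have "\<delta> * c \<le> 3 * \<eta> * c" using \<delta> c by (intro mult_right_mono) auto
      also have "\<dots> \<le> e / 2" using c e by (simp add: \<eta>_def)
      finally show ?thesis using elim(2) ps by (auto simp: P_def)
    qed
    finally show ?case by (simp add: defect_def)
  qed
  then show "\<exists>no. \<forall>n\<ge>no. norm (defect n (dg (T n)) (\<lambda>i j. dg (T n) i j + N n i j) \<tau> z - 0) < e"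
    by (simp add: eventually_sequentially)
qed

section \<open>One realisation\<close>

text \<open>The square is unbounded, but equals its truncation on a compact set that carries all measures
  involved.\<close>

lemma weak_limit_of_emp:
  assumes "real_distribution H" and w: "weak_conv_m (\<lambda>n. emp n (x n)) H"
  shows "Im z > 0 \<Longrightarrow> (\<lambda>n. stj n (x n) z) \<longlonglongrightarrow> SM H z"
    and "\<forall>\<^sub>F n in sequentially. \<forall>j<n. \<bar>x n j\<bar> \<le> L \<Longrightarrow> AE y in H. \<bar>y\<bar> \<le> L \<Longrightarrow>
       (\<lambda>n. (\<Sum>j<n. (x n j)\<^sup>2) / real n) \<longlonglongrightarrow> (LINT y|H. y\<^sup>2)"
proof -
  interpret real_distribution H by fact
  have d: "real_distribution (emp (Suc n) (x (Suc n)))" for n by (rule real_distribution_emp) simp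
  have w': "weak_conv_m (\<lambda>n. emp (Suc n) (x (Suc n))) H"
    using w unfolding weak_conv_m_def weak_conv_def by (auto intro: LIMSEQ_Suc)
  {
    assume z: "Im z > 0"
    have "(\<lambda>n. SM (emp (Suc n) (x (Suc n))) z) \<longlonglongrightarrow> SM H z" by (rule weak_conv_SM[OF d assms(1) w' z])
    then have "(\<lambda>n. stj (Suc n) (x (Suc n)) z) \<longlonglongrightarrow> SM H z" by (simp add: SM_emp z)
    then show "(\<lambda>n. stj n (x n) z) \<longlonglongrightarrow> SM H z" by (rule LIMSEQ_imp_Suc)
  }
  assume L: "\<forall>\<^sub>F n in sequentially. \<forall>j<n. \<bar>x n j\<bar> \<le> L" and supp: "AE y in H. \<bar>y\<bar> \<le> L"
  define f where "f y = (max (- L) (min L y))\<^sup>2" for y :: real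
  have fc: "isCont f y" for y unfolding f_def by (intro continuous_intros)
  have fe: "f y = y\<^sup>2" if "\<bar>y\<bar> \<le> L" for y using that by (simp add: f_def abs_le_iff max_def min_def)
  have fm: "f \<in> borel_measurable borel" unfolding f_def by measurable
  have fb: "norm (f y) \<le> L\<^sup>2" for y
  proof -
    have "\<bar>max (- L) (min L y)\<bar> \<le> \<bar>L\<bar>" by (simp add: max_def min_def abs_if)
    then show ?thesis unfolding f_def by (simp add: abs_le_square_iff)
  qed
  have "(\<lambda>n. LINT y|emp (Suc n) (x (Suc n)). f y) \<longlonglongrightarrow> (LINT y|H. f y)"
    by (rule weak_conv_imp_integral_bdd_continuous_conv[OF d assms(1) w' fc fb])
  then have "(\<lambda>n. (\<Sum>j<Suc n. f (x (Suc n) j)) / real (Suc n)) \<longlonglongrightarrow> (LINT y|H. f y)"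
    by (simp only: integral_emp[OF fm])
  then have "(\<lambda>n. (\<Sum>j<n. f (x n j)) / real n) \<longlonglongrightarrow> (LINT y|H. f y)" by (rule LIMSEQ_imp_Suc)
  moreover have "(LINT y|H. f y) = (LINT y|H. y\<^sup>2)"
    using supp by (intro integral_cong_AE) (auto elim!: eventually_mono intro: fe borel_measurable_M fm)
  moreover have "\<forall>\<^sub>F n in sequentially. (\<Sum>j<n. f (x n j)) / real n = (\<Sum>j<n. (x n j)\<^sup>2) / real n"
    using L by eventually_elim (auto simp: fe)
  ultimately show "(\<lambda>n. (\<Sum>j<n. (x n j)\<^sup>2) / real n) \<longlonglongrightarrow> (LINT y|H. y\<^sup>2)"
    using Lim_transform_eventually by fastforce
qed

text \<open>Chebyshev's inequality.\<close>

lemma tight_emp: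
  assumes C: "\<And>k. (\<Sum>j<n k. (x k j)\<^sup>2) / real (n k) \<le> C" and n: "\<And>k. n k \<ge> 1"
  shows "tight (\<lambda>k. emp (n k) (x k))"
  unfolding tight_def
proof (intro conjI allI impI)
  show "real_distribution (emp (n k) (x k))" for k by (rule real_distribution_emp[OF n])
  fix \<epsilon> :: real assume \<epsilon>: "\<epsilon> > 0"
  have C0: "C \<ge> 0" by (rule order_trans[OF _ C[of 0]]) (simp add: sum_nonneg)
  define a where "a = sqrt ((C + 1) / \<epsilon>)"
  have a2: "a\<^sup>2 = (C + 1) / \<epsilon>" using C0 \<epsilon> by (simp add: a_def)
  have a: "a > 0" using C0 \<epsilon> by (simp add: a_def)
  have small: "C / a\<^sup>2 < \<epsilon>" unfolding a2 using C0 \<epsilon> by (simp add: field_simps add_pos_nonneg)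
  show "\<exists>a b. a < b \<and> (\<forall>k. 1 - \<epsilon> < measure (emp (n k) (x k)) {a<..b})"
  proof (intro exI conjI allI)
    show "- a < a" using a by simp
    fix k
    interpret E: real_distribution "emp (n k) (x k)" by (rule real_distribution_emp[OF n])
    have N: "real (n k) > 0" using n[of k] by simp
    have "measure (emp (n k) (x k)) {- a<..a} = (LINT y|emp (n k) (x k). indicator {- a<..a} y)" by simp
    also have "\<dots> = (\<Sum>j<n k. indicator {- a<..a} (x k j)) / real (n k)" by (rule integral_emp) simp
    finally have m: "measure (emp (n k) (x k)) {- a<..a} = (\<Sum>j<n k. indicator {- a<..a} (x k j)) / real (n k)" .
    have "1 - y\<^sup>2 / a\<^sup>2 \<le> indicator {- a<..a} y" for y
    proof (cases "y \<in> {- a<..a}")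
      case False
      then have "a \<le> \<bar>y\<bar>" by auto
      then have "a\<^sup>2 \<le> \<bar>y\<bar>\<^sup>2" using a by (intro power_mono) auto
      then show ?thesis using False a by simp
    qed simp
    then have "(\<Sum>j<n k. 1 - (x k j)\<^sup>2 / a\<^sup>2) \<le> (\<Sum>j<n k. indicator {- a<..a} (x k j))" by (intro sum_mono)
    then have "(real (n k) - (\<Sum>j<n k. (x k j)\<^sup>2) / a\<^sup>2) / real (n k) \<le> measure (emp (n k) (x k)) {- a<..a}"
      unfolding m using N by (intro divide_right_mono) (simp_all add: sum_subtractf sum_divide_distrib)
    moreover have "(real (n k) - (\<Sum>j<n k. (x k j)\<^sup>2) / a\<^sup>2) / real (n k) = 1 - (\<Sum>j<n k. (x k j)\<^sup>2) / real (n k) / a\<^sup>2"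
      using N by (simp add: diff_divide_distrib mult.commute)
    moreover have "(\<Sum>j<n k. (x k j)\<^sup>2) / real (n k) / a\<^sup>2 \<le> C / a\<^sup>2" by (intro divide_right_mono C) simp
    ultimately show "1 - \<epsilon> < measure (emp (n k) (x k)) {- a<..a}" using small by linarith
  qed
qed

lemma energy_add:
  fixes b w :: "nat \<Rightarrow> nat \<Rightarrow> nat \<Rightarrow> real"
  assumes "(\<lambda>n. (\<Sum>i<n. \<Sum>j<n. (b n i j)\<^sup>2) / real n) \<longlonglongrightarrow> \<beta>"
    and "(\<lambda>n. (\<Sum>i<n. \<Sum>j<n. b n i j * w n i j) / (real n * sqrt (real n))) \<longlonglongrightarrow> 0"
    and "(\<lambda>n. (\<Sum>i<n. \<Sum>j<n. (w n i j)\<^sup>2) / (real n)\<^sup>2) \<longlonglongrightarrow> \<omega>"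
  shows "(\<lambda>n. (\<Sum>i<n. \<Sum>j<n. (b n i j + w n i j / sqrt (real n))\<^sup>2) / real n) \<longlonglongrightarrow> \<beta> + \<omega>"
proof -
  have "(\<Sum>i<n. \<Sum>j<n. (b n i j + w n i j / sqrt (real n))\<^sup>2) / real n = (\<Sum>i<n. \<Sum>j<n. (b n i j)\<^sup>2) / real n
     + 2 * ((\<Sum>i<n. \<Sum>j<n. b n i j * w n i j) / (real n * sqrt (real n))) + (\<Sum>i<n. \<Sum>j<n. (w n i j)\<^sup>2) / (real n)\<^sup>2" for n
  proof -
    have "(\<Sum>i<n. \<Sum>j<n. (b n i j + w n i j / sqrt (real n))\<^sup>2) = (\<Sum>i<n. \<Sum>j<n. (b n i j)\<^sup>2 + 2 / sqrt (real n) * (b n i j * w n i j) + (w n i j)\<^sup>2 / real n)"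
      by (intro sum.cong refl) (simp add: power2_sum power_divide)
    also have "\<dots> = (\<Sum>i<n. \<Sum>j<n. (b n i j)\<^sup>2) + 2 / sqrt (real n) * (\<Sum>i<n. \<Sum>j<n. b n i j * w n i j) + (\<Sum>i<n. \<Sum>j<n. (w n i j)\<^sup>2) / real n"
      by (simp only: sum.distrib sum_distrib_left[symmetric] sum_divide_distrib[symmetric])
    finally show ?thesis by (simp add: add_divide_distrib power2_eq_square mult.commute)
  qed
  moreover have "(\<lambda>n. (\<Sum>i<n. \<Sum>j<n. (b n i j)\<^sup>2) / real n + 2 * ((\<Sum>i<n. \<Sum>j<n. b n i j * w n i j) / (real n * sqrt (real n)))
     + (\<Sum>i<n. \<Sum>j<n. (w n i j)\<^sup>2) / (real n)\<^sup>2) \<longlonglongrightarrow> \<beta> + 2 * 0 + \<omega>"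
    by (intro tendsto_intros assms)
  ultimately show ?thesis by simp
qed

text \<open>Every limit point of the bounded sequence of traces solves the limiting equation. The function
  \<open>F\<close> need not be the transform of \<open>B\<close> itself; it may be the limit of
  another deformation, which makes the lemma iterable.\<close>

lemma pastur_limit:
  assumes S: "\<And>n. symk n (B n)" "\<And>n. symk n (X n)" and z: "Im z > 0"
    and d: "(\<lambda>n. defect n (B n) (X n) \<tau> z) \<longlonglongrightarrow> 0"
    and lim: "\<And>w. Im w > 0 \<Longrightarrow> (\<lambda>n. ST n (B n) w) \<longlonglongrightarrow> F w"
    and u: "\<And>p. Im p \<ge> 0 \<Longrightarrow> p = F (z + of_real (\<tau>\<^sup>2) * p) \<Longrightarrow> p = m"
  shows "(\<lambda>n. ST n (X n) z) \<longlonglongrightarrow> m"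
proof (rule bounded_unique_limit_point)
  show "cmod (ST n (X n) z) \<le> 1 / Im z" for n by (rule ST_bound[OF S(2) z])
  fix r :: "nat \<Rightarrow> nat" and p assume r: "strict_mono r" and p: "((\<lambda>n. ST n (X n) z) \<circ> r) \<longlonglongrightarrow> p"
  have "Im p \<ge> 0 \<and> p = F (z + of_real (\<tau>\<^sup>2) * p)"
  proof (rule pastur_limit_point[where s="(\<lambda>n. ST n (X n) z) \<circ> r" and F="\<lambda>n. ST (r n) (B (r n))"])
    show "Im (((\<lambda>n. ST n (X n) z) \<circ> r) n) \<ge> 0" for n using Im_ST[OF S(2) z] by simp
    show "cmod (ST (r n) (B (r n)) w - ST (r n) (B (r n)) w') \<le> cmod (w - w') / (Im z)\<^sup>2" if "Im w \<ge> Im z" "Im w' \<ge> Im z" for n w w'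
      by (rule ST_lipschitz[OF S(1) that z])
    show "(\<lambda>n. ST (r n) (B (r n)) w) \<longlonglongrightarrow> F w" if "Im w > 0" for w
      using LIMSEQ_subseq_LIMSEQ[OF lim[OF that] r] by (simp add: o_def)
    show "(\<lambda>n. cmod (((\<lambda>n. ST n (X n) z) \<circ> r) n - ST (r n) (B (r n)) (z + of_real (\<tau>\<^sup>2) * ((\<lambda>n. ST n (X n) z) \<circ> r) n))) \<longlonglongrightarrow> 0"
      using LIMSEQ_subseq_LIMSEQ[OF d r] by (simp add: o_def defect_def)
  qed (use z p in auto)
  then show "p = m" using u by blast
qed

text \<open>All that is needed about one realisation. The deformation of \<open>A\<close> is required at the
  actual noise level \<open>s\<close> and at the level that complements \<open>r\<close> to
  \<open>s\<close>; the deformation by \<open>Z\<close> is required for deterministic profiles only.\<close>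

locale fit =
  fixes A W Z :: "nat \<Rightarrow> real mat" and H :: "real measure" and s r K :: real
  assumes H: "real_distribution H" and K: "K > 0" and supp: "AE x in H. \<bar>x\<bar> \<le> K"
    and s: "s > 0" and r: "r \<ge> 0"
    and carr: "\<And>n. A n \<in> carrier_mat n n" "\<And>n. W n \<in> carrier_mat n n" "\<And>n. Z n \<in> carrier_mat n n"
    and sym: "\<And>n. symk n (mk_fun (A n))" "\<And>n. symk n (mk_fun (W n))" "\<And>n. symk n (mk_fun (Z n))"
    and A_lim: "\<And>w. Im w > 0 \<Longrightarrow> (\<lambda>n. stj n (\<lambda>j. eigs (A n) ! j) w) \<longlonglongrightarrow> SM H w"
    and A_sq: "(\<lambda>n. (\<Sum>j<n. (eigs (A n) ! j)\<^sup>2) / real n) \<longlonglongrightarrow> (LINT x|H. x\<^sup>2)"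
    and W_energy: "(\<lambda>n. (\<Sum>i<n. \<Sum>j<n. (W n $$ (i, j))\<^sup>2) / (real n)\<^sup>2) \<longlonglongrightarrow> 1"
    and W_cross: "(\<lambda>n. (\<Sum>i<n. \<Sum>j<n. A n $$ (i, j) * W n $$ (i, j)) / (real n * sqrt (real n))) \<longlonglongrightarrow> 0"
    and W_defect: "\<And>t z. t = s \<or> r < s \<and> t = sqrt (s\<^sup>2 - r\<^sup>2) \<Longrightarrow> Im z > 0 \<Longrightarrow>
       (\<lambda>n. defect n (mk_fun (A n)) (\<lambda>i j. A n $$ (i, j) + t * W n $$ (i, j) / sqrt (real n)) t z) \<longlonglongrightarrow> 0"
    and Z_energy: "(\<lambda>n. (\<Sum>i<n. \<Sum>j<n. (Z n $$ (i, j))\<^sup>2) / (real n)\<^sup>2) \<longlonglongrightarrow> r\<^sup>2"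
    and Z_diag: "(\<lambda>n. (\<Sum>i<n. (Z n $$ (i, i))\<^sup>2) / (real n)\<^sup>2) \<longlonglongrightarrow> 0"
    and Z_defect: "\<And>ps z. Im z > 0 \<Longrightarrow>
       (\<lambda>n. defect n (dg (step ps n)) (\<lambda>i j. dg (step ps n) i j + Z n $$ (i, j) / sqrt (real n)) r z) \<longlonglongrightarrow> 0"
begin

text \<open>The limiting Stieltjes transform of \<open>A\<close> deformed by noise of variance \<open>t\<close>.\<close>

definition msol :: "real \<Rightarrow> complex \<Rightarrow> complex" where
  "msol t z = (SOME p. Im p \<ge> 0 \<and> p = SM H (z + of_real t * p))"

lemma
  assumes z: "Im z > 0" and t: "t \<ge> 0"
  shows Im_msol: "Im (msol t z) \<ge> 0" and msol_eq: "msol t z = SM H (z + of_real t * msol t z)"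
    and msol_unique: "Im p \<ge> 0 \<Longrightarrow> p = SM H (z + of_real t * p) \<Longrightarrow> p = msol t z"
proof -
  have ex: "\<exists>p. Im p \<ge> 0 \<and> p = SM H (z + of_real t * p)"
    using real_distribution.pastur_exists[OF H z t] by metis
  note sol = someI_ex[OF ex, folded msol_def]
  show "Im (msol t z) \<ge> 0" "msol t z = SM H (z + of_real t * msol t z)" using sol by blast+
  then show "Im p \<ge> 0 \<Longrightarrow> p = SM H (z + of_real t * p) \<Longrightarrow> p = msol t z"
    by (rule real_distribution.pastur_unique[OF H z t, rotated 2])
qed

abbreviation m2 :: real where "m2 \<equiv> LINT x|H. x\<^sup>2"

abbreviation adm :: "real \<Rightarrow> bool" where "adm t \<equiv> t = s \<or> r < s \<and> t = sqrt (s\<^sup>2 - r\<^sup>2)"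

lemma sq_msol: "t \<ge> 0 \<Longrightarrow> ((\<lambda>y. y\<^sup>2 * Re (1 + Complex 0 y * msol t (Complex 0 y))) \<longlongrightarrow> m2 + t) at_top"
  by (rule real_distribution.pastur_second_moment[OF H supp])
     (auto intro: Im_msol msol_eq)

definition P :: "real \<Rightarrow> nat \<Rightarrow> real mat" where "P t n = A n + (t / sqrt (real n)) \<cdot>\<^sub>m W n"

lemma P_carrier: "P t n \<in> carrier_mat n n" using carr by (simp add: P_def)

lemma P_entry: "i < n \<Longrightarrow> j < n \<Longrightarrow> P t n $$ (i, j) = A n $$ (i, j) + t * W n $$ (i, j) / sqrt (real n)"
  using carr[of n] by (simp add: P_def)

lemma P_sym: "symk n (mk_fun (P t n))"
  using sym(1,2)[of n] by (auto simp: symk_def P_entry)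

lemma stj_P:
  assumes t: "adm t" and z: "Im z > 0"
  shows "(\<lambda>n. stj n (\<lambda>j. eigs (P t n) ! j) z) \<longlonglongrightarrow> msol (t\<^sup>2) z"
proof -
  have "(\<lambda>n. ST n (mk_fun (P t n)) z) \<longlonglongrightarrow> msol (t\<^sup>2) z"
  proof (rule pastur_limit[OF sym(1) P_sym z])
    show "(\<lambda>n. defect n (mk_fun (A n)) (mk_fun (P t n)) t z) \<longlonglongrightarrow> 0"
      using W_defect[OF t z] by (subst defect_cong[OF P_entry]) auto
    show "(\<lambda>n. ST n (mk_fun (A n)) w) \<longlonglongrightarrow> SM H w" if "Im w > 0" for w
      using A_lim[OF that] unfolding ST_def by (subst trace_resolvent_eigs[OF carr(1) sym(1) that])
    show "p = msol (t\<^sup>2) z" if "Im p \<ge> 0" "p = SM H (z + of_real (t\<^sup>2) * p)" for p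
      by (rule msol_unique[OF z _ that]) simp
  qed
  then show ?thesis unfolding ST_def by (subst (asm) trace_resolvent_eigs[OF P_carrier P_sym z])
qed

lemma sq_P: "(\<lambda>n. (\<Sum>j<n. (eigs (P t n) ! j)\<^sup>2) / real n) \<longlonglongrightarrow> m2 + t\<^sup>2"
proof -
  have "(\<lambda>n. (\<Sum>i<n. \<Sum>j<n. (A n $$ (i, j) + (t * W n $$ (i, j)) / sqrt (real n))\<^sup>2) / real n) \<longlonglongrightarrow> m2 + t\<^sup>2"
  proof (rule energy_add)
    show "(\<lambda>n. (\<Sum>i<n. \<Sum>j<n. (A n $$ (i, j))\<^sup>2) / real n) \<longlonglongrightarrow> m2"
      using A_sq by (simp only: sum_eigs_square[OF carr(1) sym(1)])
    have "(\<Sum>i<n. \<Sum>j<n. A n $$ (i, j) * (t * W n $$ (i, j))) = t * (\<Sum>i<n. \<Sum>j<n. A n $$ (i, j) * W n $$ (i, j))" for n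
      by (simp add: sum_distrib_left mult.left_commute)
    then show "(\<lambda>n. (\<Sum>i<n. \<Sum>j<n. A n $$ (i, j) * (t * W n $$ (i, j))) / (real n * sqrt (real n))) \<longlonglongrightarrow> 0"
      using tendsto_mult_left[OF W_cross, of t] by simp
    have "(\<Sum>i<n. \<Sum>j<n. (t * W n $$ (i, j))\<^sup>2) = t\<^sup>2 * (\<Sum>i<n. \<Sum>j<n. (W n $$ (i, j))\<^sup>2)" for n
      by (simp add: sum_distrib_left power_mult_distrib)
    then show "(\<lambda>n. (\<Sum>i<n. \<Sum>j<n. (t * W n $$ (i, j))\<^sup>2) / (real n)\<^sup>2) \<longlonglongrightarrow> t\<^sup>2"
      using tendsto_mult_left[OF W_energy, of "t\<^sup>2"] by simp
  qed
  then show ?thesis by (simp add: sum_eigs_square[OF P_carrier P_sym] P_entry)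
qed

lemma spectra_P: "adm t \<Longrightarrow> spectra (\<lambda>n j. eigs (P t n) ! j) (msol (t\<^sup>2)) (m2 + t\<^sup>2)"
  by unfold_locales (rule stj_P sq_P sq_msol zero_le_power2 | assumption)+

definition Q :: "(nat \<Rightarrow> real) \<Rightarrow> nat \<Rightarrow> real mat" where "Q T n = mat_diag n T + (1 / sqrt (real n)) \<cdot>\<^sub>m Z n"

lemma Q_carrier: "Q T n \<in> carrier_mat n n" using carr by (simp add: Q_def)

lemma Q_entry: "i < n \<Longrightarrow> j < n \<Longrightarrow> Q T n $$ (i, j) = dg T i j + Z n $$ (i, j) / sqrt (real n)"
  using carr[of n] by (simp add: Q_def mat_diag_def)

lemma Z_kernel_sym: "symk n (\<lambda>i j. Z n $$ (i, j) / sqrt (real n))" using sym(3)[of n] by (auto simp: symk_def)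

lemma Q_sym: "symk n (mk_fun (Q T n))"
  using sym(3)[of n] by (auto simp: symk_def Q_entry)

lemma Q_kernel_sym: "symk n (\<lambda>i j. dg T i j + Z n $$ (i, j) / sqrt (real n))"
  using sym(3)[of n] by (auto simp: symk_def)

lemma stj_Q: "Im z > 0 \<Longrightarrow> ST n (\<lambda>i j. dg T i j + Z n $$ (i, j) / sqrt (real n)) z = stj n (\<lambda>j. eigs (Q T n) ! j) z"
  using trace_resolvent_eigs[OF Q_carrier[where T=T and n=n] Q_sym[where T=T and n=n], of z] ST_cong[of n "mk_fun (Q T n)" _ z, OF Q_entry] by (simp add: ST_def)

text \<open>The noise meets the diagonal in its \<open>n\<close> diagonal entries only, so the mixed term
  vanishes by the Cauchy-Schwarz inequality, whatever the dependence between \<open>T\<close> and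
  \<open>Z\<close>.\<close>

lemma sq_Q:
  assumes T: "(\<lambda>n. (\<Sum>j<n. (T n j)\<^sup>2) / real n) \<longlonglongrightarrow> \<beta>"
  shows "(\<lambda>n. (\<Sum>j<n. (eigs (Q (T n) n) ! j)\<^sup>2) / real n) \<longlonglongrightarrow> \<beta> + r\<^sup>2"
proof -
  have "(\<lambda>n. (\<Sum>i<n. \<Sum>j<n. (dg (T n) i j + Z n $$ (i, j) / sqrt (real n))\<^sup>2) / real n) \<longlonglongrightarrow> \<beta> + r\<^sup>2"
  proof (rule energy_add[OF _ _ Z_energy])
    show "(\<lambda>n. (\<Sum>i<n. \<Sum>j<n. (dg (T n) i j)\<^sup>2) / real n) \<longlonglongrightarrow> \<beta>"
      using T by (simp add: if_distrib[of "\<lambda>x. x\<^sup>2"] cong: if_cong)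
    have "(\<Sum>i<n. \<Sum>j<n. dg (T n) i j * Z n $$ (i, j)) = (\<Sum>i<n. T n i * Z n $$ (i, i))" for n
      by (simp add: if_distrib[of "\<lambda>x. x * _"] cong: if_cong)
    moreover have "(\<lambda>n. (\<Sum>i<n. T n i * Z n $$ (i, i)) / (real n * sqrt (real n))) \<longlonglongrightarrow> 0"
    proof (rule Lim_null_comparison[OF always_eventually[rule_format]])
      fix n
      have "(\<Sum>i<n. T n i * Z n $$ (i, i))\<^sup>2 \<le> (\<Sum>i<n. (T n i)\<^sup>2) * (\<Sum>i<n. (Z n $$ (i, i))\<^sup>2)" by (rule Cauchy_Schwarz_ineq_sum)
      then have "sqrt ((\<Sum>i<n. T n i * Z n $$ (i, i))\<^sup>2) \<le> sqrt ((\<Sum>i<n. (T n i)\<^sup>2) * (\<Sum>i<n. (Z n $$ (i, i))\<^sup>2))" by (rule real_sqrt_le_mono)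
      then have "\<bar>\<Sum>i<n. T n i * Z n $$ (i, i)\<bar> / (real n * sqrt (real n)) \<le> sqrt (\<Sum>i<n. (T n i)\<^sup>2) * sqrt (\<Sum>i<n. (Z n $$ (i, i))\<^sup>2) / (real n * sqrt (real n))"
        unfolding real_sqrt_abs real_sqrt_mult by (rule divide_right_mono) simp
      then show "norm ((\<Sum>i<n. T n i * Z n $$ (i, i)) / (real n * sqrt (real n))) \<le> sqrt ((\<Sum>j<n. (T n j)\<^sup>2) / real n) * sqrt ((\<Sum>i<n. (Z n $$ (i, i))\<^sup>2) / (real n)\<^sup>2)"
        by (simp add: real_sqrt_divide mult.commute)
    next
      have "(\<lambda>n. sqrt ((\<Sum>j<n. (T n j)\<^sup>2) / real n) * sqrt ((\<Sum>i<n. (Z n $$ (i, i))\<^sup>2) / (real n)\<^sup>2)) \<longlonglongrightarrow> sqrt \<beta> * sqrt 0"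
        by (intro tendsto_mult tendsto_real_sqrt T Z_diag)
      then show "(\<lambda>n. sqrt ((\<Sum>j<n. (T n j)\<^sup>2) / real n) * sqrt ((\<Sum>i<n. (Z n $$ (i, i))\<^sup>2) / (real n)\<^sup>2)) \<longlonglongrightarrow> 0" by simp
    qed
    ultimately show "(\<lambda>n. (\<Sum>i<n. \<Sum>j<n. dg (T n) i j * Z n $$ (i, j)) / (real n * sqrt (real n))) \<longlonglongrightarrow> 0" by simp
  qed
  moreover have "(\<Sum>i<n. \<Sum>j<n. (dg (T n) i j + Z n $$ (i, j) / sqrt (real n))\<^sup>2) = (\<Sum>j<n. (eigs (Q (T n) n) ! j)\<^sup>2)" for n
    unfolding sum_eigs_square[OF Q_carrier Q_sym] by (intro sum.cong refl) (simp only: Q_entry lessThan_iff)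
  ultimately show ?thesis by simp
qed

lemma Q_defect:
  assumes T: "\<And>n. antimono_on {..<n} (T n)" "\<And>n. (\<Sum>j<n. (T n j)\<^sup>2) / real n \<le> C" and z: "Im z > 0"
  shows "(\<lambda>n. defect n (dg (T n)) (\<lambda>i j. dg (T n) i j + Z n $$ (i, j) / sqrt (real n)) r z) \<longlonglongrightarrow> 0"
  by (rule defect_uniform[OF Z_kernel_sym Z_defect[OF z] T z])

abbreviation val :: "nat \<Rightarrow> (nat \<Rightarrow> real) \<Rightarrow> real" where
  "val n T \<equiv> 1 / real n * (\<Sum>j<n. (eigs (Q T n) ! j - eigs (P s n) ! j)\<^sup>2)"

lemma val_nonneg: "0 \<le> val n T" by (simp add: sum_nonneg)

lemma fit_error_val: "fit_error n (Z n) (P s n) = (INF T\<in>{T. antimono_on {..<n} T}. val n T)"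
  unfolding fit_error_def Q_def ..

lemma fit_error_bounds:
  shows "0 \<le> fit_error n (Z n) (P s n)"
    and "antimono_on {..<n} T \<Longrightarrow> fit_error n (Z n) (P s n) \<le> val n T"
proof -
  have "antimono_on {..<n} (\<lambda>_. 0::real)" by (auto simp: monotone_on_def)
  then show "0 \<le> fit_error n (Z n) (P s n)" unfolding fit_error_val by (intro cINF_greatest val_nonneg) auto
  have "bdd_below (val n ` {T. antimono_on {..<n} T})" by (rule bdd_belowI2[of _ 0]) (rule val_nonneg)
  then show "antimono_on {..<n} T \<Longrightarrow> fit_error n (Z n) (P s n) \<le> val n T" unfolding fit_error_val by (intro cINF_lower) auto
qed

text \<open>The deformations by \<open>c\<close> and then by \<open>r\<close> compose to the one by
  \<open>s\<close> if \<open>c\<^sup>2 + r\<^sup>2 = s\<^sup>2\<close>.\<close>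

theorem fit_error_vanishes:
  assumes rs: "r < s"
  shows "(\<lambda>n. fit_error n (Z n) (P s n)) \<longlonglongrightarrow> 0"
proof -
  define c where "c = sqrt (s\<^sup>2 - r\<^sup>2)"
  have "r\<^sup>2 \<le> s\<^sup>2" using rs r by (intro power_mono) auto
  then have c2: "c\<^sup>2 = s\<^sup>2 - r\<^sup>2" by (simp add: c_def)
  have adm: "adm c" "adm s" using rs by (auto simp: c_def)
  define T where "T n j = eigs (P c n) ! j" for n j
  have anti: "antimono_on {..<n} (T n)" for n unfolding T_def by (rule eigs_antimono[OF P_carrier P_sym])
  have Tsq: "(\<lambda>n. (\<Sum>j<n. (T n j)\<^sup>2) / real n) \<longlonglongrightarrow> m2 + c\<^sup>2" unfolding T_def by (rule sq_P)
  then have "Bseq (\<lambda>n. (\<Sum>j<n. (T n j)\<^sup>2) / real n)" by (intro convergent_imp_Bseq convergentI)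
  then obtain C where "\<And>n. norm ((\<Sum>j<n. (T n j)\<^sup>2) / real n) \<le> C" by (auto simp: Bseq_def)
  then have C: "(\<Sum>j<n. (T n j)\<^sup>2) / real n \<le> C" for n by (metis abs_le_D1 real_norm_def)
  have "spectra (\<lambda>n j. eigs (Q (T n) n) ! j) (msol (s\<^sup>2)) (m2 + s\<^sup>2)"
  proof
    fix z :: complex assume z: "Im z > 0"
    have "(\<lambda>n. ST n (\<lambda>i j. dg (T n) i j + Z n $$ (i, j) / sqrt (real n)) z) \<longlonglongrightarrow> msol (s\<^sup>2) z"
    proof (rule pastur_limit[OF _ Q_kernel_sym z Q_defect[OF anti C z]])
      show "symk n (dg (T n))" for n by (auto simp: symk_def)
      show "(\<lambda>n. ST n (dg (T n)) w) \<longlonglongrightarrow> msol (c\<^sup>2) w" if "Im w > 0" for w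
        unfolding ST_diagonal[OF that] T_def by (rule stj_P[OF adm(1) that])
      fix p assume p: "Im p \<ge> 0" "p = msol (c\<^sup>2) (z + of_real (r\<^sup>2) * p)"
      have w: "Im (z + of_real (r\<^sup>2) * p) > 0" using z p(1) by (simp add: add_pos_nonneg)
      have "msol (c\<^sup>2) (z + of_real (r\<^sup>2) * p) = SM H (z + of_real (r\<^sup>2) * p + of_real (c\<^sup>2) * msol (c\<^sup>2) (z + of_real (r\<^sup>2) * p))"
        by (rule msol_eq[OF w]) simp
      then have "p = SM H (z + of_real (r\<^sup>2) * p + of_real (c\<^sup>2) * p)" unfolding p(2)[symmetric] .
      also have "z + of_real (r\<^sup>2) * p + of_real (c\<^sup>2) * p = z + of_real (s\<^sup>2) * p" unfolding c2 by (simp add: algebra_simps)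
      finally show "p = msol (s\<^sup>2) z" by (rule msol_unique[OF z zero_le_power2 p(1)])
    qed
    then show "(\<lambda>n. stj n (\<lambda>j. eigs (Q (T n) n) ! j) z) \<longlonglongrightarrow> msol (s\<^sup>2) z" by (simp only: stj_Q[OF z])
  next
    show "(\<lambda>n. (\<Sum>j<n. (eigs (Q (T n) n) ! j)\<^sup>2) / real n) \<longlonglongrightarrow> m2 + s\<^sup>2" using sq_Q[OF Tsq] by (simp add: c2)
  qed (rule sq_msol, simp)
  then have "(\<lambda>n. (\<Sum>j<n. (eigs (Q (T n) n) ! j - eigs (P s n) ! j)\<^sup>2) / real n) \<longlonglongrightarrow> 0"
    by (rule sorted_spectra_close[OF _ spectra_P[OF adm(2)] eigs_antimono[OF Q_carrier Q_sym] eigs_antimono[OF P_carrier P_sym]])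
  then have vT: "(\<lambda>n. val n (T n)) \<longlonglongrightarrow> 0" by simp
  show ?thesis
  proof (rule tendsto_sandwich[OF _ _ tendsto_const vT])
    show "\<forall>\<^sub>F n in sequentially. 0 \<le> fit_error n (Z n) (P s n)" by (intro always_eventually allI fit_error_bounds)
    show "\<forall>\<^sub>F n in sequentially. fit_error n (Z n) (P s n) \<le> val n (T n)" by (intro always_eventually allI fit_error_bounds anti)
  qed
qed

text \<open>Near-optimal diagonals have bounded second moments, since the spectra that they are fitted to
  have.\<close>

lemma near_optimal_diagonals:
  obtains T C where "\<And>n. antimono_on {..<n} (T n)" "\<And>n. (\<Sum>j<n. (T n j)\<^sup>2) / real n \<le> C"
    "\<And>n. fit_error n (Z n) (P s n) < 1 \<Longrightarrow> val n (T n) < fit_error n (Z n) (P s n) + 1 / real (Suc n)"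
proof -
  let ?E = "\<lambda>n. fit_error n (Z n) (P s n)"
  have "\<exists>T. antimono_on {..<n} T \<and> val n T < ?E n + 1 / real (Suc n)" for n
  proof -
    have "?E n < ?E n + 1 / real (Suc n)" by simp
    then have "Inf (val n ` {T. antimono_on {..<n} T}) < ?E n + 1 / real (Suc n)" unfolding fit_error_val .
    moreover have "antimono_on {..<n} (\<lambda>_. 0::real)" by (auto simp: monotone_on_def)
    then have "val n ` {T. antimono_on {..<n} T} \<noteq> {}" by blast
    ultimately obtain y where "y \<in> val n ` {T. antimono_on {..<n} T}" "y < ?E n + 1 / real (Suc n)" by (rule cInf_lessD[rotated, THEN bexE])
    then show ?thesis by blast
  qed
  then have "\<exists>T0. \<forall>n. antimono_on {..<n} (T0 n) \<and> val n (T0 n) < ?E n + 1 / real (Suc n)" by (intro choice allI)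
  then obtain T0 where "\<forall>n. antimono_on {..<n} (T0 n) \<and> val n (T0 n) < ?E n + 1 / real (Suc n)" by (rule exE)
  then have T0: "\<And>n. antimono_on {..<n} (T0 n)" "\<And>n. val n (T0 n) < ?E n + 1 / real (Suc n)" by blast+
  \<comment> \<open>Where the fit is bad, \<open>T\<close> is irrelevant and set to zero, to keep the second moments
  bounded for all \<open>n\<close>.\<close>
  define T where "T n = (if ?E n < 1 then T0 n else (\<lambda>_. 0))" for n
  have "Bseq (\<lambda>n. (\<Sum>j<n. (eigs (P s n) ! j)\<^sup>2) / real n)" using sq_P by (intro convergent_imp_Bseq convergentI)
  then obtain L1 where L1: "\<And>n. norm ((\<Sum>j<n. (eigs (P s n) ! j)\<^sup>2) / real n) \<le> L1" by (auto simp: Bseq_def)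
  have "Bseq (\<lambda>n. (\<Sum>i<n. \<Sum>j<n. (Z n $$ (i, j))\<^sup>2) / (real n)\<^sup>2)" using Z_energy by (intro convergent_imp_Bseq convergentI)
  then obtain L2 where L2: "\<And>n. norm ((\<Sum>i<n. \<Sum>j<n. (Z n $$ (i, j))\<^sup>2) / (real n)\<^sup>2) \<le> L2" by (auto simp: Bseq_def)
  have pos: "L1 \<ge> 0" "L2 \<ge> 0" using L1[of 0] L2[of 0] by auto
  have sq2: "(a + b)\<^sup>2 \<le> 2 * a\<^sup>2 + 2 * b\<^sup>2" for a b :: real
    using zero_le_power2[of "a - b"] by (simp add: power2_sum power2_diff)
  have bnd: "(\<Sum>j<n. (T0 n j)\<^sup>2) / real n \<le> 8 + 4 * L1 + 2 * L2" if "?E n < 1" for n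
  proof -
    let ?t = "\<lambda>j. eigs (Q (T0 n) n) ! j" let ?l = "\<lambda>j. eigs (P s n) ! j"
    have "1 / real (Suc n) \<le> 1" by simp
    then have v2: "val n (T0 n) \<le> 2" using T0(2)[of n] that by linarith
    have "(\<Sum>j<n. (?t j)\<^sup>2) \<le> (\<Sum>j<n. 2 * (?t j - ?l j)\<^sup>2 + 2 * (?l j)\<^sup>2)"
    proof (rule sum_mono)
      fix j show "(?t j)\<^sup>2 \<le> 2 * (?t j - ?l j)\<^sup>2 + 2 * (?l j)\<^sup>2" using sq2[of "?t j - ?l j" "?l j"] by simp
    qed
    then have "(\<Sum>j<n. (?t j)\<^sup>2) / real n \<le> (\<Sum>j<n. 2 * (?t j - ?l j)\<^sup>2 + 2 * (?l j)\<^sup>2) / real n" by (rule divide_right_mono) simp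
    also have "\<dots> = 2 * val n (T0 n) + 2 * ((\<Sum>j<n. (?l j)\<^sup>2) / real n)"
      by (simp add: sum.distrib sum_distrib_left[symmetric] add_divide_distrib)
    also have "\<dots> \<le> 2 * 2 + 2 * L1"
    proof -
      have "(\<Sum>j<n. (?l j)\<^sup>2) / real n \<le> L1" using L1[of n] by (metis abs_le_D1 real_norm_def)
      then show ?thesis using v2 by linarith
    qed
    finally have t: "(\<Sum>j<n. (?t j)\<^sup>2) / real n \<le> 4 + 2 * L1" by simp
    have "(\<Sum>j<n. (T0 n j)\<^sup>2) = (\<Sum>i<n. \<Sum>j<n. (dg (T0 n) i j)\<^sup>2)"
      by (simp add: if_distrib[of "\<lambda>x. x\<^sup>2"] cong: if_cong)
    also have "\<dots> \<le> (\<Sum>i<n. \<Sum>j<n. 2 * (Q (T0 n) n $$ (i, j))\<^sup>2 + 2 * (Z n $$ (i, j))\<^sup>2 / real n)"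
    proof (intro sum_mono)
      fix i j assume "i \<in> {..<n}" "j \<in> {..<n}"
      then have q: "Q (T0 n) n $$ (i, j) = dg (T0 n) i j + Z n $$ (i, j) / sqrt (real n)" by (intro Q_entry) auto
      have "(dg (T0 n) i j)\<^sup>2 \<le> 2 * (Q (T0 n) n $$ (i, j))\<^sup>2 + 2 * (- (Z n $$ (i, j) / sqrt (real n)))\<^sup>2"
        using sq2[of "Q (T0 n) n $$ (i, j)" "- (Z n $$ (i, j) / sqrt (real n))"] unfolding q by simp
      then show "(dg (T0 n) i j)\<^sup>2 \<le> 2 * (Q (T0 n) n $$ (i, j))\<^sup>2 + 2 * (Z n $$ (i, j))\<^sup>2 / real n"
        by (simp only: power2_minus power_divide) simp
    qed
    also have "\<dots> = 2 * (\<Sum>j<n. (?t j)\<^sup>2) + 2 * ((\<Sum>i<n. \<Sum>j<n. (Z n $$ (i, j))\<^sup>2) / real n)"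
      unfolding sum_eigs_square[OF Q_carrier Q_sym]
      by (simp add: sum.distrib sum_distrib_left sum_divide_distrib)
    finally have "(\<Sum>j<n. (T0 n j)\<^sup>2) / real n \<le> (2 * (\<Sum>j<n. (?t j)\<^sup>2) + 2 * ((\<Sum>i<n. \<Sum>j<n. (Z n $$ (i, j))\<^sup>2) / real n)) / real n"
      by (rule divide_right_mono) simp
    also have "\<dots> = 2 * ((\<Sum>j<n. (?t j)\<^sup>2) / real n) + 2 * ((\<Sum>i<n. \<Sum>j<n. (Z n $$ (i, j))\<^sup>2) / (real n)\<^sup>2)"
    proof -
      have "(2 * a + 2 * (b / N)) / N = 2 * (a / N) + 2 * (b / N\<^sup>2)" for a b N :: real
        by (simp add: add_divide_distrib power2_eq_square)
      then show ?thesis .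
    qed
    also have "\<dots> \<le> 8 + 4 * L1 + 2 * L2"
    proof -
      have "(\<Sum>i<n. \<Sum>j<n. (Z n $$ (i, j))\<^sup>2) / (real n)\<^sup>2 \<le> L2" using L2[of n] by (metis abs_le_D1 real_norm_def)
      then show ?thesis using t by linarith
    qed
    finally show ?thesis .
  qed
  show thesis
  proof (rule that[of T "8 + 4 * L1 + 2 * L2"])
    show "antimono_on {..<n} (T n)" for n using T0(1) by (auto simp: T_def monotone_on_def)
    show "(\<Sum>j<n. (T n j)\<^sup>2) / real n \<le> 8 + 4 * L1 + 2 * L2" for n using bnd[of n] pos by (auto simp: T_def)
    show "val n (T n) < ?E n + 1 / real (Suc n)" if "?E n < 1" for n using T0(2)[of n] that by (simp only: T_def if_True)
  qed
qed

text \<open>A weak limit \<open>\<nu>\<close> of near-optimal diagonals satisfies the same equation as \<open>H\<close>, with noise level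
  \<open>r\<close> instead of \<open>s\<close>. Eliminating the common solution leaves the subordination equation that
  characterises the free convolution of \<open>\<nu>\<close> with a semicircular distribution of variance
  \<open>r\<^sup>2 - s\<^sup>2\<close>.\<close>

theorem free_convolution_of_fit:
  assumes rs: "r > s" and lim: "liminf (\<lambda>n. ereal (fit_error n (Z n) (P s n))) \<le> 0"
  obtains \<nu> where "real_distribution \<nu>" "is_free_additive_convolution (semicircle (r\<^sup>2 - s\<^sup>2)) \<nu> H"
proof -
  let ?E = "\<lambda>n. fit_error n (Z n) (P s n)"
  obtain T C where anti: "\<And>n. antimono_on {..<n} (T n)" and C: "\<And>n. (\<Sum>j<n. (T n j)\<^sup>2) / real n \<le> C"
    and T: "\<And>n. ?E n < 1 \<Longrightarrow> val n (T n) < ?E n + 1 / real (Suc n)"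
    by (rule near_optimal_diagonals) blast
  obtain q0 where q0: "strict_mono q0" "((\<lambda>n. ereal (?E n)) \<circ> q0) \<longlonglongrightarrow> liminf (\<lambda>n. ereal (?E n))"
    using liminf_subseq_lim by blast
  have "0 \<le> liminf (\<lambda>n. ereal (?E n))" by (intro Liminf_bounded always_eventually allI) (simp add: fit_error_bounds)
  then have "liminf (\<lambda>n. ereal (?E n)) = 0" using lim by simp
  then have E0: "(\<lambda>k. ?E (q0 k)) \<longlonglongrightarrow> 0" using q0(2) by (simp add: o_def zero_ereal_def)
  \<comment> \<open>Sizes are shifted by one, since the empirical distribution of no points is not a probability
  measure.\<close>
  define s' where "s' k = q0 (Suc k) - 1" for k
  have s': "Suc (s' k) = q0 (Suc k)" for k using strict_mono_imp_increasing[OF q0(1), of "Suc k"] by (simp add: s'_def)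
  have sm: "strict_mono s'" unfolding strict_mono_Suc_iff
  proof
    fix k have "q0 (Suc k) < q0 (Suc (Suc k))" using q0(1) by (simp add: strict_mono_Suc_iff)
    then show "s' k < s' (Suc k)" using s'[of k] s'[of "Suc k"] by linarith
  qed
  have tight: "tight (\<lambda>k. emp (Suc k) (T (Suc k)))" by (rule tight_emp[OF C]) simp
  obtain \<rho> \<nu> where \<rho>: "strict_mono (\<rho> :: nat \<Rightarrow> nat)" "real_distribution \<nu>"
    and w: "weak_conv_m ((\<lambda>k. emp (Suc k) (T (Suc k))) \<circ> s' \<circ> \<rho>) \<nu>"
    using tight_imp_convergent_subsubsequence[OF tight sm] by blast
  define q where "q k = q0 (Suc (\<rho> k))" for k
  have q: "strict_mono q" unfolding q_def strict_mono_Suc_iff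
    using \<rho>(1) q0(1) by (simp add: strict_mono_Suc_iff strict_mono_less strict_mono_less[OF q0(1)])
  have q1: "q k \<ge> 1" for k using s'[of "\<rho> k"] by (simp add: q_def)
  have w': "weak_conv_m (\<lambda>k. emp (q k) (T (q k))) \<nu>" using w by (simp add: o_def s' q_def)
  have dist: "real_distribution (emp (q k) (T (q k)))" for k by (rule real_distribution_emp[OF q1])
  have "strict_mono (\<lambda>k. Suc (\<rho> k))" using \<rho>(1) by (simp add: strict_mono_Suc_iff)
  from LIMSEQ_subseq_LIMSEQ[OF E0 this] have Eq: "(\<lambda>k. ?E (q k)) \<longlonglongrightarrow> 0" by (simp add: o_def q_def)
  have valq: "(\<lambda>k. val (q k) (T (q k))) \<longlonglongrightarrow> 0"
  proof (rule tendsto_sandwich[OF _ _ tendsto_const])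
    show "\<forall>\<^sub>F k in sequentially. 0 \<le> val (q k) (T (q k))" by (intro always_eventually allI val_nonneg)
    have "\<forall>\<^sub>F k in sequentially. ?E (q k) < 1" using Eq by (rule order_tendstoD) simp
    then show "\<forall>\<^sub>F k in sequentially. val (q k) (T (q k)) \<le> ?E (q k) + 1 / real (Suc (q k))"
      by eventually_elim (rule less_imp_le[OF T])
    have "(\<lambda>n. 1 / real (Suc n)) \<longlonglongrightarrow> 0" using LIMSEQ_inverse_real_of_nat by (simp add: inverse_eq_divide)
    from LIMSEQ_subseq_LIMSEQ[OF this q] have "(\<lambda>k. 1 / real (Suc (q k))) \<longlonglongrightarrow> 0" by (simp add: o_def)
    from tendsto_add[OF Eq this] show "(\<lambda>k. ?E (q k) + 1 / real (Suc (q k))) \<longlonglongrightarrow> 0" by simp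
  qed
  have key: "msol (s\<^sup>2) z = SM \<nu> (z + of_real (r\<^sup>2) * msol (s\<^sup>2) z)" if z: "Im z > 0" for z
  proof -
    let ?X = "\<lambda>k i j. dg (T (q k)) i j + Z (q k) $$ (i, j) / sqrt (real (q k))"
    let ?s = "\<lambda>k. ST (q k) (?X k) z" let ?l = "\<lambda>k. stj (q k) (\<lambda>j. eigs (P s (q k)) ! j) z"
    have l: "?l \<longlonglongrightarrow> msol (s\<^sup>2) z" using LIMSEQ_subseq_LIMSEQ[OF stj_P[OF _ z] q, of s] by (simp add: o_def)
    have "(\<lambda>k. ?s k - ?l k) \<longlonglongrightarrow> 0"
    proof (rule Lim_null_comparison[OF always_eventually[rule_format]])
      show "norm (?s k - ?l k) \<le> sqrt (val (q k) (T (q k))) / (Im z)\<^sup>2" for k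
        unfolding stj_Q[OF z] using stj_perturbation[OF z] by simp
      have "(\<lambda>k. sqrt (val (q k) (T (q k))) / (Im z)\<^sup>2) \<longlonglongrightarrow> sqrt 0 / (Im z)\<^sup>2"
        by (intro tendsto_divide tendsto_real_sqrt valq tendsto_const) (use z in auto)
      then show "(\<lambda>k. sqrt (val (q k) (T (q k))) / (Im z)\<^sup>2) \<longlonglongrightarrow> 0" by simp
    qed
    from tendsto_add[OF this l] have sl: "?s \<longlonglongrightarrow> msol (s\<^sup>2) z" by simp
    have "Im (msol (s\<^sup>2) z) \<ge> 0 \<and> msol (s\<^sup>2) z = SM \<nu> (z + of_real (r\<^sup>2) * msol (s\<^sup>2) z)"
    proof (rule pastur_limit_point[OF z _ _ sl, where F="\<lambda>k. ST (q k) (dg (T (q k)))"])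
      show "Im (?s k) \<ge> 0" for k by (rule Im_ST[OF Q_kernel_sym z])
      show "cmod (ST (q k) (dg (T (q k))) w - ST (q k) (dg (T (q k))) w') \<le> cmod (w - w') / (Im z)\<^sup>2" if "Im w \<ge> Im z" "Im w' \<ge> Im z" for k w w'
        by (rule ST_lipschitz[OF _ that z]) (auto simp: symk_def)
      show "(\<lambda>k. ST (q k) (dg (T (q k))) w) \<longlonglongrightarrow> SM \<nu> w" if w: "Im w > 0" for w
        using weak_conv_SM[OF dist \<rho>(2) w' w] by (simp only: SM_emp[OF q1 w] ST_diagonal[OF w])
      show "(\<lambda>k. cmod (?s k - ST (q k) (dg (T (q k))) (z + of_real (r\<^sup>2) * ?s k))) \<longlonglongrightarrow> 0"
        using LIMSEQ_subseq_LIMSEQ[OF Q_defect[OF anti C z] q] by (simp add: o_def defect_def)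
    qed simp
    then show ?thesis by blast
  qed
  have v: "r\<^sup>2 - s\<^sup>2 > 0" using rs s by (simp add: power_strict_mono)
  have "is_free_additive_convolution (semicircle (r\<^sup>2 - s\<^sup>2)) \<nu> H"
  proof (rule free_conv_of_equation[OF H K supp v])
    fix w :: complex assume w: "Im w > s"
    then have wp: "Im w > 0" using s by simp
    define z where "z = w - of_real (s\<^sup>2) * SM H w"
    have zw: "z + of_real (s\<^sup>2) * SM H w = w" by (simp add: z_def)
    have "Im (SM H w) \<le> 1 / Im w"
      using real_distribution.SM_bound[OF H wp] abs_Im_le_cmod[of "SM H w"] by linarith
    then have "s\<^sup>2 * Im (SM H w) \<le> s\<^sup>2 * (1 / Im w)" by (intro mult_left_mono) auto
    also have "\<dots> < Im w"
    proof -
      have "s * s < Im w * Im w" using w s by (intro mult_strict_mono) auto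
      then show ?thesis using wp by (simp add: power2_eq_square pos_divide_less_eq)
    qed
    finally have z: "Im z > 0" by (simp add: z_def)
    have "SM H w = msol (s\<^sup>2) z"
      by (rule msol_unique[OF z zero_le_power2]) (use real_distribution.Im_SM_nonneg[OF H wp] zw in simp_all)
    then have "SM H w = SM \<nu> (z + of_real (r\<^sup>2) * SM H w)" using key[OF z] by simp
    also have "z + of_real (r\<^sup>2) * SM H w = w + of_real (r\<^sup>2 - s\<^sup>2) * SM H w" by (simp add: z_def algebra_simps)
    finally show "SM H w = SM \<nu> (w + of_real (r\<^sup>2 - s\<^sup>2) * SM H w)" .
  qed
  then show thesis using that \<rho>(2) by blast
qed

end

section \<open>Laws of the noise, and the conclusion\<close>

lemma sym_mat_measurable: "sym_mat n \<in> measurable (\<Pi>\<^sub>M _\<in>edges n. borel) (borel_mat n)"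
proof (rule measurable_borel_mat)
  fix i j assume "i < n" "j < n"
  then have "(min i j, max i j) \<in> edges n" by (auto simp: edges_def)
  then have "(\<lambda>g. g (min i j, max i j)) \<in> borel_measurable (\<Pi>\<^sub>M _\<in>edges n. borel :: real measure)" by measurable
  then show "(\<lambda>g. sym_mat n g $$ (i, j)) \<in> borel_measurable (\<Pi>\<^sub>M _\<in>edges n. borel)"
    using \<open>i < n\<close> \<open>j < n\<close> by (simp add: sym_mat_def)
qed (simp add: sym_mat_def)

lemma scale_measurable: "(\<lambda>X. t \<cdot>\<^sub>m X) \<in> measurable (borel_mat n) (borel_mat n)"
proof (rule measurable_borel_mat)
  show "t \<cdot>\<^sub>m X \<in> carrier_mat n n" if "X \<in> space (borel_mat n)" for X using that by (simp add: space_borel_mat)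
  fix i j assume ij: "i < n" "j < n"
  have "(\<lambda>X. t * X $$ (i, j)) \<in> borel_measurable (borel_mat n)" using borel_mat_entry[OF ij] by measurable
  then show "(\<lambda>X. (t \<cdot>\<^sub>m X) $$ (i, j)) \<in> borel_measurable (borel_mat n)"
    by (rule measurable_cong[THEN iffD1, rotated]) (use ij in \<open>auto simp: space_borel_mat\<close>)
qed

lemma nn_integral_distr_measurable:
  "T \<in> measurable M M' \<Longrightarrow> f \<in> borel_measurable M' \<Longrightarrow> integral\<^sup>N (distr M M' T) f = (\<integral>\<^sup>+x. f (T x) \<partial>M)"
  by (simp add: nn_integral_distr)

lemma wignerI:
  assumes D: "\<And>e. prob_space (D e)" and s: "\<And>e. sets (D e) = sets borel"
    and "\<And>e. integrable (D e) (\<lambda>x. x ^ 4)" "\<And>e. (\<integral>x. x ^ 4 \<partial>D e) \<le> K" "\<And>e. (\<integral>x. x \<partial>D e) = 0"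
    and "\<And>i j. i < j \<Longrightarrow> (\<integral>x. x\<^sup>2 \<partial>D (i, j)) = 1"
  shows "wigner D n K"
proof -
  interpret product_prob_space D by (rule product_prob_spaceI[OF D])
  show ?thesis by unfold_locales (use assms in auto)
qed

lemma sym_mat_PiM_measurable:
  assumes "\<And>e. sets (D e) = sets borel" shows "sym_mat n \<in> measurable (Pi\<^sub>M (edges n) D) (borel_mat n)"
  using sym_mat_measurable[of n] measurable_cong_sets[OF sets_PiM_cong[of "edges n" "edges n" D "\<lambda>_. borel"] refl] assms by blast

lemma nn_integral_matrix_law:
  assumes law: "distr M (borel_mat n) X = distr (distr (Pi\<^sub>M (edges n) D) (borel_mat n) (sym_mat n)) (borel_mat n) (\<lambda>G. t \<cdot>\<^sub>m G)"
    and X: "X \<in> measurable M (borel_mat n)" and s: "\<And>e. sets (D e) = sets borel" and f: "f \<in> borel_measurable (borel_mat n)"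
  shows "(\<integral>\<^sup>+\<omega>. f (X \<omega>) \<partial>M) = (\<integral>\<^sup>+g. f (t \<cdot>\<^sub>m sym_mat n g) \<partial>Pi\<^sub>M (edges n) D)"
proof -
  note m = sym_mat_PiM_measurable[OF s, of n]
  have m2: "(\<lambda>G. f (t \<cdot>\<^sub>m G)) \<in> borel_measurable (borel_mat n)" by (rule measurable_compose[OF scale_measurable f])
  have "(\<integral>\<^sup>+\<omega>. f (X \<omega>) \<partial>M) = (\<integral>\<^sup>+x. f x \<partial>distr M (borel_mat n) X)" by (rule nn_integral_distr_measurable[OF X f, symmetric])
  also have "\<dots> = (\<integral>\<^sup>+G. f (t \<cdot>\<^sub>m G) \<partial>distr (Pi\<^sub>M (edges n) D) (borel_mat n) (sym_mat n))"
    unfolding law by (rule nn_integral_distr_measurable) (use scale_measurable f in simp_all)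
  also have "\<dots> = (\<integral>\<^sup>+g. f (t \<cdot>\<^sub>m sym_mat n g) \<partial>Pi\<^sub>M (edges n) D)"
    by (rule nn_integral_distr_measurable[OF m m2])
  finally show ?thesis .
qed

text \<open>Conditioning is trivial here, so only the marginal law of the noise matters.\<close>

lemma noise_deterministic:
  assumes M: "prob_space M" and wig: "\<And>n. wigner D n K" and t: "t \<ge> 0"
    and b: "\<And>n. b n \<in> carrier_mat n n" "\<And>n. symk n (mk_fun (b n))"
    and X: "\<And>n. X n \<in> measurable M (borel_mat n)"
    and law: "\<And>n. distr M (borel_mat n) (X n) = distr (distr (Pi\<^sub>M (edges n) D) (borel_mat n) (sym_mat n)) (borel_mat n) (\<lambda>G. t \<cdot>\<^sub>m G)"
  shows "noise M (\<lambda>_. D) K t (\<lambda>n _. b n) X"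
proof -
  interpret prob_space M by fact
  show ?thesis
  proof (intro noise.intro noise_axioms.intro)
    show "prob_space M" by fact
    show "wigner D n K" if "n \<ge> 1" for n by (rule wig)
    show "(\<lambda>_. b n) \<in> measurable M (borel_mat n)" for n using b by (simp add: space_borel_mat)
    fix n and \<phi> :: "real mat \<times> real mat \<Rightarrow> ennreal" and C
    assume \<phi>: "\<phi> \<in> borel_measurable (borel_mat n \<Otimes>\<^sub>M borel_mat n)"
      and le: "\<And>b. b \<in> carrier_mat n n \<Longrightarrow> symk n (mk_fun b) \<Longrightarrow> (\<integral>\<^sup>+g. \<phi> (b, t \<cdot>\<^sub>m sym_mat n g) \<partial>Pi\<^sub>M (edges n) D) \<le> C"
    have f: "(\<lambda>x. \<phi> (b n, x)) \<in> borel_measurable (borel_mat n)"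
      by (rule measurable_compose[OF measurable_Pair1' \<phi>]) (simp add: space_borel_mat b)
    show "(\<integral>\<^sup>+\<omega>. \<phi> (b n, X n \<omega>) \<partial>M) \<le> C"
      unfolding nn_integral_matrix_law[OF law X wigner.sets_D[OF wig] f] by (rule le[OF b])
  qed (use X t b in auto)
qed

text \<open>Independence allows integrating over the noise first, at a fixed value of \<open>B\<close>.\<close>

lemma noise_independent:
  assumes M: "prob_space M" and wig: "\<And>n. n \<ge> 1 \<Longrightarrow> wigner D n K" and s: "\<And>e. sets (D e) = sets borel" and t: "t \<ge> 0"
    and B: "\<And>n. B n \<in> measurable M (borel_mat n)" "\<And>n \<omega>. \<omega> \<in> space M \<Longrightarrow> symk n (mk_fun (B n \<omega>))"
    and X: "\<And>n. X n \<in> measurable M (borel_mat n)"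
    and law: "\<And>n. distr M (borel_mat n) (X n) = distr (Pi\<^sub>M (edges n) D) (borel_mat n) (sym_mat n)"
    and ind: "\<And>n. distr M (borel_mat n) (B n) \<Otimes>\<^sub>M distr M (borel_mat n) (X n) = distr M (borel_mat n \<Otimes>\<^sub>M borel_mat n) (\<lambda>\<omega>. (B n \<omega>, X n \<omega>))"
  shows "noise M (\<lambda>_. D) K t B (\<lambda>n \<omega>. t \<cdot>\<^sub>m X n \<omega>)"
proof -
  interpret prob_space M by fact
  show ?thesis
  proof (intro noise.intro noise_axioms.intro)
    show "prob_space M" by fact
    show "wigner D n K" if "n \<ge> 1" for n by (rule wig[OF that])
    show "(\<lambda>\<omega>. t \<cdot>\<^sub>m X n \<omega>) \<in> measurable M (borel_mat n)" for n by (rule measurable_compose[OF X scale_measurable])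
    fix n and \<phi> :: "real mat \<times> real mat \<Rightarrow> ennreal" and C
    assume \<phi>: "\<phi> \<in> borel_measurable (borel_mat n \<Otimes>\<^sub>M borel_mat n)"
      and le: "\<And>b. b \<in> carrier_mat n n \<Longrightarrow> symk n (mk_fun b) \<Longrightarrow> (\<integral>\<^sup>+g. \<phi> (b, t \<cdot>\<^sub>m sym_mat n g) \<partial>Pi\<^sub>M (edges n) D) \<le> C"
    define \<psi> where "\<psi> p = \<phi> (fst p, t \<cdot>\<^sub>m snd p)" for p
    have "(\<lambda>p. (fst p, t \<cdot>\<^sub>m snd p)) \<in> measurable (borel_mat n \<Otimes>\<^sub>M borel_mat n) (borel_mat n \<Otimes>\<^sub>M borel_mat n)"
      by (intro measurable_Pair measurable_fst measurable_compose[OF measurable_snd scale_measurable])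
    then have \<psi>: "\<psi> \<in> borel_measurable (borel_mat n \<Otimes>\<^sub>M borel_mat n)" unfolding \<psi>_def by (rule measurable_compose[OF _ \<phi>])
    interpret L: prob_space "distr M (borel_mat n) (X n)" by (rule prob_space_distr[OF X])
    have \<psi>': "\<psi> \<in> borel_measurable (distr M (borel_mat n) (B n) \<Otimes>\<^sub>M distr M (borel_mat n) (X n))"
      using \<psi> unfolding ind by simp
    have mX: "(\<lambda>\<omega>. (B n \<omega>, X n \<omega>)) \<in> measurable M (borel_mat n \<Otimes>\<^sub>M borel_mat n)" using B X by simp
    have "(\<integral>\<^sup>+\<omega>. \<phi> (B n \<omega>, t \<cdot>\<^sub>m X n \<omega>) \<partial>M) = (\<integral>\<^sup>+\<omega>. \<psi> (B n \<omega>, X n \<omega>) \<partial>M)" by (simp add: \<psi>_def)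
    also have "\<dots> = (\<integral>\<^sup>+p. \<psi> p \<partial>distr M (borel_mat n \<Otimes>\<^sub>M borel_mat n) (\<lambda>\<omega>. (B n \<omega>, X n \<omega>)))"
      by (rule nn_integral_distr_measurable[OF mX \<psi>, symmetric])
    also have "\<dots> = (\<integral>\<^sup>+b. \<integral>\<^sup>+x. \<psi> (b, x) \<partial>distr M (borel_mat n) (X n) \<partial>distr M (borel_mat n) (B n))"
      unfolding ind[symmetric] by (rule L.nn_integral_fst[OF \<psi>', symmetric])
    also have "\<dots> = (\<integral>\<^sup>+\<omega>. \<integral>\<^sup>+x. \<psi> (B n \<omega>, x) \<partial>distr M (borel_mat n) (X n) \<partial>M)"
      by (rule nn_integral_distr[OF B(1) L.borel_measurable_nn_integral_fst[OF \<psi>']])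
    also have "\<dots> \<le> (\<integral>\<^sup>+\<omega>. C \<partial>M)"
    proof (rule nn_integral_mono)
      fix \<omega> assume w: "\<omega> \<in> space M"
      have b: "B n \<omega> \<in> carrier_mat n n" using measurable_space[OF B(1) w] by (simp add: space_borel_mat)
      have p1: "(\<lambda>x. \<psi> (B n \<omega>, x)) \<in> borel_measurable (borel_mat n)"
        by (rule measurable_compose[OF measurable_Pair1' \<psi>]) (simp add: space_borel_mat b)
      have "(\<integral>\<^sup>+x. \<psi> (B n \<omega>, x) \<partial>distr M (borel_mat n) (X n)) = (\<integral>\<^sup>+g. \<psi> (B n \<omega>, sym_mat n g) \<partial>Pi\<^sub>M (edges n) D)"
        unfolding law by (rule nn_integral_distr_measurable[OF sym_mat_PiM_measurable[OF s] p1])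
      also have "\<dots> \<le> C" unfolding \<psi>_def fst_conv snd_conv by (rule le[OF b B(2)[OF w]])
      finally show "(\<integral>\<^sup>+x. \<psi> (B n \<omega>, x) \<partial>distr M (borel_mat n) (X n)) \<le> C" .
    qed
    also have "\<dots> = C" by (simp add: emeasure_space_1)
    finally show "(\<integral>\<^sup>+\<omega>. \<phi> (B n \<omega>, t \<cdot>\<^sub>m X n \<omega>) \<partial>M) \<le> C" .
  qed (use B t in auto)
qed

text \<open>For \<open>n = 0\<close> there are no entries and the identity compares two point masses; otherwise
  it is the characterisation of independence by product laws.\<close>

lemma top_left_law:
  fixes Z :: "nat \<Rightarrow> nat \<Rightarrow> 'w \<Rightarrow> real"
  assumes M: "prob_space M"
    and sym: "\<And>i j \<omega>. \<omega> \<in> space M \<Longrightarrow> Z i j \<omega> = Z j i \<omega>"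
    and indep: "prob_space.indep_vars M (\<lambda>_. borel) (\<lambda>(i, j). Z i j) {(i, j). i \<le> j}"
    and ident: "\<And>i j. i \<le> j \<Longrightarrow> distr M borel (Z i j) = distr M borel (Z 0 0)"
  shows "distr M (borel_mat n) (\<lambda>\<omega>. top_left n (\<lambda>i j. Z i j \<omega>)) = distr (Pi\<^sub>M (edges n) (\<lambda>_. distr M borel (Z 0 0))) (borel_mat n) (sym_mat n)"
proof -
  interpret prob_space M by fact
  let ?X = "\<lambda>(i, j). Z i j" let ?Y = "\<lambda>\<omega>. \<lambda>e\<in>edges n. ?X e \<omega>"
  have rv: "random_variable borel (?X e)" if "e \<in> {(i, j). i \<le> j}" for e using indep that unfolding indep_vars_def by blast
  have ind: "indep_vars (\<lambda>_. borel) ?X (edges n)" by (rule indep_vars_subset[OF indep]) (auto simp: edges_def)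
  have Y: "?Y \<in> measurable M (\<Pi>\<^sub>M _\<in>edges n. borel)" by (rule measurable_restrict) (rule rv, auto simp: edges_def)
  have PY: "distr M (\<Pi>\<^sub>M _\<in>edges n. borel) ?Y = Pi\<^sub>M (edges n) (\<lambda>_. distr M borel (Z 0 0))"
  proof (cases "edges n = {}")
    case True
    have "distr M (\<Pi>\<^sub>M _\<in>edges n. borel) ?Y = return (count_space {\<lambda>_. undefined}) (\<lambda>_. undefined)"
    proof (rule measure_eqI)
      fix A assume "A \<in> sets (distr M (\<Pi>\<^sub>M _\<in>edges n. borel) ?Y)"
      then have A: "A \<in> sets (\<Pi>\<^sub>M _\<in>edges n. borel :: real measure)" by simp
      then have "A = {} \<or> A = {\<lambda>_. undefined}" using True by (simp add: PiM_empty) blast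
      then show "emeasure (distr M (\<Pi>\<^sub>M _\<in>edges n. borel) ?Y) A = emeasure (return (count_space {\<lambda>_. undefined}) (\<lambda>_. undefined)) A"
      proof
        assume a: "A = {\<lambda>_. undefined}"
        have "?Y -` A \<inter> space M = space M" unfolding a True by auto
        then show ?thesis unfolding emeasure_distr[OF Y A] by (simp add: a emeasure_space_1)
      qed simp
    qed (simp add: True PiM_empty)
    also have "\<dots> = Pi\<^sub>M (edges n) (\<lambda>_. distr M borel (Z 0 0))"
      unfolding True PiM_empty by (rule measure_eqI) (auto simp: emeasure_return subset_singleton_iff)
    finally show ?thesis .
  next
    case False
    have "distr M (\<Pi>\<^sub>M _\<in>edges n. borel) ?Y = (\<Pi>\<^sub>M e\<in>edges n. distr M borel (?X e))"
      using indep_vars_iff_distr_eq_PiM'[where M'="\<lambda>_. borel" and X="?X", OF False, THEN iffD1, OF _ ind] rv by (auto simp: edges_def)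
    also have "\<dots> = Pi\<^sub>M (edges n) (\<lambda>_. distr M borel (Z 0 0))"
      by (rule PiM_cong) (auto simp: edges_def intro: ident)
    finally show ?thesis .
  qed
  have "distr (Pi\<^sub>M (edges n) (\<lambda>_. distr M borel (Z 0 0))) (borel_mat n) (sym_mat n) = distr M (borel_mat n) (sym_mat n \<circ> ?Y)"
    unfolding PY[symmetric] by (rule distr_distr[OF sym_mat_measurable Y])
  also have "\<dots> = distr M (borel_mat n) (\<lambda>\<omega>. top_left n (\<lambda>i j. Z i j \<omega>))"
  proof (rule distr_cong[OF refl refl])
    fix \<omega> assume "\<omega> \<in> space M"
    then show "(sym_mat n \<circ> ?Y) \<omega> = top_left n (\<lambda>i j. Z i j \<omega>)"
      by (intro eq_matI) (auto simp: sym_mat_def top_left_def edges_def min_def max_def sym)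
  qed
  finally show ?thesis ..
qed

definition goe_entry :: "nat \<times> nat \<Rightarrow> real measure" where
  "goe_entry = (\<lambda>(i, j). density lborel (\<lambda>x. ennreal (normal_density 0 (if i = j then sqrt 2 else 1) x)))"

lemma GOE_sym_mat: "GOE n = distr (Pi\<^sub>M (edges n) goe_entry) (borel_mat n) (sym_mat n)"
  unfolding GOE_def edges_def goe_entry_def sym_mat_def[abs_def] ..

lemma wigner_goe: "wigner goe_entry n 12"
proof (rule wignerI)
  let ?s = "\<lambda>e :: nat \<times> nat. if fst e = snd e then sqrt 2 else 1"
  have E: "goe_entry e = density lborel (\<lambda>x. ennreal (normal_density 0 (?s e) x))" for e
    by (cases e) (simp add: goe_entry_def)
  have pos: "?s e > 0" for e by simp
  show "prob_space (goe_entry e)" for e unfolding E by (rule prob_space_normal_density[OF pos])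
  show "sets (goe_entry e) = sets borel" for e unfolding E by simp
  have mom: "has_bochner_integral lborel (\<lambda>x. normal_density 0 (?s e) x * x ^ (2 * k)) (fact (2 * k) / ((2 / (?s e)\<^sup>2) ^ k * fact k))" for e k
    using normal_moment_even[OF pos, of 0 e k] by (simp only: diff_zero)
  have I: "(\<integral>x. f x \<partial>goe_entry e) = (\<integral>x. normal_density 0 (?s e) x * f x \<partial>lborel)" if "f \<in> borel_measurable borel" for f :: "real \<Rightarrow> real" and e
    unfolding E by (subst integral_density) (use that normal_density_nonneg in auto)
  show "integrable (goe_entry e) (\<lambda>x. x ^ 4)" for e
    unfolding E by (subst integrable_density) (use has_bochner_integral_iff[THEN iffD1, OF mom[of e 2]] normal_density_nonneg in auto)
  have "(\<integral>x. x ^ 4 \<partial>goe_entry e) = fact (2 * 2) / ((2 / (?s e)\<^sup>2) ^ 2 * fact 2)" for e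
    using has_bochner_integral_integral_eq[OF mom[of e 2]] by (subst I) simp_all
  moreover have "sqrt 2 ^ 4 = (4 :: real)" using power_mult[of "sqrt 2" 2 2] by simp
  ultimately show "(\<integral>x. x ^ 4 \<partial>goe_entry e) \<le> 12" for e by (simp add: fact_numeral power_divide)
  show "(\<integral>x. x \<partial>goe_entry e) = 0" for e
    using integral_normal_moment_odd[OF pos, of 0 e 0] by (subst I) simp_all
  show "(\<integral>x. x\<^sup>2 \<partial>goe_entry (i, j)) = 1" if "i < j" for i j
    using has_bochner_integral_integral_eq[OF mom[of "(i, j)" 1]] that by (subst I) simp_all
qed

lemma defect_cong_both:
  assumes "\<And>i j. i < n \<Longrightarrow> j < n \<Longrightarrow> B i j = B' i j" "\<And>i j. i < n \<Longrightarrow> j < n \<Longrightarrow> X i j = X' i j"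
  shows "defect n B X \<tau> z = defect n B' X' \<tau> z"
  using ST_cong[of n B B', OF assms(1)] ST_cong[of n X X', OF assms(2)] by (simp add: defect_def)


theorem proposition4p2:
  fixes M :: "'w measure"
    and A :: "nat \<Rightarrow> 'w \<Rightarrow> real mat"
    and Z :: "nat \<Rightarrow> nat \<Rightarrow> 'w \<Rightarrow> real"
    and Zhat :: "nat \<Rightarrow> 'w \<Rightarrow> real mat"
    and H :: "real measure"
    and \<sigma> \<sigma>hat h1 h2 :: real
  assumes "prob_space M"
    and "\<sigma> > 0"
    and A_meas: "\<And>n. A n \<in> measurable M (borel_mat n)"
    and A_sym: "\<And>n \<omega>. \<omega> \<in> space M \<Longrightarrow> transpose_mat (A n \<omega>) = A n \<omega>"
    and H_prob: "real_distribution H"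
    and esd_lim: "AE \<omega> in M. weak_conv_m (\<lambda>n. esd (A n \<omega>)) H"
    and H_compact: "\<exists>a b. measure H {a..b} = 1"
    and A_bounded: "AE \<omega> in M. \<forall>\<^sub>F n in sequentially. \<forall>l. eigenvalue (A n \<omega>) l \<longrightarrow> l \<in> {h1..h2}"
    and Z_sym: "\<And>i j \<omega>. \<omega> \<in> space M \<Longrightarrow> Z i j \<omega> = Z j i \<omega>"
    and Z_indep: "prob_space.indep_vars M (\<lambda>_. borel) (\<lambda>(i, j). Z i j) {(i, j). i \<le> j}"
    and Z_ident: "\<And>i j. i \<le> j \<Longrightarrow> distr M borel (Z i j) = distr M borel (Z 0 0)"
    and Z_fourth: "integrable M (\<lambda>\<omega>. Z 0 0 \<omega> ^ 4)"
    and Z_mean: "prob_space.expectation M (Z 0 0) = 0"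
    and Z_var: "prob_space.variance M (Z 0 0) = 1"
    and A_Z_indep: "\<And>n. prob_space.indep_var M (borel_mat n) (A n)
           (borel_mat n) (\<lambda>\<omega>. top_left n (\<lambda>i j. Z i j \<omega>))"
    and H_not_conv: "\<not> (\<exists>v>0. \<exists>\<nu>. real_distribution \<nu> \<and>
           is_free_additive_convolution (semicircle v) \<nu> H)"
    and "\<sigma>hat \<ge> 0"
    and Zhat_law: "\<And>n. distr M (borel_mat n) (Zhat n) =
           distr (GOE n) (borel_mat n) (\<lambda>G. \<sigma>hat \<cdot>\<^sub>m G)"
    and Zhat_indep: "\<And>n. indep_rvs M
           (borel_mat n \<Otimes>\<^sub>M borel_mat n) (\<lambda>\<omega>. (A n \<omega>, top_left n (\<lambda>i j. Z i j \<omega>)))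
           (borel_mat n) (Zhat n)"
  defines "R \<equiv> \<lambda>n \<omega>. fit_error n (Zhat n \<omega>)
           (A n \<omega> + (\<sigma> / sqrt (real n)) \<cdot>\<^sub>m top_left n (\<lambda>i j. Z i j \<omega>))"
  shows "AE \<omega> in M.
           (\<sigma>hat < \<sigma> \<longrightarrow> limsup (\<lambda>n. ereal (R n \<omega>)) = 0) \<and>
           (\<sigma>hat > \<sigma> \<longrightarrow> liminf (\<lambda>n. ereal (R n \<omega>)) > 0)"
proof -
  interpret prob_space M by fact
  interpret H: real_distribution H by fact
  define W where "W n \<omega> = top_left n (\<lambda>i j. Z i j \<omega>)" for n \<omega>
  define D where "D = (\<lambda>_ :: nat \<times> nat. distr M borel (Z 0 0))"
  define K4 where "K4 = expectation (\<lambda>\<omega>. Z 0 0 \<omega> ^ 4)"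
  \<comment> \<open>Only meaningful if \<open>\<sigma>hat < \<sigma>\<close>.\<close>
  define c where "c = sqrt (\<sigma>\<^sup>2 - \<sigma>hat\<^sup>2)"
  have Z00: "random_variable borel (Z 0 0)" using Z_indep unfolding indep_vars_def by force
  have DI: "(\<integral>x. f x \<partial>D e) = expectation (\<lambda>\<omega>. f (Z 0 0 \<omega>))" if "f \<in> borel_measurable borel" for f :: "real \<Rightarrow> real" and e
    unfolding D_def by (rule integral_distr[OF Z00 that])
  have wigW: "wigner D n K4" for n
  proof (rule wignerI)
    show "prob_space (D e)" for e unfolding D_def by (rule prob_space_distr[OF Z00])
    show "integrable (D e) (\<lambda>x. x ^ 4)" for e unfolding D_def by (subst integrable_distr_eq[OF Z00]) (use Z_fourth in auto)
    show "(\<integral>x. x ^ 4 \<partial>D e) \<le> K4" for e by (subst DI) (auto simp: K4_def)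
    show "(\<integral>x. x \<partial>D e) = 0" for e by (subst DI) (use Z_mean in auto)
    show "(\<integral>x. x\<^sup>2 \<partial>D (i, j)) = 1" if "i < j" for i j by (subst DI) (use Z_var Z_mean in auto)
  qed (simp add: D_def)
  have Wm: "W n \<in> measurable M (borel_mat n)" and AW: "distr M (borel_mat n) (A n) \<Otimes>\<^sub>M distr M (borel_mat n) (W n) = distr M (borel_mat n \<Otimes>\<^sub>M borel_mat n) (\<lambda>\<omega>. (A n \<omega>, W n \<omega>))" for n
    using A_Z_indep[of n] unfolding indep_var_distribution_eq W_def by auto
  have Zm: "Zhat n \<in> measurable M (borel_mat n)" for n using Zhat_indep[of n] by (simp add: indep_rvs_def)
  have carrA: "A n \<omega> \<in> carrier_mat n n" if "\<omega> \<in> space M" for n \<omega> using measurable_space[OF A_meas that] by (simp add: space_borel_mat)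
  have carrZ: "Zhat n \<omega> \<in> carrier_mat n n" if "\<omega> \<in> space M" for n \<omega> using measurable_space[OF Zm that] by (simp add: space_borel_mat)
  have carrW: "W n \<omega> \<in> carrier_mat n n" for n \<omega> by (simp add: W_def top_left_def)
  have symA: "symk n (mk_fun (A n \<omega>))" if "\<omega> \<in> space M" for n \<omega> by (rule symk_mk_fun[OF carrA[OF that] A_sym[OF that]])
  have nA: "noise M (\<lambda>_. D) K4 t A (\<lambda>n \<omega>. t \<cdot>\<^sub>m W n \<omega>)" if "t \<ge> 0" for t
  proof (rule noise_independent[OF \<open>prob_space M\<close> wigW _ that A_meas symA Wm _ AW])
    show "distr M (borel_mat n) (W n) = distr (Pi\<^sub>M (edges n) D) (borel_mat n) (sym_mat n)" for n
      unfolding W_def D_def by (rule top_left_law[OF \<open>prob_space M\<close> Z_sym Z_indep Z_ident])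
  qed (simp add: D_def)
  have nZ: "noise M (\<lambda>_. goe_entry) 12 \<sigma>hat (\<lambda>n _. mat_diag n (step ps n)) Zhat" for ps
  proof (rule noise_deterministic[OF \<open>prob_space M\<close> wigner_goe \<open>\<sigma>hat \<ge> 0\<close> _ _ Zm])
    show "distr M (borel_mat n) (Zhat n) = distr (distr (Pi\<^sub>M (edges n) goe_entry) (borel_mat n) (sym_mat n)) (borel_mat n) (\<lambda>G. \<sigma>hat \<cdot>\<^sub>m G)" for n
      unfolding Zhat_law GOE_sym_mat ..
    show "symk n (mk_fun (mat_diag n (step ps n)))" for n by (auto simp: symk_def mat_diag_def)
  qed simp
  have defA: "AE \<omega> in M. \<forall>z. Im z > 0 \<longrightarrow> (\<lambda>n. defect n (mk_fun (A n \<omega>)) (\<lambda>i j. A n \<omega> $$ (i, j) + t * W n \<omega> $$ (i, j) / sqrt (real n)) t z) \<longlonglongrightarrow> 0"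
    if "t \<ge> 0" for t
    using noise.defect_tendsto[OF nA[OF that]]
  proof eventually_elim
    case (elim \<omega>)
    have "defect n (mk_fun (A n \<omega>)) (\<lambda>i j. A n \<omega> $$ (i, j) + (t \<cdot>\<^sub>m W n \<omega>) $$ (i, j) / sqrt (real n)) t z
        = defect n (mk_fun (A n \<omega>)) (\<lambda>i j. A n \<omega> $$ (i, j) + t * W n \<omega> $$ (i, j) / sqrt (real n)) t z" for n z
      by (rule defect_cong) (use carrW[of n \<omega>] in auto)
    then show ?case using elim by simp
  qed
  have "AE \<omega> in M. \<forall>ps. \<forall>z. Im z > 0 \<longrightarrow> (\<lambda>n. defect n (mk_fun (mat_diag n (step ps n))) (\<lambda>i j. mat_diag n (step ps n) $$ (i, j) + Zhat n \<omega> $$ (i, j) / sqrt (real n)) \<sigma>hat z) \<longlonglongrightarrow> 0"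
    unfolding AE_all_countable using noise.defect_tendsto[OF nZ] by blast
  then have defZ: "AE \<omega> in M. \<forall>ps. \<forall>z. Im z > 0 \<longrightarrow> (\<lambda>n. defect n (dg (step ps n)) (\<lambda>i j. dg (step ps n) i j + Zhat n \<omega> $$ (i, j) / sqrt (real n)) \<sigma>hat z) \<longlonglongrightarrow> 0"
  proof eventually_elim
    case (elim \<omega>)
    have "defect n (mk_fun (mat_diag n (step ps n))) (\<lambda>i j. mat_diag n (step ps n) $$ (i, j) + Zhat n \<omega> $$ (i, j) / sqrt (real n)) \<sigma>hat z
        = defect n (dg (step ps n)) (\<lambda>i j. dg (step ps n) i j + Zhat n \<omega> $$ (i, j) / sqrt (real n)) \<sigma>hat z" for n ps z
      by (rule defect_cong_both) (auto simp: mat_diag_def)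
    then show ?case using elim by simp
  qed
  have defc: "AE \<omega> in M. \<sigma>hat < \<sigma> \<longrightarrow> (\<forall>z. Im z > 0 \<longrightarrow> (\<lambda>n. defect n (mk_fun (A n \<omega>)) (\<lambda>i j. A n \<omega> $$ (i, j) + c * W n \<omega> $$ (i, j) / sqrt (real n)) c z) \<longlonglongrightarrow> 0)"
  proof (cases "\<sigma>hat < \<sigma>")
    case True
    then have "\<sigma>hat\<^sup>2 \<le> \<sigma>\<^sup>2" using \<open>\<sigma>hat \<ge> 0\<close> by (intro power_mono) auto
    then have "c \<ge> 0" by (simp add: c_def)
    from defA[OF this] show ?thesis by eventually_elim simp
  qed simp
  obtain a b where ab: "measure H {a..b} = 1" using H_compact by blast
  define K where "K = \<bar>a\<bar> + \<bar>b\<bar> + \<bar>h1\<bar> + \<bar>h2\<bar> + 1"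
  have supp: "AE x in H. \<bar>x\<bar> \<le> K"
    using H.AE_prob_1[OF ab] by eventually_elim (auto simp: K_def)
  have s0: "\<sigma> \<ge> 0" using \<open>\<sigma> > 0\<close> by simp
  note W1 = nA[of 1, OF zero_le_one]
  show ?thesis
    using defA[OF s0] defc defZ noise.noise_energy[OF W1] noise.cross_term[OF W1] noise.noise_sym[OF nZ[of "[]"]]
      noise.noise_energy[OF nZ[of "[]"]] noise.diag_noise[OF nZ[of "[]"]] esd_lim A_bounded AE_space
  proof eventually_elim
    case (elim \<omega>)
    note \<omega> = elim(11)
    have entW: "(1 \<cdot>\<^sub>m W n \<omega>) $$ (i, j) = W n \<omega> $$ (i, j)" if "i < n" "j < n" for n i j using carrW[of n \<omega>] that by auto
    have "esd (A n \<omega>) = emp n (\<lambda>j. eigs (A n \<omega>) ! j)" for n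
      using carrA[OF \<omega>, of n] by (simp add: esd_def emp_def)
    then have emp: "weak_conv_m (\<lambda>n. emp n (\<lambda>j. eigs (A n \<omega>) ! j)) H" using elim(9) by (simp only:)
    have bd: "\<forall>\<^sub>F n in sequentially. \<forall>j<n. \<bar>eigs (A n \<omega>) ! j\<bar> \<le> K"
      using elim(10)
    proof eventually_elim
      case (elim n)
      show ?case
      proof (intro allI impI)
        fix j assume "j < n"
        then have "eigenvalue (A n \<omega>) (eigs (A n \<omega>) ! j)" by (rule eigs_eigenvalue[OF carrA[OF \<omega>] symA[OF \<omega>]])
        then have "eigs (A n \<omega>) ! j \<in> {h1..h2}" by (rule elim[rule_format])
        then show "\<bar>eigs (A n \<omega>) ! j\<bar> \<le> K" by (auto simp: K_def)
      qed
    qed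
    note Asq = weak_limit_of_emp(2)[OF H_prob emp bd supp]
    have entries: "(\<Sum>i<n. \<Sum>j<n. (A n \<omega> $$ (i, j))\<^sup>2) = (\<Sum>j<n. (eigs (A n \<omega>) ! j)\<^sup>2)" for n
      by (rule sum_eigs_square[OF carrA[OF \<omega>] symA[OF \<omega>], symmetric])
    \<comment> \<open>The energy of \<open>A\<close> converges, so the normalisation of the cross term can be undone.\<close>
    have cross: "(\<lambda>n. (\<Sum>i<n. \<Sum>j<n. A n \<omega> $$ (i, j) * W n \<omega> $$ (i, j)) / (real n * sqrt (real n))) \<longlonglongrightarrow> 0"
    proof (rule noise.square_tendsto_zeroD[OF W1])
      let ?x = "\<lambda>n. (\<Sum>i<n. \<Sum>j<n. A n \<omega> $$ (i, j) * W n \<omega> $$ (i, j)) / (real n * sqrt (real n))"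
      let ?q = "\<lambda>n. (\<Sum>j<n. (eigs (A n \<omega>) ! j)\<^sup>2) / real n"
      have "(\<Sum>i<n. \<Sum>j<n. A n \<omega> $$ (i, j) * (1 \<cdot>\<^sub>m W n \<omega>) $$ (i, j)) = (\<Sum>i<n. \<Sum>j<n. A n \<omega> $$ (i, j) * W n \<omega> $$ (i, j))" for n
        by (intro sum.cong refl) (simp only: entW lessThan_iff)
      then have "(\<lambda>n. (?x n)\<^sup>2 / (1 + ?q n)) \<longlonglongrightarrow> 0" using elim(5) by (simp only: entries)
      from tendsto_mult[OF this tendsto_add[OF tendsto_const[of 1] Asq]]
      have "(\<lambda>n. (?x n)\<^sup>2 / (1 + ?q n) * (1 + ?q n)) \<longlonglongrightarrow> 0" by simp
      moreover have "(?x n)\<^sup>2 / (1 + ?q n) * (1 + ?q n) = (?x n)\<^sup>2" for n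
      proof -
        have "?q n \<ge> 0" by (simp add: sum_nonneg)
        then have "1 + ?q n \<noteq> 0" by linarith
        then show ?thesis by (rule nonzero_eq_divide_eq[THEN iffD1, OF _ refl])
      qed
      ultimately show "(\<lambda>n. (?x n)\<^sup>2) \<longlonglongrightarrow> 0" by (simp only:)
    qed
    interpret F: fit "\<lambda>n. A n \<omega>" "\<lambda>n. W n \<omega>" "\<lambda>n. Zhat n \<omega>" H \<sigma> \<sigma>hat K
    proof (rule fit.intro)
      show "real_distribution H" by fact
      show "K > 0" by (simp add: K_def)
      show "AE x in H. \<bar>x\<bar> \<le> K" by (rule supp)
      show "symk n (mk_fun (W n \<omega>))" for n by (auto simp: symk_def W_def top_left_def Z_sym[OF \<omega>])
      show "symk n (mk_fun (Zhat n \<omega>))" for n using elim(6) by blast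
      show "(\<lambda>n. stj n (\<lambda>j. eigs (A n \<omega>) ! j) w) \<longlonglongrightarrow> SM H w" if "Im w > 0" for w by (rule weak_limit_of_emp(1)[OF H_prob emp that])
      have "(\<Sum>i<n. \<Sum>j<n. ((1 \<cdot>\<^sub>m W n \<omega>) $$ (i, j))\<^sup>2) = (\<Sum>i<n. \<Sum>j<n. (W n \<omega> $$ (i, j))\<^sup>2)" for n
        by (intro sum.cong refl) (simp only: entW lessThan_iff)
      then show "(\<lambda>n. (\<Sum>i<n. \<Sum>j<n. (W n \<omega> $$ (i, j))\<^sup>2) / (real n)\<^sup>2) \<longlonglongrightarrow> 1" using elim(4) by (simp only: one_power2)
      show "(\<lambda>n. defect n (mk_fun (A n \<omega>)) (\<lambda>i j. A n \<omega> $$ (i, j) + t * W n \<omega> $$ (i, j) / sqrt (real n)) t z) \<longlonglongrightarrow> 0"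
        if "t = \<sigma> \<or> \<sigma>hat < \<sigma> \<and> t = sqrt (\<sigma>\<^sup>2 - \<sigma>hat\<^sup>2)" "Im z > 0" for t z
        using that elim(1,2) unfolding c_def by blast
      show "(\<lambda>n. defect n (dg (step ps n)) (\<lambda>i j. dg (step ps n) i j + Zhat n \<omega> $$ (i, j) / sqrt (real n)) \<sigma>hat z) \<longlonglongrightarrow> 0"
        if "Im z > 0" for ps z using elim(3) that by blast
    qed (use \<open>\<sigma> > 0\<close> \<open>\<sigma>hat \<ge> 0\<close> carrA[OF \<omega>] carrW carrZ[OF \<omega>] symA[OF \<omega>] Asq cross elim(7,8) in auto)
    have R: "R n \<omega> = fit_error n (Zhat n \<omega>) (F.P \<sigma> n)" for n unfolding F.P_def by (simp only: R_def W_def)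
    show ?case
    proof (intro conjI impI)
      assume "\<sigma>hat < \<sigma>"
      from F.fit_error_vanishes[OF this] have "(\<lambda>n. ereal (R n \<omega>)) \<longlonglongrightarrow> 0" unfolding R zero_ereal_def by (rule tendsto_ereal)
      then show "limsup (\<lambda>n. ereal (R n \<omega>)) = 0" by (intro lim_imp_Limsup) simp_all
    next
      assume gt: "\<sigma>hat > \<sigma>"
      show "liminf (\<lambda>n. ereal (R n \<omega>)) > 0"
      proof (rule ccontr)
        assume "\<not> liminf (\<lambda>n. ereal (R n \<omega>)) > 0"
        then have "liminf (\<lambda>n. ereal (fit_error n (Zhat n \<omega>) (F.P \<sigma> n))) \<le> 0" unfolding R by simp
        then obtain \<nu> where "real_distribution \<nu>" "is_free_additive_convolution (semicircle (\<sigma>hat\<^sup>2 - \<sigma>\<^sup>2)) \<nu> H"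
          by (rule F.free_convolution_of_fit[OF gt])
        moreover have "\<sigma>hat\<^sup>2 - \<sigma>\<^sup>2 > 0" using gt \<open>\<sigma> > 0\<close> by (simp add: power_strict_mono)
        ultimately show False using H_not_conv by blast
      qed
    qed
  qed
qed

end
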